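(* Let $\phi$, $\psi : \mathsf{A} \to A[\tau]$ be Drinfeld modules both of rank $r \geqslant 2$ with $\phi_t=\theta+\kappa_1\tau+\cdots+\kappa_r\tau^r$, $\psi_t=\theta+\eta_1\tau+\cdots+\eta_r\tau^r$, $\kappa_r,\eta_r\in\mathbb{F}_q^\times$. Then \[ L((\phi \otimes \psi)^{\vee},s) = L(A,\chi_{\phi}\chi_{\psi},rs+2) \cdot L(\boldsymbol{\mu}_{\phi} \times \boldsymbol{\mu}_{\psi},s). \]
   Context: $A=\mathbb{F}_q[\theta]$, $A_+$ its monic elements, $\mathsf{A}=\mathbb{F}_q[t]$, $\chi_\phi(a)=((-1)^{r+1}\kappa_r)^{\deg_\theta a}$, $\chi_\psi(a)=((-1)^{r+1}\eta_r)^{\deg_\theta a}$, and $L(A,\chi,s)=\sum_{a\in A_+}\chi(a)a^{-s}$. For irreducible $f\in A_+$ let $\alpha_1,\dots,\alpha_r$ be the roots of $P^\vee_{\phi,f}(X)$, the characteristic polynomial (at $t=\theta$) of Frobenius at $f$ on the dual $\lambda$-adic Tate module of $\phi$; define $\boldsymbol{\mu}_\phi(f^{k_1},\dots,f^{k_{r-1}})=S_{k_1,\dots,k_{r-1}}(\alpha_1,\dots,\alpha_r)f^{k_1+\cdots+k_{r-1}}$, where $S_{k_1,\dots,k_{r-1}}$ is the Schur polynomial of the partition $(k_1+\cdots+k_{r-1},k_2+\cdots+k_{r-1},\dots,k_{r-1},0)$, and extend multiplicatively to $(A_+)^{r-1}$; similarly $\boldsymbol{\mu}_\psi$. Set \[L(\boldsymbol{\mu}_{\phi}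 \times \boldsymbol{\mu}_{\psi},s) = \sum_{a_1,\dots,a_{r-1} \in A_+} \frac{\boldsymbol{\mu}_{\phi}(a_1, \dots, a_{r-1}) \boldsymbol{\mu}_{\psi}(a_1, \dots, a_{r-1})}{(a_1 \cdots a_{r-1})^2 (a_1 a_2^2 \cdots a_{r-1}^{r-1})^s}.\] $\phi\otimes\psi$ is the tensor product $t$-module (from $\mathcal{M}_\phi\otimes_{\mathbb{C}_\infty[t]}\mathcal{M}_\psi$ with diagonal $\tau$-action), and $L((\phi\otimes\psi)^\vee,s)=\prod_f\mathbf{Q}^\vee_{\phi\otimes\psi,f}(f^{-s})^{-1}$, where $\mathbf{Q}^\vee_{\phi\otimes\psi,f}$ is the reciprocal polynomial of $\prod_{i,j}(X-\alpha_i\beta_j)$, $\beta_j$ the roots of $P^\vee_{\psi,f}$. *)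

theory Defs
  imports
    "HOL-Analysis.Infinite_Sum"
    "HOL-Library.FuncSet"
    "HOL-Library.Cardinality"
    "HOL-Library.Poly_Mapping"
    "HOL-Computational_Algebra.Formal_Laurent_Series"
    "HOL-Algebra.Algebraic_Closure_Type"
    "Jordan_Normal_Form.Char_Poly"
begin

hide_const (open) UnivPoly.coeff UnivPoly.monom Divisibility.irreducible Divisibility.prime

text \<open>
  The finite field with $q$ elements is a type \<^typ>\<open>'q\<close> of classes \<^class>\<open>field\<close> and
  \<^class>\<open>finite\<close>, so that $q$ is \<^term>\<open>CARD('q)\<close>.  Both $A$ (polynomials in $\theta$) and its
  copy of operators (polynomials in $t$) are \<^typ>\<open>'q poly\<close>; hence the
  evaluation $t = \theta$ is the identity.
\<close>

type_synonym 'q kbar = "'q poly fract alg_closure"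

abbreviation \<theta> :: "'q::field poly" where "\<theta> \<equiv> [:0, 1:]"

definition monics :: "'q::field poly set"
  where "monics = {a. lead_coeff a = 1}"

definition monic_primes :: "'q::field poly set"
  where "monic_primes = {f \<in> monics. irreducible f}"

definition \<iota> :: "'q::field poly \<Rightarrow> 'q kbar"
  where "\<iota> a = to_ac (to_fract a)"

text \<open>$K_\infty$ is the field of Laurent series in $1/\theta$, with the metric of the library;
  \<^const>\<open>fls_X_inv\<close> is therefore the image of $\theta$.\<close>

definition A_to_Kinf :: "'q::field poly \<Rightarrow> 'q fls"
  where "A_to_Kinf a = poly (map_poly fls_const a) fls_X_inv"

definition K_to_Kinf :: "'q::field poly fract \<Rightarrow> 'q fls"
  where "K_to_Kinf x =
    (THE y. \<forall>u v. v \<noteq> 0 \<and> x = Fract u v \<longrightarrow> y = A_to_Kinf u / A_to_Kinf v)"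


text \<open>An element $\sum_i c_i \tau^i$ of $A[\tau]$ is represented by the polynomial with
  coefficients $c_i$.  Its sum is the sum of polynomials, but its product is the following one,
  which satisfies $\tau c = c^q \tau$.\<close>

definition skew_mult ::
    "'q::{field,finite} poly poly \<Rightarrow> 'q poly poly \<Rightarrow> 'q poly poly"
  where "skew_mult f g =
    (\<Sum>i\<le>degree f. \<Sum>j\<le>degree g. monom (coeff f i * coeff g j ^ (CARD('q) ^ i)) (i + j))"

definition drinfeld_module :: "('q::{field,finite} poly \<Rightarrow> 'q poly poly) \<Rightarrow> bool"
  where "drinfeld_module \<phi> \<longleftrightarrow>
    (\<forall>a b. \<phi> (a + b) = \<phi> a + \<phi> b) \<and>
    (\<forall>a b. \<phi> (a * b) = skew_mult (\<phi> a) (\<phi> b)) \<and>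
    (\<forall>c. \<phi> [:c:] = [:[:c:]:]) \<and>
    coeff (\<phi> [:0, 1:]) 0 = \<theta> \<and>
    0 < degree (\<phi> [:0, 1:])"

definition drinfeld_rank :: "('q::{field,finite} poly \<Rightarrow> 'q poly poly) \<Rightarrow> nat"
  where "drinfeld_rank \<phi> = degree (\<phi> [:0, 1:])"

definition drinfeld_act ::
    "('q::{field,finite} poly \<Rightarrow> 'q poly poly) \<Rightarrow> 'q poly \<Rightarrow> 'q kbar \<Rightarrow> 'q kbar"
  where "drinfeld_act \<phi> a x =
    (\<Sum>i\<le>degree (\<phi> a). \<iota> (coeff (\<phi> a) i) * x ^ (CARD('q) ^ i))"


text \<open>An element of the $\lambda$-adic completion, i.e. of the inverse limit of the quotients by
  $\lambda^m$, is the sequence of its reduced representatives.  Sums are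
  pointwise.\<close>

definition adic :: "'q::field poly \<Rightarrow> (nat \<Rightarrow> 'q poly) set"
  where "adic l = {a. \<forall>m. a m = a (Suc m) mod l ^ m}"

definition adic_mult ::
    "'q::field poly \<Rightarrow> (nat \<Rightarrow> 'q poly) \<Rightarrow> (nat \<Rightarrow> 'q poly) \<Rightarrow> nat \<Rightarrow> 'q poly"
  where "adic_mult l a b = (\<lambda>m. (a m * b m) mod l ^ m)"

text \<open>The sequence \<open>a\<close>, taken modulo the powers of $\lambda$, is the image of the
  $\lambda$-integral element \<open>c\<close> of $K$ in the completion.\<close>

definition adic_represents ::
    "'q::field poly \<Rightarrow> 'q poly fract \<Rightarrow> (nat \<Rightarrow> 'q poly) \<Rightarrow> bool"
  where "adic_represents l c a \<longleftrightarrow>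
    (\<exists>u v. c = Fract u v \<and> \<not> l dvd v \<and> (\<forall>m. l ^ m dvd v * a m - u))"

text \<open>The inverse limit of the modules of $\lambda^m$-torsion points along the action of
  $\lambda$.\<close>

definition tate_module ::
    "('q::{field,finite} poly \<Rightarrow> 'q poly poly) \<Rightarrow> 'q poly \<Rightarrow> (nat \<Rightarrow> 'q kbar) set"
  where "tate_module \<phi> l = {x. x 0 = 0 \<and> (\<forall>m. drinfeld_act \<phi> l (x (Suc m)) = x m)}"

definition tate_smult ::
    "('q::{field,finite} poly \<Rightarrow> 'q poly poly) \<Rightarrow>
      (nat \<Rightarrow> 'q poly) \<Rightarrow> (nat \<Rightarrow> 'q kbar) \<Rightarrow> nat \<Rightarrow> 'q kbar"
  where "tate_smult \<phi> a x = (\<lambda>m. drinfeld_act \<phi> (a m) (x m))"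

definition tate_dual ::
    "('q::{field,finite} poly \<Rightarrow> 'q poly poly) \<Rightarrow> 'q poly \<Rightarrow>
      ((nat \<Rightarrow> 'q kbar) \<Rightarrow> nat \<Rightarrow> 'q poly) set"
  where "tate_dual \<phi> l =
    {h \<in> tate_module \<phi> l \<rightarrow>\<^sub>E adic l.
      (\<forall>x\<in>tate_module \<phi> l. \<forall>y\<in>tate_module \<phi> l.
        h (\<lambda>m. x m + y m) = (\<lambda>m. h x m + h y m)) \<and>
      (\<forall>a\<in>adic l. \<forall>x\<in>tate_module \<phi> l.
        h (tate_smult \<phi> a x) = adic_mult l a (h x))}"

definition dual_lincomb ::
    "'q::field poly \<Rightarrow> nat \<Rightarrow> (nat \<Rightarrow> nat \<Rightarrow> 'q poly) \<Rightarrow>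
      (nat \<Rightarrow> (nat \<Rightarrow> 'q kbar) \<Rightarrow> nat \<Rightarrow> 'q poly) \<Rightarrow> (nat \<Rightarrow> 'q kbar) \<Rightarrow> nat \<Rightarrow> 'q poly"
  where "dual_lincomb l n c b x = (\<lambda>m. \<Sum>i<n. adic_mult l (c i) (b i x) m)"

definition tate_dual_basis ::
    "('q::{field,finite} poly \<Rightarrow> 'q poly poly) \<Rightarrow> 'q poly \<Rightarrow> nat \<Rightarrow>
      (nat \<Rightarrow> (nat \<Rightarrow> 'q kbar) \<Rightarrow> nat \<Rightarrow> 'q poly) \<Rightarrow> bool"
  where "tate_dual_basis \<phi> l n b \<longleftrightarrow>
    (\<forall>i<n. b i \<in> tate_dual \<phi> l) \<and>
    (\<forall>h\<in>tate_dual \<phi> l. \<exists>!c. c \<in> {..<n} \<rightarrow>\<^sub>E adic l \<and>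
      (\<forall>x\<in>tate_module \<phi> l. h x = dual_lincomb l n c b x))"


text \<open>Restriction identifies the automorphisms of $\overline{K}$ over $K$ with those of the
  separable closure, so we may work in \<^typ>\<open>'q kbar\<close>.\<close>

definition galois_K :: "('q::field kbar \<Rightarrow> 'q kbar) set"
  where "galois_K = {\<sigma>. bij \<sigma> \<and>
    (\<forall>x y. \<sigma> (x + y) = \<sigma> x + \<sigma> y) \<and> (\<forall>x y. \<sigma> (x * y) = \<sigma> x * \<sigma> y) \<and>
    (\<forall>c. \<sigma> (to_ac c) = to_ac c)}"

definition integral_closure_A :: "'q::field kbar set"
  where "integral_closure_A = {x. \<exists>p. lead_coeff p = 1 \<and> poly (map_poly \<iota> p) x = 0}"

definition prime_above :: "'q::field poly \<Rightarrow> 'q kbar set \<Rightarrow> bool"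
  where "prime_above f \<PP> \<longleftrightarrow>
    \<PP> \<subseteq> integral_closure_A \<and> \<iota> f \<in> \<PP> \<and> 1 \<notin> \<PP> \<and>
    (\<forall>x\<in>\<PP>. \<forall>y\<in>\<PP>. x + y \<in> \<PP>) \<and>
    (\<forall>x\<in>integral_closure_A. \<forall>y\<in>\<PP>. x * y \<in> \<PP>) \<and>
    (\<forall>x\<in>integral_closure_A. \<forall>y\<in>integral_closure_A. x * y \<in> \<PP> \<longrightarrow> x \<in> \<PP> \<or> y \<in> \<PP>)"

definition frobenius_at ::
    "'q::{field,finite} poly \<Rightarrow> ('q kbar \<Rightarrow> 'q kbar) set"
  where "frobenius_at f = {\<sigma> \<in> galois_K. \<exists>\<PP>. prime_above f \<PP> \<and>
    (\<forall>x\<in>integral_closure_A. \<sigma> x - x ^ (CARD('q) ^ degree f) \<in> \<PP>)}"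

definition galois_dual_act ::
    "('q::{field,finite} poly \<Rightarrow> 'q poly poly) \<Rightarrow> 'q poly \<Rightarrow> ('q kbar \<Rightarrow> 'q kbar) \<Rightarrow>
      ((nat \<Rightarrow> 'q kbar) \<Rightarrow> nat \<Rightarrow> 'q poly) \<Rightarrow> (nat \<Rightarrow> 'q kbar) \<Rightarrow> nat \<Rightarrow> 'q poly"
  where "galois_dual_act \<phi> l \<sigma> h = (\<lambda>x\<in>tate_module \<phi> l. h (inv_into UNIV \<sigma> \<circ> x))"

text \<open>\<open>P\<close> is the characteristic polynomial of \<open>\<sigma>\<close> on the dual Tate module.  The
  matrix \<open>M\<close> of \<open>\<sigma>\<close> has entries in the completion, and its characteristic polynomial is computed
  modulo each power of $\lambda$.\<close>

definition is_dual_char_poly ::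
    "('q::{field,finite} poly \<Rightarrow> 'q poly poly) \<Rightarrow> 'q poly \<Rightarrow> ('q kbar \<Rightarrow> 'q kbar) \<Rightarrow>
      'q poly fract poly \<Rightarrow> bool"
  where "is_dual_char_poly \<phi> l \<sigma> P \<longleftrightarrow>
    (\<exists>n b M. tate_dual_basis \<phi> l n b \<and>
      (\<forall>i<n. \<forall>j<n. M i j \<in> adic l) \<and>
      (\<forall>j<n. \<forall>x\<in>tate_module \<phi> l.
        galois_dual_act \<phi> l \<sigma> (b j) x = dual_lincomb l n (\<lambda>i. M i j) b x) \<and>
      (\<forall>k. adic_represents l (coeff P k)
        (\<lambda>m. coeff (char_poly (mat n n (\<lambda>(i, j). M i j m))) k)))"

text \<open>$P^\vee_{\phi,f}$ does not depend on $\lambda \neq f$, nor on the Frobenius element.\<close>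

definition frob_dual_poly ::
    "('q::{field,finite} poly \<Rightarrow> 'q poly poly) \<Rightarrow> 'q poly \<Rightarrow> 'q poly fract poly"
  where "frob_dual_poly \<phi> f =
    (THE P. \<forall>l\<in>monic_primes - {f}. \<forall>\<sigma>\<in>frobenius_at f. is_dual_char_poly \<phi> l \<sigma> P)"

definition frob_dual_roots ::
    "('q::{field,finite} poly \<Rightarrow> 'q poly poly) \<Rightarrow> 'q poly \<Rightarrow> nat \<Rightarrow> 'q kbar"
  where "frob_dual_roots \<phi> f =
    (SOME \<alpha>. map_poly to_ac (frob_dual_poly \<phi> f) = (\<Prod>i<drinfeld_rank \<phi>. [:- \<alpha> i, 1:]))"


type_synonym mpol = "(nat \<Rightarrow>\<^sub>0 nat) \<Rightarrow>\<^sub>0 int"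

definition mvar :: "nat \<Rightarrow> mpol"
  where "mvar j = Poly_Mapping.single (Poly_Mapping.single j 1) 1"

definition mpol_eval :: "mpol \<Rightarrow> (nat \<Rightarrow> 'a::comm_ring_1) \<Rightarrow> 'a"
  where "mpol_eval S x =
    (\<Sum>m\<in>Poly_Mapping.keys S. of_int (Poly_Mapping.lookup S m) *
      (\<Prod>i\<in>Poly_Mapping.keys m. x i ^ Poly_Mapping.lookup m i))"

definition alternant :: "nat \<Rightarrow> (nat \<Rightarrow> nat) \<Rightarrow> mpol"
  where "alternant r e = det (mat r r (\<lambda>(i, j). mvar j ^ e i))"

text \<open>The partition is $p_0 \geq p_1 \geq \dots \geq p_{r-1}$ and the variables are those of index
  less than \<open>r\<close>; the Schur polynomial is the quotient of the alternant by the
  Vandermonde determinant, taken before evaluation since the roots may coincide.\<close>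

definition schur :: "nat \<Rightarrow> (nat \<Rightarrow> nat) \<Rightarrow> mpol"
  where "schur r p =
    (THE S. S * alternant r (\<lambda>i. r - 1 - i) = alternant r (\<lambda>i. p i + (r - 1 - i)))"

definition partition_of :: "nat \<Rightarrow> (nat \<Rightarrow> nat) \<Rightarrow> nat \<Rightarrow> nat"
  where "partition_of r k i = (\<Sum>j\<in>{i<..<r}. k j)"


text \<open>Tuples $(a_1, \dots, a_{r-1})$ are functions on $\{1, \dots, r-1\}$.  The variable $s$ of the
  series below is a natural number: these are the integers at which all of them converge.\<close>

definition mu_prime_power ::
    "('q::{field,finite} poly \<Rightarrow> 'q poly poly) \<Rightarrow> 'q poly \<Rightarrow> (nat \<Rightarrow> nat) \<Rightarrow> 'q kbar"
  where "mu_prime_power \<phi> f k =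
    mpol_eval (schur (drinfeld_rank \<phi>) (partition_of (drinfeld_rank \<phi>) k)) (frob_dual_roots \<phi> f) *
    \<iota> f ^ (\<Sum>j\<in>{1..<drinfeld_rank \<phi>}. k j)"

text \<open>The values of $\boldsymbol{\mu}_\phi$ are symmetric in the roots, so they lie in $K$ and
  \<^const>\<open>of_ac\<close> loses nothing.  The exponent of \<open>f\<close> in \<open>a j\<close> is spelled out because
  \<^const>\<open>multiplicity\<close> is not available for polynomials over a mere \<^class>\<open>field\<close>.\<close>

definition mu ::
    "('q::{field,finite} poly \<Rightarrow> 'q poly poly) \<Rightarrow> (nat \<Rightarrow> 'q poly) \<Rightarrow> 'q poly fract"
  where "mu \<phi> a = of_ac
    (\<Prod>f \<in> {f \<in> monic_primes. f dvd (\<Prod>j\<in>{1..<drinfeld_rank \<phi>}. a j)}.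
      mu_prime_power \<phi> f (\<lambda>j. Max {n. f ^ n dvd a j}))"

definition monic_tuples :: "nat \<Rightarrow> (nat \<Rightarrow> 'q::field poly) set"
  where "monic_tuples r = {1..<r} \<rightarrow>\<^sub>E monics"

definition conv_term ::
    "('q::{field,finite} poly \<Rightarrow> 'q poly poly) \<Rightarrow> ('q poly \<Rightarrow> 'q poly poly) \<Rightarrow> nat \<Rightarrow>
      (nat \<Rightarrow> 'q poly) \<Rightarrow> 'q fls"
  where "conv_term \<phi> \<psi> s a = K_to_Kinf
    (mu \<phi> a * mu \<psi> a /
      to_fract ((\<Prod>j\<in>{1..<drinfeld_rank \<phi>}. a j) ^ 2 *
                (\<Prod>j\<in>{1..<drinfeld_rank \<phi>}. a j ^ j) ^ s))"

definition L_conv ::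
    "('q::{field,finite} poly \<Rightarrow> 'q poly poly) \<Rightarrow> ('q poly \<Rightarrow> 'q poly poly) \<Rightarrow> nat \<Rightarrow> 'q fls"
  where "L_conv \<phi> \<psi> s = infsum (conv_term \<phi> \<psi> s) (monic_tuples (drinfeld_rank \<phi>))"

definition chi :: "nat \<Rightarrow> 'q::field \<Rightarrow> 'q poly \<Rightarrow> 'q"
  where "chi r \<kappa> a = ((- 1) ^ (r + 1) * \<kappa>) ^ degree a"

definition LA_term :: "('q::field poly \<Rightarrow> 'q) \<Rightarrow> nat \<Rightarrow> 'q poly \<Rightarrow> 'q fls"
  where "LA_term \<chi> s a = fls_const (\<chi> a) * inverse (A_to_Kinf a ^ s)"

definition L_A :: "('q::field poly \<Rightarrow> 'q) \<Rightarrow> nat \<Rightarrow> 'q fls"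
  where "L_A \<chi> s = infsum (LA_term \<chi> s) monics"

text \<open>$\mathbf{Q}^\vee_{\phi \otimes \psi, f}$, the reciprocal polynomial of
  $\prod_{i,j} (X - \alpha_i \beta_j)$.  It has coefficients in $K$.  This is how the tensor product
  $t$-module $\phi \otimes \psi$ enters its $L$-series, which is the Euler product below.\<close>

definition tensor_dual_Q ::
    "('q::{field,finite} poly \<Rightarrow> 'q poly poly) \<Rightarrow> ('q poly \<Rightarrow> 'q poly poly) \<Rightarrow> 'q poly \<Rightarrow>
      'q kbar poly"
  where "tensor_dual_Q \<phi> \<psi> f = reflect_poly
    (\<Prod>i<drinfeld_rank \<phi>. \<Prod>j<drinfeld_rank \<psi>.
      [:- (frob_dual_roots \<phi> f i * frob_dual_roots \<psi> f j), 1:])"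

definition tensor_factor ::
    "('q::{field,finite} poly \<Rightarrow> 'q poly poly) \<Rightarrow> ('q poly \<Rightarrow> 'q poly poly) \<Rightarrow> nat \<Rightarrow>
      'q poly \<Rightarrow> 'q fls"
  where "tensor_factor \<phi> \<psi> s f =
    inverse (K_to_Kinf (of_ac (poly (tensor_dual_Q \<phi> \<psi> f) (inverse (\<iota> f ^ s)))))"

text \<open>The Euler product is the limit over finite sets of primes, ordered by inclusion.\<close>

definition L_tensor_dual ::
    "('q::{field,finite} poly \<Rightarrow> 'q poly poly) \<Rightarrow> ('q poly \<Rightarrow> 'q poly poly) \<Rightarrow> nat \<Rightarrow> 'q fls"
  where "L_tensor_dual \<phi> \<psi> s =
    Lim (finite_subsets_at_top monic_primes) (\<lambda>F. \<Prod>f\<in>F. tensor_factor \<phi> \<psi> s f)"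

end

theory Submission
  imports Defs
begin

text \<open>
  Let $C$ be the matrix of $\tau^d$, $d = \deg f$, on the motive of $\phi$, which is free of rank
  $r$ over $A[t]$ with basis $1, \tau, \dots, \tau^{r-1}$.  Pairing this basis with a basis of the
  $\lambda^m$-torsion gives a matrix $B$ with $B \equiv M B C$ modulo a prime above $f$ and
  $\lambda(t)^m$, where $M$ is the matrix of Frobenius on the dual.  As $\det B$ is invertible there,
  the characteristic polynomial of $M$ is $\det(X C - 1)/\det C$ reduced modulo $f$.  Hence it has
  coefficients in $K$ independent of $\lambda$, its constant term is known, and its Newton polygon at
  infinity is bounded by the degrees of the entries of $C$.

  Cauchy's identity $\prod_{i,j} (1 - \alpha_i \beta_j X) \sum_\lambda S_\lambda(\alpha)
  S_\lambda(\beta) X^{|\lambda|} = 1 - \prod_i \alpha_i \prod_j \beta_j X^r$, the sum being over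
  partitions with at most $r - 1$ parts, then identifies each Euler factor with the product of the
  local factors of the two series on the right, the term $\prod_i \alpha_i \prod_j \beta_j$ being
  $\chi_\phi(f) \chi_\psi(f) / f^2$.  The valuation bound makes all sums and products converge, and
  unique factorization in $A$ gives the Euler products.
\<close>

text \<open>Two variables must be kept apart: the matrices live over A[t], reduction modulo
  \<open>f\<close> concerns \<theta>, while the characteristic polynomial has coefficients in
  F_q(t), and t becomes \<theta> only at the end. A polynomial in t over F_q is determined by its
  class modulo \<open>f\<close>, since F_q embeds into A/f, and by its class modulo \<lambda>(t)^m
  once its degree is bounded. The matrix B can be cancelled because the q-th power map carries the
  values of its determinant at the roots of \<lambda> into each other, up to factors that are prime
  to \<open>f\<close> as \<open>f\<close> differs from \<lambda>. The constancy of
  \<open>\<kappa>\<^sub>r\<close> makes torsion points integral and frees the relation for \<tau>^r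
  from denominators. Frobenius elements have to be shown to exist, as otherwise the description of
  the dual polynomial would hold vacuously for every polynomial. Convergence is measured in
  K_infinity although the roots are only algebraic over K: Schur values are written as determinants
  in the coefficients of the characteristic polynomial, so the valuation is never extended.\<close>

section \<open>Finite fields and the q-power map\<close>

lemma finite_field_power_card:
  fixes a :: "'q::{field,finite}"
  shows "a ^ CARD('q) = a"
proof (cases "a = 0")
  case True
  then show ?thesis by (simp add: zero_power)
next
  case False
  let ?U = "UNIV - {0::'q}"
  have "bij_betw ((*) a) ?U ?U"
    by (rule bij_betw_byWitness[where f' = "\<lambda>x. x / a"]) (use False in auto)
  then have "(\<Prod>x\<in>?U. x) = (\<Prod>x\<in>?U. a * x)"
    by (rule prod.reindex_bij_betw[symmetric])
  also have "\<dots> = a ^ card ?U * (\<Prod>x\<in>?U. x)"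
    by (simp add: prod.distrib)
  finally have "a ^ card ?U = 1"
    by (simp add: prod_zero_iff)
  moreover have "CARD('q) = Suc (card ?U)"
    by (rule card_Suc_Diff1[symmetric]) simp_all
  ultimately show ?thesis
    by (metis mult.right_neutral power_Suc)
qed

lemma card_field_gt_1: "CARD('q::{field,finite}) > 1"
proof -
  have "card {0, 1::'q} \<le> CARD('q)"
    by (rule card_mono) auto
  then show ?thesis by simp
qed

lemma poly_eq_0_many_roots:
  fixes p :: "'a::idom poly"
  assumes "\<And>x. x \<in> S \<Longrightarrow> poly p x = 0" and "finite S" and "degree p < card S"
  shows "p = 0"
proof (rule ccontr)
  assume p: "p \<noteq> 0"
  then have "card {x. poly p x = 0} \<le> degree p"
    by (rule poly_roots_degree)
  moreover have "card S \<le> card {x. poly p x = 0}"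
    using assms poly_roots_finite[OF p] by (intro card_mono) auto
  ultimately show False
    using assms by simp
qed

lemma degree_diff_less_monic:
  fixes p q :: "'a::comm_ring_1 poly"
  assumes "degree p = n" "degree q = n" "lead_coeff p = 1" "lead_coeff q = 1" "n > 0"
  shows "degree (p - q) < n"
proof -
  have "degree (p - q) \<le> n" using assms by (intro degree_diff_le) auto
  moreover have "degree (p - q) \<noteq> n"
  proof
    assume n: "degree (p - q) = n"
    then have "lead_coeff (p - q) = 0" using assms by simp
    then show False using n assms by (metis degree_0 leading_coeff_0_iff less_irrefl)
  qed
  ultimately show ?thesis by simp
qed

lemma degree_prod_linear:
  "degree (\<Prod>a\<in>A. [:- g a, 1:] :: 'a::idom poly) = card A"
  by (cases "finite A") (simp_all add: degree_prod_eq_sum_degree)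

text \<open>The polynomial $X^q - X = \prod_a (X - a)$ is invariant under translation by elements of
  $\mathbb{F}_q$, so that $g(X + y) - g(X) - g(y)$ has too many zeros.\<close>
lemma frobenius_add:
  fixes e :: "'q::{field,finite} \<Rightarrow> 'l::idom" and x y :: 'l
  assumes "comm_ring_hom e"
  shows "(x + y) ^ CARD('q) = x ^ CARD('q) + y ^ CARD('q)"
proof -
  interpret e: comm_ring_hom e by fact
  let ?q = "CARD('q)"
  have inj: "inj e"
  proof (rule injI)
    fix a b assume ab: "e a = e b"
    show "a = b"
    proof (rule ccontr)
      assume "a \<noteq> b"
      then have "e ((a - b) * inverse (a - b)) = 1" by simp
      then show False using ab by (simp only: e.hom_mult e.hom_minus) simp
    qed
  qed
  define g where "g = (monom 1 ?q - [:0, 1:] :: 'l poly)"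
  have dg: "degree g = ?q" "lead_coeff g = 1"
  proof -
    have g: "g = monom 1 ?q + [:0, - 1:]" by (simp add: g_def)
    have less: "degree [:0, - 1 :: 'l:] < degree (monom (1 :: 'l) ?q)"
      using card_field_gt_1[where 'q = 'q] by (simp add: degree_monom_eq)
    show "degree g = ?q"
      unfolding g degree_add_eq_left[OF less] by (simp add: degree_monom_eq)
    show "lead_coeff g = 1"
      unfolding g degree_add_eq_left[OF less] using less
      by (simp add: degree_monom_eq coeff_eq_0)
  qed
  have root: "poly g (z + e a) = poly g z" for z a
  proof -
    define h where "h = (\<Prod>a\<in>UNIV. [:- e a, 1:])"
    have cardr: "card (range e) = ?q" by (simp add: card_image inj)
    have dh: "degree h = ?q" unfolding h_def by (rule degree_prod_linear)
    have lh: "lead_coeff h = 1" unfolding h_def by (simp add: lead_coeff_prod)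
    have "g - h = 0"
    proof (rule poly_eq_0_many_roots)
      fix x assume "x \<in> range e"
      then obtain a where a: "x = e a" by auto
      have "poly g x = 0"
        by (simp add: g_def poly_monom a finite_field_power_card flip: e.hom_power)
      moreover have "poly h x = 0"
        by (auto simp: h_def poly_prod a)
      ultimately show "poly (g - h) x = 0" by simp
    next
      show "degree (g - h) < card (range e)"
        unfolding cardr using dg dh lh card_field_gt_1[where 'q = 'q]
        by (intro degree_diff_less_monic) auto
    qed simp
    then have gh: "poly g z = (\<Prod>b\<in>UNIV. z - e b)" for z
      by (simp add: h_def poly_prod)
    have "bij_betw (\<lambda>b. b - a) UNIV UNIV"
      by (rule bij_betw_byWitness[where f' = "\<lambda>x. x + a"]) auto
    then have "(\<Prod>b\<in>UNIV. z - e b) = (\<Prod>b\<in>UNIV. z - e (b - a))"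
      by (rule prod.reindex_bij_betw[symmetric])
    then show ?thesis
      by (simp add: gh e.hom_minus diff_diff_eq2)
  qed
  \<comment> \<open>The X^q terms of g(X + y) and g cancel, so \<open>k\<close> has degree below q,
    while it vanishes at the q elements of the image of F_q.\<close>
  define k where "k = pcompose g [:y, 1:] - g - [:poly g y:]"
  have "k = 0"
  proof (rule poly_eq_0_many_roots)
    fix x assume "x \<in> range e"
    then obtain a where a: "x = e a" by auto
    have "poly g x = 0"
      by (simp add: g_def poly_monom a finite_field_power_card flip: e.hom_power)
    then show "poly k x = 0"
      using root[of y a] by (simp add: k_def poly_pcompose a)
  next
    have dp: "degree (pcompose g [:y, 1:]) = ?q" "lead_coeff (pcompose g [:y, 1:]) = 1"
      using dg lead_coeff_comp[of "[:y, 1:]" g] by simp_all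
    have "degree (pcompose g [:y, 1:] - g) < ?q"
      using dg dp card_field_gt_1[where 'q = 'q]
      by (intro degree_diff_less_monic) auto
    then show "degree k < card (range e)"
      unfolding k_def using card_field_gt_1[where 'q = 'q]
      by (simp add: card_image inj degree_diff_less)
  qed simp
  then have "poly k x = 0" by simp
  then have "poly g (y + x) = poly g x + poly g y"
    by (simp add: k_def poly_pcompose algebra_simps)
  then show ?thesis
    by (simp add: g_def poly_monom algebra_simps)
qed

lemma frobenius_power_add:
  fixes e :: "'q::{field,finite} \<Rightarrow> 'l::idom" and x y :: 'l
  assumes "comm_ring_hom e"
  shows "(x + y) ^ (CARD('q) ^ n) = x ^ (CARD('q) ^ n) + y ^ (CARD('q) ^ n)"
proof (induction n)
  case (Suc n)
  show ?case
    unfolding power_Suc2 power_mult Suc frobenius_add[OF assms] by (rule refl)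
qed simp

lemma frobenius_power_sum:
  fixes e :: "'q::{field,finite} \<Rightarrow> 'l::idom" and f :: "'i \<Rightarrow> 'l"
  assumes "comm_ring_hom e"
  shows "(\<Sum>i\<in>A. f i) ^ (CARD('q) ^ n) = (\<Sum>i\<in>A. f i ^ (CARD('q) ^ n))"
  by (induction A rule: infinite_finite_induct)
     (simp_all add: frobenius_power_add[OF assms] power_0_left)

lemma finite_field_power_card_power:
  fixes a :: "'q::{field,finite}"
  shows "a ^ (CARD('q) ^ n) = a"
proof (induction n)
  case (Suc n)
  show ?case
    unfolding power_Suc power_mult finite_field_power_card Suc by (rule refl)
qed simp

section \<open>Embeddings into the algebraic closure of K\<close>

interpretation to_fract: comm_ring_hom "to_fract :: 'a::idom \<Rightarrow> 'a fract"
  by unfold_locales simp_all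

interpretation to_ac: field_hom "to_ac :: 'a::field \<Rightarrow> 'a alg_closure"
  by unfold_locales simp_all

interpretation iota: inj_comm_ring_hom "\<iota> :: 'q::field poly \<Rightarrow> 'q kbar"
  by unfold_locales (simp_all add: \<iota>_def)

text \<open>The embedding of F_q, through which the q-power map becomes additive on the algebraic
  closure.\<close>

abbreviation scal :: "'q::field \<Rightarrow> 'q kbar"
  where "scal c \<equiv> \<iota> [:c:]"

interpretation scal: inj_comm_ring_hom "scal :: 'q::field \<Rightarrow> 'q kbar"
proof
  show "scal (a + b) = scal a + scal b" for a b :: 'q
    by (simp flip: iota.hom_add)
  show "scal (a * b) = scal a * scal b" for a b :: 'q
    by (simp flip: iota.hom_mult)
  show "scal 1 = (1 :: 'q kbar)"
    by (simp flip: one_pCons)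
qed simp_all

section \<open>Divisibility of polynomials over a field\<close>

lemma poly_ideal_principal:
  fixes I :: "'a::field poly set"
  assumes "\<And>x y. x \<in> I \<Longrightarrow> y \<in> I \<Longrightarrow> x + y \<in> I" and "\<And>x y. y \<in> I \<Longrightarrow> x * y \<in> I"
    and "z \<in> I"
  obtains g where "g \<in> I" and "\<And>x. x \<in> I \<Longrightarrow> g dvd x"
proof (cases "I \<subseteq> {0}")
  case True
  then show ?thesis using that assms(3) by auto
next
  case False
  then obtain g where g: "g \<in> I - {0}" "\<And>x. x \<in> I - {0} \<Longrightarrow> degree g \<le> degree x"
    using ex_has_least_nat[of "\<lambda>x. x \<in> I - {0}" _ degree] by blast
  have "g dvd x" if "x \<in> I" for x
  proof -
    have "x mod g = x + (- (x div g)) * g"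
      by (simp add: minus_div_mult_eq_mod[symmetric])
    then have "x mod g \<in> I"
      using assms(1)[of x "- (x div g) * g"] assms(2)[of g "- (x div g)"] g that by simp
    moreover have "x mod g = 0 \<or> degree (x mod g) < degree g"
      using degree_mod_less[of g x] g by blast
    ultimately have "x mod g = 0"
      using g(2)[of "x mod g"] by (metis DiffI empty_iff insert_iff leD)
    then show ?thesis by (simp add: dvd_eq_mod_eq_0)
  qed
  then show ?thesis using that g by blast
qed

lemma irreducible_bezout:
  fixes f :: "'a::field poly"
  assumes "irreducible f" and "\<not> f dvd a"
  obtains u v where "u * a + v * f = 1"
proof -
  define I where "I = {u * a + v * f | u v. True}"
  have add: "x + y \<in> I" if "x \<in> I" "y \<in> I" for x y
  proof -
    obtain u v u' v' where "x = u * a + v * f" "y = u' * a + v' * f"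
      using \<open>x \<in> I\<close> \<open>y \<in> I\<close> unfolding I_def by blast
    then have "x + y = (u + u') * a + (v + v') * f" by (simp add: algebra_simps)
    then show ?thesis unfolding I_def by blast
  qed
  have mult: "x * y \<in> I" if "y \<in> I" for x y
  proof -
    obtain u v where "y = u * a + v * f"
      using \<open>y \<in> I\<close> unfolding I_def by blast
    then have "x * y = (x * u) * a + (x * v) * f" by (simp add: algebra_simps)
    then show ?thesis unfolding I_def by blast
  qed
  have a: "a \<in> I" unfolding I_def by (rule CollectI, rule exI[of _ 1], rule exI[of _ 0]) simp
  have f: "f \<in> I" unfolding I_def by (rule CollectI, rule exI[of _ 0], rule exI[of _ 1]) simp
  obtain g where g: "g \<in> I" "\<And>x. x \<in> I \<Longrightarrow> g dvd x"
    by (rule poly_ideal_principal[OF add mult a]) auto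
  have "g dvd 1"
  proof (rule ccontr)
    assume "\<not> g dvd 1"
    obtain h where h: "f = g * h" using g(2)[OF f] by (elim dvdE)
    then have "h dvd 1" using assms(1) \<open>\<not> g dvd 1\<close> Factorial_Ring.irreducibleD by blast
    then have "f dvd g" using h by (metis dvd_mult_unit_iff dvd_refl)
    then show False using g(2)[OF a] assms(2) dvd_trans by blast
  qed
  then have "1 \<in> I" using mult[OF g(1)] by (metis dvdE mult.commute)
  then show ?thesis using that unfolding I_def by auto
qed

text \<open>A divisor of least positive degree is irreducible; dividing by its leading coefficient
  makes it monic.\<close>

lemma irreducible_factor_exists:
  fixes a :: "'a::field poly"
  assumes "degree a > 0"
  obtains f where "irreducible f" and "f dvd a" and "lead_coeff f = 1"
proof -
  let ?P = "\<lambda>x. x dvd a \<and> degree x > 0"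
  obtain g where g: "?P g" "\<And>x. ?P x \<Longrightarrow> degree g \<le> degree x"
    using ex_has_least_nat[of ?P a degree] assms by auto
  have g0: "g \<noteq> 0" using g by auto
  define f where "f = smult (inverse (lead_coeff g)) g"
  have f: "?P f" "degree f = degree g" "lead_coeff f = 1" "f \<noteq> 0"
    using g g0 by (auto simp: f_def smult_dvd_iff)
  have "irreducible f"
  proof (rule Factorial_Ring.irreducibleI)
    show "f \<noteq> 0" "\<not> f dvd 1" using f by (auto simp: is_unit_iff_degree)
    fix x y assume xy: "f = x * y"
    then have "x \<noteq> 0" "y \<noteq> 0" using f by auto
    then have deg: "degree f = degree x + degree y" using xy by (simp add: degree_mult_eq)
    have "x dvd a" "y dvd a" using f xy by (auto intro: dvd_mult_left dvd_mult_right)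
    then have "degree x = 0 \<or> degree y = 0"
      using g(2)[of x] g(2)[of y] deg f(2) by (cases "degree x > 0"; cases "degree y > 0") auto
    then show "x dvd 1 \<or> y dvd 1"
      using \<open>x \<noteq> 0\<close> \<open>y \<noteq> 0\<close> by (auto simp: is_unit_iff_degree)
  qed
  then show ?thesis using that f by blast
qed

lemma monic_primes_irreducible: "f \<in> monic_primes \<Longrightarrow> irreducible f"
  and monic_primes_monic: "f \<in> monic_primes \<Longrightarrow> lead_coeff f = 1"
  and monic_primes_nonzero: "f \<in> monic_primes \<Longrightarrow> f \<noteq> 0"
  and monic_primes_prime: "f \<in> monic_primes \<Longrightarrow> prime_elem f"
  and monic_primes_degree: "f \<in> monic_primes \<Longrightarrow> degree f > 0"
  using field_poly_irreducible_imp_prime[of f]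
  by (auto simp: monic_primes_def monics_def is_unit_iff_degree irreducible_def)

lemma monic_primes_dvd_imp_eq:
  assumes "f \<in> monic_primes" "g \<in> monic_primes" "f dvd g"
  shows "f = g"
proof -
  obtain h where h: "g = f * h" using assms(3) by (elim dvdE)
  then have "h dvd 1"
    using assms monic_primes_irreducible Factorial_Ring.irreducibleD[of g f h] monic_primes_degree[of f]
    by (auto simp: is_unit_iff_degree)
  moreover have "h \<noteq> 0" using h monic_primes_nonzero[OF assms(2)] by auto
  ultimately have "degree h = 0" by (simp add: is_unit_iff_degree)
  then obtain c where c: "h = [:c:]" by (rule degree_eq_zeroE)
  then have "c = 1"
    using h monic_primes_monic[OF assms(1)] monic_primes_monic[OF assms(2)]
    by (simp add: lead_coeff_mult split: if_splits)
  then show ?thesis using h c by (simp add: one_pCons[symmetric])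
qed

section \<open>Integral elements over $A$ and primes above $f$\<close>

lemma pm_induct [case_names zero add]:
  assumes "P 0" and "\<And>w m c. P w \<Longrightarrow> P (w + Poly_Mapping.single m c)"
  shows "P (w :: 'a \<Rightarrow>\<^sub>0 'b::comm_monoid_add)"
proof (induction w rule: update_induct)
  case (update f a b)
  have "Poly_Mapping.update a b f = f + Poly_Mapping.single a b"
  proof (rule poly_mapping_eqI)
    fix k
    have "Poly_Mapping.lookup f a = 0" using update by (simp add: in_keys_iff)
    then show "Poly_Mapping.lookup (Poly_Mapping.update a b f) k =
        Poly_Mapping.lookup (f + Poly_Mapping.single a b) k"
      by (auto simp: lookup_update lookup_add lookup_single when_def)
  qed
  then show ?case using assms(2) update by simp
qed (fact assms(1))

text \<open>The additive extension of a map given on monomials. It serves three times: for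
  functionals and for the q-power map on the tensor product, and for the evaluation of integer
  polynomials.\<close>

definition pm_extend :: "('a \<Rightarrow> 'b \<Rightarrow> 'c::comm_monoid_add) \<Rightarrow> ('a \<Rightarrow>\<^sub>0 'b::zero) \<Rightarrow> 'c"
  where "pm_extend g w = (\<Sum>m\<in>Poly_Mapping.keys w. g m (Poly_Mapping.lookup w m))"

lemma pm_extend_superset:
  assumes "finite A" "Poly_Mapping.keys w \<subseteq> A" "\<And>m. g m 0 = 0"
  shows "pm_extend g w = (\<Sum>m\<in>A. g m (Poly_Mapping.lookup w m))"
  unfolding pm_extend_def
  by (rule sum.mono_neutral_left) (use assms in \<open>auto simp: in_keys_iff\<close>)

locale pm_additive =
  fixes g :: "'a \<Rightarrow> 'b::comm_monoid_add \<Rightarrow> 'c::ab_group_add"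
  assumes g_add: "g m (a + b) = g m a + g m b"
begin

lemma g_zero: "g m 0 = 0"
  using g_add[of m 0 0] by simp

lemma extend_zero [simp]: "pm_extend g 0 = 0"
  by (simp add: pm_extend_def)

lemma extend_add: "pm_extend g (v + w) = pm_extend g v + pm_extend g w"
proof -
  let ?A = "Poly_Mapping.keys v \<union> Poly_Mapping.keys w"
  have "pm_extend g (v + w) = (\<Sum>m\<in>?A. g m (Poly_Mapping.lookup (v + w) m))"
    by (rule pm_extend_superset) (use Poly_Mapping.keys_add[of v w] in \<open>auto simp: g_zero\<close>)
  moreover have "pm_extend g v = (\<Sum>m\<in>?A. g m (Poly_Mapping.lookup v m))"
    by (rule pm_extend_superset) (auto simp: g_zero)
  moreover have "pm_extend g w = (\<Sum>m\<in>?A. g m (Poly_Mapping.lookup w m))"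
    by (rule pm_extend_superset) (auto simp: g_zero)
  ultimately show ?thesis
    by (simp add: lookup_add g_add sum.distrib)
qed

lemma extend_single [simp]: "pm_extend g (Poly_Mapping.single m c) = g m c"
  by (cases "c = 0") (simp_all add: pm_extend_def g_zero)

end

lemma pm_extend_mult:
  fixes g :: "'a::comm_monoid_add \<Rightarrow> 'b::comm_ring_1 \<Rightarrow> 'c::comm_ring_1"
  assumes "\<And>m a b. g m (a + b) = g m a + g m b"
    and "\<And>m n a b. g (m + n) (a * b) = g m a * g n b"
  shows "pm_extend g (v * w) = pm_extend g v * pm_extend g w"
proof -
  interpret pm_additive g by standard (fact assms(1))
  have single: "pm_extend g (Poly_Mapping.single m c * w) = g m c * pm_extend g w" for m c w
    by (induction w rule: pm_induct)
       (simp_all add: extend_add distrib_left mult_single assms(2))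
  show ?thesis
    by (induction v rule: pm_induct) (simp_all add: extend_add distrib_right single)
qed

section \<open>Ideals of subrings\<close>

definition is_subring :: "'a::comm_ring_1 set \<Rightarrow> bool"
  where "is_subring S \<longleftrightarrow> 1 \<in> S \<and> (\<forall>x\<in>S. - x \<in> S) \<and> (\<forall>x\<in>S. \<forall>y\<in>S. x + y \<in> S \<and> x * y \<in> S)"

definition is_ideal :: "'a::comm_ring_1 set \<Rightarrow> 'a set \<Rightarrow> bool"
  where "is_ideal S I \<longleftrightarrow> I \<subseteq> S \<and> 0 \<in> I \<and> (\<forall>x\<in>I. \<forall>y\<in>I. x + y \<in> I) \<and> (\<forall>s\<in>S. \<forall>x\<in>I. s * x \<in> I)"

text \<open>Zorn's lemma yields an ideal \<open>P\<close> maximal among those that contain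
  \<open>I\<close> and miss \<open>W\<close>. If neither \<open>x\<close> nor \<open>y\<close> is in
  \<open>P\<close>, then P + S x and P + S y both meet \<open>W\<close>; the product of the two
  elements of \<open>W\<close> would lie in \<open>P\<close> if \<open>x * y\<close> did.\<close>

lemma prime_ideal_avoiding:
  fixes S :: "'a::comm_ring_1 set"
  assumes S: "is_subring S" and I: "is_ideal S I"
    and W: "W \<subseteq> S" "1 \<in> W" "\<And>x y. x \<in> W \<Longrightarrow> y \<in> W \<Longrightarrow> x * y \<in> W" "W \<inter> I = {}"
  obtains P where "is_ideal S P" "I \<subseteq> P" "P \<inter> W = {}"
    "\<And>x y. x \<in> S \<Longrightarrow> y \<in> S \<Longrightarrow> x * y \<in> P \<Longrightarrow> x \<in> P \<or> y \<in> P"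
proof -
  define U where "U = {P. is_ideal S P \<and> I \<subseteq> P \<and> P \<inter> W = {}}"
  have "\<exists>M\<in>U. (\<forall>Ic\<in>U. M \<subseteq> Ic \<longrightarrow> Ic = M)"
  proof (rule subset_Zorn_nonempty)
    show "U \<noteq> {}" using I W by (auto simp: U_def)
    fix C assume C: "C \<noteq> {}" "subset.chain U C"
    have CA: "C \<subseteq> U" and lin: "\<And>Ia Ib. Ia \<in> C \<Longrightarrow> Ib \<in> C \<Longrightarrow> Ia \<subseteq> Ib \<or> Ib \<subseteq> Ia"
      using C(2) by (auto simp: subset.chain_def)
    have id: "is_ideal S Ia" if "Ia \<in> C" for Ia using CA that by (auto simp: U_def)
    have "is_ideal S (\<Union>C)"
      unfolding is_ideal_def
    proof (intro conjI ballI)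
      show "\<Union>C \<subseteq> S" using id unfolding is_ideal_def by blast
      show "0 \<in> \<Union>C" using id C(1) unfolding is_ideal_def by blast
      show "s * x \<in> \<Union>C" if "s \<in> S" "x \<in> \<Union>C" for s x
        using that id unfolding is_ideal_def by blast
      show "x + y \<in> \<Union>C" if xy: "x \<in> \<Union>C" "y \<in> \<Union>C" for x y
      proof -
        obtain Ia Ib where Iab: "Ia \<in> C" "Ib \<in> C" "x \<in> Ia" "y \<in> Ib" using xy by blast
        then obtain Ic where "Ic \<in> C" "x \<in> Ic" "y \<in> Ic" using lin[of Ia Ib] by blast
        then show ?thesis using id[of Ic] unfolding is_ideal_def by blast
      qed
    qed
    moreover have "I \<subseteq> \<Union>C" using CA C(1) unfolding U_def by blast
    moreover have "\<Union>C \<inter> W = {}" using CA unfolding U_def by blast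
    ultimately show "\<Union>C \<in> U" unfolding U_def by blast
  qed
  then obtain P where P: "P \<in> U" and max: "\<And>Ia. Ia \<in> U \<Longrightarrow> P \<subseteq> Ia \<Longrightarrow> Ia = P" by blast
  have Pid: "is_ideal S P" using P by (simp add: U_def)
  have meets: "\<exists>p\<in>P. \<exists>s\<in>S. p + s * x \<in> W" if x: "x \<in> S" "x \<notin> P" for x
  proof (rule ccontr)
    assume no: "\<not> ?thesis"
    define Ia where "Ia = {p + s * x | p s. p \<in> P \<and> s \<in> S}"
    have 0: "0 \<in> S" "1 \<in> S" using S Pid unfolding is_ideal_def is_subring_def by blast+
    have PIa: "P \<subseteq> Ia"
    proof
      fix p assume "p \<in> P"
      then have "p + 0 * x \<in> Ia" unfolding Ia_def using 0 by blast
      then show "p \<in> Ia" by simp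
    qed
    have "is_ideal S Ia"
      unfolding is_ideal_def
    proof (intro conjI ballI)
      show "Ia \<subseteq> S"
      proof
        fix z assume "z \<in> Ia"
        then obtain p s where "z = p + s * x" "p \<in> P" "s \<in> S" unfolding Ia_def by blast
        then show "z \<in> S" using Pid S x unfolding is_ideal_def is_subring_def by blast
      qed
      show "0 \<in> Ia" using PIa Pid unfolding is_ideal_def by blast
      fix u v assume "u \<in> Ia" "v \<in> Ia"
      then obtain p s p' s' where *: "u = p + s * x" "v = p' + s' * x" "p \<in> P" "s \<in> S" "p' \<in> P" "s' \<in> S"
        unfolding Ia_def by blast
      then have "u + v = (p + p') + (s + s') * x" by (simp add: algebra_simps)
      moreover have "p + p' \<in> P" "s + s' \<in> S"
        using * Pid S unfolding is_ideal_def is_subring_def by blast+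
      ultimately show "u + v \<in> Ia" unfolding Ia_def by blast
    next
      fix t u assume "t \<in> S" "u \<in> Ia"
      then obtain p s where *: "u = p + s * x" "p \<in> P" "s \<in> S" unfolding Ia_def by blast
      then have "t * u = (t * p) + (t * s) * x" by (simp add: algebra_simps)
      moreover have "t * p \<in> P" "t * s \<in> S"
        using * Pid S \<open>t \<in> S\<close> unfolding is_ideal_def is_subring_def by blast+
      ultimately show "t * u \<in> Ia" unfolding Ia_def by blast
    qed
    moreover have "Ia \<inter> W = {}" using no unfolding Ia_def by blast
    ultimately have "Ia \<in> U" using P PIa by (auto simp: U_def)
    then have IaP: "Ia = P" using max PIa by blast
    have "0 \<in> P" using Pid unfolding is_ideal_def by blast
    then have "0 + 1 * x \<in> Ia" unfolding Ia_def using 0 by blast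
    then show False using IaP x by simp
  qed
  show ?thesis
  proof (rule that)
    show "is_ideal S P" "I \<subseteq> P" "P \<inter> W = {}" using P by (auto simp: U_def)
    fix x y assume xy: "x \<in> S" "y \<in> S" "x * y \<in> P"
    show "x \<in> P \<or> y \<in> P"
    proof (rule ccontr)
      assume "\<not> ?thesis"
      then obtain p s p' s' where *: "p \<in> P" "s \<in> S" "p + s * x \<in> W" "p' \<in> P" "s' \<in> S" "p' + s' * y \<in> W"
        using meets[of x] meets[of y] xy by blast
      have "(p + s * x) * (p' + s' * y) = (p' + s' * y) * p + ((s * x) * p' + (s * s') * (x * y))"
        by (simp add: algebra_simps)
      also have "\<dots> \<in> P"
      proof -
        have S': "u * v \<in> S" if "u \<in> S" "v \<in> S" for u v
          using S that unfolding is_subring_def by blast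
        have P1: "u * v \<in> P" if "u \<in> S" "v \<in> P" for u v
          using Pid that unfolding is_ideal_def by blast
        have P2: "v + w \<in> P" if "v \<in> P" "w \<in> P" for v w
          using Pid that unfolding is_ideal_def by blast
        have "p' + s' * y \<in> S" using * W(1) by blast
        then show ?thesis
          using P2[OF P1[OF _ *(1)] P2[OF P1[OF S' *(4)] P1[OF S' xy(3)]]] * xy by blast
      qed
      finally show False using W(3)[OF *(3) *(6)] P by (auto simp: U_def)
    qed
  qed
qed

section \<open>The integral closure of A\<close>

lemmas iota_simps = iota.hom_add iota.hom_mult iota.hom_uminus iota.hom_minus iota.hom_power
  iota.hom_sum iota.hom_prod

interpretation iota_module: Modules.module "\<lambda>(a::'q::field poly) (x::'q kbar). \<iota> a * x"
  by unfold_locales (simp_all add: algebra_simps iota_simps)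

text \<open>The determinant trick: multiplication by \<open>x\<close> on the generators is given by
  a matrix over A, and the vector of generators is an eigenvector for \<open>x\<close>, nonzero
  because of \<open>v\<close>. So the monic characteristic polynomial vanishes at
  \<open>x\<close>.\<close>

lemma integral_closure_A_I:
  fixes x :: "'q::field kbar"
  assumes V: "finite V" "v \<in> V" "v \<noteq> 0"
    and closed: "\<And>w. w \<in> V \<Longrightarrow> x * w \<in> iota_module.span V"
  shows "x \<in> integral_closure_A"
proof -
  obtain h where h: "bij_betw h {0..<card V} V"
    using ex_bij_betw_nat_finite[OF V(1)] by blast
  let ?n = "card V"
  have "\<exists>u. x * w = (\<Sum>v\<in>V. \<iota> (u v) * v)" if "w \<in> V" for w
    using closed[OF that] unfolding iota_module.span_finite[OF V(1)] by (simp add: image_iff)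
  then have "\<forall>w\<in>V. \<exists>u. x * w = (\<Sum>v\<in>V. \<iota> (u v) * v)" by blast
  from bchoice[OF this] obtain u where u: "\<And>w. w \<in> V \<Longrightarrow> x * w = (\<Sum>v\<in>V. \<iota> (u w v) * v)"
    by blast
  define N where "N = mat ?n ?n (\<lambda>(i, j). u (h i) (h j))"
  have N: "N \<in> carrier_mat ?n ?n" by (simp add: N_def)
  let ?N = "map_mat \<iota> N"
  define z where "z = vec ?n h"
  have hV: "h i \<in> V" if "i < ?n" for i using h that by (auto simp: bij_betw_def)
  have "eigenvector ?N z x"
    unfolding eigenvector_def
  proof (intro conjI)
    show "z \<in> carrier_vec (dim_row ?N)" by (simp add: z_def N_def)
    have "v \<in> h ` {0..<?n}" using h V(2) by (simp add: bij_betw_def)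
    then obtain i where i: "i < ?n" "h i = v" by auto
    show "z \<noteq> 0\<^sub>v (dim_row ?N)"
    proof
      assume "z = 0\<^sub>v (dim_row ?N)"
      then have "z $ i = 0\<^sub>v (dim_row ?N) $ i" by simp
      then show False using V(3) i by (simp add: z_def N_def)
    qed
    show "?N *\<^sub>v z = x \<cdot>\<^sub>v z"
    proof (rule eq_vecI)
      fix i assume i: "i < dim_vec (x \<cdot>\<^sub>v z)"
      then have i: "i < ?n" by (simp add: z_def)
      have "x * h i = (\<Sum>j\<in>{0..<?n}. \<iota> (u (h i) (h j)) * h j)"
        unfolding u[OF hV[OF i]] by (rule sum.reindex_bij_betw[OF h, symmetric])
      then show "(?N *\<^sub>v z) $ i = (x \<cdot>\<^sub>v z) $ i"
        using i by (simp add: z_def N_def scalar_prod_def)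
    qed (simp add: z_def N_def)
  qed
  then have "poly (char_poly ?N) x = 0"
    using eigenvalue_root_char_poly[of ?N ?n] N by (auto simp: eigenvalue_def)
  moreover have "char_poly ?N = map_poly \<iota> (char_poly N)"
    by (rule iota.char_poly_hom[OF N])
  moreover have "lead_coeff (char_poly N) = 1"
    using degree_monic_char_poly[OF N] by simp
  ultimately show ?thesis
    unfolding integral_closure_A_def by (intro CollectI exI[of _ "char_poly N"]) simp
qed

lemma poly_map_iota:
  "poly (map_poly \<iota> p) x = (\<Sum>i\<le>degree p. \<iota> (coeff p i) * x ^ i)"
proof -
  have "degree (map_poly \<iota> p) = degree p" by simp
  then show ?thesis by (simp add: poly_altdef)
qed

text \<open>A monic equation of degree \<open>n\<close> reduces powers of \<open>x\<close> to those
  below \<open>n\<close>. The factor \<open>y\<close> lets the reduction act on one variable of a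
  product of powers.\<close>

lemma integral_closure_A_span_powers:
  fixes x :: "'q::field kbar"
  assumes "x \<in> integral_closure_A"
  obtains n where "n > 0" and "\<And>i y V. i \<le> n \<Longrightarrow> (\<And>j. j < n \<Longrightarrow> x ^ j * y \<in> V) \<Longrightarrow> x ^ i * y \<in> iota_module.span V"
proof -
  obtain p where p: "lead_coeff p = 1" "poly (map_poly \<iota> p) x = 0"
    using assms by (auto simp: integral_closure_A_def)
  have "degree p \<noteq> 0"
  proof
    assume "degree p = 0"
    then obtain c where "p = [:c:]" by (rule degree_eq_zeroE)
    then have "p = 1" using p(1) by (simp add: one_pCons)
    then show False using p(2) by simp
  qed
  then obtain m where m: "degree p = Suc m" by (cases "degree p") auto
  have pow: "x ^ degree p = - (\<Sum>i<degree p. \<iota> (coeff p i) * x ^ i)"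
    using p unfolding poly_map_iota lessThan_Suc_atMost[symmetric]
    by (simp add: eq_neg_iff_add_eq_0 add.commute)
  show ?thesis
  proof (rule that[of "degree p"])
    show "degree p > 0" by (simp add: m)
    fix i y V assume i: "i \<le> degree p" and V: "\<And>j. j < degree p \<Longrightarrow> x ^ j * y \<in> V"
    show "x ^ i * y \<in> iota_module.span V"
    proof (cases "i < degree p")
      case True
      then show ?thesis by (auto intro: iota_module.span_base V)
    next
      case False
      then have "x ^ i * y = (\<Sum>j<degree p. \<iota> (- coeff p j) * (x ^ j * y))"
        using i by (simp add: pow sum_distrib_right sum_negf mult.assoc iota_simps)
      also have "\<dots> \<in> iota_module.span V"
        by (intro iota_module.span_sum iota_module.span_scale iota_module.span_base V) simp
      finally show ?thesis .
    qed
  qed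
qed

lemma span_mult_closed:
  assumes "\<And>w. w \<in> V \<Longrightarrow> x * w \<in> iota_module.span V" and "z \<in> iota_module.span V"
  shows "x * z \<in> iota_module.span V"
  using assms(2)
proof (induction rule: iota_module.span_induct_alt)
  case base
  then show ?case by (simp add: iota_module.span_zero)
next
  case (step c u y)
  have "x * (\<iota> c * u + y) = \<iota> c * (x * u) + x * y" by (simp add: algebra_simps)
  then show ?case using step assms(1)
    by (auto intro!: iota_module.span_add iota_module.span_scale)
qed

lemma
  fixes x y :: "'q::field kbar"
  assumes "x \<in> integral_closure_A" "y \<in> integral_closure_A"
  shows integral_closure_A_add: "x + y \<in> integral_closure_A"
    and integral_closure_A_mult: "x * y \<in> integral_closure_A"
proof -
  obtain n where n: "n > 0" "\<And>i y V. i \<le> n \<Longrightarrow> (\<And>j. j < n \<Longrightarrow> x ^ j * y \<in> V) \<Longrightarrow> x ^ i * y \<in> iota_module.span V"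
    by (rule integral_closure_A_span_powers[OF assms(1)]) blast
  obtain m where m: "m > 0" "\<And>i x V. i \<le> m \<Longrightarrow> (\<And>j. j < m \<Longrightarrow> y ^ j * x \<in> V) \<Longrightarrow> y ^ i * x \<in> iota_module.span V"
    by (rule integral_closure_A_span_powers[OF assms(2)]) blast
  \<comment> \<open>The monomials below the two degrees span a module stable under \<open>x\<close>
    and \<open>y\<close>, hence under their sum and product.\<close>
  define V where "V = (\<lambda>(i, j). x ^ i * y ^ j) ` ({..<n} \<times> {..<m})"
  have V: "x ^ i * y ^ j \<in> V" if "i < n" "j < m" for i j using that by (auto simp: V_def)
  have fin: "finite V" by (simp add: V_def)
  have one: "1 \<in> V" using V[OF n(1) m(1)] by simp
  have x: "x * w \<in> iota_module.span V" if w: "w \<in> V" for w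
  proof -
    obtain i j where ij: "i < n" "j < m" "w = x ^ i * y ^ j" using w by (auto simp: V_def)
    then have "x ^ Suc i * y ^ j \<in> iota_module.span V" by (intro n(2)) (auto intro: V)
    then show ?thesis by (simp add: ij mult.assoc)
  qed
  have y: "y * w \<in> iota_module.span V" if w: "w \<in> V" for w
  proof -
    obtain i j where ij: "i < n" "j < m" "w = x ^ i * y ^ j" using w by (auto simp: V_def)
    then have "y ^ Suc j * x ^ i \<in> iota_module.span V"
      using V by (intro m(2)) (auto simp: mult.commute)
    then show ?thesis by (simp add: ij mult_ac)
  qed
  show "x + y \<in> integral_closure_A"
    by (rule integral_closure_A_I[OF fin one])
       (auto simp: distrib_right intro!: iota_module.span_add x y)
  show "x * y \<in> integral_closure_A"
    by (rule integral_closure_A_I[OF fin one])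
       (auto simp: mult.assoc intro!: span_mult_closed[OF x] y)
qed

lemma integral_closure_A_iota [simp]: "\<iota> a \<in> integral_closure_A"
proof -
  have "poly (map_poly \<iota> [:- a, 1:]) (\<iota> a) = 0" by (simp add: map_poly_pCons iota_simps)
  then show ?thesis unfolding integral_closure_A_def
    by (intro CollectI exI[of _ "[:- a, 1:]"]) simp
qed

lemma integral_closure_A_0 [simp]: "0 \<in> integral_closure_A"
  and integral_closure_A_1 [simp]: "1 \<in> integral_closure_A"
  using integral_closure_A_iota[of 0] integral_closure_A_iota[of 1] by simp_all

lemma integral_closure_A_uminus: "x \<in> integral_closure_A \<Longrightarrow> - x \<in> integral_closure_A"
  using integral_closure_A_mult[OF integral_closure_A_iota[of "- 1"], of x] by (simp add: iota_simps)

lemma integral_closure_A_diff: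
  "x \<in> integral_closure_A \<Longrightarrow> y \<in> integral_closure_A \<Longrightarrow> x - y \<in> integral_closure_A"
  using integral_closure_A_add[of x "- y"] integral_closure_A_uminus[of y] by simp

lemma integral_closure_A_power: "x \<in> integral_closure_A \<Longrightarrow> x ^ n \<in> integral_closure_A"
  by (induction n) (auto intro: integral_closure_A_mult)

lemma integral_closure_A_sum:
  "(\<And>i. i \<in> I \<Longrightarrow> f i \<in> integral_closure_A) \<Longrightarrow> sum f I \<in> integral_closure_A"
  by (induction I rule: infinite_finite_induct) (auto intro: integral_closure_A_add)

lemma is_subring_integral_closure_A: "is_subring (integral_closure_A :: 'q::field kbar set)"
  by (simp add: is_subring_def integral_closure_A_uminus integral_closure_A_add integral_closure_A_mult)

text \<open>A is integrally closed: in a denominator \<open>b\<close> of least degree, a prime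
  factor would divide the numerator as well, by the integral equation multiplied by a power of
  \<open>b\<close>, and could be cancelled.\<close>

lemma integral_closure_A_K:
  fixes c :: "'q::field poly fract"
  assumes "to_ac c \<in> integral_closure_A"
  obtains a where "to_ac c = \<iota> a"
proof -
  let ?P = "\<lambda>b. b \<noteq> 0 \<and> (\<exists>a. \<iota> b * to_ac c = \<iota> a)"
  obtain a' b' where "c = Fract a' b'" "b' \<noteq> 0" by (cases c) auto
  then have "to_fract b' * c = to_fract a'" by (simp add: Fract_conv_to_fract)
  then have "\<iota> b' * to_ac c = \<iota> a'" unfolding \<iota>_def by (simp flip: to_ac_mult)
  then have "?P b'" using \<open>b' \<noteq> 0\<close> by blast
  then obtain b where b: "?P b" "\<And>x. ?P x \<Longrightarrow> degree b \<le> degree x"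
    using ex_has_least_nat[of ?P b' degree] by auto
  then obtain a where a: "\<iota> b * to_ac c = \<iota> a" by auto
  obtain p where p: "lead_coeff p = 1" "poly (map_poly \<iota> p) (to_ac c) = 0"
    using assms by (auto simp: integral_closure_A_def)
  have "degree b = 0"
  proof (rule ccontr)
    assume "degree b \<noteq> 0"
    then have "degree b > 0" by simp
    then obtain f where f: "irreducible f" "f dvd b" "lead_coeff f = 1"
      by (rule irreducible_factor_exists)
    then obtain b1 where b1: "b = f * b1" by (elim dvdE)
    let ?n = "degree p"
    have "0 = \<iota> b ^ ?n * (\<Sum>i\<le>?n. \<iota> (coeff p i) * to_ac c ^ i)"
      using p by (simp add: poly_map_iota)
    also have "\<dots> = (\<Sum>i\<le>?n. \<iota> (coeff p i * b ^ (?n - i) * a ^ i))"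
      unfolding sum_distrib_left
    proof (rule sum.cong)
      fix i assume "i \<in> {..?n}"
      then have "\<iota> b ^ ?n = \<iota> b ^ (?n - i) * \<iota> b ^ i" by (simp flip: power_add)
      then show "\<iota> b ^ ?n * (\<iota> (coeff p i) * to_ac c ^ i) = \<iota> (coeff p i * b ^ (?n - i) * a ^ i)"
        by (simp add: a[symmetric] iota.hom_mult iota.hom_power power_mult_distrib mult_ac)
    qed simp
    also have "\<dots> = \<iota> (\<Sum>i\<le>?n. coeff p i * b ^ (?n - i) * a ^ i)" by (simp add: iota.hom_sum)
    finally have "(\<Sum>i\<le>?n. coeff p i * b ^ (?n - i) * a ^ i) = 0" by simp
    then have "a ^ ?n = - (\<Sum>i<?n. coeff p i * b ^ (?n - i) * a ^ i)"
      using p(1) by (simp add: lessThan_Suc_atMost[symmetric] eq_neg_iff_add_eq_0 add.commute)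
    moreover have "f dvd (\<Sum>i<?n. coeff p i * b ^ (?n - i) * a ^ i)"
    proof (rule dvd_sum)
      fix i assume "i \<in> {..<?n}"
      then have "b dvd b ^ (?n - i)" by (simp add: dvd_power)
      then show "f dvd coeff p i * b ^ (?n - i) * a ^ i"
        using dvd_trans[OF f(2), of "b ^ (?n - i)"] by (intro dvd_mult2 dvd_mult) auto
    qed
    ultimately have "f dvd a ^ ?n" by simp
    then have "f dvd a"
      by (rule prime_elem_dvd_power[OF field_poly_irreducible_imp_prime[OF f(1)]])
    then obtain a1 where a1: "a = f * a1" by (elim dvdE)
    have f0: "\<iota> f \<noteq> 0" using f by (auto simp: irreducible_def)
    have "\<iota> f * (\<iota> b1 * to_ac c) = \<iota> f * \<iota> a1"
      using a unfolding a1 b1 by (simp only: iota.hom_mult mult.assoc)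
    then have "\<iota> b1 * to_ac c = \<iota> a1" by (simp only: mult_left_cancel[OF f0])
    moreover have "b1 \<noteq> 0" "degree b1 < degree b"
    proof -
      show "b1 \<noteq> 0" using b b1 by auto
      have "degree f > 0" using f by (auto simp: irreducible_def is_unit_iff_degree)
      then show "degree b1 < degree b"
        unfolding b1 using \<open>b1 \<noteq> 0\<close> f by (subst degree_mult_eq) (auto simp: irreducible_def)
    qed
    ultimately show False using b(2)[of b1] by auto
  qed
  then obtain k where k: "b = [:k:]" by (rule degree_eq_zeroE)
  have "k \<noteq> 0" using b(1) k by auto
  have "\<iota> ([:inverse k:] * a) = scal (inverse k) * scal k * to_ac c"
    unfolding iota.hom_mult a[symmetric] k by (simp only: mult.assoc)
  also have "scal (inverse k) * scal k = 1"
    using \<open>k \<noteq> 0\<close> by (simp flip: scal.hom_mult)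
  finally have "to_ac c = \<iota> ([:inverse k:] * a)" by simp
  then show ?thesis by (rule that)
qed

text \<open>An algebraic element times the leading coefficient of an equation over A satisfies a
  monic equation over A.\<close>

lemma integral_closure_A_clear:
  fixes x :: "'q::field kbar"
  obtains a where "a \<noteq> 0" "\<iota> a * x \<in> integral_closure_A"
proof -
  obtain p0 where p0: "p0 \<noteq> 0" "poly (map_poly to_ac p0) x = 0"
    by (rule alg_closure_algebraic)
  obtain p :: "'q poly poly" where p: "p \<noteq> 0" "poly (map_poly \<iota> p) x = 0"
  proof -
    have "\<exists>d p. d \<noteq> 0 \<and> smult (to_fract d) p0 = map_poly to_fract (p :: 'q poly poly)"
    proof (induction p0)
      case 0
      then show ?case by (intro exI[of _ 1] exI[of _ 0]) simp
    next
      case (pCons c p0)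
      then obtain d p where dp: "d \<noteq> 0" "smult (to_fract d) p0 = map_poly to_fract (p :: 'q poly poly)"
        by auto
      obtain u v where c: "c = Fract u v" "v \<noteq> 0" by (cases c) auto
      have "smult (to_fract (v * d)) (pCons c p0) = map_poly to_fract (pCons (d * u) (smult v p))"
      proof (rule poly_eqI)
        fix i
        have 1: "to_fract (v * d) * c = to_fract (d * u)"
          using c by (simp add: Fract_conv_to_fract)
        have 2: "to_fract (v * d) * coeff p0 k = to_fract (v * coeff p k)" for k
          using arg_cong[OF dp(2), of "\<lambda>p. to_fract v * coeff p k"]
          by (simp add: coeff_map_poly to_fract.hom_mult mult.assoc)
        show "coeff (smult (to_fract (v * d)) (pCons c p0)) i =
            coeff (map_poly to_fract (pCons (d * u) (smult v p))) i"
          using 1 2 by (cases i) (simp_all add: coeff_map_poly)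
      qed
      moreover have "v * d \<noteq> 0" using dp(1) c(2) by simp
      ultimately show ?case by blast
    qed
    then obtain d p where dp: "d \<noteq> 0" "smult (to_fract d) p0 = map_poly to_fract (p :: 'q poly poly)"
      by auto
    have "map_poly \<iota> p = map_poly to_ac (map_poly to_fract p)"
      by (intro poly_eqI) (simp add: coeff_map_poly \<iota>_def)
    also have "\<dots> = smult (to_ac (to_fract d)) (map_poly to_ac p0)"
      unfolding dp(2)[symmetric] by (intro poly_eqI) (simp add: coeff_map_poly)
    finally have "poly (map_poly \<iota> p) x = 0" by (simp add: p0)
    moreover have "p \<noteq> 0" using dp p0 by auto
    ultimately show ?thesis using that by blast
  qed
  define n where "n = degree p"
  have "n > 0"
  proof (rule ccontr)
    assume "\<not> n > 0"
    then have "degree p = 0" by (simp add: n_def)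
    then obtain c where "p = [:c:]" by (rule degree_eq_zeroE)
    then show False using p by (simp add: map_poly_pCons)
  qed
  define y where "y = \<iota> (lead_coeff p) * x"
  \<comment> \<open>Multiplying the equation of \<open>x\<close> by the power \<open>n - 1\<close>
    of its leading coefficient turns it into this monic equation for \<open>y\<close>.\<close>
  define r where "r = monom 1 n + (\<Sum>i<n. monom (coeff p i * lead_coeff p ^ (n - 1 - i)) i)"
  have ri: "coeff r i = (if i = n then 1 else if i < n then coeff p i * lead_coeff p ^ (n - 1 - i) else 0)" for i
  proof -
    have "(\<Sum>j<n. coeff (monom (coeff p j * lead_coeff p ^ (n - 1 - j)) j) i)
        = (\<Sum>j<n. if j = i then coeff p i * lead_coeff p ^ (n - 1 - i) else 0)"
      by (intro sum.cong) auto
    also have "\<dots> = (if i < n then coeff p i * lead_coeff p ^ (n - 1 - i) else 0)"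
      by (simp add: sum.delta)
    finally show ?thesis by (auto simp: r_def coeff_sum)
  qed
  have degr: "degree r = n"
    by (intro antisym degree_le le_degree) (auto simp: ri)
  have pp: "poly (map_poly \<iota> p) x = (\<Sum>i\<le>n. \<iota> (coeff p i) * x ^ i)"
    by (simp add: poly_map_iota n_def)
  have pr: "poly (map_poly \<iota> r) y = (\<Sum>i\<le>n. \<iota> (coeff r i) * y ^ i)"
    by (simp add: poly_map_iota degr)
  have "poly (map_poly \<iota> r) y = \<iota> (lead_coeff p) ^ (n - 1) * poly (map_poly \<iota> p) x"
    unfolding pr pp sum_distrib_left
  proof (rule sum.cong)
    fix i assume "i \<in> {..n}"
    then have "i = n \<or> i < n" by auto
    then consider "i = n" | "i < n" by blast
    then show "\<iota> (coeff r i) * y ^ i = \<iota> (lead_coeff p) ^ (n - 1) * (\<iota> (coeff p i) * x ^ i)"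
    proof cases
      case 1
      obtain m where m: "n = Suc m" using \<open>n > 0\<close> by (cases n) auto
      have "coeff p n = lead_coeff p" by (simp add: n_def)
      then show ?thesis unfolding 1 ri y_def power_mult_distrib by (simp add: m)
    next
      case 2
      then have "\<iota> (lead_coeff p) ^ (n - 1) = \<iota> (lead_coeff p) ^ (n - 1 - i) * \<iota> (lead_coeff p) ^ i"
        by (simp flip: power_add)
      then show ?thesis using 2
        by (simp add: ri y_def power_mult_distrib iota.hom_mult iota.hom_power mult_ac)
    qed
  qed simp
  then have "y \<in> integral_closure_A"
    unfolding integral_closure_A_def using p degr by (intro CollectI exI[of _ r]) (simp add: ri)
  then show ?thesis using that[of "lead_coeff p"] p by (simp add: y_def)
qed

section \<open>Residues modulo a prime\<close>

text \<open>Canonical representatives modulo a polynomial of degree \<open>n\<close>. Prescribing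
  coefficients instead of the degree makes \<open>lowdeg 0\<close> equal to \<open>{0}\<close>, so
  that the count q^n holds for all \<open>n\<close>.\<close>

definition lowdeg :: "nat \<Rightarrow> 'a::zero poly set"
  where "lowdeg n = {p. \<forall>i\<ge>n. coeff p i = 0}"

lemma lowdeg_iff: "p \<in> lowdeg n \<longleftrightarrow> p = 0 \<or> degree p < n"
  unfolding lowdeg_def using le_degree[of p] coeff_eq_0[of p]
  by (auto simp: not_less[symmetric])

lemma lowdeg_0 [simp]: "lowdeg 0 = {0}"
  by (auto simp: lowdeg_iff)

lemma lowdeg_Suc: "lowdeg (Suc n) = (\<lambda>(a, p). pCons a p) ` (UNIV \<times> lowdeg n)"
proof (intro equalityI subsetI)
  fix p :: "'a poly" assume p: "p \<in> lowdeg (Suc n)"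
  obtain a p' where "p = pCons a p'" by (cases p)
  moreover have "p' \<in> lowdeg n"
    unfolding lowdeg_def
  proof (intro CollectI allI impI)
    fix i assume "i \<ge> n"
    then have "coeff p (Suc i) = 0" using p by (simp add: lowdeg_def)
    then show "coeff p' i = 0" using \<open>p = pCons a p'\<close> by simp
  qed
  ultimately show "p \<in> (\<lambda>(a, p). pCons a p) ` (UNIV \<times> lowdeg n)" by auto
next
  fix p :: "'a poly" assume "p \<in> (\<lambda>(a, p). pCons a p) ` (UNIV \<times> lowdeg n)"
  then show "p \<in> lowdeg (Suc n)" by (auto simp: lowdeg_def coeff_pCons split: nat.splits)
qed

lemma finite_lowdeg [simp]: "finite (lowdeg n :: 'q::{zero,finite} poly set)"
  by (induction n) (simp_all add: lowdeg_Suc)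

lemma card_lowdeg: "card (lowdeg n :: 'q::{zero,finite} poly set) = CARD('q) ^ n"
proof (induction n)
  case (Suc n)
  have "inj_on (\<lambda>(a, p). pCons a p) (UNIV \<times> lowdeg n :: ('q \<times> 'q poly) set)"
    by (auto simp: inj_on_def)
  then show ?case using Suc by (simp add: lowdeg_Suc card_image card_cartesian_product)
qed simp

lemma mod_lowdeg: "degree f > 0 \<Longrightarrow> (a mod f :: 'a::field poly) \<in> lowdeg (degree f)"
proof -
  assume "degree f > 0"
  then have "f \<noteq> 0" by auto
  then show ?thesis using degree_mod_less[of f a] by (simp add: lowdeg_iff)
qed

lemma prime_elem_dvd_prodD:
  assumes "prime_elem p" "finite A" "p dvd prod f A"
  shows "\<exists>x\<in>A. p dvd f x"
  using assms(2,3)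
proof (induction A rule: finite_induct)
  case empty
  then show ?case using assms(1) by (simp add: prime_elem_def)
next
  case (insert x A)
  then show ?case using assms(1) by (auto simp: prime_elem_dvd_mult_iff)
qed

text \<open>Multiplication by \<open>a\<close> prime to \<open>f\<close> permutes the nonzero
  residues; compare the products of all of them.\<close>

lemma poly_little_fermat:
  fixes f a :: "'q::{field,finite} poly"
  assumes "irreducible f"
  shows "f dvd a ^ (CARD('q) ^ degree f) - a"
proof (cases "f dvd a")
  case True
  then show ?thesis by (intro dvd_diff dvd_trans[OF True dvd_power]) auto
next
  case False
  let ?U = "lowdeg (degree f) - {0} :: 'q poly set"
  have prime: "prime_elem f" by (rule field_poly_irreducible_imp_prime[OF assms])
  have f: "f \<noteq> 0" "degree f > 0"
    using assms by (auto simp: irreducible_def is_unit_iff_degree)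
  have ndvd: "\<not> f dvd x" if "x \<in> ?U" for x
  proof
    assume "f dvd x"
    then have "degree f \<le> degree x" using that by (intro dvd_imp_degree_le) auto
    then show False using that by (auto simp: lowdeg_iff)
  qed
  have inj: "inj_on (\<lambda>x. (a * x) mod f) ?U"
  proof (rule inj_onI)
    fix x y assume xy: "x \<in> ?U" "y \<in> ?U" "(a * x) mod f = (a * y) mod f"
    then have "f dvd a * (x - y)" by (simp add: mod_eq_dvd_iff right_diff_distrib)
    then have "f dvd x - y" using prime False by (simp add: prime_elem_dvd_mult_iff)
    moreover have "x - y \<in> lowdeg (degree f)" using xy by (auto simp: lowdeg_def)
    ultimately have "x - y = 0" using ndvd[of "x - y"] by blast
    then show "x = y" by simp
  qed
  have sub: "(\<lambda>x. (a * x) mod f) ` ?U \<subseteq> ?U"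
  proof (rule image_subsetI)
    fix x assume x: "x \<in> ?U"
    have "\<not> f dvd a * x" using ndvd[OF x] False prime by (simp add: prime_elem_dvd_mult_iff)
    then show "(a * x) mod f \<in> ?U" using mod_lowdeg[of f] f by (auto simp: dvd_eq_mod_eq_0)
  qed
  have bij: "bij_betw (\<lambda>x. (a * x) mod f) ?U ?U"
    using inj sub by (simp add: bij_betw_def endo_inj_surj)
  have "(\<Prod>x\<in>?U. x) mod f = (\<Prod>x\<in>?U. (a * x) mod f) mod f"
    using prod.reindex_bij_betw[OF bij, of "\<lambda>x. x"] by simp
  also have "\<dots> = (\<Prod>x\<in>?U. a * x) mod f"
    by (rule mod_prod_eq)
  also have "(\<Prod>x\<in>?U. a * x) = a ^ card ?U * (\<Prod>x\<in>?U. x)"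
    by (simp add: prod.distrib)
  finally have "f dvd a ^ card ?U * (\<Prod>x\<in>?U. x) - (\<Prod>x\<in>?U. x)"
    by (simp add: mod_eq_dvd_iff dvd_diff_commute)
  then have "f dvd (a ^ card ?U - 1) * (\<Prod>x\<in>?U. x)"
    by (simp add: left_diff_distrib)
  moreover have "\<not> f dvd (\<Prod>x\<in>?U. x)"
    using prime_elem_dvd_prodD[OF prime, of ?U "\<lambda>x. x"] ndvd by auto
  ultimately have "f dvd a ^ card ?U - 1"
    using prime by (simp add: prime_elem_dvd_mult_iff)
  then have "f dvd a * (a ^ card ?U - 1)" by simp
  moreover have "CARD('q) ^ degree f = Suc (card ?U)"
    using card_Suc_Diff1[of "lowdeg (degree f) :: 'q poly set" 0]
    by (simp add: card_lowdeg lowdeg_iff)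
  ultimately show ?thesis by (simp add: right_diff_distrib)
qed

section \<open>Primes above f\<close>

text \<open>By Bezout, 1 would otherwise be in \<open>P\<close>. So \<open>P\<close> meets A exactly
  in the multiples of \<open>f\<close>.\<close>

lemma prime_above_not_mem:
  assumes P: "prime_above f P" and f: "irreducible f" and a: "\<not> f dvd a"
  shows "\<iota> a \<notin> P"
proof
  assume aP: "\<iota> a \<in> P"
  obtain u v where "u * a + v * f = 1" using irreducible_bezout[OF f a] .
  then have "1 = \<iota> u * \<iota> a + \<iota> v * \<iota> f" by (metis iota.hom_add iota.hom_mult iota.hom_one)
  also have "\<dots> \<in> P" using P aP by (simp add: prime_above_def)
  finally show False using P by (simp add: prime_above_def)
qed

lemma prime_above_is_ideal: "prime_above f P \<Longrightarrow> is_ideal integral_closure_A P"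
  unfolding is_ideal_def prime_above_def
  by (metis integral_closure_A_0 mult_zero_left)

lemma prime_above_add: "prime_above f P \<Longrightarrow> x \<in> P \<Longrightarrow> y \<in> P \<Longrightarrow> x + y \<in> P"
  and prime_above_mult: "prime_above f P \<Longrightarrow> x \<in> integral_closure_A \<Longrightarrow> y \<in> P \<Longrightarrow> x * y \<in> P"
  and prime_above_prime: "prime_above f P \<Longrightarrow> x \<in> integral_closure_A \<Longrightarrow> y \<in> integral_closure_A \<Longrightarrow>
    x * y \<in> P \<Longrightarrow> x \<in> P \<or> y \<in> P"
  and prime_above_integral: "prime_above f P \<Longrightarrow> x \<in> P \<Longrightarrow> x \<in> integral_closure_A"
  and prime_above_1: "prime_above f P \<Longrightarrow> 1 \<notin> P"
  unfolding prime_above_def by blast+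

lemma prime_above_0: "prime_above f P \<Longrightarrow> 0 \<in> P"
  using prime_above_is_ideal[of f P] by (simp add: is_ideal_def)

lemma prime_above_uminus: "prime_above f P \<Longrightarrow> x \<in> P \<Longrightarrow> - x \<in> P"
  using prime_above_mult[of f P "- 1" x] integral_closure_A_uminus[of 1] by simp

lemma prime_above_diff: "prime_above f P \<Longrightarrow> x \<in> P \<Longrightarrow> y \<in> P \<Longrightarrow> x - y \<in> P"
  using prime_above_add[of f P x "- y"] prime_above_uminus[of f P y] by simp

lemma prime_above_dvd:
  assumes P: "prime_above f P" and "f dvd a"
  shows "\<iota> a \<in> P"
proof -
  obtain b where "a = f * b" using assms(2) by (elim dvdE)
  then show ?thesis using P by (simp add: prime_above_def iota.hom_mult mult.commute)
qed

text \<open>The ideal generated by \<open>f\<close> is proper: 1/f lies in K but not in A, hence is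
  not integral. An ideal that is prime and avoids \<open>{1}\<close> then exists above it.\<close>

lemma prime_above_exists:
  assumes "irreducible f"
  obtains P where "prime_above f P"
proof -
  let ?R = "integral_closure_A :: 'a kbar set"
  define I where "I = (\<lambda>x. \<iota> f * x) ` ?R"
  have f: "f \<noteq> 0" using assms by (auto simp: irreducible_def)
  have I: "is_ideal ?R I"
    unfolding is_ideal_def
  proof (intro conjI ballI)
    show "I \<subseteq> ?R" by (auto simp: I_def intro: integral_closure_A_mult)
    show "0 \<in> I" unfolding I_def by (rule image_eqI[of _ _ 0]) auto
    fix x y assume "x \<in> I" "y \<in> I"
    then obtain u v where "x = \<iota> f * u" "y = \<iota> f * v" "u \<in> ?R" "v \<in> ?R" unfolding I_def by blast
    then have "x + y = \<iota> f * (u + v)" "u + v \<in> ?R" by (auto simp: algebra_simps intro: integral_closure_A_add)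
    then show "x + y \<in> I" unfolding I_def by blast
  next
    fix s x assume "s \<in> ?R" "x \<in> I"
    then obtain u where "x = \<iota> f * u" "u \<in> ?R" unfolding I_def by blast
    then have "s * x = \<iota> f * (s * u)" "s * u \<in> ?R"
      using \<open>s \<in> ?R\<close> by (auto simp: algebra_simps intro: integral_closure_A_mult)
    then show "s * x \<in> I" unfolding I_def by blast
  qed
  have "1 \<notin> I"
  proof
    assume "1 \<in> I"
    then obtain x where x: "1 = \<iota> f * x" "x \<in> ?R" unfolding I_def by blast
    have fx: "\<iota> f \<noteq> 0" using f by simp
    have "x = to_ac (inverse (to_fract f))"
      using x(1) fx by (simp add: \<iota>_def field_simps)
    then obtain a where "x = \<iota> a" using integral_closure_A_K x(2) by metis
    then have "f * a = 1" using x(1) by (metis iota.hom_mult iota.hom_one iota.eq_iff)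
    then have "f dvd 1" by (metis dvd_triv_left)
    then show False using irreducible_not_unit[OF assms] by simp
  qed
  then obtain P where P: "is_ideal ?R P" "I \<subseteq> P" "P \<inter> {1} = {}"
    "\<And>x y. x \<in> ?R \<Longrightarrow> y \<in> ?R \<Longrightarrow> x * y \<in> P \<Longrightarrow> x \<in> P \<or> y \<in> P"
    using prime_ideal_avoiding[OF is_subring_integral_closure_A I, of "{1}"] by auto
  have "\<iota> f \<in> I" unfolding I_def by (rule image_eqI[of _ _ 1]) auto
  then have "prime_above f P"
    using P unfolding prime_above_def is_ideal_def by blast
  then show ?thesis by (rule that)
qed

section \<open>Functionals over K and q-powers\<close>

interpretation Kvs: vector_space "\<lambda>(c::'q::field poly fract) (x::'q kbar). to_ac c * x"
  by unfold_locales (simp_all add: algebra_simps)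

interpretation Kvs: vector_space_pair "\<lambda>(c::'q::field poly fract) (x::'q kbar). to_ac c * x"
  "\<lambda>(c::'q poly fract) (x::'q kbar). to_ac c * x" ..

text \<open>Elements of the tensor product of the algebraic closure with itself over K are tested by
  the maps x \<otimes> y to x h(y), one for each such \<open>h\<close>.\<close>

definition K_linear :: "('q::field kbar \<Rightarrow> 'q kbar) \<Rightarrow> bool"
  where "K_linear h \<longleftrightarrow> (\<forall>x y. h (x + y) = h x + h y) \<and> (\<forall>c x. h (to_ac c * x) = to_ac c * h x)"

lemma K_linear_0: "K_linear h \<Longrightarrow> h 0 = 0"
  by (metis K_linear_def add_cancel_right_right)

lemma K_linear_sum: "K_linear h \<Longrightarrow> h (\<Sum>i\<in>I. to_ac (c i) * x i) = (\<Sum>i\<in>I. to_ac (c i) * h (x i))"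
  by (induction I rule: infinite_finite_induct) (simp_all add: K_linear_def K_linear_0)

text \<open>Among the multiples with entries in A take one of least total degree: if
  \<open>f\<close> divided all its entries, it could be divided out. Thus a relation over K can be
  chosen that stays nontrivial modulo \<open>f\<close>.\<close>

lemma primitive_multiple:
  fixes u :: "'i \<Rightarrow> 'q::field poly fract"
  assumes "finite B" "b0 \<in> B" "u b0 \<noteq> 0" and f: "irreducible f"
  obtains c t where "t \<noteq> 0" "\<And>b. b \<in> B \<Longrightarrow> to_fract (c b) = t * u b" "\<exists>b\<in>B. \<not> f dvd c b"
proof -
  have f0: "degree f > 0" "f \<noteq> 0" using f by (auto simp: irreducible_def is_unit_iff_degree)
  define Q where "Q c \<longleftrightarrow> (\<exists>t. t \<noteq> 0 \<and> (\<forall>b\<in>B. to_fract (c b) = t * u b))" for c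
  have "\<exists>c. Q c"
  proof -
    have "\<exists>n d. u b = Fract n d \<and> d \<noteq> 0" for b by (cases "u b") auto
    then obtain n d where nd: "\<And>b. u b = Fract (n b) (d b)" "\<And>b. d b \<noteq> 0" by metis
    define t where "t = to_fract (\<Prod>b\<in>B. d b)"
    have "to_fract (n b * (\<Prod>b'\<in>B - {b}. d b')) = t * u b" if "b \<in> B" for b
    proof -
      have "(\<Prod>b\<in>B. d b) = d b * (\<Prod>b'\<in>B - {b}. d b')" by (rule prod.remove[OF assms(1) that])
      then show ?thesis using nd by (simp add: t_def Fract_conv_to_fract)
    qed
    moreover have "t \<noteq> 0" using nd assms(1) by (simp add: t_def)
    ultimately show ?thesis unfolding Q_def
      by (intro exI[of _ "\<lambda>b. n b * (\<Prod>b'\<in>B - {b}. d b')"] exI[of _ t]) simp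
  qed
  then obtain c where c: "Q c" "\<And>c'. Q c' \<Longrightarrow> (\<Sum>b\<in>B. degree (c b)) \<le> (\<Sum>b\<in>B. degree (c' b))"
    using ex_has_least_nat[of Q _ "\<lambda>c. \<Sum>b\<in>B. degree (c b)"] by metis
  obtain t where t: "t \<noteq> 0" "\<And>b. b \<in> B \<Longrightarrow> to_fract (c b) = t * u b"
    using c(1) by (auto simp: Q_def)
  have "\<exists>b\<in>B. \<not> f dvd c b"
  proof (rule ccontr)
    assume "\<not> ?thesis"
    then have "\<forall>b\<in>B. \<exists>e. c b = f * e" by (auto elim: dvdE)
    then obtain e where e: "\<And>b. b \<in> B \<Longrightarrow> c b = f * e b" by metis
    have "Q e"
      unfolding Q_def
    proof (intro exI conjI ballI)
      show "t / to_fract f \<noteq> 0" using t f0 by simp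
      fix b assume "b \<in> B"
      then have "to_fract f * to_fract (e b) = t * u b" using t(2) e by (simp flip: to_fract_mult)
      then show "to_fract (e b) = t / to_fract f * u b" using f0 by (simp add: field_simps)
    qed
    moreover have "(\<Sum>b\<in>B. degree (e b)) < (\<Sum>b\<in>B. degree (c b))"
    proof (rule sum_strict_mono_ex1[OF assms(1)])
      show "\<forall>b\<in>B. degree (e b) \<le> degree (c b)"
        using e f0 degree_mult_right_le[of f] by (simp add: mult.commute[of f])
      have "c b0 \<noteq> 0" using t assms by force
      then have "e b0 \<noteq> 0" using e[OF assms(2)] by auto
      then have "degree (c b0) = degree f + degree (e b0)"
        using e[OF assms(2)] f0 by (simp add: degree_mult_eq)
      then show "\<exists>b\<in>B. degree (e b) < degree (c b)" using assms(2) f0 by (intro bexI[of _ b0]) auto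
    qed
    ultimately show False using c(2) by (metis not_less)
  qed
  then show ?thesis using that t by blast
qed

text \<open>This says that $x \otimes y \mapsto x y^Q \bmod \mathfrak{P}$ is well defined on the image of
  $R \otimes_A R$ in $\overline{K} \otimes_K \overline{K}$.  The elements \<open>b\<close> are removed
  one at a time by a relation among them with a coefficient that is invertible at \<open>f\<close>.\<close>
lemma tensor_frobenius_well_defined:
  fixes f :: "'q::{field,finite} poly"
  assumes P: "prime_above f P" and f: "irreducible f"
    and "finite B" and "B \<subseteq> integral_closure_A" and "\<And>b. b \<in> B \<Longrightarrow> a b \<in> integral_closure_A"
    and "\<And>h. K_linear h \<Longrightarrow> (\<Sum>b\<in>B. a b * h b) = 0"
  shows "(\<Sum>b\<in>B. a b * b ^ (CARD('q) ^ degree f)) \<in> P"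
  using assms(3-)
proof (induction "card B" arbitrary: B a)
  case 0
  then show ?case using prime_above_is_ideal[OF P] by (simp add: is_ideal_def)
next
  case (Suc n)
  let ?Q = "CARD('q) ^ degree f" and ?R = "integral_closure_A :: 'q kbar set"
  note Pid = prime_above_is_ideal[OF P]
  show ?case
  proof (cases "Kvs.dependent B")
    case False
    \<comment> \<open>An independent family has a functional that is 1 at \<open>b0\<close> and 0 at
      its other members; it isolates the coefficient.\<close>
    have "a b0 = 0" if b0: "b0 \<in> B" for b0
    proof -
      obtain h where h: "Vector_Spaces.linear (\<lambda>c. (*) (to_ac c)) (\<lambda>c. (*) (to_ac c)) h"
        "\<forall>x\<in>B. h x = (if x = b0 then 1 else 0)"
        using Kvs.linear_independent_extend[OF False, of "\<lambda>x. if x = b0 then 1 else 0"] by blast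
      interpret h: Vector_Spaces.linear "\<lambda>c. (*) (to_ac c)" "\<lambda>c. (*) (to_ac c)" h by (rule h(1))
      have "K_linear h" by (simp add: K_linear_def h.add h.scale)
      then have "0 = (\<Sum>b\<in>B. a b * h b)" using Suc.prems by simp
      also have "\<dots> = (\<Sum>b\<in>B. if b = b0 then a b0 else 0)" by (intro sum.cong) (auto simp: h(2))
      also have "\<dots> = a b0" using b0 Suc.prems by simp
      finally show ?thesis by simp
    qed
    then show ?thesis using Pid by (simp add: is_ideal_def)
  next
    case True
    then obtain u b0 where u: "b0 \<in> B" "u b0 \<noteq> 0" "(\<Sum>b\<in>B. to_ac (u b) * b) = 0"
      using Kvs.dependent_finite[OF Suc.prems(1)] by auto
    obtain c t where c: "t \<noteq> 0" "\<And>b. b \<in> B \<Longrightarrow> to_fract (c b) = t * u b" "\<exists>b\<in>B. \<not> f dvd c b"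
      by (rule primitive_multiple[of B b0 u f]) (use u Suc.prems f in auto)
    obtain j where j: "j \<in> B" "\<not> f dvd c j" using c by auto
    have rel: "(\<Sum>b\<in>B. \<iota> (c b) * h b) = 0" if "K_linear h" for h
    proof -
      have "(\<Sum>b\<in>B. \<iota> (c b) * h b) = (\<Sum>b\<in>B. to_ac t * (to_ac (u b) * h b))"
      proof (rule sum.cong)
        fix b assume "b \<in> B"
        then have "\<iota> (c b) = to_ac t * to_ac (u b)" unfolding \<iota>_def c(2)[OF \<open>b \<in> B\<close>] by simp
        then show "\<iota> (c b) * h b = to_ac t * (to_ac (u b) * h b)" by (simp only: mult.assoc)
      qed simp
      also have "\<dots> = to_ac t * (\<Sum>b\<in>B. to_ac (u b) * h b)" by (simp only: sum_distrib_left)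
      also have "\<dots> = to_ac t * h (\<Sum>b\<in>B. to_ac (u b) * b)"
        by (simp only: K_linear_sum[OF that, of u "\<lambda>b. b" B])
      finally show ?thesis by (simp add: u K_linear_0[OF that])
    qed
    \<comment> \<open>The Q-th power of the relation has coefficients c^Q, which are congruent to c
      modulo \<open>f\<close>; so the relation persists modulo \<open>P\<close> for the Q-th powers
      of the elements.\<close>
    have relP: "(\<Sum>b\<in>B. \<iota> (c b) * b ^ ?Q) \<in> P"
    proof -
      have "(\<Sum>b\<in>B. \<iota> (c b) * b) = 0" using rel[of "\<lambda>x. x"] by (simp add: K_linear_def)
      then have "0 = (\<Sum>b\<in>B. \<iota> (c b) * b) ^ ?Q" by (simp add: power_0_left)
      also have "\<dots> = (\<Sum>b\<in>B. \<iota> (c b) ^ ?Q * b ^ ?Q)"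
        by (simp add: frobenius_power_sum[OF scal.comm_ring_hom_axioms] power_mult_distrib)
      finally have "(\<Sum>b\<in>B. \<iota> (c b) * b ^ ?Q) = (\<Sum>b\<in>B. b ^ ?Q * \<iota> (- (c b ^ ?Q - c b)))"
        by (simp add: iota_simps algebra_simps sum_subtractf)
      also have "\<dots> \<in> P"
      proof -
        have "\<iota> (- (c b ^ ?Q - c b)) \<in> P" for b
          by (rule prime_above_dvd[OF P]) (use poly_little_fermat[OF f, of "c b"] in \<open>simp only: dvd_minus_iff\<close>)
        then have "b ^ ?Q * \<iota> (- (c b ^ ?Q - c b)) \<in> P" if "b \<in> B" for b
          using Pid Suc.prems that integral_closure_A_power[of b ?Q] by (auto simp: is_ideal_def)
        then show ?thesis
          using Pid by (induction B rule: infinite_finite_induct) (auto simp: is_ideal_def)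
      qed
      finally show ?thesis .
    qed
    \<comment> \<open>Subtracting a multiple of the relation removes \<open>j\<close>, at the price
      of the factor \<open>\<iota> (c j)\<close>, which is not in \<open>P\<close>.\<close>
    define a' where "a' b = \<iota> (c j) * a b - a j * \<iota> (c b)" for b
    have split: "(\<Sum>b\<in>B - {j}. a' b * g b) = \<iota> (c j) * (\<Sum>b\<in>B. a b * g b) - a j * (\<Sum>b\<in>B. \<iota> (c b) * g b)" for g
    proof -
      have "(\<Sum>b\<in>B. a' b * g b) = a' j * g j + (\<Sum>b\<in>B - {j}. a' b * g b)"
        by (rule sum.remove) (use Suc.prems j in auto)
      moreover have "a' j = 0" by (simp add: a'_def)
      ultimately show ?thesis
        by (simp add: a'_def sum_distrib_left left_diff_distrib sum_subtractf mult.assoc)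
    qed
    have "(\<Sum>b\<in>B - {j}. a' b * b ^ ?Q) \<in> P"
    proof (rule Suc.hyps(1))
      show "n = card (B - {j})" using Suc.hyps(2) j Suc.prems by simp
      show "a' b \<in> ?R" if "b \<in> B - {j}" for b
        unfolding a'_def using Suc.prems(3) that j
        by (auto intro!: integral_closure_A_diff integral_closure_A_mult)
      show "(\<Sum>b\<in>B - {j}. a' b * h b) = 0" if "K_linear h" for h
        unfolding split using Suc.prems(4)[OF that] rel[OF that] by simp
    qed (use Suc.prems in auto)
    then have "\<iota> (c j) * (\<Sum>b\<in>B. a b * b ^ ?Q) - a j * (\<Sum>b\<in>B. \<iota> (c b) * b ^ ?Q) \<in> P"
      by (simp only: split)
    moreover have "a j * (\<Sum>b\<in>B. \<iota> (c b) * b ^ ?Q) \<in> P"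
      using relP Pid Suc.prems(3)[OF j(1)] by (simp add: is_ideal_def)
    ultimately have "\<iota> (c j) * (\<Sum>b\<in>B. a b * b ^ ?Q) \<in> P"
      using prime_above_add[OF P] by force
    moreover have "(\<Sum>b\<in>B. a b * b ^ ?Q) \<in> ?R"
      using Suc.prems by (auto intro!: integral_closure_A_sum integral_closure_A_mult integral_closure_A_power)
    ultimately show ?thesis
      using prime_above_prime[OF P integral_closure_A_iota] prime_above_not_mem[OF P f j(2)] by blast
  qed
qed

section \<open>Existence of Frobenius elements\<close>

text \<open>\<open>poly_mapping\<close> multiplies monomials by adding exponents, so the
  multiplicative monoid is rewritten additively.\<close>

typedef 'a mcopy = "UNIV :: 'a set" morphisms unmc mc ..

instantiation mcopy :: (comm_monoid_mult) comm_monoid_add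
begin

definition "0 = mc 1"
definition "a + b = mc (unmc a * unmc b)"

instance
  by standard (simp_all add: zero_mcopy_def plus_mcopy_def mc_inverse unmc_inverse mult_ac)

end

lemma unmc_mc [simp]: "unmc (mc x) = x"
  and mc_unmc [simp]: "mc (unmc m) = m"
  and unmc_0 [simp]: "unmc 0 = 1"
  and unmc_add [simp]: "unmc (m + n) = unmc m * unmc n"
  by (simp_all add: zero_mcopy_def plus_mcopy_def mc_inverse unmc_inverse)

text \<open>The monoid algebra of the multiplicative monoid of $\overline{K}$ over $\overline{K}$, which
  maps onto $\overline{K} \otimes_K \overline{K}$.\<close>
type_synonym 'q tens = "'q kbar mcopy \<Rightarrow>\<^sub>0 'q kbar"

definition tconst :: "'q::field kbar \<Rightarrow> 'q tens"
  where "tconst c = Poly_Mapping.single 0 c"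

definition telem :: "'q::field kbar \<Rightarrow> 'q tens"
  where "telem x = Poly_Mapping.single (mc x) 1"

interpretation tconst: inj_comm_ring_hom "tconst :: 'q::field kbar \<Rightarrow> 'q tens"
proof
  show "x = 0" if "tconst x = 0" for x :: "'q kbar"
    using arg_cong[OF that, of "\<lambda>w. Poly_Mapping.lookup w 0"] by (simp add: tconst_def)
qed (simp_all add: tconst_def single_add mult_single)

text \<open>A monomial \<open>m\<close> with coefficient \<open>a\<close> stands for a \<otimes> m,
  and this is the functional x \<otimes> y to x h(y).\<close>

definition tlev :: "('q::field kbar \<Rightarrow> 'q kbar) \<Rightarrow> 'q tens \<Rightarrow> 'q kbar"
  where "tlev h = pm_extend (\<lambda>m a. a * h (unmc m))"

lemma tlev_add: "tlev h (v + w) = tlev h v + tlev h w"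
  and tlev_0 [simp]: "tlev h 0 = 0"
  and tlev_single [simp]: "tlev h (Poly_Mapping.single m c) = c * h (unmc m)"
proof -
  interpret pm_additive "\<lambda>m a. a * h (unmc m)" by standard (simp add: distrib_right)
  show "tlev h (v + w) = tlev h v + tlev h w" "tlev h 0 = 0"
    "tlev h (Poly_Mapping.single m c) = c * h (unmc m)"
    by (simp_all add: tlev_def extend_add)
qed

lemma tlev_uminus: "tlev h (- w) = - tlev h w"
  using tlev_add[of h w "- w"] by (simp add: eq_neg_iff_add_eq_0 add.commute)

lemma tlev_single_mult:
  "tlev h (Poly_Mapping.single m c * w) = c * tlev (\<lambda>x. h (unmc m * x)) w"
  by (induction w rule: pm_induct) (simp_all add: tlev_add distrib_left mult_single mult_ac)

text \<open>The kernel of the map onto the tensor product over K, since the functionals separate its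
  points.\<close>

definition tkernel :: "'q::field tens set"
  where "tkernel = {w. \<forall>h. K_linear h \<longrightarrow> tlev h w = 0}"

text \<open>A \<open>K_linear\<close> map composed with a multiplication is again
  \<open>K_linear\<close>.\<close>

lemma is_ideal_tkernel: "is_ideal UNIV tkernel"
proof -
  have "s * w \<in> tkernel" if w: "w \<in> tkernel" for s w :: "'q::field tens"
  proof (induction s rule: pm_induct)
    case (add s m c)
    have "tlev h (Poly_Mapping.single m c * w) = 0" if "K_linear h" for h
    proof -
      have "K_linear (\<lambda>x. h (unmc m * x))"
        using that unfolding K_linear_def by (simp add: distrib_left mult.left_commute)
      then show ?thesis using w by (simp add: tlev_single_mult tkernel_def)
    qed
    then show ?case using add by (simp add: tkernel_def distrib_right tlev_add)
  qed (simp add: tkernel_def)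
  moreover have "v + w \<in> tkernel" if "v \<in> tkernel" "w \<in> tkernel" for v w :: "'q::field tens"
    using that by (simp add: tkernel_def tlev_add)
  moreover have "0 \<in> tkernel" by (simp add: tkernel_def)
  ultimately show ?thesis
    unfolding is_ideal_def by blast
qed

lemma telem_mult: "telem (x * y) = telem x * telem y"
  by (simp add: telem_def mult_single plus_mcopy_def)

lemma telem_power: "telem (x ^ n) = telem x ^ n"
  by (induction n) (simp_all add: telem_mult, simp add: telem_def flip: zero_mcopy_def)

text \<open>The elements coming from R \<otimes> R, where R is the integral closure of A.\<close>

inductive_set tintegral :: "'q::field tens set" where
  zero: "0 \<in> tintegral"
| add: "w \<in> tintegral \<Longrightarrow> a \<in> integral_closure_A \<Longrightarrow> b \<in> integral_closure_A \<Longrightarrow>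
    w + Poly_Mapping.single (mc b) a \<in> tintegral"

lemma tintegral_single:
  "a \<in> integral_closure_A \<Longrightarrow> b \<in> integral_closure_A \<Longrightarrow> Poly_Mapping.single (mc b) a \<in> tintegral"
  using tintegral.add[OF tintegral.zero] by simp

lemma tintegral_add:
  assumes "v \<in> tintegral" and "w \<in> tintegral"
  shows "v + w \<in> tintegral"
  using assms(2) by induction (auto simp: assms(1) add.assoc[symmetric] intro: tintegral.add)

lemma tintegral_mult:
  assumes "v \<in> tintegral" and "w \<in> tintegral"
  shows "v * w \<in> tintegral"
proof -
  have single: "Poly_Mapping.single (mc b) a * w \<in> tintegral"
    if "a \<in> integral_closure_A" "b \<in> integral_closure_A" for a b
    using assms(2)
    by induction (auto simp: distrib_left mult_single plus_mcopy_def that intro!: tintegral.zero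
        tintegral_add tintegral_single integral_closure_A_mult)
  show ?thesis
    using assms(1) by induction (auto simp: distrib_right single intro!: tintegral.zero tintegral_add)
qed

lemma tintegral_lookup:
  assumes "w \<in> tintegral"
  shows "Poly_Mapping.lookup w m \<in> integral_closure_A"
    and "m \<in> Poly_Mapping.keys w \<Longrightarrow> unmc m \<in> integral_closure_A"
  using assms
proof induction
  case (add w a b)
  case 1
  show ?case using add
    by (simp add: lookup_add lookup_single when_def integral_closure_A_add)
  case 2
  then show ?case using add Poly_Mapping.keys_add[of w "Poly_Mapping.single (mc b) a"]
    by (auto split: if_splits)
qed simp_all

definition tfrob :: "nat \<Rightarrow> 'q::field tens \<Rightarrow> 'q kbar"
  where "tfrob n = pm_extend (\<lambda>m a. a * unmc m ^ n)"

lemma tfrob_mult: "tfrob n (v * w) = tfrob n v * tfrob n w"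
  unfolding tfrob_def by (rule pm_extend_mult) (simp_all add: algebra_simps power_mult_distrib)

lemma
  fixes v w :: "'q::field tens" and c :: "'q kbar"
  shows tfrob_add: "tfrob n (v + w) = tfrob n v + tfrob n w"
    and tfrob_single [simp]: "tfrob n (Poly_Mapping.single m c) = c * unmc m ^ n"
proof -
  interpret pm_additive "\<lambda>(m :: 'q kbar mcopy) a. a * unmc m ^ n" by standard (simp add: distrib_right)
  show "tfrob n (v + w) = tfrob n v + tfrob n w"
    "tfrob n (Poly_Mapping.single m c) = c * unmc m ^ n"
    by (simp_all add: tfrob_def extend_add)
qed

lemma tfrob_kernel:
  fixes f :: "'q::{field,finite} poly"
  assumes P: "prime_above f P" and f: "irreducible f"
    and w: "w \<in> tintegral" "w \<in> tkernel"
  shows "tfrob (CARD('q) ^ degree f) w \<in> P"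
proof -
  let ?B = "unmc ` Poly_Mapping.keys w" and ?a = "\<lambda>b. Poly_Mapping.lookup w (mc b)"
  have inj: "inj_on unmc (Poly_Mapping.keys w)"
    by (metis inj_onI mc_unmc)
  have ext: "pm_extend (\<lambda>m a. a * g (unmc m)) w = (\<Sum>b\<in>?B. ?a b * g b)" for g
    by (simp add: pm_extend_def sum.reindex[OF inj])
  show ?thesis
    unfolding tfrob_def ext[of "\<lambda>b. b ^ (CARD('q) ^ degree f)"]
  proof (rule tensor_frobenius_well_defined[OF P f])
    show "(\<Sum>b\<in>?B. ?a b * h b) = 0" if "K_linear h" for h
    proof -
      have "tlev h w = 0" using w(2) that by (simp add: tkernel_def)
      then show ?thesis by (simp only: tlev_def ext[of h])
    qed
  qed (use tintegral_lookup[OF w(1)] in auto)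
qed

text \<open>An automorphism over K is a point of the tensor product of the algebraic closure with
  itself. Take a prime ideal \<open>\<pp>\<close> above the kernel that misses all integral elements
  sent outside \<open>\<PP>\<close> by \<open>tfrob\<close>, and their products with nonzero
  integral constants. Modulo \<open>\<pp>\<close> every 1 \<otimes> x is congruent to a unique
  constant, which defines \<open>\<sigma> x\<close> on the whole algebraic closure at once. For
  integral \<open>x\<close> the element 1 \<otimes> x - \<sigma>(x) \<otimes> 1 of
  \<open>\<pp>\<close> has its image under \<open>tfrob\<close> in \<open>\<PP>\<close>, which is
  the Frobenius congruence.\<close>

theorem frobenius_exists:
  fixes f :: "'q::{field,finite} poly"
  assumes f: "irreducible f"
  obtains \<sigma> where "\<sigma> \<in> frobenius_at f"
proof -
  let ?R = "integral_closure_A :: 'q kbar set" and ?Q = "CARD('q) ^ degree f"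
  obtain \<PP> where \<PP>: "prime_above f \<PP>" using prime_above_exists[OF f] .
  define W where "W = {tconst s * w | s w. s \<in> ?R \<and> s \<noteq> 0 \<and> w \<in> tintegral \<and> tfrob ?Q w \<notin> \<PP>}"
  have one: "(1 :: 'q tens) \<in> tintegral" "tfrob ?Q (1 :: 'q tens) = 1"
    using tintegral_single[of "1 :: 'q kbar" 1] tfrob_single[of ?Q 0 "1 :: 'q kbar"]
    by (simp_all add: zero_mcopy_def[symmetric] single_one del: tfrob_single)
  have \<PP>1: "1 \<notin> \<PP>" using \<PP> by (simp add: prime_above_def)
  have W1: "1 \<in> W"
    unfolding W_def using one \<PP>1 by (intro CollectI exI[of _ 1]) simp
  have Wmult: "x * y \<in> W" if xy: "x \<in> W" "y \<in> W" for x y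
  proof -
    obtain s w s' w' where *: "x = tconst s * w" "y = tconst s' * w'"
      "s \<in> ?R" "s \<noteq> 0" "w \<in> tintegral" "tfrob ?Q w \<notin> \<PP>"
      "s' \<in> ?R" "s' \<noteq> 0" "w' \<in> tintegral" "tfrob ?Q w' \<notin> \<PP>"
      using xy unfolding W_def by blast
    have R: "tfrob ?Q u \<in> ?R" if "u \<in> tintegral" for u
      using that
    proof induction
      case zero
      then show ?case by (simp add: tfrob_def pm_extend_def)
    next
      case (add w a b)
      then show ?case
        by (auto simp: tfrob_add intro!: integral_closure_A_add integral_closure_A_mult integral_closure_A_power)
    qed
    have "x * y = tconst (s * s') * (w * w')" using * by (simp add: tconst.hom_mult mult_ac)
    moreover have "tfrob ?Q (w * w') \<notin> \<PP>"
      using \<PP> * R unfolding tfrob_mult prime_above_def by blast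
    ultimately show ?thesis unfolding W_def
      using tintegral_mult[OF *(5) *(9)] integral_closure_A_mult[OF *(3) *(7)] *(4,8)
      by (intro CollectI exI[of _ "s * s'"] exI[of _ "w * w'"]) simp
  qed
  \<comment> \<open>\<open>tfrob\<close> maps integral elements of the kernel into
    \<open>\<PP>\<close>, and a nonzero constant factor does not affect membership in the
    kernel.\<close>
  have disj: "W \<inter> tkernel = {}"
  proof (rule ccontr)
    assume "W \<inter> tkernel \<noteq> {}"
    then obtain s w where *: "tconst s * w \<in> tkernel" "s \<noteq> 0" "w \<in> tintegral" "tfrob ?Q w \<notin> \<PP>"
      unfolding W_def by blast
    have "s * tlev h w = 0" if "K_linear h" for h
      using *(1) that by (simp add: tconst_def tkernel_def tlev_single_mult)
    then have "w \<in> tkernel" using *(2) by (simp add: tkernel_def)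
    then show False using tfrob_kernel[OF \<PP> f *(3)] *(4) by blast
  qed
  obtain \<pp> where \<pp>: "is_ideal UNIV \<pp>" "tkernel \<subseteq> \<pp>" "\<pp> \<inter> W = {}"
    and prime: "\<And>x y. x * y \<in> \<pp> \<Longrightarrow> x \<in> \<pp> \<or> y \<in> \<pp>"
    by (rule prime_ideal_avoiding[of UNIV tkernel W])
       (use is_ideal_tkernel W1 Wmult disj in \<open>auto simp: is_subring_def\<close>)
  have padd: "x + y \<in> \<pp>" if "x \<in> \<pp>" "y \<in> \<pp>" for x y using \<pp>(1) that by (simp add: is_ideal_def)
  have pmult: "x * y \<in> \<pp>" if "y \<in> \<pp>" for x y using \<pp>(1) that by (simp add: is_ideal_def)
  have pdiff: "x - y \<in> \<pp>" if "x \<in> \<pp>" "y \<in> \<pp>" for x y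
    using padd[OF that(1) pmult[OF that(2), of "- 1"]] by simp
  \<comment> \<open>A nonzero constant becomes integral after multiplication by some
    \<open>\<iota> a\<close>, and then lies in \<open>W\<close>.\<close>
  have pconst: "c = 0" if "tconst c \<in> \<pp>" for c
  proof (rule ccontr)
    assume "c \<noteq> 0"
    obtain a where a: "a \<noteq> 0" "\<iota> a * c \<in> ?R" by (rule integral_closure_A_clear)
    then have "tconst (\<iota> a * c) * 1 \<in> W" unfolding W_def using one \<PP>1 \<open>c \<noteq> 0\<close>
      by (intro CollectI exI[of _ "\<iota> a * c"] exI[of _ 1]) simp
    then show False using pmult[OF that, of "tconst (\<iota> a)"] \<pp>(3) by (auto simp: tconst.hom_mult)
  qed
  have unique: "y = y'" if "telem x - tconst y \<in> \<pp>" "telem x - tconst y' \<in> \<pp>" for x y y'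
  proof -
    have "tconst (y' - y) \<in> \<pp>" using pdiff[OF that] by (simp add: tconst.hom_minus)
    then show ?thesis using pconst[of "y' - y"] by simp
  qed
  \<comment> \<open>The polynomial splits into linear factors, one of which the prime ideal must
    contain.\<close>
  have root: "\<exists>y. poly g y = 0 \<and> telem x - tconst y \<in> \<pp>"
    if "g \<noteq> 0" "poly (map_poly tconst g) (telem x) \<in> \<pp>" for g x
    using that
  proof (induction "degree g" arbitrary: g)
    case 0
    then obtain c where c: "g = [:c:]" by (metis degree_eq_zeroE)
    then have "tconst c \<in> \<pp>" using 0 by (simp add: map_poly_pCons)
    then show ?case using pconst 0 c by auto
  next
    case (Suc n)
    then obtain y where y: "poly g y = 0" by (metis alg_closed_imp_poly_has_root zero_less_Suc)
    then obtain g' where g': "g = [:- y, 1:] * g'" unfolding poly_eq_0_iff_dvd by (elim dvdE)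
    have "g' \<noteq> 0" using Suc g' by auto
    then have deg: "degree g = Suc (degree g')" unfolding g' by (subst degree_mult_eq) auto
    have "poly (map_poly tconst g) (telem x) = (telem x - tconst y) * poly (map_poly tconst g') (telem x)"
    proof -
      interpret map_poly_comm_ring_hom "tconst :: 'q kbar \<Rightarrow> 'q tens" ..
      show ?thesis unfolding g' hom_mult by (simp add: map_poly_pCons tconst.hom_uminus left_diff_distrib)
    qed
    then have "telem x - tconst y \<in> \<pp> \<or> poly (map_poly tconst g') (telem x) \<in> \<pp>"
      using prime Suc.prems by metis
    then show ?case
    proof
      assume "poly (map_poly tconst g') (telem x) \<in> \<pp>"
      then obtain z where "poly g' z = 0" "telem x - tconst z \<in> \<pp>"
        using Suc.hyps(1)[of g'] Suc.hyps(2) deg \<open>g' \<noteq> 0\<close> by auto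
      then show ?thesis unfolding g' by auto
    qed (use y in blast)
  qed
  have rootK: "\<exists>y. poly (map_poly to_ac p) y = 0 \<and> telem x - tconst y \<in> \<pp>"
    if p: "p \<noteq> 0" "poly (map_poly to_ac p) x = 0" for p x
  proof (rule root)
    have "poly (map_poly tconst (map_poly to_ac p)) (telem x)
        = (\<Sum>i\<le>degree p. tconst (to_ac (coeff p i)) * telem (x ^ i))"
      by (simp add: poly_altdef coeff_map_poly telem_power)
    also have "\<dots> \<in> tkernel"
      unfolding tkernel_def
    proof (intro CollectI allI impI)
      fix h :: "'q kbar \<Rightarrow> 'q kbar" assume h: "K_linear h"
      have "tlev h (\<Sum>i\<in>I. tconst (to_ac (coeff p i)) * telem (x ^ i)) =
          (\<Sum>i\<in>I. to_ac (coeff p i) * h (x ^ i))" for I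
        by (induction I rule: infinite_finite_induct)
           (simp_all add: tlev_add tconst_def telem_def mult_single)
      also have "(\<Sum>i\<le>degree p. to_ac (coeff p i) * h (x ^ i)) = h (\<Sum>i\<le>degree p. to_ac (coeff p i) * x ^ i)"
        using K_linear_sum[OF h] by metis
      also have "(\<Sum>i\<le>degree p. to_ac (coeff p i) * x ^ i) = 0"
        using p(2) by (simp add: poly_altdef coeff_map_poly)
      finally show "tlev h (\<Sum>i\<le>degree p. tconst (to_ac (coeff p i)) * telem (x ^ i)) = 0"
        by (simp add: K_linear_0[OF h])
    qed
    finally show "poly (map_poly tconst (map_poly to_ac p)) (telem x) \<in> \<pp>" using \<pp>(2) by blast
  qed (use p in simp)
  have "\<exists>y. telem x - tconst y \<in> \<pp>" for x
    by (rule alg_closure_algebraic[of x]) (use rootK in blast)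
  then obtain \<sigma> where \<sigma>: "\<And>x. telem x - tconst (\<sigma> x) \<in> \<pp>" by metis
  have \<sigma>root: "poly (map_poly to_ac p) (\<sigma> x) = 0" if "p \<noteq> 0" "poly (map_poly to_ac p) x = 0" for p x
    using rootK[OF that] unique[OF \<sigma>] by metis
  have \<sigma>add: "\<sigma> (x + y) = \<sigma> x + \<sigma> y" for x y
  proof (rule unique[OF \<sigma>])
    have "telem (x + y) - telem x - telem y \<in> tkernel"
      by (simp add: tkernel_def K_linear_def diff_conv_add_uminus tlev_add tlev_uminus telem_def
          del: add_uminus_conv_diff)
    then have "(telem (x + y) - telem x - telem y) + ((telem x - tconst (\<sigma> x)) + (telem y - tconst (\<sigma> y))) \<in> \<pp>"
      using \<pp>(2) by (intro padd \<sigma>) auto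
    then show "telem (x + y) - tconst (\<sigma> x + \<sigma> y) \<in> \<pp>"
      by (simp add: tconst.hom_add algebra_simps)
  qed
  have \<sigma>mult: "\<sigma> (x * y) = \<sigma> x * \<sigma> y" for x y
  proof (rule unique[OF \<sigma>])
    have "telem x * (telem y - tconst (\<sigma> y)) + tconst (\<sigma> y) * (telem x - tconst (\<sigma> x)) \<in> \<pp>"
      by (intro padd pmult \<sigma>)
    then show "telem (x * y) - tconst (\<sigma> x * \<sigma> y) \<in> \<pp>"
      by (simp add: tconst.hom_mult telem_mult algebra_simps)
  qed
  have \<sigma>K: "\<sigma> (to_ac c) = to_ac c" for c
  proof (rule unique[OF \<sigma>])
    have "h (to_ac c) = to_ac c * h 1" if "K_linear h" for h :: "'q kbar \<Rightarrow> 'q kbar"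
      using that unfolding K_linear_def by (metis mult.right_neutral)
    then have "telem (to_ac c) - tconst (to_ac c) \<in> tkernel"
      by (simp add: tkernel_def diff_conv_add_uminus tlev_add tlev_uminus telem_def tconst_def
          del: add_uminus_conv_diff)
    then show "telem (to_ac c) - tconst (to_ac c) \<in> \<pp>" using \<pp>(2) by blast
  qed
  have \<sigma>0: "\<sigma> 0 = 0" using \<sigma>K[of 0] by simp
  have \<sigma>1: "\<sigma> 1 = 1" using \<sigma>K[of 1] by simp
  have "inj \<sigma>"
  proof (rule injI)
    fix x y assume "\<sigma> x = \<sigma> y"
    show "x = y"
    proof (rule ccontr)
      assume "x \<noteq> y"
      then have "\<sigma> ((x - y) * inverse (x - y)) = 1" by (simp add: \<sigma>1)
      moreover have "\<sigma> (x - y) = 0"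
        using \<sigma>add[of "x - y" y] \<open>\<sigma> x = \<sigma> y\<close> by simp
      ultimately show False by (simp add: \<sigma>mult)
    qed
  qed
  \<comment> \<open>\<open>\<sigma>\<close> maps the finitely many roots of a polynomial over K
    injectively to themselves, hence onto.\<close>
  have "surj \<sigma>"
    unfolding surj_def
  proof
    fix y :: "'q kbar"
    obtain p where p: "p \<noteq> 0" "poly (map_poly to_ac p) y = 0" by (rule alg_closure_algebraic)
    let ?Z = "{x. poly (map_poly to_ac p) x = 0}"
    have "\<sigma> ` ?Z = ?Z"
    proof (rule endo_inj_surj)
      show "finite ?Z" using p by (intro poly_roots_finite) simp
      show "\<sigma> ` ?Z \<subseteq> ?Z" using \<sigma>root[OF p(1)] by auto
      show "inj_on \<sigma> ?Z" using \<open>inj \<sigma>\<close> by (rule inj_on_subset) simp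
    qed
    then show "\<exists>x. y = \<sigma> x" using p(2) by blast
  qed
  have "\<sigma> \<in> galois_K"
    using \<open>inj \<sigma>\<close> \<open>surj \<sigma>\<close> \<sigma>add \<sigma>mult \<sigma>K by (simp add: galois_K_def bij_def)
  moreover have "\<sigma> x - x ^ ?Q \<in> \<PP>" if x: "x \<in> ?R" for x
  proof (rule ccontr)
    assume notin: "\<sigma> x - x ^ ?Q \<notin> \<PP>"
    obtain p where p: "lead_coeff p = 1" "poly (map_poly \<iota> p) x = 0"
      using x by (auto simp: integral_closure_A_def)
    have map: "map_poly \<iota> p = map_poly to_ac (map_poly to_fract p)"
      by (intro poly_eqI) (simp add: coeff_map_poly \<iota>_def)
    have "map_poly to_fract p \<noteq> 0" using p(1)
      by (metis coeff_map_poly leading_coeff_0_iff to_fract_eq_0_iff to_fract.hom_zero coeff_0 zero_neq_one)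
    then have "poly (map_poly \<iota> p) (\<sigma> x) = 0" using \<sigma>root p(2) unfolding map by blast
    then have \<sigma>x: "\<sigma> x \<in> ?R" using p(1) unfolding integral_closure_A_def by blast
    \<comment> \<open>If the congruence failed, this element would belong both to \<open>W\<close>
      and to \<open>\<pp>\<close>.\<close>
    define w where "w = Poly_Mapping.single (mc x) 1 + Poly_Mapping.single (mc 1) (- \<sigma> x)"
    have "w \<in> tintegral"
      unfolding w_def using x \<sigma>x by (intro tintegral_add tintegral_single integral_closure_A_uminus) simp_all
    moreover have "tfrob ?Q w \<notin> \<PP>"
    proof
      assume "tfrob ?Q w \<in> \<PP>"
      then have "(- 1) * (x ^ ?Q - \<sigma> x) \<in> \<PP>"
        using \<PP> integral_closure_A_uminus[of 1] unfolding prime_above_def w_def tfrob_add tfrob_single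
        by (metis integral_closure_A_1 mult_minus_left mult.right_neutral unmc_mc
            mult_1 power_one diff_conv_add_uminus)
      then show False using notin by simp
    qed
    ultimately have "tconst 1 * w \<in> W" unfolding W_def
      by (intro CollectI exI[of _ 1] exI[of _ w]) simp
    moreover have "w = telem x - tconst (\<sigma> x)"
      by (simp add: w_def telem_def tconst_def zero_mcopy_def single_uminus)
    ultimately show False using \<sigma>[of x] \<pp>(3) by auto
  qed
  ultimately have "\<sigma> \<in> frobenius_at f"
    using \<PP> by (auto simp: frobenius_at_def)
  then show ?thesis by (rule that)
qed

section \<open>Torsion of Drinfeld modules\<close>

lemma is_subringD:
  assumes "is_subring S"
  shows "1 \<in> S" "0 \<in> S" "x \<in> S \<Longrightarrow> - x \<in> S" "x \<in> S \<Longrightarrow> y \<in> S \<Longrightarrow> x + y \<in> S"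
    "x \<in> S \<Longrightarrow> y \<in> S \<Longrightarrow> x - y \<in> S" "x \<in> S \<Longrightarrow> y \<in> S \<Longrightarrow> x * y \<in> S"
proof -
  show 1: "1 \<in> S" and neg: "\<And>x. x \<in> S \<Longrightarrow> - x \<in> S"
    and add: "\<And>x y. x \<in> S \<Longrightarrow> y \<in> S \<Longrightarrow> x + y \<in> S"
    and "x \<in> S \<Longrightarrow> y \<in> S \<Longrightarrow> x * y \<in> S"
    using assms unfolding is_subring_def by blast+
  show "0 \<in> S" using add[OF 1 neg[OF 1]] by simp
  show "x - y \<in> S" if "x \<in> S" "y \<in> S" using add[OF that(1) neg[OF that(2)]] by simp
qed

lemma is_subring_prod: "is_subring S \<Longrightarrow> (\<And>i. i \<in> A \<Longrightarrow> f i \<in> S) \<Longrightarrow> prod f A \<in> S"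
  by (induction A rule: infinite_finite_induct) (simp_all add: is_subringD)

lemma is_subring_sum: "is_subring S \<Longrightarrow> (\<And>i. i \<in> A \<Longrightarrow> f i \<in> S) \<Longrightarrow> sum f A \<in> S"
  by (induction A rule: infinite_finite_induct) (simp_all add: is_subringD)

lemma is_subring_signof: "is_subring S \<Longrightarrow> signof p \<in> S"
  by (simp add: sign_def is_subringD)

lemma is_subring_det:
  assumes "is_subring S" "A \<in> carrier_mat n n" "\<And>i j. i < n \<Longrightarrow> j < n \<Longrightarrow> A $$ (i, j) \<in> S"
  shows "det A \<in> S"
  unfolding det_def'[OF assms(2)]
  by (intro is_subring_sum[OF assms(1)] is_subringD(6)[OF assms(1)] is_subring_signof[OF assms(1)]
      is_subring_prod[OF assms(1)] assms(3)) (auto dest: permutes_in_image)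

lemma is_idealD:
  assumes "is_ideal S I"
  shows "0 \<in> I" "x \<in> I \<Longrightarrow> x \<in> S" "x \<in> I \<Longrightarrow> y \<in> I \<Longrightarrow> x + y \<in> I"
    "s \<in> S \<Longrightarrow> x \<in> I \<Longrightarrow> s * x \<in> I"
  using assms unfolding is_ideal_def by blast+

lemma is_ideal_sum: "is_ideal S I \<Longrightarrow> (\<And>i. i \<in> A \<Longrightarrow> f i \<in> I) \<Longrightarrow> sum f A \<in> I"
  by (induction A rule: infinite_finite_induct) (simp_all add: is_idealD)

lemma is_ideal_uminus:
  assumes "is_subring S" "is_ideal S I" "x \<in> I" shows "- x \<in> I"
  using is_idealD(4)[OF assms(2) is_subringD(3)[OF assms(1) is_subringD(1)[OF assms(1)]] assms(3)] by simp

lemma is_ideal_diff: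
  assumes "is_subring S" "is_ideal S I" "x \<in> I" "y \<in> I" shows "x - y \<in> I"
  using is_idealD(3)[OF assms(2,3) is_ideal_uminus[OF assms(1,2,4)]] by simp

lemma ideal_cong_mult:
  assumes S: "is_subring S" and I: "is_ideal S I"
    and "a \<in> S" "b' \<in> S" "a - a' \<in> I" "b - b' \<in> I"
  shows "a * b - a' * b' \<in> I"
proof -
  have "a * b - a' * b' = a * (b - b') + b' * (a - a')" by (simp add: algebra_simps)
  then show ?thesis using assms by (simp add: is_idealD)
qed

lemma ideal_cong_prod:
  assumes S: "is_subring S" and I: "is_ideal S I"
    and "\<And>i. i \<in> A \<Longrightarrow> f i \<in> S" "\<And>i. i \<in> A \<Longrightarrow> g i \<in> S" "\<And>i. i \<in> A \<Longrightarrow> f i - g i \<in> I"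
  shows "prod f A - prod g A \<in> I"
  using assms(3-)
proof (induction A rule: infinite_finite_induct)
  case (insert x A)
  then show ?case
    by (simp add: ideal_cong_mult[OF S I] is_subring_prod[OF S])
qed (simp_all add: is_idealD[OF I])

text \<open>The Leibniz formula reduces this to products. Ring and ideal are sets, since later
  applications concern polynomials with integral coefficients modulo the ideal \<open>J\<close>, and
  polynomials over these.\<close>

lemma ideal_cong_det:
  assumes S: "is_subring S" and I: "is_ideal S I"
    and A: "A \<in> carrier_mat n n" "\<And>i j. i < n \<Longrightarrow> j < n \<Longrightarrow> A $$ (i, j) \<in> S"
    and B: "B \<in> carrier_mat n n" "\<And>i j. i < n \<Longrightarrow> j < n \<Longrightarrow> B $$ (i, j) \<in> S"
    and AB: "\<And>i j. i < n \<Longrightarrow> j < n \<Longrightarrow> A $$ (i, j) - B $$ (i, j) \<in> I"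
  shows "det A - det B \<in> I"
  unfolding det_def'[OF A(1)] det_def'[OF B(1)] sum_subtractf[symmetric] right_diff_distrib[symmetric]
  by (intro is_ideal_sum[OF I] is_idealD(4)[OF I] is_subring_signof[OF S] ideal_cong_prod[OF S I] A B AB)
     (auto dest: permutes_in_image)

lemma is_ideal_dvd: "is_ideal UNIV {x :: 'a::comm_ring_1. z dvd x}"
  by (auto simp: is_ideal_def)

lemma is_subring_UNIV [simp]: "is_subring UNIV"
  by (simp add: is_subring_def)

lemma det_cong_dvd:
  assumes "A \<in> carrier_mat n n" "B \<in> carrier_mat n n"
    and "\<And>i j. i < n \<Longrightarrow> j < n \<Longrightarrow> z dvd A $$ (i, j) - B $$ (i, j)"
  shows "z dvd det A - det B"
  using ideal_cong_det[OF is_subring_UNIV is_ideal_dvd assms(1) _ assms(2), of z] assms(3) by simp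

text \<open>A root shared by a linear factor and its cofactor would be a root of the derivative; so
  linear factors can be split off one by one.\<close>

lemma card_roots_separable:
  fixes p :: "'a::alg_closed_field poly"
  assumes "p \<noteq> 0" "\<And>x. poly p x = 0 \<Longrightarrow> poly (pderiv p) x \<noteq> 0"
  shows "card {x. poly p x = 0} = degree p"
  using assms
proof (induction "degree p" arbitrary: p)
  case 0
  then obtain c where "p = [:c:]" by (metis degree_eq_zeroE)
  then show ?case using 0 by auto
next
  case (Suc n)
  then obtain y where y: "poly p y = 0" by (metis alg_closed_imp_poly_has_root zero_less_Suc)
  then obtain p' where p': "p = [:- y, 1:] * p'" unfolding poly_eq_0_iff_dvd by (elim dvdE)
  have "p' \<noteq> 0" using Suc p' by auto
  then have deg: "degree p = Suc (degree p')" unfolding p' by (subst degree_mult_eq) auto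
  have pd: "poly (pderiv p) x = poly p' x + (x - y) * poly (pderiv p') x" for x
    unfolding p' pderiv_mult by (simp add: pderiv_pCons algebra_simps)
  have y': "poly p' y \<noteq> 0" using Suc.prems(2)[OF y] by (simp add: pd)
  have "card {x. poly p' x = 0} = degree p'"
  proof (rule Suc.hyps(1))
    show "n = degree p'" using deg Suc.hyps(2) by simp
    show "poly (pderiv p') x \<noteq> 0" if "poly p' x = 0" for x
    proof -
      have "poly p x = 0" by (simp add: p' that)
      from Suc.prems(2)[OF this] show ?thesis unfolding pd using that by simp
    qed
  qed fact
  moreover have "{x. poly p x = 0} = insert y {x. poly p' x = 0}" by (auto simp: p')
  moreover have "finite {x. poly p' x = 0}" using \<open>p' \<noteq> 0\<close> by (rule poly_roots_finite)
  ultimately show ?case using y' deg by simp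
qed

text \<open>Translation by 1 permutes the field, so adding \<open>CARD('q)\<close> times 1 does not
  change the sum of all elements.\<close>

lemma of_nat_card_field: "of_nat CARD('q) = (0 :: 'q::{field,finite})"
proof -
  have "bij_betw (\<lambda>x. x + 1) UNIV (UNIV :: 'q set)"
    by (rule bij_betw_byWitness[where f' = "\<lambda>x. x - 1"]) auto
  then have "(\<Sum>x\<in>(UNIV :: 'q set). x) = (\<Sum>x\<in>UNIV. x + 1)"
    by (rule sum.reindex_bij_betw[symmetric])
  then show ?thesis by (simp add: sum.distrib)
qed

lemma of_nat_card_kbar: "of_nat CARD('q) = (0 :: 'q::{field,finite} kbar)"
  using arg_cong[OF of_nat_card_field, of "scal :: 'q \<Rightarrow> 'q kbar"] by (simp only: scal.hom_of_nat scal.hom_zero)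

section \<open>Twisted polynomials as additive polynomials\<close>

definition skew_eval :: "'q::{field,finite} poly poly \<Rightarrow> 'q kbar \<Rightarrow> 'q kbar"
  where "skew_eval g x = (\<Sum>i\<le>degree g. \<iota> (coeff g i) * x ^ (CARD('q) ^ i))"

lemma drinfeld_act_eq: "drinfeld_act \<phi> a = skew_eval (\<phi> a)"
  by (simp add: drinfeld_act_def skew_eval_def fun_eq_iff)

lemma skew_eval_bound:
  fixes g :: "'q::{field,finite} poly poly"
  assumes "degree g \<le> n"
  shows "skew_eval g x = (\<Sum>i\<le>n. \<iota> (coeff g i) * x ^ (CARD('q) ^ i))"
  unfolding skew_eval_def
  by (rule sum.mono_neutral_left) (use assms in \<open>auto simp: coeff_eq_0\<close>)

lemma skew_eval_add_left: "skew_eval (g + h) x = skew_eval g x + skew_eval h x"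
proof -
  let ?n = "max (degree g) (degree h)"
  have "degree (g + h) \<le> ?n" by (rule degree_add_le_max)
  then show ?thesis
    by (simp add: skew_eval_bound[of _ ?n] iota.hom_add distrib_right sum.distrib)
qed

lemma skew_eval_0 [simp]: "skew_eval 0 x = 0"
  by (simp add: skew_eval_def)

lemma skew_eval_sum: "skew_eval (\<Sum>i\<in>I. g i) x = (\<Sum>i\<in>I. skew_eval (g i) x)"
  by (induction I rule: infinite_finite_induct) (simp_all add: skew_eval_add_left)

lemma skew_eval_monom:
  "skew_eval (monom c i) (x :: 'q::{field,finite} kbar) = \<iota> c * x ^ (CARD('q) ^ i)"
proof -
  have "skew_eval (monom c i) x = (\<Sum>j\<le>i. \<iota> (coeff (monom c i) j) * x ^ (CARD('q) ^ j))"
    by (rule skew_eval_bound) (rule degree_monom_le)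
  also have "\<dots> = (\<Sum>j\<le>i. if j = i then \<iota> c * x ^ (CARD('q) ^ i) else 0)"
    by (rule sum.cong) auto
  finally show ?thesis by simp
qed

lemmas kbar_frobenius_add = frobenius_power_add[OF scal.comm_ring_hom_axioms]
lemmas kbar_frobenius_sum = frobenius_power_sum[OF scal.comm_ring_hom_axioms]

lemma skew_eval_skew_mult: "skew_eval (skew_mult f g) x = skew_eval f (skew_eval g x)"
proof -
  have "skew_eval f (skew_eval g x) = (\<Sum>i\<le>degree f. \<iota> (coeff f i) *
      (\<Sum>j\<le>degree g. \<iota> (coeff g j) ^ CARD('a) ^ i * (x ^ CARD('a) ^ j) ^ CARD('a) ^ i))"
    by (simp add: skew_eval_def kbar_frobenius_sum power_mult_distrib)
  also have "\<dots> = (\<Sum>i\<le>degree f. \<Sum>j\<le>degree g.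
      \<iota> (coeff f i * coeff g j ^ (CARD('a) ^ i)) * x ^ CARD('a) ^ (i + j))"
    by (intro sum.cong refl)
       (simp add: sum_distrib_left iota.hom_mult iota.hom_power power_add mult_ac flip: power_mult)
  finally show ?thesis
    by (simp add: skew_mult_def skew_eval_sum skew_eval_monom)
qed

lemma skew_eval_add:
  fixes x y :: "'q::{field,finite} kbar"
  shows "skew_eval g (x + y) = skew_eval g x + skew_eval g y"
  by (simp add: skew_eval_def kbar_frobenius_add distrib_left sum.distrib)

lemma skew_eval_zero [simp]: "skew_eval g 0 = 0"
  by (simp add: skew_eval_def power_0_left)

lemma skew_eval_scal: "skew_eval g (scal c * x) = scal c * skew_eval g x"
proof -
  have "scal c ^ CARD('a) ^ i = scal c" for i
    by (simp add: finite_field_power_card_power flip: scal.hom_power)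
  then show ?thesis
    by (simp add: skew_eval_def power_mult_distrib sum_distrib_left mult_ac)
qed

lemma
  fixes f g :: "'q::{field,finite} poly poly"
  assumes "f \<noteq> 0" "g \<noteq> 0"
  shows degree_skew_mult: "degree (skew_mult f g) = degree f + degree g"
    and lead_coeff_skew_mult:
      "lead_coeff (skew_mult f g) = lead_coeff f * lead_coeff g ^ CARD('q) ^ degree f"
    and coeff_0_skew_mult: "coeff (skew_mult f g) 0 = coeff f 0 * coeff g 0"
proof -
  have c: "coeff (skew_mult f g) n = (\<Sum>i\<le>degree f. \<Sum>j\<le>degree g.
      if i + j = n then coeff f i * coeff g j ^ CARD('q) ^ i else 0)" for n
    by (simp add: skew_mult_def coeff_sum)
  have top: "coeff (skew_mult f g) (degree f + degree g) =
      lead_coeff f * lead_coeff g ^ CARD('q) ^ degree f"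
  proof -
    have "coeff (skew_mult f g) (degree f + degree g) = (\<Sum>i\<le>degree f. \<Sum>j\<le>degree g.
        if i = degree f then if j = degree g then lead_coeff f * lead_coeff g ^ CARD('q) ^ degree f else 0 else 0)"
      unfolding c by (intro sum.cong refl) auto
    also have "\<dots> = (\<Sum>i\<le>degree f. if i = degree f then
        (\<Sum>j\<le>degree g. if j = degree g then lead_coeff f * lead_coeff g ^ CARD('q) ^ degree f else 0) else 0)"
      by (intro sum.cong) auto
    finally show ?thesis by simp
  qed
  have "degree (skew_mult f g) \<le> degree f + degree g"
    by (rule degree_le) (auto simp: c intro!: sum.neutral)
  moreover have "degree (skew_mult f g) \<ge> degree f + degree g"
    by (rule le_degree) (use assms in \<open>simp add: top\<close>)
  ultimately show deg: "degree (skew_mult f g) = degree f + degree g" by simp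
  then show "lead_coeff (skew_mult f g) = lead_coeff f * lead_coeff g ^ CARD('q) ^ degree f"
    by (simp add: top)
  have "coeff (skew_mult f g) 0 = (\<Sum>i\<le>degree f. \<Sum>j\<le>degree g.
      if i = 0 then if j = 0 then coeff f 0 * coeff g 0 else 0 else 0)"
    unfolding c by (intro sum.cong refl) auto
  also have "\<dots> = (\<Sum>i\<le>degree f. if i = 0 then (\<Sum>j\<le>degree g. if j = 0 then coeff f 0 * coeff g 0 else 0) else 0)"
    by (intro sum.cong) auto
  finally show "coeff (skew_mult f g) 0 = coeff f 0 * coeff g 0" by simp
qed

section \<open>The action of a Drinfeld module on the algebraic closure\<close>

locale drinfeld =
  fixes \<phi> :: "'q::{field,finite} poly \<Rightarrow> 'q poly poly" and \<kappa> :: "nat \<Rightarrow> 'q poly" and \<kappa>\<^sub>r :: 'q and r :: nat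
  assumes r_ge: "r \<ge> 2" and module: "drinfeld_module \<phi>"
    and \<phi>_theta: "\<phi> [:0, 1:] = [:\<theta>:] + (\<Sum>i=1..<r. monom (\<kappa> i) i) + monom [:\<kappa>\<^sub>r:] r"
    and \<kappa>r: "\<kappa>\<^sub>r \<noteq> 0"
begin

abbreviation act :: "'q poly \<Rightarrow> 'q kbar \<Rightarrow> 'q kbar" where "act \<equiv> drinfeld_act \<phi>"

lemma coeff_\<phi>_theta:
  "coeff (\<phi> [:0, 1:]) i = (if i = 0 then \<theta> else if i < r then \<kappa> i else if i = r then [:\<kappa>\<^sub>r:] else 0)"
proof -
  have "(\<Sum>j=1..<r. coeff (monom (\<kappa> j) j) i) = (\<Sum>j=1..<r. if j = i then \<kappa> i else 0)"
    by (rule sum.cong) auto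
  then show ?thesis
    using r_ge by (auto simp: \<phi>_theta coeff_sum coeff_pCons split: nat.splits)
qed

lemma degree_\<phi>_theta: "degree (\<phi> [:0, 1:]) = r"
  by (intro antisym degree_le le_degree) (use r_ge \<kappa>r in \<open>auto simp: coeff_\<phi>_theta\<close>)

lemma rank: "drinfeld_rank \<phi> = r"
  by (simp add: drinfeld_rank_def degree_\<phi>_theta)

lemma \<phi>_add: "\<phi> (a + b) = \<phi> a + \<phi> b"
  and \<phi>_mult: "\<phi> (a * b) = skew_mult (\<phi> a) (\<phi> b)"
  and \<phi>_const: "\<phi> [:c:] = [:[:c:]:]"
  using module by (simp_all add: drinfeld_module_def)

lemma act_add_left: "act (a + b) x = act a x + act b x"
  by (simp add: drinfeld_act_eq \<phi>_add skew_eval_add_left)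

lemma act_mult: "act (a * b) x = act a (act b x)"
  by (simp add: drinfeld_act_eq \<phi>_mult skew_eval_skew_mult)

lemma act_const: "act [:c:] x = scal c * x"
  using skew_eval_monom[of "[:c:]" 0 x] by (simp add: drinfeld_act_eq \<phi>_const monom_0)

lemma act_0_left [simp]: "act 0 x = 0"
  using act_const[of 0] by simp

lemma act_1 [simp]: "act 1 x = x"
  using act_const[of 1 x] by (simp add: one_pCons)

lemma act_add: "act a (x + y) = act a x + act a y"
  by (simp add: drinfeld_act_eq skew_eval_add)

lemma act_0 [simp]: "act a 0 = 0"
  by (simp add: drinfeld_act_eq)

lemma act_uminus: "act a (- x) = - act a x"
  using act_add[of a x "- x"] by (simp add: eq_neg_iff_add_eq_0 add.commute)

lemma act_uminus_left: "act (- a) x = - act a x"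
  using act_add_left[of a "- a" x] by (simp add: eq_neg_iff_add_eq_0 add.commute)

lemma act_diff_left: "act (a - b) x = act a x - act b x"
  using act_add_left[of a "- b" x] by (simp add: act_uminus_left)

lemma act_sum: "act a (\<Sum>i\<in>I. f i) = (\<Sum>i\<in>I. act a (f i))"
  by (induction I rule: infinite_finite_induct) (simp_all add: act_add)

lemma act_sum_left: "act (\<Sum>i\<in>I. f i) x = (\<Sum>i\<in>I. act (f i) x)"
  by (induction I rule: infinite_finite_induct) (simp_all add: act_add_left)

lemma act_commute: "act a (act b x) = act b (act a x)"
  by (metis act_mult mult.commute)

lemma act_theta: "act [:0, 1:] x =
  \<iota> \<theta> * x + (\<Sum>i=1..<r. \<iota> (\<kappa> i) * x ^ CARD('q) ^ i) + scal \<kappa>\<^sub>r * x ^ CARD('q) ^ r"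
proof -
  have "skew_eval [:\<theta>:] x = \<iota> \<theta> * x" using skew_eval_monom[of \<theta> 0 x] by (simp add: monom_0)
  then show ?thesis
    by (simp add: drinfeld_act_eq \<phi>_theta skew_eval_add_left skew_eval_sum skew_eval_monom)
qed

text \<open>Induction on the digits of \<open>a\<close>: in the skew product the leading coefficient
  is twisted, but remains a nonzero constant because \<open>\<kappa>\<^sub>r\<close> is one. This
  makes all torsion points integral.\<close>

lemma \<phi>_degree:
  assumes "a \<noteq> 0"
  shows "degree (\<phi> a) = r * degree a \<and> (\<exists>c. c \<noteq> 0 \<and> lead_coeff (\<phi> a) = [:c:])"
  using assms
proof (induction a)
  case (pCons c b)
  have eq: "pCons c b = [:c:] + b * [:0, 1:]" by simp
  show ?case
  proof (cases "b = 0")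
    case True
    then show ?thesis using pCons by (simp add: \<phi>_const)
  next
    case False
    then obtain e where e: "degree (\<phi> b) = r * degree b" "e \<noteq> 0" "lead_coeff (\<phi> b) = [:e:]"
      using pCons.IH by blast
    have nz: "\<phi> b \<noteq> 0" "\<phi> [:0, 1:] \<noteq> 0" using e degree_\<phi>_theta r_ge by auto
    let ?s = "skew_mult (\<phi> b) (\<phi> [:0, 1:])"
    have deg: "degree ?s = r * degree (pCons c b)"
      using False by (simp add: degree_skew_mult[OF nz] degree_\<phi>_theta e)
    have lc: "lead_coeff ?s = [:e * \<kappa>\<^sub>r ^ CARD('q) ^ degree (\<phi> b):]"
      unfolding lead_coeff_skew_mult[OF nz] degree_\<phi>_theta e(3) coeff_\<phi>_theta
      using r_ge by (simp add: poly_const_pow)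
    have less: "degree [:[:c:]:] < degree ?s" using deg r_ge False by simp
    have "\<phi> (pCons c b) = [:[:c:]:] + ?s" unfolding eq \<phi>_add \<phi>_mult \<phi>_const ..
    moreover have "degree ([:[:c:]:] + ?s) = degree ?s" by (rule degree_add_eq_right[OF less])
    moreover have "coeff [:[:c:]:] (degree ?s) = 0" using less by (simp add: coeff_eq_0)
    ultimately show ?thesis
      using deg lc e(2) \<kappa>r by (intro conjI exI[of _ "e * \<kappa>\<^sub>r ^ CARD('q) ^ degree (\<phi> b)"]) simp_all
  qed
qed simp

lemma coeff_\<phi>_0: "coeff (\<phi> a) 0 = a"
proof (induction a)
  case 0
  then show ?case using \<phi>_const[of 0] by simp
next
  case (pCons c b)
  have eq: "pCons c b = [:c:] + b * [:0, 1:]" by simp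
  show ?case
  proof (cases "b = 0")
    case True
    then show ?thesis by (simp add: \<phi>_const)
  next
    case False
    then have nz: "\<phi> b \<noteq> 0" "\<phi> [:0, 1:] \<noteq> 0" using \<phi>_degree[of b] degree_\<phi>_theta r_ge by auto
    have "coeff (\<phi> (pCons c b)) 0 = [:c:] + b * \<theta>"
      unfolding eq \<phi>_add \<phi>_mult \<phi>_const by (simp add: coeff_0_skew_mult[OF nz] pCons coeff_\<phi>_theta)
    then show ?thesis by simp
  qed
qed

definition act_poly :: "'q poly \<Rightarrow> 'q kbar poly"
  where "act_poly a = (\<Sum>i\<le>degree (\<phi> a). monom (\<iota> (coeff (\<phi> a) i)) (CARD('q) ^ i))"

lemma poly_act_poly [simp]: "poly (act_poly a) x = act a x"
  by (simp add: act_poly_def drinfeld_act_def poly_sum poly_monom)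

lemma coeff_act_poly: "coeff (act_poly a) (CARD('q) ^ i) = \<iota> (coeff (\<phi> a) i)"
proof -
  have "(CARD('q) ^ j = CARD('q) ^ i) = (j = i)" for j
    using card_field_gt_1[where 'q = 'q] by simp
  then have "coeff (act_poly a) (CARD('q) ^ i) =
      (\<Sum>j\<le>degree (\<phi> a). if j = i then \<iota> (coeff (\<phi> a) i) else 0)"
    by (auto simp: act_poly_def coeff_sum intro!: sum.cong)
  then show ?thesis by (simp add: coeff_eq_0)
qed

lemma degree_act_poly: "a \<noteq> 0 \<Longrightarrow> degree (act_poly a) = CARD('q) ^ (r * degree a)"
proof (intro antisym)
  assume a: "a \<noteq> 0"
  show "degree (act_poly a) \<le> CARD('q) ^ (r * degree a)"
    unfolding act_poly_def
  proof (rule degree_sum_le)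
    fix i assume "i \<in> {..degree (\<phi> a)}"
    then have "CARD('q) ^ i \<le> CARD('q) ^ (r * degree a)"
      using \<phi>_degree[OF a] card_field_gt_1[where 'q = 'q] by (intro power_increasing) auto
    then show "degree (monom (\<iota> (coeff (\<phi> a) i)) (CARD('q) ^ i)) \<le> CARD('q) ^ (r * degree a)"
      using degree_monom_le order_trans by blast
  qed simp
  show "CARD('q) ^ (r * degree a) \<le> degree (act_poly a)"
    by (rule le_degree) (use \<phi>_degree[OF a] in \<open>auto simp: coeff_act_poly\<close>)
qed

text \<open>All exponents above 1 are multiples of q, which is 0. So \<open>act_poly a\<close> is
  separable for nonzero \<open>a\<close>.\<close>

lemma pderiv_act_poly: "pderiv (act_poly a) = [:\<iota> a:]"
proof -
  have p: "pderiv (\<Sum>i\<in>I. g i) = (\<Sum>i\<in>I. pderiv (g i))" for g :: "nat \<Rightarrow> 'q kbar poly" and I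
    by (induction I rule: infinite_finite_induct) (simp_all add: pderiv_add)
  have "pderiv (monom c (CARD('q) ^ i)) = (if i = 0 then [:c:] else 0)" for c :: "'q kbar" and i
  proof (cases i)
    case (Suc j)
    have "of_nat (CARD('q) ^ i) = (0 :: 'q kbar)"
      by (simp add: Suc of_nat_card_kbar)
    then show ?thesis using Suc by (simp add: pderiv_monom)
  qed (simp add: pderiv_monom monom_0)
  then have "pderiv (act_poly a) = (\<Sum>i\<le>degree (\<phi> a). if i = 0 then [:\<iota> (coeff (\<phi> a) 0):] else 0)"
    unfolding act_poly_def p by (intro sum.cong) auto
  then show ?thesis by (simp add: coeff_\<phi>_0)
qed

definition torsion :: "'q poly \<Rightarrow> 'q kbar set" where "torsion a = {x. act a x = 0}"

lemma card_torsion: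
  assumes "a \<noteq> 0" shows "card (torsion a) = CARD('q) ^ (r * degree a)"
proof -
  have "act_poly a \<noteq> 0" using pderiv_act_poly[of a] assms by auto
  then have "card {x. poly (act_poly a) x = 0} = degree (act_poly a)"
    by (rule card_roots_separable) (use assms in \<open>simp add: pderiv_act_poly\<close>)
  then show ?thesis by (simp add: torsion_def degree_act_poly assms)
qed

lemma finite_torsion: "a \<noteq> 0 \<Longrightarrow> finite (torsion a)"
  using card_torsion[of a] card_ge_0_finite[of "torsion a"] by simp

lemma act_surj:
  assumes "a \<noteq> 0" obtains y where "act a y = x"
proof -
  have less: "degree [:- x:] < degree (act_poly a)" by (simp add: degree_act_poly assms)
  have "degree (act_poly a + [:- x:]) > 0" using degree_add_eq_left[OF less] less by simp
  then obtain y where "poly (act_poly a + [:- x:]) y = 0" using alg_closed_imp_poly_has_root by blast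
  then show ?thesis using that by simp
qed

text \<open>Dividing by the constant leading coefficient gives a monic equation over A.\<close>

lemma torsion_integral:
  assumes "a \<noteq> 0" "x \<in> torsion a"
  shows "x \<in> integral_closure_A"
proof -
  obtain c where c: "c \<noteq> 0" "lead_coeff (\<phi> a) = [:c:]" using \<phi>_degree[OF assms(1)] by blast
  let ?n = "degree (\<phi> a)"
  define p where "p = smult [:inverse c:] (\<Sum>i\<le>?n. monom (coeff (\<phi> a) i) (CARD('q) ^ i))"
  have inj: "(CARD('q) ^ j = CARD('q) ^ i) = (j = i)" for i j
    using card_field_gt_1[where 'q = 'q] by simp
  have co: "coeff p (CARD('q) ^ ?n) = 1"
  proof -
    have "(\<Sum>j\<le>?n. coeff (monom (coeff (\<phi> a) j) (CARD('q) ^ j)) (CARD('q) ^ ?n)) =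
      (\<Sum>j\<le>?n. if j = ?n then [:c:] else 0)"
      by (rule sum.cong) (auto simp: inj c)
    then show ?thesis using c(1) by (simp add: p_def coeff_sum one_pCons)
  qed
  have "degree p \<le> CARD('q) ^ ?n"
    unfolding p_def
  proof (intro order_trans[OF degree_smult_le] degree_sum_le)
    fix i assume "i \<in> {..?n}"
    then have "CARD('q) ^ i \<le> CARD('q) ^ ?n"
      using card_field_gt_1[where 'q = 'q] by (intro power_increasing) auto
    then show "degree (monom (coeff (\<phi> a) i) (CARD('q) ^ i)) \<le> CARD('q) ^ ?n"
      using degree_monom_le order_trans by blast
  qed simp
  then have deg: "degree p = CARD('q) ^ ?n" using le_degree[of p "CARD('q) ^ ?n"] co by simp
  interpret mp: map_poly_comm_ring_hom "\<iota> :: 'q poly \<Rightarrow> 'q kbar" ..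
  have "poly (map_poly \<iota> p) x = scal (inverse c) * act a x"
    by (simp add: p_def iota.map_poly_hom_smult mp.hom_sum poly_sum poly_monom drinfeld_act_def)
  then have "poly (map_poly \<iota> p) x = 0" using assms by (simp add: torsion_def)
  then show ?thesis unfolding integral_closure_A_def using co deg by (intro CollectI exI[of _ p]) simp
qed

end

section \<open>Tate modules and their duals\<close>

lemma adic_mod:
  assumes "a \<in> adic l" shows "a m mod l ^ m = a m"
proof -
  have "a m = a (Suc m) mod l ^ m" using assms unfolding adic_def by blast
  then show ?thesis using mod_mod_trivial[of "a (Suc m)" "l ^ m"] by simp
qed

lemma adicI: "(\<And>m. a m = a (Suc m) mod l ^ m) \<Longrightarrow> a \<in> adic l"
  unfolding adic_def by blast

lemma adicD: "a \<in> adic l \<Longrightarrow> a m = a (Suc m) mod l ^ m"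
  unfolding adic_def by blast

lemma mod_power_Suc_mod: "x mod l ^ Suc m mod l ^ m = (x mod l ^ m :: 'a::field poly)"
  by (rule mod_mod_cancel) (simp add: le_imp_power_dvd)

lemma adic_mult_in_adic:
  assumes "a \<in> adic l" "b \<in> adic l" shows "adic_mult l a b \<in> adic l"
proof (rule adicI)
  fix m
  have "a m * b m mod l ^ m = (a (Suc m) mod l ^ m) * (b (Suc m) mod l ^ m) mod l ^ m"
    by (simp only: adicD[OF assms(1), of m, symmetric] adicD[OF assms(2), of m, symmetric])
  then show "adic_mult l a b m = adic_mult l a b (Suc m) mod l ^ m"
    by (simp add: adic_mult_def mod_power_Suc_mod mod_mult_eq del: power_Suc)
qed

lemma adic_add: "a \<in> adic l \<Longrightarrow> b \<in> adic l \<Longrightarrow> (\<lambda>m. a m + b m) \<in> adic l"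
  by (rule adicI) (simp only: poly_mod_add_left adicD[symmetric])

lemma adic_0 [simp]: "(\<lambda>m. 0) \<in> adic l"
  by (rule adicI) simp

lemma adic_sum: "(\<And>i. i \<in> I \<Longrightarrow> f i \<in> adic l) \<Longrightarrow> (\<lambda>m. \<Sum>i\<in>I. f i m) \<in> adic l"
proof (induction I rule: infinite_finite_induct)
  case (insert x I)
  then show ?case using adic_add[of "f x" l "\<lambda>m. \<Sum>i\<in>I. f i m"] by simp
qed simp_all

lemma sum_mod_poly: "(\<Sum>i\<in>I. f i) mod (m :: 'a::field poly) = (\<Sum>i\<in>I. f i mod m)"
  by (induction I rule: infinite_finite_induct) (simp_all add: poly_mod_add_left)

text \<open>The reduction matters at level 0, where the representative of 1 is 0.\<close>

definition adic_one :: "'q::field poly \<Rightarrow> nat \<Rightarrow> 'q poly" where "adic_one l = (\<lambda>m. 1 mod l ^ m)"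

lemma adic_one [simp]: "adic_one l \<in> adic l"
  by (rule adicI) (simp add: adic_one_def mod_power_Suc_mod del: power_Suc)

lemma adic_mult_one: "c \<in> adic l \<Longrightarrow> adic_mult l c (adic_one l) = c"
  by (rule ext) (simp add: adic_mult_def adic_one_def adic_mod mod_mult_right_eq)

lemma adic_mult_0 [simp]: "adic_mult l c (\<lambda>m. 0) = (\<lambda>m. 0)"
  by (rule ext) (simp add: adic_mult_def)

lemma adic_mult_commute: "adic_mult l a b = adic_mult l b a"
  by (rule ext) (simp add: adic_mult_def mult.commute)

lemma dual_lincomb_eq: "dual_lincomb l n c b x m = (\<Sum>i<n. c i m * b i x m) mod l ^ m"
  by (simp add: dual_lincomb_def sum_mod_poly adic_mult_def)

lemma dual_lincomb_cong: "(\<And>i. i < n \<Longrightarrow> c i = c' i) \<Longrightarrow> dual_lincomb l n c b x = dual_lincomb l n c' b x"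
  by (simp add: dual_lincomb_def)

section \<open>The Tate module is free of rank r\<close>

locale drinfeld_tate = drinfeld \<phi> \<kappa> \<kappa>\<^sub>r r
  for \<phi> :: "'q::{field,finite} poly \<Rightarrow> 'q poly poly" and \<kappa> \<kappa>\<^sub>r r +
  fixes l :: "'q poly"
  assumes l: "l \<in> monic_primes"
begin

abbreviation "T \<equiv> tate_module \<phi> l"
abbreviation "n \<equiv> degree l"

lemma l0 [simp]: "l \<noteq> 0" and n_pos: "n > 0" and deg_l_power: "degree (l ^ m) = m * n"
proof -
  show "l \<noteq> 0" by (rule monic_primes_nonzero[OF l])
  then show "degree (l ^ m) = m * n" by (simp add: degree_power_eq)
  show "n > 0" by (rule monic_primes_degree[OF l])
qed

lemma tate_D: "x \<in> T \<Longrightarrow> x 0 = 0" "x \<in> T \<Longrightarrow> act l (x (Suc m)) = x m"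
  by (simp_all add: tate_module_def)

lemma tate_I: "x 0 = 0 \<Longrightarrow> (\<And>m. act l (x (Suc m)) = x m) \<Longrightarrow> x \<in> T"
  by (simp add: tate_module_def)

lemma tate_act_power: "x \<in> T \<Longrightarrow> act (l ^ k) (x (m + k)) = x m"
proof (induction k)
  case (Suc k)
  have "act (l ^ Suc k) (x (m + Suc k)) = act (l ^ k) (act l (x (Suc (m + k))))"
    by (simp add: act_mult[symmetric] mult.commute)
  then show ?case using Suc tate_D by simp
qed simp

lemma tate_torsion: "x \<in> T \<Longrightarrow> x m \<in> torsion (l ^ m)"
  using tate_act_power[of x m 0] tate_D by (simp add: torsion_def)

lemma act_mod_torsion: "x \<in> torsion a \<Longrightarrow> act (c mod a) x = act c x"
proof -
  assume x: "x \<in> torsion a"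
  have "act c x = act (c div a * a + c mod a) x" by simp
  also have "\<dots> = act (c mod a) x" unfolding act_add_left act_mult using x by (simp add: torsion_def)
  finally show ?thesis by simp
qed

lemma act_cong_torsion: "x \<in> torsion a \<Longrightarrow> c mod a = d mod a \<Longrightarrow> act c x = act d x"
  by (metis act_mod_torsion)

lemma torsion_add: "x \<in> torsion a \<Longrightarrow> y \<in> torsion a \<Longrightarrow> x + y \<in> torsion a"
  and torsion_act: "x \<in> torsion a \<Longrightarrow> act c x \<in> torsion a"
  and torsion_0 [simp]: "0 \<in> torsion a"
  by (simp_all add: torsion_def act_add) (metis act_commute act_0)

lemma torsion_sum: "(\<And>i. i \<in> I \<Longrightarrow> f i \<in> torsion a) \<Longrightarrow> sum f I \<in> torsion a"
  by (induction I rule: infinite_finite_induct) (simp_all add: torsion_add)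

lemma card_tuples: "card ({..<k} \<rightarrow>\<^sub>E (lowdeg m :: 'q poly set)) = CARD('q) ^ (m * k)"
  by (simp add: card_PiE card_lowdeg power_mult)

definition independent_family :: "nat \<Rightarrow> (nat \<Rightarrow> 'q kbar) \<Rightarrow> bool"
  where "independent_family k x \<longleftrightarrow> (\<forall>i<k. x i \<in> torsion l) \<and>
    (\<forall>a. (\<Sum>i<k. act (a i) (x i)) = 0 \<longrightarrow> (\<forall>i<k. l dvd a i))"

lemma tuple_inj:
  assumes "\<And>a. (\<Sum>i<k. act (a i) (x i)) = 0 \<Longrightarrow> \<forall>i<k. b dvd a i" and "b \<noteq> 0"
  shows "inj_on (\<lambda>a. \<Sum>i<k. act (a i) (x i)) ({..<k} \<rightarrow>\<^sub>E lowdeg (degree b))"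
proof (rule inj_onI)
  fix a a' assume a: "a \<in> {..<k} \<rightarrow>\<^sub>E lowdeg (degree b)" "a' \<in> {..<k} \<rightarrow>\<^sub>E lowdeg (degree b)"
    and eq: "(\<Sum>i<k. act (a i) (x i)) = (\<Sum>i<k. act (a' i) (x i))"
  have "(\<Sum>i<k. act (a i - a' i) (x i)) = 0" using eq by (simp add: act_diff_left sum_subtractf)
  from assms(1)[OF this] have dvd: "b dvd a i - a' i" if "i < k" for i using that by blast
  show "a = a'"
  proof (rule PiE_ext[OF a])
    fix i assume i: "i \<in> {..<k}"
    have "a i - a' i \<in> lowdeg (degree b)" using a i by (auto simp: PiE_iff lowdeg_def)
    then show "a i = a' i" using dvd[of i] i dvd_imp_degree_le[of b "a i - a' i"]
      by (fastforce simp: lowdeg_iff)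
  qed
qed

text \<open>Counting: the span of \<open>k\<close> elements has at most q^(n k) members, which for
  \<open>k\<close> below \<open>r\<close> is less than the q^(n r) points of the
  \<lambda>-torsion.\<close>

lemma independent_family_exists: "k \<le> r \<Longrightarrow> \<exists>x. independent_family k x"
proof (induction k)
  case (Suc k)
  then obtain x where x: "independent_family k x" by auto
  let ?S = "(\<lambda>a. \<Sum>i<k. act (a i) (x i)) ` ({..<k} \<rightarrow>\<^sub>E lowdeg n)"
  have "card ?S \<le> CARD('q) ^ (n * k)"
    using card_image_le[of "{..<k} \<rightarrow>\<^sub>E (lowdeg n :: 'q poly set)"] by (simp add: card_tuples finite_PiE)
  also have "\<dots> < CARD('q) ^ (n * r)"
    using Suc.prems n_pos card_field_gt_1[where 'q = 'q] by (intro power_strict_increasing) auto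
  also have "\<dots> = card (torsion l)" by (simp add: card_torsion mult.commute)
  finally have "\<not> torsion l \<subseteq> ?S"
    using card_mono[of ?S "torsion l"] by (auto simp: finite_PiE)
  then obtain y where y: "y \<in> torsion l" "y \<notin> ?S" by blast
  have span: "(\<Sum>i<k. act (a i) (x i)) \<in> ?S" for a
  proof (rule image_eqI)
    show "(\<lambda>i\<in>{..<k}. a i mod l) \<in> {..<k} \<rightarrow>\<^sub>E lowdeg n" using mod_lowdeg[OF n_pos] by auto
    show "(\<Sum>i<k. act (a i) (x i)) = (\<Sum>i<k. act ((\<lambda>i\<in>{..<k}. a i mod l) i) (x i))"
      by (rule sum.cong) (use x in \<open>auto simp: independent_family_def act_mod_torsion\<close>)
  qed
  let ?x = "x(k := y)"
  have "independent_family (Suc k) ?x"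
    unfolding independent_family_def
  proof (intro conjI allI impI)
    show "?x i \<in> torsion l" if "i < Suc k" for i
      using that x y by (auto simp: independent_family_def less_Suc_eq)
    fix a i assume 0: "(\<Sum>i<Suc k. act (a i) (?x i)) = 0" and i: "i < Suc k"
    have 0: "(\<Sum>i<k. act (a i) (x i)) + act (a k) y = 0" using 0 by simp
    \<comment> \<open>Otherwise inverting \<open>a k\<close> modulo \<lambda> would place
      \<open>y\<close> in the span of the others.\<close>
    have "l dvd a k"
    proof (rule ccontr)
      assume "\<not> l dvd a k"
      then obtain u v where uv: "u * a k + v * l = 1"
        using irreducible_bezout[OF monic_primes_irreducible[OF l]] by metis
      have "y = act (u * a k + v * l) y" by (simp add: uv)
      also have "\<dots> = act u (act (a k) y)" unfolding act_add_left act_mult using y by (simp add: torsion_def)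
      also have "act (a k) y = - (\<Sum>i<k. act (a i) (x i))" using 0 by (simp add: eq_neg_iff_add_eq_0 add.commute)
      also have "act u \<dots> = (\<Sum>i<k. act (- u * a i) (x i))"
        unfolding act_mult by (simp add: act_uminus act_sum act_uminus_left sum_negf)
      finally have "y \<in> ?S" using span[of "\<lambda>i. - u * a i"] by simp
      then show False using y(2) by blast
    qed
    moreover from this have "act (a k) y = 0"
      using act_mod_torsion[OF y(1), of "a k"] by (simp add: dvd_eq_mod_eq_0)
    then have "\<forall>i<k. l dvd a i" using x 0 by (simp add: independent_family_def)
    ultimately show "l dvd a i" using i by (auto simp: less_Suc_eq)
  qed
  then show ?case by blast
qed (auto simp: independent_family_def)

lemma tate_lift: "x \<in> torsion l \<Longrightarrow> \<exists>y\<in>T. y 1 = x"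
proof -
  assume x: "x \<in> torsion l"
  have "\<forall>z. \<exists>w. act l w = z" using act_surj[OF l0] by blast
  from choice[OF this] obtain g where g: "\<And>z. act l (g z) = z" by blast
  define y where "y m = (case m of 0 \<Rightarrow> 0 | Suc k \<Rightarrow> (g ^^ k) x)" for m
  have "y \<in> T"
  proof (rule tate_I)
    show "act l (y (Suc m)) = y m" for m
      using x g by (cases m) (simp_all add: y_def torsion_def)
  qed (simp add: y_def)
  moreover have "y 1 = x" by (simp add: y_def)
  ultimately show ?thesis by blast
qed

text \<open>Lifts of a basis of the \<lambda>-torsion. As in Nakayama's lemma they form a basis of
  the whole Tate module, which is verified level by level.\<close>

definition tbase :: "nat \<Rightarrow> nat \<Rightarrow> 'q kbar"
  where "tbase = (SOME y. (\<forall>i<r. y i \<in> T) \<and> independent_family r (\<lambda>i. y i 1))"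

lemma tbase: "i < r \<Longrightarrow> tbase i \<in> T" "independent_family r (\<lambda>i. tbase i 1)"
proof -
  obtain x where x: "independent_family r x" using independent_family_exists by blast
  have "\<forall>i. \<exists>y. i < r \<longrightarrow> y \<in> T \<and> y 1 = x i"
  proof
    fix i show "\<exists>y. i < r \<longrightarrow> y \<in> T \<and> y 1 = x i"
    proof (cases "i < r")
      case True
      then have "x i \<in> torsion l" using x by (simp add: independent_family_def)
      then obtain y where "y \<in> T" "y 1 = x i" using tate_lift by blast
      then show ?thesis by blast
    qed simp
  qed
  from choice[OF this] obtain y where y: "\<And>i. i < r \<Longrightarrow> y i \<in> T \<and> y i 1 = x i" by blast
  then have "independent_family r (\<lambda>i. y i 1)" using x by (simp add: independent_family_def)
  then have "(\<forall>i<r. y i \<in> T) \<and> independent_family r (\<lambda>i. y i 1)" using y by simp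
  from someI[of "\<lambda>y. (\<forall>i<r. y i \<in> T) \<and> independent_family r (\<lambda>i. y i 1)", OF this]
  have *: "(\<forall>i<r. tbase i \<in> T) \<and> independent_family r (\<lambda>i. tbase i 1)"
    unfolding tbase_def .
  then show "independent_family r (\<lambda>i. tbase i 1)" by blast
  show "tbase i \<in> T" if "i < r" using * that by blast
qed

text \<open>Acting by \<lambda>^m brings a relation at level m + 1 down to level 1, where \<lambda>
  must divide all coefficients; after dividing them by \<lambda> it is a relation at level
  m.\<close>

lemma tbase_independent:
  "(\<Sum>i<r. act (a i) (tbase i m)) = 0 \<Longrightarrow> \<forall>i<r. l ^ m dvd a i"
proof (induction m arbitrary: a)
  case (Suc m)
  have "0 = act (l ^ m) (\<Sum>i<r. act (a i) (tbase i (Suc m)))" using Suc.prems by simp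
  also have "\<dots> = (\<Sum>i<r. act (a i) (act (l ^ m) (tbase i (1 + m))))"
    by (simp add: act_sum act_commute[of "l ^ m"])
  also have "\<dots> = (\<Sum>i<r. act (a i) (tbase i 1))"
    by (rule sum.cong) (simp_all add: tate_act_power tbase(1) del: One_nat_def)
  finally have "\<forall>i<r. l dvd a i" using tbase(2) unfolding independent_family_def by metis
  then have "\<forall>i. \<exists>b. i < r \<longrightarrow> a i = l * b" by (auto elim: dvdE)
  from choice[OF this] obtain b where b: "\<And>i. i < r \<Longrightarrow> a i = b i * l" by (auto simp: mult.commute)
  have "0 = (\<Sum>i<r. act (b i) (tbase i m))"
    unfolding Suc.prems[symmetric]
    by (rule sum.cong) (simp_all add: b act_mult tate_D(2)[OF tbase(1)])
  then have "\<forall>i<r. l ^ m dvd b i" using Suc.IH[of b] by simp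
  then show ?case using b by (simp add: mult.commute mult_dvd_mono)
qed simp

text \<open>Injectivity is the independence just shown, and both sides have q^(r m n)
  elements.\<close>

lemma tuple_bij: "bij_betw (\<lambda>a. \<Sum>i<r. act (a i) (tbase i m)) ({..<r} \<rightarrow>\<^sub>E lowdeg (m * n)) (torsion (l ^ m))"
  unfolding bij_betw_def
proof
  let ?f = "\<lambda>a. \<Sum>i<r. act (a i) (tbase i m)" and ?D = "{..<r} \<rightarrow>\<^sub>E (lowdeg (m * n) :: 'q poly set)"
  show inj: "inj_on ?f ?D"
    using tuple_inj[where k = r and x = "\<lambda>i. tbase i m" and b = "l ^ m"] tbase_independent by (simp add: deg_l_power)
  show "?f ` ?D = torsion (l ^ m)"
  proof (rule card_subset_eq)
    show "finite (torsion (l ^ m))" by (rule finite_torsion) simp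
    show "?f ` ?D \<subseteq> torsion (l ^ m)"
      by (intro image_subsetI torsion_sum torsion_act tate_torsion tbase) simp
    show "card (?f ` ?D) = card (torsion (l ^ m))"
      by (simp add: card_image[OF inj] card_tuples card_torsion deg_l_power mult_ac)
  qed
qed

definition coord :: "nat \<Rightarrow> (nat \<Rightarrow> 'q kbar) \<Rightarrow> nat \<Rightarrow> 'q poly"
  where "coord i x m = the_inv_into ({..<r} \<rightarrow>\<^sub>E lowdeg (m * n)) (\<lambda>a. \<Sum>i<r. act (a i) (tbase i m)) (x m) i"

lemma coord_sum: "x \<in> T \<Longrightarrow> (\<Sum>i<r. act (coord i x m) (tbase i m)) = x m"
  and coord_lowdeg: "x \<in> T \<Longrightarrow> i < r \<Longrightarrow> coord i x m \<in> lowdeg (m * n)"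
proof -
  assume x: "x \<in> T"
  then have "x m \<in> torsion (l ^ m)" by (rule tate_torsion)
  then have img: "x m \<in> (\<lambda>a. \<Sum>i<r. act (a i) (tbase i m)) ` ({..<r} \<rightarrow>\<^sub>E lowdeg (m * n))"
    using tuple_bij[of m] by (simp add: bij_betw_def)
  have inj: "inj_on (\<lambda>a. \<Sum>i<r. act (a i) (tbase i m)) ({..<r} \<rightarrow>\<^sub>E lowdeg (m * n))"
    using tuple_bij[of m] by (simp add: bij_betw_def)
  show "(\<Sum>i<r. act (coord i x m) (tbase i m)) = x m"
    using f_the_inv_into_f[OF inj img] by (simp add: coord_def)
  show "coord i x m \<in> lowdeg (m * n)" if "i < r"
    using the_inv_into_into[OF inj img subset_refl] that by (auto simp: coord_def PiE_iff)
qed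

lemma lowdeg_mod: "a \<in> lowdeg (m * n) \<Longrightarrow> a mod l ^ m = a"
  by (cases "a = 0") (simp_all add: lowdeg_iff deg_l_power mod_poly_less)

lemma mod_in_lowdeg: "a mod l ^ m \<in> lowdeg (m * n)"
proof (cases "m = 0")
  case False
  then have "degree (l ^ m) > 0" using n_pos by (simp add: deg_l_power)
  then show ?thesis using mod_lowdeg[of "l ^ m" a] by (simp add: deg_l_power)
qed simp

lemma coord_unique:
  assumes "x \<in> T" "(\<Sum>i<r. act (a i) (tbase i m)) = x m" "i < r"
  shows "coord i x m = a i mod l ^ m"
proof -
  have "(\<Sum>i<r. act (coord i x m - a i) (tbase i m)) = 0"
    using assms coord_sum[OF assms(1)] by (simp add: act_diff_left sum_subtractf)
  from tbase_independent[OF this] have "coord i x m mod l ^ m = a i mod l ^ m"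
    using assms(3) by (simp add: mod_eq_dvd_iff)
  then show ?thesis using lowdeg_mod[OF coord_lowdeg[OF assms(1,3)]] by simp
qed

lemma coord_adic: "x \<in> T \<Longrightarrow> i < r \<Longrightarrow> coord i x \<in> adic l"
proof (rule adicI)
  fix m assume x: "x \<in> T" and i: "i < r"
  have "(\<Sum>i<r. act (coord i x (Suc m)) (tbase i m)) = act l (\<Sum>i<r. act (coord i x (Suc m)) (tbase i (Suc m)))"
    unfolding act_sum
  proof (rule sum.cong)
    fix j assume "j \<in> {..<r}"
    then show "act (coord j x (Suc m)) (tbase j m) = act l (act (coord j x (Suc m)) (tbase j (Suc m)))"
      by (subst act_commute) (simp add: tate_D(2)[OF tbase(1)])
  qed simp
  also have "\<dots> = x m" by (simp add: coord_sum[OF x] tate_D(2)[OF x])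
  finally show "coord i x m = coord i x (Suc m) mod l ^ m" by (rule coord_unique[OF x _ i])
qed

lemma tate_add: "x \<in> T \<Longrightarrow> y \<in> T \<Longrightarrow> (\<lambda>m. x m + y m) \<in> T"
  by (rule tate_I) (simp_all add: tate_D act_add)

lemma tate_0: "(\<lambda>m. 0) \<in> T"
  by (rule tate_I) simp_all

lemma tate_smult: "a \<in> adic l \<Longrightarrow> x \<in> T \<Longrightarrow> tate_smult \<phi> a x \<in> T"
proof (rule tate_I)
  assume a: "a \<in> adic l" and x: "x \<in> T"
  show "tate_smult \<phi> a x 0 = 0" by (simp add: tate_smult_def tate_D(1)[OF x])
  fix m
  have "act l (act (a (Suc m)) (x (Suc m))) = act (a (Suc m)) (x m)"
    by (subst act_commute) (simp add: tate_D(2)[OF x])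
  also have "\<dots> = act (a m) (x m)"
    by (rule act_cong_torsion[OF tate_torsion[OF x]]) (simp only: adicD[OF a, of m, symmetric] adic_mod[OF a])
  finally show "act l (tate_smult \<phi> a x (Suc m)) = tate_smult \<phi> a x m" by (simp add: tate_smult_def)
qed

lemma coord_add: "x \<in> T \<Longrightarrow> y \<in> T \<Longrightarrow> i < r \<Longrightarrow> coord i (\<lambda>m. x m + y m) = (\<lambda>m. coord i x m + coord i y m)"
proof
  fix m assume x: "x \<in> T" and y: "y \<in> T" and i: "i < r"
  have "coord i (\<lambda>m. x m + y m) m = (coord i x m + coord i y m) mod l ^ m"
    by (rule coord_unique[OF tate_add[OF x y] _ i])
       (simp add: act_add_left sum.distrib coord_sum x y)
  then show "coord i (\<lambda>m. x m + y m) m = coord i x m + coord i y m"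
    by (simp add: poly_mod_add_left adic_mod[OF coord_adic] x y i)
qed

lemma coord_smult:
  assumes "a \<in> adic l" "x \<in> T" "i < r"
  shows "coord i (tate_smult \<phi> a x) = adic_mult l a (coord i x)"
proof
  fix m
  have "coord i (tate_smult \<phi> a x) m = (a m * coord i x m) mod l ^ m"
  proof (rule coord_unique[OF tate_smult[OF assms(1,2)] _ assms(3)])
    have "(\<Sum>i<r. act (a m * coord i x m) (tbase i m)) = act (a m) (\<Sum>i<r. act (coord i x m) (tbase i m))"
      by (simp add: act_mult act_sum)
    then show "(\<Sum>i<r. act (a m * coord i x m) (tbase i m)) = tate_smult \<phi> a x m"
      by (simp add: coord_sum assms tate_smult_def)
  qed
  then show "coord i (tate_smult \<phi> a x) m = adic_mult l a (coord i x) m" by (simp add: adic_mult_def)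
qed

lemma coord_tbase: "i < r \<Longrightarrow> j < r \<Longrightarrow> coord i (tbase j) = (if i = j then adic_one l else (\<lambda>m. 0))"
proof
  fix m assume i: "i < r" and j: "j < r"
  have "(\<Sum>i<r. act (if i = j then 1 else 0) (tbase i m)) = (\<Sum>i<r. if i = j then tbase j m else 0)"
    by (rule sum.cong) auto
  then have "coord i (tbase j) m = (if i = j then 1 else 0) mod l ^ m"
    using j by (intro coord_unique[OF tbase(1)[OF j] _ i]) simp
  then show "coord i (tbase j) m = (if i = j then adic_one l else (\<lambda>m. 0)) m"
    by (simp add: adic_one_def)
qed

section \<open>The dual of the Tate module\<close>

text \<open>Only the linearity conditions of \<open>tate_dual\<close>, without extensionality, so
  that they apply to a functional composed with a Galois element.\<close>

definition tate_linear :: "((nat \<Rightarrow> 'q kbar) \<Rightarrow> nat \<Rightarrow> 'q poly) \<Rightarrow> bool"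
  where "tate_linear h \<longleftrightarrow>
      (\<forall>x\<in>T. \<forall>y\<in>T. h (\<lambda>m. x m + y m) = (\<lambda>m. h x m + h y m)) \<and>
      (\<forall>a\<in>adic l. \<forall>x\<in>T. h (tate_smult \<phi> a x) = adic_mult l a (h x))"

lemma tate_linear_add:
  assumes "tate_linear h" "x \<in> T" "y \<in> T"
  shows "h (\<lambda>m. x m + y m) = (\<lambda>m. h x m + h y m)"
proof -
  have "\<forall>x\<in>T. \<forall>y\<in>T. h (\<lambda>m. x m + y m) = (\<lambda>m. h x m + h y m)"
    using assms(1) unfolding tate_linear_def by (rule conjunct1)
  from bspec[OF bspec[OF this assms(2)] assms(3)] show ?thesis .
qed

lemma tate_linear_smult:
  assumes "tate_linear h" "a \<in> adic l" "x \<in> T"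
  shows "h (tate_smult \<phi> a x) = adic_mult l a (h x)"
  using assms unfolding tate_linear_def by simp

lemma tate_dual_linear: "h \<in> tate_dual \<phi> l \<Longrightarrow> tate_linear h"
  by (simp add: tate_dual_def tate_linear_def)

text \<open>Additivity is given for two summands in the Tate module, so partial sums of the
  expansion are shown to lie there along with the formula.\<close>

lemma tate_linear_expand:
  assumes h: "tate_linear h" and x: "x \<in> T"
  shows "h x m = (\<Sum>i<r. adic_mult l (coord i x) (h (tbase i)) m)"
proof -
  have 0: "h (\<lambda>m. 0) = (\<lambda>m. 0)"
    using tate_linear_smult[OF h adic_0 x] by (simp add: tate_smult_def adic_mult_def)
  have part: "(\<lambda>m. \<Sum>i<k. tate_smult \<phi> (coord i x) (tbase i) m) \<in> T \<and>
      h (\<lambda>m. \<Sum>i<k. tate_smult \<phi> (coord i x) (tbase i) m) =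
      (\<lambda>m. \<Sum>i<k. adic_mult l (coord i x) (h (tbase i)) m)" if "k \<le> r" for k
    using that
  proof (induction k)
    case 0
    then show ?case using \<open>h (\<lambda>m. 0) = (\<lambda>m. 0)\<close> tate_0 by simp
  next
    case (Suc k)
    then have k: "k < r" by simp
    let ?y = "\<lambda>m. \<Sum>i<k. tate_smult \<phi> (coord i x) (tbase i) m" and ?z = "tate_smult \<phi> (coord k x) (tbase k)"
    have z: "?z \<in> T" by (intro tate_smult coord_adic x k tbase)
    have y: "?y \<in> T" using Suc by simp
    have "h (\<lambda>m. ?y m + ?z m) = (\<lambda>m. h ?y m + h ?z m)" by (rule tate_linear_add[OF h y z])
    moreover have "h ?z = adic_mult l (coord k x) (h (tbase k))"
      by (rule tate_linear_smult[OF h coord_adic[OF x k] tbase(1)[OF k]])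
    ultimately show ?case using Suc tate_add[OF y z] by simp
  qed
  have "(\<lambda>m. \<Sum>i<r. tate_smult \<phi> (coord i x) (tbase i) m) = x"
    by (rule ext) (simp add: tate_smult_def coord_sum[OF x])
  then show ?thesis using part[of r] by simp
qed

definition dbase :: "nat \<Rightarrow> (nat \<Rightarrow> 'q kbar) \<Rightarrow> nat \<Rightarrow> 'q poly"
  where "dbase i = (\<lambda>x\<in>T. coord i x)"

lemma dbase_dual: "i < r \<Longrightarrow> dbase i \<in> tate_dual \<phi> l"
  unfolding tate_dual_def
  by (auto simp: dbase_def coord_adic coord_add coord_smult tate_add tate_smult)

lemma dual_expand:
  assumes "h \<in> tate_dual \<phi> l" "x \<in> T"
  shows "h x = dual_lincomb l r (\<lambda>i. h (tbase i)) dbase x"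
  using tate_linear_expand[OF tate_dual_linear[OF assms(1)] assms(2)] assms(2)
  by (simp add: fun_eq_iff dual_lincomb_def dbase_def adic_mult_commute[of l "coord _ x"])

lemma dual_lincomb_tbase:
  assumes "c \<in> {..<r} \<rightarrow>\<^sub>E adic l" "j < r"
  shows "dual_lincomb l r c dbase (tbase j) = c j"
proof
  fix m
  have "dual_lincomb l r c dbase (tbase j) m = (\<Sum>i<r. if i = j then c j m else 0)"
    unfolding dual_lincomb_def
  proof (rule sum.cong)
    fix i assume "i \<in> {..<r}"
    moreover have "c j \<in> adic l" using assms by auto
    ultimately show "adic_mult l (c i) (dbase i (tbase j)) m = (if i = j then c j m else 0)"
      using assms(2) by (simp add: dbase_def tbase coord_tbase adic_mult_one)
  qed simp
  then show "dual_lincomb l r c dbase (tbase j) m = c j m" using assms(2) by simp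
qed

lemma dual_values_adic: "h \<in> tate_dual \<phi> l \<Longrightarrow> x \<in> T \<Longrightarrow> h x \<in> adic l"
  by (auto simp: tate_dual_def)

lemma dbase_basis: "tate_dual_basis \<phi> l r dbase"
  unfolding tate_dual_basis_def
proof (intro conjI allI impI ballI)
  fix h assume h: "h \<in> tate_dual \<phi> l"
  let ?c = "\<lambda>i\<in>{..<r}. h (tbase i)"
  show "\<exists>!c. c \<in> {..<r} \<rightarrow>\<^sub>E adic l \<and> (\<forall>x\<in>T. h x = dual_lincomb l r c dbase x)"
  proof (rule ex1I[of _ ?c])
    have "dual_lincomb l r ?c dbase x = dual_lincomb l r (\<lambda>i. h (tbase i)) dbase x" for x
      by (rule dual_lincomb_cong) simp
    then show "?c \<in> {..<r} \<rightarrow>\<^sub>E adic l \<and> (\<forall>x\<in>T. h x = dual_lincomb l r ?c dbase x)"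
      using dual_expand[OF h] dual_values_adic[OF h] tbase by auto
    fix c assume c: "c \<in> {..<r} \<rightarrow>\<^sub>E adic l \<and> (\<forall>x\<in>T. h x = dual_lincomb l r c dbase x)"
    have cc: "?c \<in> {..<r} \<rightarrow>\<^sub>E adic l" using dual_values_adic[OF h] tbase by auto
    show "c = ?c"
    proof (rule PiE_ext[OF conjunct1[OF c] cc])
      show "c i = ?c i" if "i \<in> {..<r}" for i
        using dual_lincomb_tbase[of c i] c tbase(1)[of i] that by auto
    qed
  qed
qed (fact dbase_dual)

end

section \<open>The Galois action on the dual and its matrix\<close>

context drinfeld_tate
begin

lemma galois_act:
  assumes "\<sigma> \<in> galois_K"
  shows "\<sigma> (act a x) = act a (\<sigma> x)"
proof -
  have add: "\<sigma> (x + y) = \<sigma> x + \<sigma> y" and mult: "\<sigma> (x * y) = \<sigma> x * \<sigma> y"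
    and K: "\<sigma> (to_ac c) = to_ac c" for x y c
    using assms by (simp_all add: galois_K_def)
  have zero: "\<sigma> 0 = 0" and one: "\<sigma> 1 = 1" using K[of 0] K[of 1] by simp_all
  have sum: "\<sigma> (\<Sum>i\<in>I. f i) = (\<Sum>i\<in>I. \<sigma> (f i))" for f :: "nat \<Rightarrow> 'q kbar" and I
    by (induction I rule: infinite_finite_induct) (simp_all add: add zero)
  have power: "\<sigma> (x ^ n) = \<sigma> x ^ n" for x n by (induction n) (simp_all add: one mult)
  show ?thesis by (simp add: drinfeld_act_def sum mult power) (simp add: \<iota>_def K)
qed

lemma galois_tate: "\<sigma> \<in> galois_K \<Longrightarrow> x \<in> T \<Longrightarrow> \<sigma> \<circ> x \<in> T"
proof (rule tate_I)
  assume \<sigma>: "\<sigma> \<in> galois_K" and x: "x \<in> T"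
  have "\<sigma> (to_ac 0) = to_ac 0" using \<sigma> unfolding galois_K_def by blast
  then show "(\<sigma> \<circ> x) 0 = 0" by (simp add: tate_D(1)[OF x])
  show "act l ((\<sigma> \<circ> x) (Suc m)) = (\<sigma> \<circ> x) m" for m
    by (simp add: galois_act[OF \<sigma>, symmetric] tate_D(2)[OF x])
qed

lemma galois_inv: "\<sigma> \<in> galois_K \<Longrightarrow> inv_into UNIV \<sigma> \<in> galois_K"
proof -
  assume \<sigma>: "\<sigma> \<in> galois_K"
  then have bij: "bij \<sigma>" and add: "\<And>x y. \<sigma> (x + y) = \<sigma> x + \<sigma> y" and mult: "\<And>x y. \<sigma> (x * y) = \<sigma> x * \<sigma> y"
    and K: "\<And>c. \<sigma> (to_ac c) = to_ac c"
    by (simp_all add: galois_K_def)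
  let ?\<tau> = "inv_into UNIV \<sigma>"
  have s: "\<sigma> (?\<tau> x) = x" for x using bij by (simp add: bij_is_surj surj_f_inv_f)
  have eq: "?\<tau> x = y" if "\<sigma> y = x" for x y using bij that by (auto simp: bij_is_inj)
  show "?\<tau> \<in> galois_K"
    unfolding galois_K_def
  proof (intro CollectI conjI allI)
    show "bij ?\<tau>" by (rule bij_imp_bij_inv[OF bij])
    show "?\<tau> (x + y) = ?\<tau> x + ?\<tau> y" for x y by (rule eq) (simp add: add s)
    show "?\<tau> (x * y) = ?\<tau> x * ?\<tau> y" for x y by (rule eq) (simp add: mult s)
    show "?\<tau> (to_ac c) = to_ac c" for c by (rule eq) (rule K)
  qed
qed

text \<open>Row \<open>i\<close> holds the coordinates of the inverse of \<open>\<sigma>\<close>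
  applied to \<open>tbase i\<close>; then column \<open>j\<close> describes \<open>\<sigma>\<close>
  acting on \<open>dbase j\<close>.\<close>

definition gmat :: "('q kbar \<Rightarrow> 'q kbar) \<Rightarrow> nat \<Rightarrow> nat \<Rightarrow> nat \<Rightarrow> 'q poly"
  where "gmat \<sigma> i j = coord j (inv_into UNIV \<sigma> \<circ> tbase i)"

lemma gmat_adic: "\<sigma> \<in> galois_K \<Longrightarrow> i < r \<Longrightarrow> j < r \<Longrightarrow> gmat \<sigma> i j \<in> adic l"
  unfolding gmat_def by (intro coord_adic galois_tate galois_inv tbase)

lemma galois_linear:
  assumes \<sigma>: "\<sigma> \<in> galois_K" and h: "h \<in> tate_dual \<phi> l"
  shows "tate_linear (\<lambda>x. h (inv_into UNIV \<sigma> \<circ> x))"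
proof -
  let ?\<tau> = "inv_into UNIV \<sigma>"
  have \<tau>: "?\<tau> \<in> galois_K" by (rule galois_inv[OF \<sigma>])
  note hl = tate_dual_linear[OF h]
  show ?thesis
    unfolding tate_linear_def
  proof (intro conjI ballI)
    fix x y assume "x \<in> T" "y \<in> T"
    moreover have "?\<tau> \<circ> (\<lambda>m. x m + y m) = (\<lambda>m. (?\<tau> \<circ> x) m + (?\<tau> \<circ> y) m)"
      using \<tau> by (auto simp: galois_K_def)
    ultimately show "h (?\<tau> \<circ> (\<lambda>m. x m + y m)) = (\<lambda>m. h (?\<tau> \<circ> x) m + h (?\<tau> \<circ> y) m)"
      using tate_linear_add[OF hl galois_tate[OF \<tau>] galois_tate[OF \<tau>]] by simp
  next
    fix a x assume "a \<in> adic l" "x \<in> T"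
    moreover have "?\<tau> \<circ> tate_smult \<phi> a x = tate_smult \<phi> a (?\<tau> \<circ> x)"
      by (auto simp: tate_smult_def galois_act[OF \<tau>])
    ultimately show "h (?\<tau> \<circ> tate_smult \<phi> a x) = adic_mult l a (h (?\<tau> \<circ> x))"
      using tate_linear_smult[OF hl _ galois_tate[OF \<tau>]] by simp
  qed
qed

lemma galois_expand:
  assumes \<sigma>: "\<sigma> \<in> galois_K" and h: "h \<in> tate_dual \<phi> l" and x: "x \<in> T"
  shows "galois_dual_act \<phi> l \<sigma> h x m =
    (\<Sum>i<r. adic_mult l (coord i x) (h (inv_into UNIV \<sigma> \<circ> tbase i)) m)"
  using tate_linear_expand[OF galois_linear[OF \<sigma> h] x] x by (simp add: galois_dual_act_def)

lemma gmat_matrix: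
  assumes \<sigma>: "\<sigma> \<in> galois_K" and "j < r" "x \<in> T"
  shows "galois_dual_act \<phi> l \<sigma> (dbase j) x = dual_lincomb l r (\<lambda>i. gmat \<sigma> i j) dbase x"
proof
  fix m
  show "galois_dual_act \<phi> l \<sigma> (dbase j) x m = dual_lincomb l r (\<lambda>i. gmat \<sigma> i j) dbase x m"
    unfolding galois_expand[OF \<sigma> dbase_dual[OF assms(2)] assms(3)] dual_lincomb_def
  proof (rule sum.cong)
    fix i assume "i \<in> {..<r}"
    then have "inv_into UNIV \<sigma> \<circ> tbase i \<in> T" by (intro galois_tate galois_inv \<sigma> tbase) simp
    then show "adic_mult l (coord i x) (dbase j (inv_into UNIV \<sigma> \<circ> tbase i)) m
        = adic_mult l (gmat \<sigma> i j) (dbase i x) m"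
      using assms(3) by (simp add: gmat_def dbase_def adic_mult_commute)
  qed simp
qed

abbreviation "gM \<sigma> m \<equiv> mat r r (\<lambda>(i, j). gmat \<sigma> i j m)"

lemma is_dual_char_polyI:
  assumes "\<sigma> \<in> galois_K" "\<And>k. adic_represents l (coeff P k) (\<lambda>m. coeff (char_poly (gM \<sigma> m)) k)"
  shows "is_dual_char_poly \<phi> l \<sigma> P"
  unfolding is_dual_char_poly_def
  by (intro exI[of _ r] exI[of _ dbase] exI[of _ "gmat \<sigma>"] conjI allI impI ballI
      dbase_basis gmat_adic gmat_matrix assms)

lemma mod_sum_mult:
  "(\<Sum>i<k. a i * b i) mod c = (\<Sum>i<k. a i * (b i mod c)) mod (c :: 'a::field poly)"
  by (simp add: sum_mod_poly mod_mult_right_eq)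

text \<open>Change of basis: with $C'_{jk} = b_k(x_j)$ one has $M C' \equiv C' M'$ modulo each power of
  $\lambda$.\<close>
lemma dual_basis_change:
  assumes \<sigma>: "\<sigma> \<in> galois_K" and b: "tate_dual_basis \<phi> l k b"
    and M: "\<And>i j. i < k \<Longrightarrow> j < k \<Longrightarrow> M i j \<in> adic l"
    and Mb: "\<And>j x. j < k \<Longrightarrow> x \<in> T \<Longrightarrow> galois_dual_act \<phi> l \<sigma> (b j) x = dual_lincomb l k (\<lambda>i. M i j) b x"
  shows "k = r"
    and "\<And>i. l ^ m dvd coeff (char_poly (gM \<sigma> m) - char_poly (mat k k (\<lambda>(i, j). M i j m))) i"
proof -
  have bd: "b i \<in> tate_dual \<phi> l" if "i < k" for i using b that by (simp add: tate_dual_basis_def)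
  have bu: "\<exists>!c. c \<in> {..<k} \<rightarrow>\<^sub>E adic l \<and> (\<forall>x\<in>T. h x = dual_lincomb l k c b x)" if "h \<in> tate_dual \<phi> l" for h
    using b that by (simp add: tate_dual_basis_def)
  have "\<forall>i. \<exists>c. i < r \<longrightarrow> c \<in> {..<k} \<rightarrow>\<^sub>E adic l \<and> (\<forall>x\<in>T. dbase i x = dual_lincomb l k c b x)"
    using bu[OF dbase_dual] by blast
  from choice[OF this] obtain c where c: "\<And>i. i < r \<Longrightarrow> c i \<in> {..<k} \<rightarrow>\<^sub>E adic l"
    "\<And>i x. i < r \<Longrightarrow> x \<in> T \<Longrightarrow> dbase i x = dual_lincomb l k (c i) b x" by blast
  \<comment> \<open>\<open>C'\<close> writes the given basis in terms of \<open>dbase\<close>, and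
    \<open>C\<close> writes \<open>dbase\<close> in terms of the given one.\<close>
  define C' where "C' m = mat r k (\<lambda>(j, i). b i (tbase j) m)" for m
  define C where "C m = mat k r (\<lambda>(i, j). c j i m)" for m
  have C'C: "l ^ m dvd (C' m * C m) $$ (i, j) - 1\<^sub>m r $$ (i, j)" if ij: "i < r" "j < r" for m i j
  proof -
    have "(C' m * C m) $$ (i, j) = (\<Sum>p<k. c j p m * b p (tbase i) m)"
      using ij by (simp add: C_def C'_def scalar_prod_def atLeast0LessThan mult.commute)
    also have "\<dots> mod l ^ m = dbase j (tbase i) m"
      unfolding c(2)[OF ij(2) tbase(1)[OF ij(1)]] dual_lincomb_eq ..
    also have "\<dots> = 1\<^sub>m r $$ (i, j) mod l ^ m"
      using ij by (simp add: dbase_def tbase coord_tbase adic_one_def)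
    finally show ?thesis by (simp add: mod_eq_dvd_iff)
  qed
  have CC': "l ^ m dvd (C m * C' m) $$ (i, j) - 1\<^sub>m k $$ (i, j)" if ij: "i < k" "j < k" for m i j
  proof -
    \<comment> \<open>Substituting one expansion into the other expresses \<open>b j\<close> in the
      given basis with coefficients \<open>e\<close>, while the trivial expression has coefficients
      \<open>d\<close>; uniqueness identifies the two.\<close>
    define e where "e = (\<lambda>p\<in>{..<k}. \<lambda>m. (\<Sum>q<r. c q p m * b j (tbase q) m) mod l ^ m)"
    define d where "d = (\<lambda>p\<in>{..<k}. if p = j then adic_one l else (\<lambda>m. 0))"
    have e: "e \<in> {..<k} \<rightarrow>\<^sub>E adic l"
    proof (rule PiE_I)
      fix p assume p: "p \<in> {..<k}"
      have "e p = (\<lambda>m. \<Sum>q<r. adic_mult l (c q p) (b j (tbase q)) m)"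
        using p by (simp add: e_def adic_mult_def sum_mod_poly)
      also have "\<dots> \<in> adic l"
        using p ij c(1) tbase(1)
        by (intro adic_sum adic_mult_in_adic dual_values_adic[OF bd]) auto
      finally show "e p \<in> adic l" .
    qed (simp add: e_def)
    have d: "d \<in> {..<k} \<rightarrow>\<^sub>E adic l" by (auto simp: d_def)
    have de: "b j x = dual_lincomb l k d b x" if x: "x \<in> T" for x
    proof
      fix m
      have "(\<Sum>p<k. d p m * b p x m) = (\<Sum>p<k. if p = j then (1 mod l ^ m) * b j x m else 0)"
        by (rule sum.cong) (auto simp: d_def adic_one_def)
      also have "\<dots> mod l ^ m = b j x m"
        using ij adic_mod[OF dual_values_adic[OF bd[OF ij(2)] x]] by (simp add: mod_mult_left_eq)
      finally show "b j x m = dual_lincomb l k d b x m" by (simp add: dual_lincomb_eq)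
    qed
    have ee: "b j x = dual_lincomb l k e b x" if x: "x \<in> T" for x
    proof
      fix m
      have "b j x m = (\<Sum>q<r. b j (tbase q) m * dbase q x m) mod l ^ m"
        unfolding dual_expand[OF bd[OF ij(2)] x] dual_lincomb_eq ..
      also have "\<dots> = (\<Sum>q<r. b j (tbase q) m * ((\<Sum>p<k. c q p m * b p x m) mod l ^ m)) mod l ^ m"
        by (intro arg_cong[where f = "\<lambda>z. z mod l ^ m"] sum.cong refl) (simp add: c(2)[OF _ x] dual_lincomb_eq)
      also have "\<dots> = (\<Sum>q<r. b j (tbase q) m * (\<Sum>p<k. c q p m * b p x m)) mod l ^ m"
        by (rule mod_sum_mult[symmetric])
      also have "(\<Sum>q<r. b j (tbase q) m * (\<Sum>p<k. c q p m * b p x m)) =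
          (\<Sum>p<k. b p x m * (\<Sum>q<r. c q p m * b j (tbase q) m))"
        unfolding sum_distrib_left by (subst sum.swap) (simp add: mult_ac)
      also have "\<dots> mod l ^ m = (\<Sum>p<k. b p x m * ((\<Sum>q<r. c q p m * b j (tbase q) m) mod l ^ m)) mod l ^ m"
        by (rule mod_sum_mult)
      also have "\<dots> = (\<Sum>p<k. e p m * b p x m) mod l ^ m"
        by (intro arg_cong[where f = "\<lambda>z. z mod l ^ m"] sum.cong refl) (simp add: e_def mult.commute)
      finally show "b j x m = dual_lincomb l k e b x m" by (simp add: dual_lincomb_eq)
    qed
    have "(THE c. c \<in> {..<k} \<rightarrow>\<^sub>E adic l \<and> (\<forall>x\<in>T. b j x = dual_lincomb l k c b x)) = e"
      by (rule the1_equality[OF bu[OF bd[OF ij(2)]]]) (use e ee in simp)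
    moreover have "(THE c. c \<in> {..<k} \<rightarrow>\<^sub>E adic l \<and> (\<forall>x\<in>T. b j x = dual_lincomb l k c b x)) = d"
      by (rule the1_equality[OF bu[OF bd[OF ij(2)]]]) (use d de in simp)
    ultimately have "e = d" by simp
    then have "e i m = d i m" by simp
    then have "(\<Sum>q<r. c q i m * b j (tbase q) m) mod l ^ m = 1\<^sub>m k $$ (i, j) mod l ^ m"
      using ij by (simp add: e_def d_def adic_one_def)
    moreover have "(C m * C' m) $$ (i, j) = (\<Sum>q<r. c q i m * b j (tbase q) m)"
      using ij by (simp add: C_def C'_def scalar_prod_def atLeast0LessThan)
    ultimately show ?thesis by (simp add: mod_eq_dvd_iff)
  qed
  \<comment> \<open>For \<open>k'' < k'\<close>, padding both rectangular matrices with zeros to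
    square ones gives determinant 0, which cannot be congruent to 1 modulo \<lambda>.\<close>
  have small: "k' \<le> k''" if A: "A \<in> carrier_mat k' k''" and B: "B \<in> carrier_mat k'' k'"
    and AB: "\<And>i j. i < k' \<Longrightarrow> j < k' \<Longrightarrow> l dvd (A * B) $$ (i, j) - 1\<^sub>m k' $$ (i, j)" for k' k'' and A B :: "'q poly mat"
  proof (rule ccontr)
    assume "\<not> k' \<le> k''"
    then have less: "k'' < k'" by simp
    define A' where "A' = mat k' k' (\<lambda>(i, j). if j < k'' then A $$ (i, j) else 0)"
    define B' where "B' = mat k' k' (\<lambda>(i, j). if i < k'' then B $$ (i, j) else 0)"
    have eq: "A' * B' = A * B"
    proof (rule eq_matI)
      fix i j assume "i < dim_row (A * B)" "j < dim_col (A * B)"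
      then have ij: "i < k'" "j < k'" using A B by auto
      have "(A' * B') $$ (i, j) = (\<Sum>p<k'. if p < k'' then A $$ (i, p) * B $$ (p, j) else 0)"
        using ij by (auto simp: A'_def B'_def scalar_prod_def atLeast0LessThan intro!: sum.cong)
      also have "\<dots> = (\<Sum>p<k''. A $$ (i, p) * B $$ (p, j))"
        using less by (intro sum.mono_neutral_cong_right) auto
      finally show "(A' * B') $$ (i, j) = (A * B) $$ (i, j)"
        using ij A B by (simp add: scalar_prod_def atLeast0LessThan)
    qed (use A B in \<open>simp_all add: A'_def B'_def\<close>)
    have A': "A' \<in> carrier_mat k' k'" and B': "B' \<in> carrier_mat k' k'" by (simp_all add: A'_def B'_def)
    have "l dvd det (A' * B') - det (1\<^sub>m k')"
      by (rule det_cong_dvd[OF mult_carrier_mat[OF A' B']]) (use AB eq in auto)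
    moreover have "det (A' * B') = 0"
    proof -
      have "det (A'\<^sup>T) = 0"
      proof -
        have "A'\<^sup>T = mat\<^sub>r k' k' (\<lambda>i. if i = k'' then 0\<^sub>v k' else row (A'\<^sup>T) i)"
          by (rule eq_matI) (auto simp: A'_def)
        then show ?thesis using det_row_0[OF less, of "\<lambda>i. row (A'\<^sup>T) i"] A' by auto
      qed
      then show ?thesis using det_mult[OF A' B'] det_transpose[OF A'] by simp
    qed
    ultimately have "l dvd 1" by (simp add: dvd_diff_commute)
    then show False using monic_primes_irreducible[OF l] irreducible_not_unit by blast
  qed
  have "r \<le> k" by (rule small[of "C' 1" _ _ "C 1"]) (use C'C[of _ _ 1] in \<open>auto simp: C_def C'_def\<close>)
  moreover have "k \<le> r" by (rule small[of "C 1" _ _ "C' 1"]) (use CC'[of _ _ 1] in \<open>auto simp: C_def C'_def\<close>)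
  ultimately show kr: "k = r" by simp
  fix m i
  define M' where "M' = mat r r (\<lambda>(i, j). M i j m)"
  have cM: "gM \<sigma> m \<in> carrier_mat r r" and cM': "M' \<in> carrier_mat r r" and cC: "C m \<in> carrier_mat r r"
    and cC': "C' m \<in> carrier_mat r r" by (simp_all add: M'_def C_def C'_def kr)
  have comm: "l ^ m dvd (gM \<sigma> m * C' m) $$ (i, j) - (C' m * M') $$ (i, j)" if ij: "i < r" "j < r" for i j
  proof -
    have j: "j < k" using ij kr by simp
    have "(C' m * M') $$ (i, j) mod l ^ m = dual_lincomb l k (\<lambda>p. M p j) b (tbase i) m"
      using ij kr by (simp add: C'_def M'_def scalar_prod_def atLeast0LessThan dual_lincomb_eq mult.commute)
    also have "\<dots> = galois_dual_act \<phi> l \<sigma> (b j) (tbase i) m"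
      by (simp only: Mb[OF j tbase(1)[OF ij(1)]])
    also have "\<dots> = (\<Sum>p<r. adic_mult l (coord p (tbase i)) (b j (inv_into UNIV \<sigma> \<circ> tbase p)) m)"
      by (rule galois_expand[OF \<sigma> bd[OF j] tbase(1)[OF ij(1)]])
    also have "\<dots> = (\<Sum>p<r. if p = i then b j (inv_into UNIV \<sigma> \<circ> tbase i) m else 0)"
    proof (rule sum.cong)
      fix p assume "p \<in> {..<r}"
      moreover have "b j (inv_into UNIV \<sigma> \<circ> tbase i) \<in> adic l"
        by (intro dual_values_adic[OF bd[OF j]] galois_tate galois_inv \<sigma> tbase ij)
      ultimately show "adic_mult l (coord p (tbase i)) (b j (inv_into UNIV \<sigma> \<circ> tbase p)) m =
          (if p = i then b j (inv_into UNIV \<sigma> \<circ> tbase i) m else 0)"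
        using ij by (simp add: coord_tbase adic_mult_one adic_mult_commute[of l "adic_one l"]
            adic_mult_commute[of l "\<lambda>m. 0"])
    qed simp
    also have "\<dots> = b j (inv_into UNIV \<sigma> \<circ> tbase i) m" using ij by simp
    also have "\<dots> = (\<Sum>p<r. b j (tbase p) m * dbase p (inv_into UNIV \<sigma> \<circ> tbase i) m) mod l ^ m"
      using dual_expand[OF bd[OF j], of "inv_into UNIV \<sigma> \<circ> tbase i"]
        galois_tate[OF galois_inv[OF \<sigma>] tbase(1)[OF ij(1)]] by (simp add: dual_lincomb_eq)
    also have "(\<Sum>p<r. b j (tbase p) m * dbase p (inv_into UNIV \<sigma> \<circ> tbase i) m) = (gM \<sigma> m * C' m) $$ (i, j)"
      using ij kr galois_tate[OF galois_inv[OF \<sigma>] tbase(1)[OF ij(1)]]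
      by (simp add: C'_def scalar_prod_def atLeast0LessThan gmat_def dbase_def mult.commute)
    finally show ?thesis by (metis mod_eq_dvd_iff)
  qed
  let ?L = "[:l ^ m:]"
  let ?cp = "\<lambda>A :: 'q poly mat. [:0, 1:] \<cdot>\<^sub>m 1\<^sub>m r + map_mat (\<lambda>a. [:- a:]) A"
  let ?c = "map_mat (\<lambda>a. [:a:])"
  have ch: "char_poly A = det (?cp A)" if "A \<in> carrier_mat r r" for A
    using that by (simp add: char_poly_def char_poly_matrix_def)
  interpret cp: comm_ring_hom "\<lambda>c :: 'q poly. [:c:]" by unfold_locales (simp_all add: one_pCons)
  \<comment> \<open>(X - M) C' and C' (X - M') are congruent entrywise, so their determinants are
    congruent; \<open>det (C' m)\<close> is invertible modulo \<lambda>^m and will be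
    cancelled.\<close>
  have "?L dvd det (?cp (gM \<sigma> m) * ?c (C' m)) - det (?c (C' m) * ?cp M')"
  proof (rule det_cong_dvd)
    fix i j assume ij: "i < r" "j < r"
    have delta: "(\<Sum>p<r. [:0, if i = p then 1 else 0:] * [:f p:]) = [:0, f i:]" for f :: "nat \<Rightarrow> 'q poly"
    proof -
      have "(\<Sum>p<r. [:0, if i = p then 1 else 0:] * [:f p:]) = (\<Sum>p<r. if p = i then [:0, f i:] else 0)"
        by (rule sum.cong) auto
      then show ?thesis using ij by simp
    qed
    have delta': "(\<Sum>p<r. [:f p:] * [:0, if p = j then 1 else 0:]) = [:0, f j:]" for f :: "nat \<Rightarrow> 'q poly"
    proof -
      have "(\<Sum>p<r. [:f p:] * [:0, if p = j then 1 else 0:]) = (\<Sum>p<r. if p = j then [:0, f j:] else 0)"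
        by (rule sum.cong) auto
      then show ?thesis using ij by simp
    qed
    have 1: "(?cp (gM \<sigma> m) * ?c (C' m)) $$ (i, j) = [:0, C' m $$ (i, j):] - [:(gM \<sigma> m * C' m) $$ (i, j):]"
    proof -
      have "(?cp (gM \<sigma> m) * ?c (C' m)) $$ (i, j) =
          (\<Sum>p<r. ([:0, if i = p then 1 else 0:] - [:gM \<sigma> m $$ (i, p):]) * [:C' m $$ (p, j):])"
        using ij kr by (simp add: C'_def scalar_prod_def atLeast0LessThan)
          (auto intro!: sum.cong simp: one_pCons)
      also have "\<dots> = [:0, C' m $$ (i, j):] - (\<Sum>p<r. [:gM \<sigma> m $$ (i, p):] * [:C' m $$ (p, j):])"
        unfolding left_diff_distrib sum_subtractf delta ..
      also have "(\<Sum>p<r. [:gM \<sigma> m $$ (i, p):] * [:C' m $$ (p, j):]) = [:\<Sum>p<r. gM \<sigma> m $$ (i, p) * C' m $$ (p, j):]"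
        by (simp only: cp.hom_sum cp.hom_mult)
      finally show ?thesis using ij kr by (simp add: C'_def scalar_prod_def atLeast0LessThan)
    qed
    have 2: "(?c (C' m) * ?cp M') $$ (i, j) = [:0, C' m $$ (i, j):] - [:(C' m * M') $$ (i, j):]"
    proof -
      have "(?c (C' m) * ?cp M') $$ (i, j) =
          (\<Sum>p<r. [:C' m $$ (i, p):] * ([:0, if p = j then 1 else 0:] - [:M' $$ (p, j):]))"
        using ij kr by (simp add: C'_def M'_def scalar_prod_def atLeast0LessThan)
          (auto intro!: sum.cong simp: one_pCons)
      also have "\<dots> = [:0, C' m $$ (i, j):] - (\<Sum>p<r. [:C' m $$ (i, p):] * [:M' $$ (p, j):])"
        unfolding right_diff_distrib sum_subtractf delta' ..
      also have "(\<Sum>p<r. [:C' m $$ (i, p):] * [:M' $$ (p, j):]) = [:\<Sum>p<r. C' m $$ (i, p) * M' $$ (p, j):]"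
        by (simp only: cp.hom_sum cp.hom_mult)
      finally show ?thesis using ij kr by (simp add: C'_def M'_def scalar_prod_def atLeast0LessThan)
    qed
    have "?L dvd [:(C' m * M') $$ (i, j) - (gM \<sigma> m * C' m) $$ (i, j):]"
      using comm[OF ij] by (simp add: const_poly_dvd dvd_diff_commute)
    moreover have "(?cp (gM \<sigma> m) * ?c (C' m)) $$ (i, j) - (?c (C' m) * ?cp M') $$ (i, j) =
        [:(C' m * M') $$ (i, j) - (gM \<sigma> m * C' m) $$ (i, j):]"
      unfolding 1 2 by simp
    ultimately show "?L dvd (?cp (gM \<sigma> m) * ?c (C' m)) $$ (i, j) - (?c (C' m) * ?cp M') $$ (i, j)"
      by simp
  qed (use cM cM' cC' in auto)
  then have "?L dvd (char_poly (gM \<sigma> m) - char_poly M') * [:det (C' m):]"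
    using cM cM' cC'
    by (simp add: ch[OF cM] ch[OF cM'] det_mult[of _ r] cp.hom_det[symmetric] algebra_simps del: cp.hom_det)
  then have dvd1: "l ^ m dvd det (C' m) * coeff (char_poly (gM \<sigma> m) - char_poly M') i"
    unfolding const_poly_dvd_iff by (simp add: mult.commute)
  have "l ^ m dvd det (C m) * det (C' m) - 1"
  proof -
    have "l ^ m dvd det (C m * C' m) - det (1\<^sub>m r)"
      by (rule det_cong_dvd) (use CC'[of _ _ m] cC cC' kr in auto)
    then show ?thesis using det_mult[OF cC cC'] by simp
  qed
  then have "l ^ m dvd det (C m) * (det (C' m) * coeff (char_poly (gM \<sigma> m) - char_poly M') i)
      - (det (C m) * det (C' m) - 1) * coeff (char_poly (gM \<sigma> m) - char_poly M') i"
    by (rule dvd_diff[OF dvd_mult[OF dvd1] dvd_mult2])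
  then show "l ^ m dvd coeff (char_poly (gM \<sigma> m) - char_poly (mat k k (\<lambda>(i, j). M i j m))) i"
    unfolding M'_def[symmetric] kr by (simp add: algebra_simps M'_def)
qed

section \<open>Uniqueness of the characteristic polynomial\<close>

lemma adic_represents_cong:
  assumes "adic_represents l c a" "\<And>m. l ^ m dvd a m - b m"
  shows "adic_represents l c b"
proof -
  obtain u v where uv: "c = Fract u v" "\<not> l dvd v" "\<And>m. l ^ m dvd v * a m - u"
    using assms(1) by (auto simp: adic_represents_def)
  have "l ^ m dvd v * b m - u" for m
  proof -
    have "l ^ m dvd (v * a m - u) - v * (a m - b m)" by (rule dvd_diff[OF uv(3) dvd_mult[OF assms(2)]])
    then show ?thesis by (simp add: algebra_simps)
  qed
  then show ?thesis using uv by (auto simp: adic_represents_def)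
qed

text \<open>After cross-multiplication the difference of the two fractions has a numerator divisible
  by every power of \<lambda>.\<close>

lemma adic_represents_unique:
  assumes "adic_represents l c a" "adic_represents l d a"
  shows "c = d"
proof -
  obtain u v where uv: "c = Fract u v" "\<not> l dvd v" "\<And>m. l ^ m dvd v * a m - u"
    using assms(1) by (auto simp: adic_represents_def)
  obtain u' v' where uv': "d = Fract u' v'" "\<not> l dvd v'" "\<And>m. l ^ m dvd v' * a m - u'"
    using assms(2) by (auto simp: adic_represents_def)
  let ?w = "u' * v - u * v'"
  have "?w = 0"
  proof (rule ccontr)
    assume w: "?w \<noteq> 0"
    let ?m = "Suc (degree ?w)"
    have "l ^ ?m dvd v' * (v * a ?m - u) - v * (v' * a ?m - u')"
      by (rule dvd_diff[OF dvd_mult[OF uv(3)] dvd_mult[OF uv'(3)]])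
    then have "l ^ ?m dvd ?w" by (simp add: algebra_simps)
    then have "?m * n \<le> degree ?w" using dvd_imp_degree_le[OF _ w] by (simp only: deg_l_power[symmetric])
    then show False using n_pos by (cases n) auto
  qed
  moreover have "v \<noteq> 0" "v' \<noteq> 0" using uv uv' by auto
  ultimately show ?thesis using uv uv' by (simp add: eq_fract)
qed

text \<open>The definition allows any basis; the change of basis reduces every witness to the matrix
  \<open>gM\<close>.\<close>

lemma is_dual_char_polyD:
  assumes \<sigma>: "\<sigma> \<in> galois_K" and "is_dual_char_poly \<phi> l \<sigma> P"
  shows "adic_represents l (coeff P i) (\<lambda>m. coeff (char_poly (gM \<sigma> m)) i)"
proof -
  obtain k b M where A: "tate_dual_basis \<phi> l k b" and B: "\<forall>i<k. \<forall>j<k. M i j \<in> adic l"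
    and C: "\<forall>j<k. \<forall>x\<in>T. galois_dual_act \<phi> l \<sigma> (b j) x = dual_lincomb l k (\<lambda>i. M i j) b x"
    and D: "\<forall>i. adic_represents l (coeff P i) (\<lambda>m. coeff (char_poly (mat k k (\<lambda>(i, j). M i j m))) i)"
    using assms(2) unfolding is_dual_char_poly_def by (elim exE conjE)
  show ?thesis
  proof (rule adic_represents_cong[OF spec[OF D]])
    fix m
    show "l ^ m dvd coeff (char_poly (mat k k (\<lambda>(i, j). M i j m))) i - coeff (char_poly (gM \<sigma> m)) i"
      using dual_basis_change(2)[OF \<sigma> A, of M m i] B C by (simp add: dvd_diff_commute)
  qed
qed

lemma dual_char_poly_unique:
  assumes "\<sigma> \<in> galois_K" "is_dual_char_poly \<phi> l \<sigma> P" "is_dual_char_poly \<phi> l \<sigma> P'"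
  shows "P = P'"
  by (rule poly_eqI) (rule adic_represents_unique[OF is_dual_char_polyD[OF assms(1,2)] is_dual_char_polyD[OF assms(1,3)]])

end

section \<open>The matrix of $\tau^d$ on the Anderson motive\<close>

interpretation const_hom: inj_comm_ring_hom "\<lambda>c :: 'a::comm_ring_1. [:c:]"
  by unfold_locales (simp_all add: one_pCons)

interpretation emb: map_poly_inj_comm_ring_hom "\<lambda>c :: 'a::comm_ring_1. [:c:]" ..

text \<open>In A[t] the inner variable is \<theta> and the outer one is t; \<open>emb a\<close> is
  a(t).\<close>

abbreviation emb :: "'a::comm_ring_1 poly \<Rightarrow> 'a poly poly" where "emb \<equiv> map_poly (\<lambda>c. [:c:])"

interpretation afrob: comm_ring_hom "\<lambda>a :: 'q::{field,finite} poly. a ^ CARD('q)"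
proof
  show "(x + y) ^ CARD('q) = x ^ CARD('q) + y ^ CARD('q)" for x y :: "'q poly"
    by (rule frobenius_add[of "\<lambda>c. [:c:]"]) unfold_locales
qed (simp_all add: power_mult_distrib power_0_left)

interpretation atw: map_poly_comm_ring_hom "\<lambda>a :: 'q::{field,finite} poly. a ^ CARD('q)" ..

text \<open>The effect of \<tau> on coordinates: coefficients are raised to the q-th power and t is
  fixed.\<close>

abbreviation atw :: "'q::{field,finite} poly poly \<Rightarrow> 'q poly poly" where "atw \<equiv> map_poly (\<lambda>a. a ^ CARD('q))"

lemma coeff_atw [simp]: "coeff (atw p) i = coeff p i ^ CARD('q)" for p :: "'q::{field,finite} poly poly"
  by (simp add: coeff_map_poly power_0_left)

lemma const_power_card [simp]: "[:c:] ^ CARD('q) = [:c:]" for c :: "'q::{field,finite}"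
  by (simp add: poly_const_pow finite_field_power_card)

lemma poly_emb_theta: "poly (emb a) [:0, 1:] = (a :: 'a::comm_ring_1 poly)"
  by (induction a) (simp_all add: map_poly_pCons)

lemma poly_emb_frobenius:
  fixes a x :: "'q::{field,finite} poly"
  shows "poly (emb a) (x ^ CARD('q) ^ i) = poly (emb a) x ^ CARD('q) ^ i"
proof -
  have add: "(x + y) ^ CARD('q) ^ i = x ^ CARD('q) ^ i + y ^ CARD('q) ^ i" for x y :: "'q poly"
    by (rule frobenius_power_add[of "\<lambda>c. [:c:]"]) unfold_locales
  have c: "[:c:] ^ CARD('q) ^ i = [:c:]" for c :: 'q
    by (simp add: poly_const_pow finite_field_power_card_power)
  show ?thesis
    by (induction a) (simp_all add: map_poly_pCons add c power_mult_distrib power_0_left)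
qed

text \<open>Polynomials over the domain $A/f$ have few zeros; stated with representatives.\<close>
lemma many_roots_mod_prime:
  fixes f :: "'a::field poly"
  assumes f: "prime_elem f"
    and "finite S" "p \<in> lowdeg (card S)" "\<And>s. s \<in> S \<Longrightarrow> f dvd poly p s"
    and "\<And>s s'. s \<in> S \<Longrightarrow> s' \<in> S \<Longrightarrow> f dvd s - s' \<Longrightarrow> s = s'"
  shows "[:f:] dvd p"
  using assms(2-)
proof (induction S arbitrary: p rule: finite_induct)
  case (insert s S)
  define p1 where "p1 = synthetic_div p s"
  have p: "p = [:- s, 1:] * p1 + [:poly p s:]" unfolding p1_def by (rule synthetic_div_correct'[symmetric])
  have "p1 \<in> lowdeg (card S)"
  proof (cases "p1 = 0")
    case False
    then have "degree p = Suc (degree p1)" using degree_synthetic_div[of p s] synthetic_div_eq_0_iff[of p s]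
      unfolding p1_def by simp
    moreover have "p \<noteq> 0" using calculation by auto
    ultimately show ?thesis using insert.prems(1) insert.hyps by (auto simp: lowdeg_iff)
  qed (simp add: lowdeg_def)
  moreover have "f dvd poly p1 s'" if s': "s' \<in> S" for s'
  proof -
    have "poly p s' = (s' - s) * poly p1 s' + poly p s"
      by (subst p) (simp add: algebra_simps)
    then have "(s' - s) * poly p1 s' = poly p s' - poly p s" by simp
    then have "f dvd (s' - s) * poly p1 s'" using insert.prems(2) s' by (simp add: dvd_diff)
    moreover have "\<not> f dvd s' - s" using insert.prems(3)[of s' s] s' insert.hyps by auto
    ultimately show ?thesis using f by (simp add: prime_elem_dvd_mult_iff)
  qed
  ultimately have p1: "[:f:] dvd p1" using insert.prems(3) by (intro insert.IH) auto
  have "[:f:] dvd [:poly p s:]" using insert.prems(2) by (simp add: const_poly_dvd)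
  from dvd_add[OF dvd_mult[OF p1] this, of "[:- s, 1:]"] show ?case by (simp only: p[symmetric])
qed simp

lemma poly_diff_dvd: "x - y dvd poly p x - poly p (y :: 'a::comm_ring_1)"
proof (induction p)
  case (pCons c p)
  have "x * poly p x - y * poly p y = x * (poly p x - poly p y) + poly p y * (x - y)"
    by (simp only: algebra_simps)
  then show ?case using pCons.IH by simp
qed simp

text \<open>If the q^k-power map fixed \<theta> modulo \<open>f\<close>, it would fix all of A/f,
  and X^(q^k) - X would have q^(deg f) incongruent zeros, more than its degree.\<close>

lemma theta_powers_incongruent:
  fixes f :: "'q::{field,finite} poly"
  assumes f: "irreducible f" and k: "0 < k" "k < degree f"
  shows "\<not> f dvd \<theta> ^ CARD('q) ^ k - \<theta>"
proof
  assume dvd: "f dvd \<theta> ^ CARD('q) ^ k - \<theta>"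
  have prime: "prime_elem f" by (rule field_poly_irreducible_imp_prime[OF f])
  have q1: "1 < CARD('q)" by (rule card_field_gt_1)
  have all: "f dvd a ^ CARD('q) ^ k - a" for a
  proof -
    have "\<theta> ^ CARD('q) ^ k - \<theta> dvd poly (emb a) (\<theta> ^ CARD('q) ^ k) - poly (emb a) \<theta>"
      by (rule poly_diff_dvd)
    then have "\<theta> ^ CARD('q) ^ k - \<theta> dvd a ^ CARD('q) ^ k - a"
      by (simp only: poly_emb_frobenius poly_emb_theta)
    then show ?thesis using dvd dvd_trans by blast
  qed
  define p where "p = monom (1 :: 'q poly) (CARD('q) ^ k) - monom 1 1"
  have "1 < CARD('q) ^ k" using one_less_power[OF q1 k(1)] .
  then have cp: "coeff p (CARD('q) ^ k) = 1" by (simp add: p_def)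
  have "CARD('q) ^ k < CARD('q) ^ degree f" using k q1 by (intro power_strict_increasing) auto
  then have low: "p \<in> lowdeg (card (lowdeg (degree f) :: 'q poly set))"
    using \<open>1 < CARD('q) ^ k\<close> unfolding card_lowdeg by (auto simp: lowdeg_def p_def)
  have "[:f:] dvd p"
  proof (rule many_roots_mod_prime[OF prime _ low])
    show "f dvd poly p s" for s using all[of s] by (simp add: p_def poly_monom)
    show "s = s'" if "s \<in> lowdeg (degree f)" "s' \<in> lowdeg (degree f)" "f dvd s - s'" for s s' :: "'q poly"
    proof (rule ccontr)
      assume "s \<noteq> s'"
      then have "degree f \<le> degree (s - s')" using that by (intro dvd_imp_degree_le) auto
      moreover have "s - s' \<in> lowdeg (degree f)" using that by (simp add: lowdeg_def)
      ultimately show False using \<open>s \<noteq> s'\<close> by (auto simp: lowdeg_iff)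
    qed
  qed simp
  then have "f dvd 1" using cp by (metis const_poly_dvd_iff)
  then show False using irreducible_not_unit[OF f] by simp
qed

text \<open>The class of \<theta> is a root of f(t) in A/f, and so are its q-powers; being
  \<open>degree f\<close> incongruent roots of a monic polynomial of this degree, they are all of
  them.\<close>

lemma emb_irreducible_cong:
  fixes f :: "'q::{field,finite} poly"
  assumes f: "f \<in> monic_primes"
  shows "[:f:] dvd emb f - (\<Prod>i<degree f. [:- (\<theta> ^ CARD('q) ^ i), 1:])"
proof -
  let ?S = "(\<lambda>i. \<theta> ^ CARD('q) ^ i) ` {..<degree f} :: 'q poly set"
  have prime: "prime_elem f" by (rule monic_primes_prime[OF f])
  have inc: "i = j" if ij: "i < degree f" "j < degree f" "f dvd \<theta> ^ CARD('q) ^ i - \<theta> ^ CARD('q) ^ j" "i \<le> j" for i j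
  proof (rule ccontr)
    assume "i \<noteq> j"
    then have k: "0 < j - i" "j - i < degree f" using ij by auto
    have add: "(x + y) ^ CARD('q) ^ i = x ^ CARD('q) ^ i + y ^ CARD('q) ^ i" for x y :: "'q poly"
      by (rule frobenius_power_add[of "\<lambda>c. [:c:]"]) unfold_locales
    \<comment> \<open>The q^i-power map is injective modulo the prime \<open>f\<close>, so both
      exponents can be lowered by \<open>i\<close>.\<close>
    have "(\<theta> :: 'q poly) ^ CARD('q) ^ j = (\<theta> ^ CARD('q) ^ (j - i) - \<theta> + \<theta>) ^ CARD('q) ^ i"
      using ij(4) by (simp flip: power_mult power_add)
    also have "\<dots> = (\<theta> ^ CARD('q) ^ (j - i) - \<theta>) ^ CARD('q) ^ i + \<theta> ^ CARD('q) ^ i" by (rule add)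
    finally have "f dvd (\<theta> ^ CARD('q) ^ (j - i) - \<theta>) ^ CARD('q) ^ i"
      using ij(3) by (simp add: dvd_diff_commute)
    then have "f dvd \<theta> ^ CARD('q) ^ (j - i) - \<theta>" by (rule prime_elem_dvd_power[OF prime])
    then show False using theta_powers_incongruent[OF monic_primes_irreducible[OF f] k] by simp
  qed
  have inc': "i = j" if "i < degree f" "j < degree f" "f dvd \<theta> ^ CARD('q) ^ i - \<theta> ^ CARD('q) ^ j" for i j
    using inc[of i j] inc[of j i] that by (cases "i \<le> j") (auto simp: dvd_diff_commute)
  have "inj_on (\<lambda>i. \<theta> ^ CARD('q) ^ i :: 'q poly) {..<degree f}"
    by (rule inj_onI) (use inc' in auto)
  then have card: "card ?S = degree f" by (simp add: card_image)
  let ?p = "\<Prod>i<degree f. [:- (\<theta> ^ CARD('q) ^ i), 1:] :: 'q poly poly"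
  have p: "degree ?p = degree f" "lead_coeff ?p = 1"
    using degree_prod_linear[of "\<lambda>i. \<theta> ^ CARD('q) ^ i :: 'q poly" "{..<degree f}"]
    by simp (simp add: lead_coeff_prod)
  have e: "degree (emb f) = degree f" by (rule degree_map_poly) simp
  then have e: "degree (emb f) = degree f" "lead_coeff (emb f) = 1"
    using monic_primes_monic[OF f] by (simp_all add: coeff_map_poly)
  have "degree (emb f - ?p) < degree f"
    by (rule degree_diff_less_monic) (use p e monic_primes_degree[OF f] in auto)
  then have low: "emb f - ?p \<in> lowdeg (card ?S)" unfolding card lowdeg_iff by simp
  show ?thesis
  proof (rule many_roots_mod_prime[OF prime _ low])
    fix s assume "s \<in> ?S"
    then obtain i where i: "i < degree f" "s = \<theta> ^ CARD('q) ^ i" by auto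
    have "poly ?p s = 0" using i by (auto simp: poly_prod)
    moreover have "poly (emb f) s = f ^ CARD('q) ^ i"
      unfolding i poly_emb_frobenius poly_emb_theta ..
    ultimately show "f dvd poly (emb f - ?p) s" by (simp add: dvd_power)
  next
    fix s s' assume "s \<in> ?S" "s' \<in> ?S" "f dvd s - s'"
    then show "s = s'" using inc' by auto
  qed simp
qed

section \<open>Coordinates of powers of \<tau>\<close>

context drinfeld
begin

text \<open>The coordinates of $\tau^e$ with respect to the basis $1, \tau, \dots, \tau^{r-1}$ of
  $A\{\tau\}$ over $A[t]$, where $t$ acts by right multiplication by $\phi_\theta$.\<close>
primrec crep :: "nat \<Rightarrow> nat \<Rightarrow> 'q poly poly" where
  "crep 0 = (\<lambda>i. if i = 0 then 1 else 0)"
| "crep (Suc e) = (\<lambda>i. if i = 0 then atw (crep e (r - 1)) * [:- ([:inverse \<kappa>\<^sub>r:] * \<theta>), [:inverse \<kappa>\<^sub>r:]:]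
      else atw (crep e (i - 1)) - smult ([:inverse \<kappa>\<^sub>r:] * \<kappa> i) (atw (crep e (r - 1))))"

declare crep.simps [simp del]

lemma crep_small: "j < r \<Longrightarrow> i < r \<Longrightarrow> crep j i = (if i = j then 1 else 0)"
proof (induction j arbitrary: i)
  case (Suc j)
  then show ?case by (cases i) (auto simp: crep.simps)
qed (simp add: crep.simps)

text \<open>The recursion replaces \<tau>^r by the quotient of t - \<theta> - (middle terms) by
  \<open>\<kappa>\<^sub>r\<close>. If t has weight \<open>r\<close> and \<tau> weight 1, this never
  raises the weight, which therefore stays at most \<open>e\<close>.\<close>

lemma crep_bound: "i < r \<Longrightarrow> coeff (crep e i) k \<noteq> 0 \<Longrightarrow> r * k + i \<le> e"
proof (induction e arbitrary: i k)
  case 0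
  then show ?case by (auto simp: crep.simps coeff_1 split: if_splits)
next
  case (Suc e)
  have IH: "r * k + i \<le> e" if "i < r" "coeff (atw (crep e i)) k \<noteq> 0" for i k
    using Suc.IH[of i k] that card_field_gt_1[where 'q = 'q] by auto
  have r: "r - 1 < r" "1 \<le> r" using r_ge by auto
  show ?case
  proof (cases "i = 0")
    case True
    let ?c = "coeff (atw (crep e (r - 1)))"
    have "coeff (crep (Suc e) i) k = - ([:inverse \<kappa>\<^sub>r:] * \<theta>) * ?c k + [:inverse \<kappa>\<^sub>r:] * (if k = 0 then 0 else ?c (k - 1))"
      unfolding crep.simps using True by (cases k) (simp_all add: mult.commute[of "atw _"])
    then have "?c k \<noteq> 0 \<or> (k \<noteq> 0 \<and> ?c (k - 1) \<noteq> 0)" using Suc.prems(2) by (auto split: if_splits)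
    then show ?thesis
    proof
      assume "?c k \<noteq> 0"
      from IH[OF r(1) this] show ?thesis using True by simp
    next
      assume "k \<noteq> 0 \<and> ?c (k - 1) \<noteq> 0"
      then have "r * (k - 1) + (r - 1) \<le> e" "k \<noteq> 0" using IH[OF r(1)] by auto
      moreover have "r * k = r * (k - 1) + r" using \<open>k \<noteq> 0\<close> by (cases k) auto
      ultimately show ?thesis using True r by linarith
    qed
  next
    case False
    then have "coeff (atw (crep e (i - 1))) k \<noteq> 0 \<or> coeff (atw (crep e (r - 1))) k \<noteq> 0"
      using Suc.prems(2) by (auto simp: crep.simps)
    then show ?thesis
    proof
      assume "coeff (atw (crep e (i - 1))) k \<noteq> 0"
      moreover have "i - 1 < r" using Suc.prems by simp
      ultimately have "r * k + (i - 1) \<le> e" using IH by blast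
      then show ?thesis using False by arith
    next
      assume "coeff (atw (crep e (r - 1))) k \<noteq> 0"
      from IH[OF r(1) this] show ?thesis using Suc.prems r by linarith
    qed
  qed
qed

text \<open>Column \<open>j\<close> holds the coordinates of \<tau>^(e + j), the image of the basis
  element \<tau>^j under \<tau>^e.\<close>

definition cmat :: "nat \<Rightarrow> 'q poly poly mat"
  where "cmat e = mat r r (\<lambda>(i, j). crep (e + j) i)"

lemma cmat_carrier [simp]: "cmat e \<in> carrier_mat r r"
  by (simp add: cmat_def)

lemma cmat_0: "cmat 0 = 1\<^sub>m r"
  by (rule eq_matI) (auto simp: cmat_def crep_small)

text \<open>A further factor \<tau> on the left twists the coordinates and acts on the basis through
  the companion matrix \<open>cmat (Suc 0)\<close>.\<close>

lemma cmat_Suc: "cmat (Suc e) = cmat (Suc 0) * map_mat atw (cmat e)"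
proof (rule eq_matI)
  fix i j assume "i < dim_row (cmat (Suc 0) * map_mat atw (cmat e))" "j < dim_col (cmat (Suc 0) * map_mat atw (cmat e))"
  then have ij: "i < r" "j < r" by (simp_all add: cmat_def)
  define r' where "r' = r - 1"
  have r': "Suc r' = r" "r - 1 = r'" "r - Suc 0 = r'" "r' < r" using r_ge by (auto simp: r'_def)
  let ?c = "\<lambda>p. atw (crep (e + j) p)"
  have 1: "crep (Suc p) i = (if Suc p = i then 1 else 0)" if "p < r'" for p
    using crep_small[of "Suc p" i] that ij r' by auto
  have small: "crep r' i = (if i = r' then 1 else 0)" "i \<noteq> 0 \<Longrightarrow> crep r' (i - 1) = 0" "crep r' r' = 1"
    using crep_small[of r' i] crep_small[of r' "i - 1"] crep_small[of r' r'] ij r' by auto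
  have cr0: "crep r 0 = [:- ([:inverse \<kappa>\<^sub>r:] * \<theta>), [:inverse \<kappa>\<^sub>r:]:]"
    using crep.simps(2)[of r'] by (simp add: r' small)
  have crS: "crep r i = [:- ([:inverse \<kappa>\<^sub>r:] * \<kappa> i):]" if "i \<noteq> 0"
    using crep.simps(2)[of r'] that small(2,3) by (simp add: r' small)
  have "(cmat (Suc 0) * map_mat atw (cmat e)) $$ (i, j) = (\<Sum>p<Suc r'. crep (Suc p) i * ?c p)"
    unfolding r' using ij by (simp add: cmat_def scalar_prod_def atLeast0LessThan)
  also have "\<dots> = (\<Sum>p<r'. if Suc p = i then ?c p else 0) + crep (Suc r') i * ?c r'"
    unfolding sum.lessThan_Suc by (intro arg_cong2[where f = "(+)"] sum.cong) (simp_all add: 1)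
  also have "\<dots> = crep (Suc (e + j)) i"
  proof (cases i)
    case 0
    then show ?thesis by (simp add: crep.simps r' small cr0)
  next
    case (Suc i')
    then have i': "i' < r'" using ij r' by simp
    have "(\<Sum>p<r'. if Suc p = i then ?c p else 0) = (\<Sum>p<r'. if p = i' then ?c i' else 0)"
      by (rule sum.cong) (auto simp: Suc)
    also have "\<dots> = ?c i'" using i' by simp
    finally show ?thesis using Suc crS r' by (simp add: crep.simps)
  qed
  finally show "cmat (Suc e) $$ (i, j) = (cmat (Suc 0) * map_mat atw (cmat e)) $$ (i, j)"
    using ij by (simp add: cmat_def)
qed (simp_all add: cmat_def)

text \<open>The constant of the companion determinant. Its inverse is the number whose powers are
  the values of \<open>chi\<close>; the sign belongs to the cofactor at the corner.\<close>

abbreviation "\<epsilon> \<equiv> (- 1) ^ (r + 1) * inverse \<kappa>\<^sub>r"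

text \<open>The first row has a single nonzero entry, in the last column, and deleting both leaves
  the identity matrix.\<close>

lemma det_cmat_1: "det (cmat (Suc 0)) = smult [:\<epsilon>:] [:- \<theta>, 1:]"
proof -
  define r' where "r' = r - 1"
  have r': "Suc r' = r" "r - 1 = r'" "r - Suc 0 = r'" "r' < r" using r_ge by (auto simp: r'_def)
  have c1: "cmat (Suc 0) $$ (0, j) = (if j = r' then [:- ([:inverse \<kappa>\<^sub>r:] * \<theta>), [:inverse \<kappa>\<^sub>r:]:] else 0)" if "j < r" for j
    using that crep_small[of j r'] r' by (simp add: cmat_def crep.simps)
  have "det (cmat (Suc 0)) = (\<Sum>j<r. cmat (Suc 0) $$ (0, j) * cofactor (cmat (Suc 0)) 0 j)"
    by (rule laplace_expansion_row[OF cmat_carrier]) (use r_ge in simp)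
  also have "\<dots> = (\<Sum>j<r. if j = r' then [:- ([:inverse \<kappa>\<^sub>r:] * \<theta>), [:inverse \<kappa>\<^sub>r:]:] * cofactor (cmat (Suc 0)) 0 r' else 0)"
    by (rule sum.cong) (auto simp: c1)
  also have "\<dots> = [:- ([:inverse \<kappa>\<^sub>r:] * \<theta>), [:inverse \<kappa>\<^sub>r:]:] * cofactor (cmat (Suc 0)) 0 r'"
    using r'(4) by simp
  finally have 1: "det (cmat (Suc 0)) = [:- ([:inverse \<kappa>\<^sub>r:] * \<theta>), [:inverse \<kappa>\<^sub>r:]:] * cofactor (cmat (Suc 0)) 0 r'" .
  have "mat_delete (cmat (Suc 0)) 0 r' = 1\<^sub>m r'"
  proof (rule eq_matI)
    fix i j assume "i < dim_row (1\<^sub>m r' :: 'q poly poly mat)" "j < dim_col (1\<^sub>m r' :: 'q poly poly mat)"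
    then have ij: "i < r'" "j < r'" by auto
    then have "mat_delete (cmat (Suc 0)) 0 r' $$ (i, j) = crep (Suc j) (Suc i)"
      using r'(1,4) by (simp add: mat_delete_def carrier_matD[OF cmat_carrier] cmat_def)
    also have "\<dots> = 1\<^sub>m r' $$ (i, j)"
      using ij crep_small[of "Suc j" "Suc i"] r' by simp
    finally show "mat_delete (cmat (Suc 0)) 0 r' $$ (i, j) = 1\<^sub>m r' $$ (i, j)" .
  qed (simp_all add: mat_delete_def cmat_def r')
  then have "cofactor (cmat (Suc 0)) 0 r' = (- 1) ^ r'" by (simp add: cofactor_def)
  with 1 have "det (cmat (Suc 0)) = [:- ([:inverse \<kappa>\<^sub>r:] * \<theta>), [:inverse \<kappa>\<^sub>r:]:] * (- 1) ^ r'"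
    by simp
  also have "(- 1) ^ r' = ([:[:(- 1) ^ (r + 1):]:] :: 'q poly poly)"
  proof -
    have "(- 1 :: 'q) ^ (r + 1) = (- 1) ^ r'" by (simp flip: r'(1))
    moreover have "[:[:(- 1) ^ k :: 'q:]:] = (- 1) ^ k" for k
      by (simp only: const_hom.hom_power const_hom.hom_uminus const_hom.hom_one)
    ultimately show ?thesis by simp
  qed
  finally show ?thesis by (simp add: mult.commute)
qed

text \<open>Each further \<tau> twists the determinant and so replaces \<theta> by its q-th power.
  For \<open>e\<close> the degree of \<open>f\<close> the product is congruent to f(t) modulo
  \<open>f\<close>.\<close>

lemma det_cmat: "det (cmat e) = smult [:\<epsilon> ^ e:] (\<Prod>i<e. [:- (\<theta> ^ CARD('q) ^ i), 1:])"
proof (induction e)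
  case 0
  then show ?case by (simp add: cmat_0 one_pCons[symmetric])
next
  case (Suc e)
  have "det (cmat (Suc e)) = det (cmat (Suc 0)) * det (map_mat atw (cmat e))"
    unfolding cmat_Suc[of e] by (rule det_mult[OF cmat_carrier]) simp
  also have "det (map_mat atw (cmat e)) = atw (det (cmat e))" by (rule atw.hom_det)
  also have "\<dots> = smult [:\<epsilon> ^ e:] (\<Prod>i<e. [:- (\<theta> ^ CARD('q) ^ Suc i), 1:])"
  proof -
    have "atw [:- (\<theta> ^ CARD('q) ^ i), 1:] = [:- (\<theta> ^ CARD('q) ^ Suc i), 1 :: 'q poly:]" for i
      by (simp add: map_poly_pCons afrob.hom_uminus flip: power_mult) (simp add: mult.commute)
    then show ?thesis unfolding Suc afrob.map_poly_hom_smult const_power_card by (simp add: atw.hom_prod)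
  qed
  also have "det (cmat (Suc 0)) = smult [:\<epsilon>:] [:- (\<theta> ^ CARD('q) ^ 0), 1:]" by (simp add: det_cmat_1)
  finally show ?case
    unfolding prod.lessThan_Suc_shift mult_smult_left mult_smult_right smult_smult by (simp add: mult.commute)
qed

text \<open>$\det(X C - 1)$, where \<open>C\<close> is the matrix of $\tau^d$: up to a scalar, the reciprocal of its
  characteristic polynomial.\<close>
definition wmat :: "nat \<Rightarrow> 'q poly poly poly mat"
  where "wmat d = mat r r (\<lambda>(i, j). [:- (if i = j then 1 else 0), cmat d $$ (i, j):])"

definition wpoly :: "nat \<Rightarrow> 'q poly poly poly" where "wpoly d = det (wmat d)"

text \<open>The exponents of X and t lie below a line of slope d/r, with an offset \<open>w\<close>
  that is additive in products.\<close>

definition wt_le :: "nat \<Rightarrow> int \<Rightarrow> 'q poly poly poly \<Rightarrow> bool"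
  where "wt_le d w p \<longleftrightarrow> (\<forall>k j. coeff (coeff p k) j \<noteq> 0 \<longrightarrow> int r * int j \<le> int k * int d + w)"

lemma wt_le_mult:
  assumes "wt_le d v p" "wt_le d w s"
  shows "wt_le d (v + w) (p * s)"
  unfolding wt_le_def
proof (intro allI impI)
  fix k j assume nz: "coeff (coeff (p * s) k) j \<noteq> 0"
  have "coeff (coeff (p * s) k) j =
    (\<Sum>i\<le>k. \<Sum>h\<le>j. coeff (coeff p i) h * coeff (coeff s (k - i)) (j - h))"
    by (simp add: coeff_mult coeff_sum)
  then obtain i h where ih: "i \<le> k" "h \<le> j" "coeff (coeff p i) h * coeff (coeff s (k - i)) (j - h) \<noteq> 0"
    using nz by (metis (no_types, lifting) sum.neutral atMost_iff)
  then have "coeff (coeff p i) h \<noteq> 0" "coeff (coeff s (k - i)) (j - h) \<noteq> 0" by auto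
  then have "int r * int h \<le> int i * int d + v" "int r * int (j - h) \<le> int (k - i) * int d + w"
    using assms unfolding wt_le_def by blast+
  then show "int r * int j \<le> int k * int d + (v + w)"
  proof -
    have "int r * int j = int r * int h + int r * int (j - h)"
      unfolding distrib_left[symmetric] using ih(2) by simp
    moreover have "int k * int d = int i * int d + int (k - i) * int d"
      unfolding distrib_right[symmetric] using ih(1) by simp
    ultimately show ?thesis using \<open>int r * int h \<le> _\<close> \<open>int r * int (j - h) \<le> _\<close> by linarith
  qed
qed

lemma wt_le_prod: "finite I \<Longrightarrow> (\<And>i. i \<in> I \<Longrightarrow> wt_le d (w i) (p i)) \<Longrightarrow> wt_le d (sum w I) (prod p I)"
proof (induction I rule: finite_induct)
  case empty
  then show ?case by (auto simp: wt_le_def coeff_1 split: if_splits)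
qed (simp add: wt_le_mult)

lemma wt_le_sum: "(\<And>i. i \<in> I \<Longrightarrow> wt_le d w (p i)) \<Longrightarrow> wt_le d w (sum p I)"
  unfolding wt_le_def coeff_sum
  by (metis (no_types, lifting) sum.neutral)

text \<open>By \<open>crep_bound\<close> the entry in row \<open>i\<close> and column
  \<open>j\<close> has offset j - i, and along a permutation these offsets add up to 0. This
  estimate is the source of the size of the Frobenius roots at infinity.\<close>

lemma wpoly_bound:
  assumes "coeff (coeff (wpoly d) k) j \<noteq> 0"
  shows "r * j \<le> k * d"
proof -
  have entry: "wt_le d (int j - int i) (wmat d $$ (i, j))" if "i < r" "j < r" for i j
    unfolding wt_le_def
  proof (intro allI impI)
    fix k h assume nz: "coeff (coeff (wmat d $$ (i, j)) k) h \<noteq> 0"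
    show "int r * int h \<le> int k * int d + (int j - int i)"
    proof (cases k)
      case 0
      then show ?thesis using nz that by (auto simp: wmat_def coeff_1 split: if_splits)
    next
      case (Suc k')
      then have "k' = 0" "coeff (crep (d + j) i) h \<noteq> 0"
        using nz that by (auto simp: wmat_def cmat_def coeff_pCons split: nat.splits)
      then have "r * h + i \<le> d + j" using crep_bound[OF that(1)] by blast
      then show ?thesis using Suc \<open>k' = 0\<close> by (simp flip: of_nat_add of_nat_mult)
    qed
  qed
  have "wt_le d 0 (wpoly d)"
  proof -
    have carrier: "wmat d \<in> carrier_mat r r" by (simp add: wmat_def)
    have "wt_le d 0 (signof p * (\<Prod>i = 0..<r. wmat d $$ (i, p i)))" if p: "p permutes {0..<r}" for p
    proof -
      have "wt_le d (\<Sum>i = 0..<r. int (p i) - int i) (\<Prod>i = 0..<r. wmat d $$ (i, p i))"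
        by (rule wt_le_prod) (use p in \<open>auto intro!: entry dest: permutes_in_image\<close>)
      moreover have "(\<Sum>i = 0..<r. int (p i) - int i) = 0"
        using sum.permute[OF p, of int] by (simp add: sum_subtractf)
      moreover have "wt_le d 0 (signof p)" by (auto simp: sign_def wt_le_def coeff_1 split: if_splits)
      ultimately show ?thesis using wt_le_mult[of d 0 "signof p" 0] by simp
    qed
    then show ?thesis unfolding wpoly_def det_def'[OF carrier] by (intro wt_le_sum) auto
  qed
  then have "int r * int j \<le> int k * int d" using assms by (auto simp: wt_le_def)
  then show ?thesis by (simp flip: of_nat_mult)
qed

lemma wpoly_0: "coeff (wpoly d) 0 = (- 1) ^ r"
proof -
  have "coeff (wpoly d) 0 = det (map_mat (\<lambda>p. poly p 0) (wmat d))"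
    unfolding wpoly_def poly_0_coeff_0[symmetric]
    by (rule comm_ring_hom.hom_det[OF poly_hom.comm_ring_hom_axioms, symmetric])
  also have "map_mat (\<lambda>p. poly p 0) (wmat d) = (- 1) \<cdot>\<^sub>m 1\<^sub>m r"
    by (rule eq_matI) (auto simp: wmat_def)
  finally show ?thesis by simp
qed

end

section \<open>The pairing of the motive with torsion\<close>

definition polyset :: "'a::zero set \<Rightarrow> 'a poly set" where "polyset S = {p. \<forall>k. coeff p k \<in> S}"

lemma polysetI: "(\<And>k. coeff p k \<in> S) \<Longrightarrow> p \<in> polyset S"
  and polysetD: "p \<in> polyset S \<Longrightarrow> coeff p k \<in> S"
  by (simp_all add: polyset_def)

lemma is_subring_polyset:
  assumes "is_subring S" shows "is_subring (polyset S)"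
  unfolding is_subring_def
  by (intro conjI ballI polysetI)
     (auto simp: coeff_1 coeff_mult intro!: is_subringD[OF assms] is_subring_sum[OF assms] dest: polysetD)

lemma is_ideal_polyset:
  assumes S: "is_subring S" and I: "is_ideal S I" shows "is_ideal (polyset S) (polyset I)"
  unfolding is_ideal_def
proof (intro conjI ballI subsetI polysetI)
  fix s x k assume "s \<in> polyset S" "x \<in> polyset I"
  then show "coeff (s * x) k \<in> I"
    unfolding coeff_mult by (intro is_ideal_sum[OF I] is_idealD(4)[OF I]) (auto dest: polysetD)
qed (auto dest!: polysetD intro: is_idealD[OF I])

lemma polyset_const: "is_subring S \<Longrightarrow> c \<in> S \<Longrightarrow> [:c:] \<in> polyset S"
  by (rule polysetI) (auto simp: coeff_pCons is_subringD split: nat.splits)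

text \<open>The leading coefficient of \<open>b\<close> exposes the highest coefficient of
  \<open>v\<close> outside \<open>I\<close> in a coefficient of \<open>b * v\<close> of index at
  least \<open>n\<close>. With \<open>I\<close> the integral closure or a prime of it, this controls
  quotients by \<lambda>(t)^m.\<close>

lemma monic_mult_polyset:
  fixes b v :: "'a::comm_ring_1 poly"
  assumes b: "degree b = n" "coeff b n = 1"
    and I: "0 \<in> I" "\<And>x y. x \<in> I \<Longrightarrow> y \<in> I \<Longrightarrow> x - y \<in> I" "\<And>x k. x \<in> I \<Longrightarrow> coeff b k * x \<in> I"
    and bv: "\<And>j. j \<ge> n \<Longrightarrow> coeff (b * v) j \<in> I"
  shows "v \<in> polyset I"
proof (rule ccontr)
  assume "v \<notin> polyset I"
  let ?K = "{k. coeff v k \<notin> I}"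
  have fin: "finite ?K"
  proof (rule finite_subset)
    show "?K \<subseteq> {..degree v}" using I(1) coeff_eq_0[of v] by (force simp: not_le[symmetric])
  qed simp
  have ne: "?K \<noteq> {}" using \<open>v \<notin> polyset I\<close> by (auto simp: polyset_def)
  define K where "K = Max ?K"
  have K: "coeff v K \<notin> I" using Max_in[OF fin ne] by (simp add: K_def)
  have above: "coeff v k \<in> I" if "k > K" for k
    using Max_ge[OF fin, of k] that by (force simp: K_def)
  have neg: "- x \<in> I" if "x \<in> I" for x using I(2)[OF I(1) that] by simp
  have add: "x + y \<in> I" if "x \<in> I" "y \<in> I" for x y using I(2)[OF that(1) neg[OF that(2)]] by simp
  have sum: "(\<Sum>i\<in>A. g i) \<in> I" if "\<And>i. i \<in> A \<Longrightarrow> g i \<in> I" for A :: "nat set" and g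
    using that by (induction A rule: infinite_finite_induct) (simp_all add: I(1) add)
  have "coeff (b * v) (n + K) = (\<Sum>i\<le>n + K. coeff b i * coeff v (n + K - i))"
    by (simp add: coeff_mult)
  also have "\<dots> = (\<Sum>i\<le>n. coeff b i * coeff v (n + K - i))"
    by (rule sum.mono_neutral_right) (use b in \<open>auto simp: coeff_eq_0\<close>)
  also have "\<dots> = (\<Sum>i<n. coeff b i * coeff v (n + K - i)) + coeff v K"
    using b(2) by (simp add: lessThan_Suc_atMost[symmetric])
  finally have "coeff v K = coeff (b * v) (n + K) - (\<Sum>i<n. coeff b i * coeff v (n + K - i))" by simp
  also have "\<dots> \<in> I"
  proof (rule I(2)[OF bv sum])
    fix i assume "i \<in> {..<n}"
    then show "coeff b i * coeff v (n + K - i) \<in> I" by (intro I(3) above) auto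
  qed simp
  finally show False using K by simp
qed

interpretation es: map_poly_inj_comm_ring_hom "scal :: 'q::field \<Rightarrow> 'q kbar" ..
interpretation ek: map_poly_inj_comm_ring_hom "\<iota> :: 'q::field poly \<Rightarrow> 'q kbar" ..

text \<open>\<open>es\<close> reads a polynomial over F_q as one in t over the algebraic closure, so
  its values are fixed by the twist \<open>ktw\<close>; \<open>ek\<close> embeds A[t].\<close>

abbreviation es :: "'q::field poly \<Rightarrow> 'q kbar poly" where "es \<equiv> map_poly scal"
abbreviation ek :: "'q::field poly poly \<Rightarrow> 'q kbar poly" where "ek \<equiv> map_poly \<iota>"

lemma ek_emb: "ek (emb p) = es p"
  by (intro poly_eqI) (simp add: coeff_map_poly)

interpretation kfrob: comm_ring_hom "\<lambda>x :: 'q::{field,finite} kbar. x ^ CARD('q)"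
proof
  show "(x + y) ^ CARD('q) = x ^ CARD('q) + y ^ CARD('q)" for x y :: "'q kbar"
    by (rule frobenius_add[OF scal.comm_ring_hom_axioms])
qed (simp_all add: power_mult_distrib power_0_left)

interpretation ktw: map_poly_comm_ring_hom "\<lambda>x :: 'q::{field,finite} kbar. x ^ CARD('q)" ..

abbreviation ktw :: "'q::{field,finite} kbar poly \<Rightarrow> 'q kbar poly" where "ktw \<equiv> map_poly (\<lambda>x. x ^ CARD('q))"

lemma coeff_ktw [simp]: "coeff (ktw p) i = coeff p i ^ CARD('q)" for p :: "'q::{field,finite} kbar poly"
  by (simp add: coeff_map_poly power_0_left)

lemma scal_power_card: "scal c ^ CARD('q) ^ i = scal (c :: 'q::{field,finite})"
  by (simp add: finite_field_power_card_power flip: scal.hom_power)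

lemma ktw_es: "ktw (es p) = es p" for p :: "'q::{field,finite} poly"
proof (rule poly_eqI)
  fix i show "coeff (ktw (es p)) i = coeff (es p) i"
    using scal_power_card[of "coeff p i" 1] by simp
qed

lemma ktw_ek: "ktw (ek p) = ek (atw p)" for p :: "'q::{field,finite} poly poly"
  by (rule poly_eqI) (simp add: iota.hom_power)

lemma es_const_hom: "comm_ring_hom (\<lambda>c :: 'q::field. [:scal c:])"
proof
  show "[:scal (1::'q):] = 1" unfolding iota.hom_one const_hom.hom_one by (simp flip: one_pCons)
qed (simp_all add: scal.hom_add scal.hom_mult)

lemma es_pCons: "es (pCons c p) = pCons (scal c) (es p)"
  by (rule poly_eqI) (simp add: coeff_map_poly coeff_pCons split: nat.splits)

lemma ek_pCons: "ek (pCons c p) = pCons (\<iota> c) (ek p)"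
  by (rule poly_eqI) (simp add: coeff_map_poly coeff_pCons split: nat.splits)

lemma kpoly_frobenius_add: "(x + y) ^ CARD('q) ^ n = x ^ CARD('q) ^ n + y ^ CARD('q) ^ n"
  for x y :: "'q::{field,finite} kbar poly"
  by (rule frobenius_power_add[OF es_const_hom])

lemma kbar_frobenius_diff: "(x - y) ^ CARD('q) ^ n = x ^ CARD('q) ^ n - y ^ CARD('q) ^ n"
  for x y :: "'q::{field,finite} kbar"
  using kbar_frobenius_add[of "x - y" y n] by simp

section \<open>The pairing and the module structures\<close>

context drinfeld
begin

text \<open>The pairing of $\tau^e$ with a torsion point \<open>x\<close>, with values in
  $\overline{K}[t]/a$: it is $a(t) \sum_k \theta^k(x)^{q^e} t^{-k-1}$.\<close>
definition pair :: "'q poly \<Rightarrow> nat \<Rightarrow> 'q kbar \<Rightarrow> 'q kbar poly"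
  where "pair a e x = (\<Sum>k<degree a. smult (act (\<theta> ^ k) x ^ CARD('q) ^ e) (es (poly_shift (Suc k) a)))"

lemma pair_add: "pair a e (x + y) = pair a e x + pair a e y"
  by (simp add: pair_def act_add kbar_frobenius_add smult_add_left sum.distrib)

lemma pair_0 [simp]: "pair a e 0 = 0"
  by (simp add: pair_def power_0_left)

lemma pair_sum: "pair a e (\<Sum>i\<in>I. f i) = (\<Sum>i\<in>I. pair a e (f i))"
  by (induction I rule: infinite_finite_induct) (simp_all add: pair_add)

lemma act_scal: "act a (scal c * x) = scal c * act a x"
  by (simp add: drinfeld_act_eq skew_eval_scal)

lemma pair_scal: "pair a e (scal c * x) = smult (scal c) (pair a e x)"
  by (simp add: pair_def act_scal power_mult_distrib scal_power_card smult_sum2)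

lemma ktw_pair: "ktw (pair a e x) = pair a (Suc e) x"
proof -
  have "ktw (smult (act (\<theta> ^ k) x ^ CARD('q) ^ e) (es p)) = smult (act (\<theta> ^ k) x ^ CARD('q) ^ Suc e) (es p)" for k p
    unfolding kfrob.map_poly_hom_smult ktw_es by (simp add: mult.commute flip: power_mult)
  then show ?thesis by (simp add: pair_def ktw.hom_sum)
qed

lemma act_expand: "act a x = (\<Sum>k\<le>degree a. scal (coeff a k) * act (\<theta> ^ k) x)"
proof -
  have "a = (\<Sum>k\<le>degree a. [:coeff a k:] * \<theta> ^ k)"
    using poly_as_sum_of_monoms[of a] by (simp add: monom_altdef)
  then have "act a x = act (\<Sum>k\<le>degree a. [:coeff a k:] * \<theta> ^ k) x" by simp
  also have "\<dots> = (\<Sum>k\<le>degree a. scal (coeff a k) * act (\<theta> ^ k) x)"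
    unfolding act_sum_left act_mult act_const ..
  finally show ?thesis .
qed

text \<open>Multiplication by t shifts the sum by one power of \<theta>. What is left over at the
  top vanishes by a power of the equation \<open>act a x = 0\<close>, and what is left at the bottom
  is the multiple of a(t).\<close>

lemma pair_theta:
  assumes "x \<in> torsion a"
  shows "[:0, 1:] * pair a e x = pair a e (act \<theta> x) + smult (x ^ CARD('q) ^ e) (es a)"
proof -
  let ?n = "degree a"
  define y where "y k = act (\<theta> ^ k) x ^ CARD('q) ^ e" for k
  define h where "h k = es (poly_shift k a)" for k
  have shift: "[:0, 1:] * h (Suc k) = h k - [:scal (coeff a k):]" for k
  proof -
    have "poly_shift k a = pCons (coeff a k) (poly_shift (Suc k) a)"
      by (rule poly_eqI) (simp add: coeff_poly_shift coeff_pCons split: nat.splits)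
    then show ?thesis unfolding h_def by (simp add: es_pCons)
  qed
  have hn: "h ?n = [:scal (coeff a ?n):]"
  proof -
    have "poly_shift ?n a = [:coeff a ?n:]"
      by (rule poly_eqI) (simp add: coeff_poly_shift coeff_pCons coeff_eq_0 split: nat.splits)
    then show ?thesis unfolding h_def by (simp add: es_pCons)
  qed
  have "(\<Sum>k\<le>?n. scal (coeff a k) * y k) = (act a x) ^ CARD('q) ^ e"
    unfolding act_expand[of a x] by (simp add: kbar_frobenius_sum power_mult_distrib scal_power_card y_def)
  also have "\<dots> = 0" using assms by (simp add: torsion_def power_0_left)
  finally have "(\<Sum>k\<le>?n. [:scal (coeff a k) * y k:]) = 0"
    by (simp flip: const_hom.hom_sum)
  then have zero: "(\<Sum>k<?n. [:scal (coeff a k) * y k:]) + smult (y ?n) (h ?n) = 0"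
    by (simp add: lessThan_Suc_atMost[symmetric] hn mult.commute)
  have "[:0, 1:] * pair a e x = (\<Sum>k<?n. smult (y k) (h k)) - (\<Sum>k<?n. [:scal (coeff a k) * y k:])"
    unfolding pair_def sum_distrib_left mult_smult_right y_def[symmetric] h_def[symmetric] shift
    by (simp add: smult_diff_right sum_subtractf mult.commute del: mult_pCons_left)
  also have "(\<Sum>k<?n. smult (y k) (h k)) = (\<Sum>k<Suc ?n. smult (y k) (h k)) - smult (y ?n) (h ?n)" by simp
  also have "(\<Sum>k<Suc ?n. smult (y k) (h k)) = smult (y 0) (h 0) + (\<Sum>k<?n. smult (y (Suc k)) (h (Suc k)))"
    by (rule sum.lessThan_Suc_shift)
  also have "(\<Sum>k<?n. smult (y (Suc k)) (h (Suc k))) = pair a e (act \<theta> x)"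
    by (simp add: pair_def y_def h_def act_mult[symmetric] mult.commute)
  finally show ?thesis using zero by (simp add: y_def h_def algebra_simps)
qed

lemma torsion_act': "x \<in> torsion a \<Longrightarrow> act c x \<in> torsion a"
  by (simp add: torsion_def act_commute[of a])

text \<open>By \<open>pair_theta\<close>, \<theta> acts as t modulo a(t); induction on the digits of
  \<open>c\<close>.\<close>

lemma pair_act:
  assumes "x \<in> torsion a"
  shows "es a dvd pair a e (act c x) - es c * pair a e x"
proof (induction c)
  case (pCons c0 c)
  let ?z = "act c x"
  have "pCons c0 c = [:c0:] + [:0, 1:] * c" by simp
  then have "act (pCons c0 c) x = scal c0 * x + act \<theta> ?z" by (simp only: act_add_left act_mult act_const)
  then have "pair a e (act (pCons c0 c) x) = smult (scal c0) (pair a e x) + pair a e (act \<theta> ?z)"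
    by (simp add: pair_add pair_scal)
  also have "pair a e (act \<theta> ?z) = [:0, 1:] * pair a e ?z - smult (?z ^ CARD('q) ^ e) (es a)"
    using pair_theta[OF torsion_act'[OF assms], of e c] by simp
  finally have "pair a e (act (pCons c0 c) x) - es (pCons c0 c) * pair a e x =
      [:0, 1:] * (pair a e ?z - es c * pair a e x) - smult (?z ^ CARD('q) ^ e) (es a)"
    by (simp add: es_pCons algebra_simps smult_add_right smult_diff_right)
  moreover have "es a dvd [:0, 1:] * (pair a e ?z - es c * pair a e x) - smult (?z ^ CARD('q) ^ e) (es a)"
    by (rule dvd_diff[OF dvd_mult[OF pCons.IH] dvd_smult]) simp
  ultimately show ?case by simp
qed simp

text \<open>The same pairing with \<theta> x, now expanded through the q-powers of \<open>x\<close>,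
  each of which stands for a power of \<tau>.\<close>

lemma pair_act_theta:
  "pair a 0 (act \<theta> x) = smult (\<iota> \<theta>) (pair a 0 x) + (\<Sum>i=1..<r. smult (\<iota> (\<kappa> i)) (pair a i x))
    + smult (scal \<kappa>\<^sub>r) (pair a r x)"
proof -
  have "act (\<theta> ^ k) (act \<theta> x) = \<iota> \<theta> * act (\<theta> ^ k) x + (\<Sum>i=1..<r. \<iota> (\<kappa> i) * act (\<theta> ^ k) x ^ CARD('q) ^ i)
      + scal \<kappa>\<^sub>r * act (\<theta> ^ k) x ^ CARD('q) ^ r" for k
    by (subst act_commute) (rule act_theta)
  then have "pair a 0 (act \<theta> x) = (\<Sum>k<degree a. smult (\<iota> \<theta>) (smult (act (\<theta> ^ k) x) (es (poly_shift (Suc k) a)))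
     + (\<Sum>i=1..<r. smult (\<iota> (\<kappa> i)) (smult (act (\<theta> ^ k) x ^ CARD('q) ^ i) (es (poly_shift (Suc k) a))))
     + smult (scal \<kappa>\<^sub>r) (smult (act (\<theta> ^ k) x ^ CARD('q) ^ r) (es (poly_shift (Suc k) a))))"
    by (simp only: pair_def power_0 power_one_right smult_add_left smult_sum smult_smult)
  also have "\<dots> = smult (\<iota> \<theta>) (pair a 0 x) + (\<Sum>i=1..<r. smult (\<iota> (\<kappa> i)) (pair a i x))
    + smult (scal \<kappa>\<^sub>r) (pair a r x)"
    unfolding pair_def smult_sum2 sum.distrib by (subst sum.swap) simp
  finally show ?thesis .
qed

text \<open>The two expressions for the pairing with \<theta> x, by t and by q-powers, yield the
  relation of the motive from which \<open>crep\<close> is built; the twist \<open>ktw\<close>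
  carries the congruence from \<open>e\<close> to \<open>e + 1\<close>.\<close>

lemma pair_crep:
  assumes "x \<in> torsion a"
  shows "es a dvd pair a e x - (\<Sum>i<r. ek (crep e i) * pair a i x)"
proof (induction e)
  case 0
  have "(\<Sum>i<r. ek (crep 0 i) * pair a i x) = (\<Sum>i<r. if i = 0 then pair a 0 x else 0)"
    by (rule sum.cong) (auto simp: crep.simps)
  then show ?case using r_ge by simp
next
  case (Suc e)
  define r' where "r' = r - 1"
  have r': "Suc r' = r" "r - Suc 0 = r'" using r_ge by (simp_all add: r'_def)
  define c where "c i = ek (atw (crep e i))" for i
  define k' where "k' = scal (inverse \<kappa>\<^sub>r)"
  have k': "k' * scal \<kappa>\<^sub>r = 1" using \<kappa>r by (simp add: k'_def flip: scal.hom_mult)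
  obtain v where v: "pair a e x - (\<Sum>i<r. ek (crep e i) * pair a i x) = es a * v" using Suc by (elim dvdE)
  have "es a * ktw v = ktw (es a * v)" by (simp add: ktw.hom_mult ktw_es)
  also have "\<dots> = pair a (Suc e) x - (\<Sum>i<r. c i * pair a (Suc i) x)"
    unfolding v[symmetric] ktw.hom_minus ktw.hom_sum ktw.hom_mult ktw_pair ktw_ek c_def ..
  finally have 1: "pair a (Suc e) x = (\<Sum>i<r. c i * pair a (Suc i) x) + es a * ktw v" by simp
  \<comment> \<open>The comparison of the two expressions, solved for the pairing with
    \<tau>^r.\<close>
  have rel: "pair a r x = smult k' ([:0, 1:] * pair a 0 x - smult (\<iota> \<theta>) (pair a 0 x)
      - (\<Sum>i=1..<r. smult (\<iota> (\<kappa> i)) (pair a i x)) - smult x (es a))"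
  proof -
    have "smult k' (smult (scal \<kappa>\<^sub>r) (pair a r x)) = pair a r x" by (simp add: k')
    moreover have "smult (scal \<kappa>\<^sub>r) (pair a r x) = [:0, 1:] * pair a 0 x - smult (\<iota> \<theta>) (pair a 0 x)
      - (\<Sum>i=1..<r. smult (\<iota> (\<kappa> i)) (pair a i x)) - smult x (es a)"
      using pair_theta[OF assms, of 0] pair_act_theta[of a x] by (simp add: algebra_simps)
    ultimately show ?thesis by simp
  qed
  have crep0: "ek (crep (Suc e) 0) = c r' * [:- (k' * \<iota> \<theta>), k':]"
    by (simp add: crep.simps ek.hom_mult c_def k'_def r' ek_pCons iota.hom_uminus iota.hom_mult
      del: mult_pCons_left mult_pCons_right)
  have crepS: "ek (crep (Suc e) i) = c (i - 1) - smult (k' * \<iota> (\<kappa> i)) (c r')" if "i \<noteq> 0" for i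
    using that by (simp add: crep.simps ek.hom_minus iota.map_poly_hom_smult c_def k'_def r' iota.hom_mult
      del: mult_pCons_left mult_pCons_right)
  have "(\<Sum>i<r. ek (crep (Suc e) i) * pair a i x) =
      c r' * [:- (k' * \<iota> \<theta>), k':] * pair a 0 x + (\<Sum>i=1..<r. ek (crep (Suc e) i) * pair a i x)"
  proof -
    have "{..<r} = insert 0 {1..<r}" using r_ge by auto
    then show ?thesis by (simp add: crep0)
  qed
  also have "(\<Sum>i=1..<r. ek (crep (Suc e) i) * pair a i x) =
      (\<Sum>i=1..<r. c (i - 1) * pair a i x) - c r' * smult k' (\<Sum>i=1..<r. smult (\<iota> (\<kappa> i)) (pair a i x))"
    unfolding smult_sum2 sum_distrib_left sum_subtractf[symmetric]
    by (rule sum.cong) (auto simp: crepS left_diff_distrib)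
  also have "(\<Sum>i=1..<r. c (i - 1) * pair a i x) = (\<Sum>i<r'. c i * pair a (Suc i) x)"
    by (rule sum.reindex_bij_witness[of _ Suc "\<lambda>i. i - 1"]) (auto simp: r'(1)[symmetric])
  finally have 2: "(\<Sum>i<r. ek (crep (Suc e) i) * pair a i x) = c r' * [:- (k' * \<iota> \<theta>), k':] * pair a 0 x
     + ((\<Sum>i<r'. c i * pair a (Suc i) x) - c r' * smult k' (\<Sum>i=1..<r. smult (\<iota> (\<kappa> i)) (pair a i x)))" .
  have 3: "(\<Sum>i<r. c i * pair a (Suc i) x) = (\<Sum>i<r'. c i * pair a (Suc i) x) + c r' * pair a r x"
    unfolding r'(1)[symmetric] by simp
  have 4: "[:- (k' * \<iota> \<theta>), k':] * pair a 0 x = smult k' ([:0, 1:] * pair a 0 x - smult (\<iota> \<theta>) (pair a 0 x))"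
    by (simp add: smult_diff_right)
  have "pair a (Suc e) x - (\<Sum>i<r. ek (crep (Suc e) i) * pair a i x) = es a * ktw v - es a * smult (k' * x) (c r')"
    unfolding 1 2 3 rel mult.assoc 4 by (simp add: smult_diff_right smult_add_right algebra_simps)
  then show ?case by (simp only: right_diff_distrib[symmetric] dvd_triv_left)
qed

text \<open>For fixed \<zeta> the sum is a polynomial in \<open>x\<close> of degree at most q^(r deg
  a - 1); vanishing at all q^(r deg a) torsion points, it is 0. Its dominating term, from the
  highest power of \<theta>, then forces all \<open>c j\<close> to be 0.\<close>

lemma pair_nondegenerate:
  assumes a: "degree a > 0"
    and 0: "\<And>x. x \<in> torsion a \<Longrightarrow> (\<Sum>j<r. c j * poly (pair a j x) \<zeta>) = 0" and "j < r"
  shows "c j = 0"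
proof -
  let ?q = "CARD('q)"
  have q1: "1 < ?q" by (rule card_field_gt_1)
  have a0: "a \<noteq> 0" using a by auto
  define gp where "gp = (\<Sum>j<r. monom (c j) (?q ^ j))"
  define \<mu> where "\<mu> k = poly (es (poly_shift (Suc k) a)) \<zeta>" for k
  obtain N where N: "degree a = Suc N" using a by (cases "degree a") auto
  have cg: "coeff gp (?q ^ j) = c j" if "j < r" for j
  proof -
    have "coeff gp (?q ^ j) = (\<Sum>i<r. if i = j then c j else 0)"
      unfolding gp_def coeff_sum by (rule sum.cong) (use q1 in auto)
    then show ?thesis using that by simp
  qed
  have "gp = 0"
  proof (rule ccontr)
    assume gp: "gp \<noteq> 0"
    have c0: "coeff gp 0 = 0" by (simp add: gp_def coeff_sum)
    have d1: "degree gp > 0"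
    proof (rule ccontr)
      assume "\<not> degree gp > 0"
      then show False using c0 gp by (metis leading_coeff_0_iff neq0_conv)
    qed
    have d2: "degree gp \<le> ?q ^ (r - 1)"
      unfolding gp_def
    proof (rule degree_sum_le)
      fix i assume "i \<in> {..<r}"
      then have "?q ^ i \<le> ?q ^ (r - 1)" using q1 by (intro power_increasing) auto
      then show "degree (monom (c i) (?q ^ i)) \<le> ?q ^ (r - 1)"
        using degree_monom_le order_trans by blast
    qed simp
    define g where "g k = pcompose gp (act_poly (\<theta> ^ k))" for k
    have dg: "degree (g k) = degree gp * ?q ^ (r * k)" for k
      unfolding g_def by (simp add: degree_pcompose degree_act_poly degree_power_eq)
    define Hp where "Hp = (\<Sum>k<Suc N. smult (\<mu> k) (g k))"
    have \<mu>N: "\<mu> N \<noteq> 0"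
    proof -
      have "poly_shift (Suc N) a = [:coeff a (Suc N):]"
        by (rule poly_eqI) (simp add: coeff_poly_shift coeff_pCons coeff_eq_0 N split: nat.splits)
      moreover have "coeff a (Suc N) \<noteq> 0" using a0 N by (metis leading_coeff_0_iff)
      ultimately show ?thesis by (simp add: \<mu>_def es_pCons)
    qed
    \<comment> \<open>Composing with the action of \<theta>^k multiplies the degree by q^(r k), so
      the last summand dominates.\<close>
    have low: "degree (\<Sum>k<N. smult (\<mu> k) (g k)) < degree (smult (\<mu> N) (g N))"
    proof (cases N)
      case 0
      then show ?thesis using d1 \<mu>N by (simp add: dg)
    next
      case (Suc N')
      have "degree (\<Sum>k<N. smult (\<mu> k) (g k)) \<le> degree gp * ?q ^ (r * N')"
      proof (rule degree_sum_le)
        fix k assume "k \<in> {..<N}"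
        then have "?q ^ (r * k) \<le> ?q ^ (r * N')" using q1 Suc by (intro power_increasing) auto
        then show "degree (smult (\<mu> k) (g k)) \<le> degree gp * ?q ^ (r * N')"
          using degree_smult_le[of "\<mu> k" "g k"] unfolding dg by (meson mult_le_mono2 order_trans)
      qed simp
      also have "\<dots> < degree gp * ?q ^ (r * N)"
        using d1 q1 Suc r_ge by (intro mult_strict_left_mono power_strict_increasing) auto
      finally show ?thesis using \<mu>N by (simp add: dg)
    qed
    have dH: "degree Hp = degree gp * ?q ^ (r * N)"
      unfolding Hp_def sum.lessThan_Suc degree_add_eq_right[OF low] using \<mu>N by (simp add: dg)
    have "Hp = 0"
    proof (rule poly_eq_0_many_roots)
      show "finite (torsion a)" by (rule finite_torsion[OF a0])
      have "degree Hp \<le> ?q ^ (r - 1) * ?q ^ (r * N)" unfolding dH using d2 by simp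
      also have "\<dots> = ?q ^ (r - 1 + r * N)" by (simp add: power_add)
      also have "\<dots> < ?q ^ (r * Suc N)" using q1 r_ge by (intro power_strict_increasing) auto
      finally show "degree Hp < card (torsion a)" by (simp add: card_torsion[OF a0] N)
      fix x assume x: "x \<in> torsion a"
      have "poly Hp x = (\<Sum>k<Suc N. \<mu> k * (\<Sum>j<r. c j * act (\<theta> ^ k) x ^ ?q ^ j))"
        by (simp add: Hp_def poly_sum g_def poly_pcompose gp_def poly_monom del: sum.lessThan_Suc)
      also have "\<dots> = (\<Sum>j<r. c j * poly (pair a j x) \<zeta>)"
        unfolding pair_def N poly_sum sum_distrib_left poly_smult \<mu>_def
        by (subst sum.swap) (simp add: mult_ac del: sum.lessThan_Suc)
      finally show "poly Hp x = 0" using 0[OF x] by simp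
    qed
    then show False using dH d1 q1 by simp
  qed
  then show ?thesis using cg[OF assms(3)] by simp
qed

lemma pair_integral:
  assumes "a \<noteq> 0" "x \<in> torsion a"
  shows "pair a e x \<in> polyset integral_closure_A"
  unfolding pair_def
  by (intro is_subring_sum[OF is_subring_polyset[OF is_subring_integral_closure_A]] polysetI)
     (auto simp: coeff_map_poly intro!: integral_closure_A_mult[OF integral_closure_A_power[OF torsion_integral[OF assms(1) torsion_act'[OF assms(2)]]] integral_closure_A_iota])

end

lemma ek_integral: "ek p \<in> polyset integral_closure_A"
  by (rule polysetI) simp

lemma es_integral: "es p \<in> polyset integral_closure_A"
  by (rule polysetI) simp

section \<open>The characteristic polynomial of Frobenius\<close>

lemma linear_dvd_minus_value: "[:- z, 1:] dvd p - [:poly p z:]" for z :: "'a::idom"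
  by (rule iffD1[OF poly_eq_0_iff_dvd]) simp

lemma (in comm_ring_hom) poly_map_poly_hom: "poly (map_poly hom p) (hom x) = hom (poly p x)"
  by (induction p) (simp_all add: hom_add hom_mult map_poly_pCons_hom)

section \<open>The determinant of the pairing is prime to P\<close>

locale drinfeld_frobenius = drinfeld_tate \<phi> \<kappa> \<kappa>\<^sub>r r l
  for \<phi> :: "'q::{field,finite} poly \<Rightarrow> 'q poly poly" and \<kappa> \<kappa>\<^sub>r r l +
  fixes f :: "'q poly" and \<sigma> P and m :: nat
  assumes f: "f \<in> monic_primes" and fl: "f \<noteq> l" and \<sigma>: "\<sigma> \<in> galois_K"
    and P: "prime_above f P"
    and frob: "\<And>x. x \<in> integral_closure_A \<Longrightarrow> \<sigma> x - x ^ (CARD('q) ^ degree f) \<in> P"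
    and m_pos: "m > 0"
begin

abbreviation "R \<equiv> (integral_closure_A :: 'q kbar set)"
abbreviation "la \<equiv> l ^ m"
abbreviation "lb \<equiv> es la"
abbreviation "tb k \<equiv> tbase k m"

lemma R_ring: "is_subring R"
  by (rule is_subring_integral_closure_A)

lemmas R_poly = is_subring_polyset[OF R_ring]
lemmas P_ideal = prime_above_is_ideal[OF P]
lemmas P_poly = is_ideal_polyset[OF R_ring P_ideal]

lemma tb_torsion: "k < r \<Longrightarrow> tb k \<in> torsion la"
  by (rule tate_torsion[OF tbase(1)])

lemma la0: "la \<noteq> 0" by simp

definition bmat :: "'q kbar poly mat" where "bmat = mat r r (\<lambda>(k, j). pair la j (tb k))"
definition D :: "'q kbar poly" where "D = det bmat"

lemma bmat_carrier: "bmat \<in> carrier_mat r r"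
  by (simp add: bmat_def)

lemma bmat_integral: "i < r \<Longrightarrow> j < r \<Longrightarrow> bmat $$ (i, j) \<in> polyset R"
  by (simp add: bmat_def pair_integral tb_torsion)

lemma D_integral: "D \<in> polyset R"
  unfolding D_def by (rule is_subring_det[OF R_poly bmat_carrier bmat_integral])

lemma lb_root: "poly (es l) \<zeta> = 0 \<Longrightarrow> poly lb \<zeta> = 0"
  using m_pos by (simp add: es.hom_power power_0_left)

lemma poly_eq_of_dvd: "lb dvd p - p' \<Longrightarrow> poly (es l) \<zeta> = 0 \<Longrightarrow> poly p \<zeta> = poly p' \<zeta>"
  using lb_root[of \<zeta>] by (auto elim!: dvdE simp: algebra_simps)

text \<open>A kernel vector of the matrix at \<zeta> gives a combination of the pairings that
  vanishes on the basis, hence by \<open>pair_act\<close> on all torsion points, against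
  \<open>pair_nondegenerate\<close>.\<close>

lemma D_root_nonzero:
  assumes \<zeta>: "poly (es l) \<zeta> = 0"
  shows "poly D \<zeta> \<noteq> 0"
proof
  let ?A = "map_mat (\<lambda>p. poly p \<zeta>) bmat"
  have A: "?A \<in> carrier_mat r r" using bmat_carrier by simp
  assume "poly D \<zeta> = 0"
  then have "det ?A = 0"
    unfolding D_def by (simp add: comm_ring_hom.hom_det[OF poly_hom.comm_ring_hom_axioms])
  then obtain v where v: "v \<in> carrier_vec r" "v \<noteq> 0\<^sub>v r" "?A *\<^sub>v v = 0\<^sub>v r"
    using det_0_iff_vec_prod_zero[OF A] by blast
  have base: "(\<Sum>j<r. v $ j * poly (pair la j (tb k)) \<zeta>) = 0" if "k < r" for k
  proof -
    have "(?A *\<^sub>v v) $ k = (\<Sum>j<r. v $ j * poly (pair la j (tb k)) \<zeta>)"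
      using that v(1) bmat_carrier by (simp add: scalar_prod_def bmat_def atLeast0LessThan mult.commute)
    then show ?thesis using v(3) that by simp
  qed
  have "v $ j = 0" if "j < r" for j
  proof (rule pair_nondegenerate[of la "\<lambda>j. v $ j" \<zeta>, OF _ _ that])
    show "degree la > 0" using m_pos n_pos by (simp add: deg_l_power)
    fix y assume "y \<in> torsion la"
    then obtain g where y: "y = (\<Sum>i<r. act (g i) (tb i))"
      using tuple_bij[of m] unfolding bij_betw_def by blast
    have "poly (pair la j y) \<zeta> = (\<Sum>i<r. poly (es (g i)) \<zeta> * poly (pair la j (tb i)) \<zeta>)" for j
    proof -
      have "poly (pair la j (act (g i) (tb i))) \<zeta> = poly (es (g i) * pair la j (tb i)) \<zeta>" if "i < r" for i
        by (rule poly_eq_of_dvd[OF pair_act[OF tb_torsion[OF that]] \<zeta>])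
      then show ?thesis unfolding y pair_sum poly_sum by simp
    qed
    then have "(\<Sum>j<r. v $ j * poly (pair la j y) \<zeta>) =
        (\<Sum>i<r. poly (es (g i)) \<zeta> * (\<Sum>j<r. v $ j * poly (pair la j (tb i)) \<zeta>))"
      unfolding sum_distrib_left by (subst sum.swap) (simp add: sum_distrib_left mult_ac)
    then show "(\<Sum>j<r. v $ j * poly (pair la j y) \<zeta>) = 0" by (simp add: base)
  qed
  then have "v = 0\<^sub>v r" using v(1) by (intro eq_vecI) auto
  then show False using v(2) by blast
qed

text \<open>The twist turns the pairing with \<tau>^j into that with \<tau>^(j + 1), which the
  companion matrix expresses in the basis.\<close>

lemma D_frobenius: "lb dvd ktw D - D * ek (det (cmat (Suc 0)))"
proof -
  let ?C = "map_mat ek (cmat (Suc 0))"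
  have C: "?C \<in> carrier_mat r r" by simp
  have "lb dvd det (map_mat ktw bmat) - det (bmat * ?C)"
  proof (rule det_cong_dvd[of _ r])
    fix k j assume kj: "k < r" "j < r"
    have "map_mat ktw bmat $$ (k, j) = pair la (Suc j) (tb k)"
      using kj by (simp add: bmat_def ktw_pair)
    moreover have "(bmat * ?C) $$ (k, j) = (\<Sum>i<r. ek (crep (Suc j) i) * pair la i (tb k))"
      using kj by (simp add: bmat_def cmat_def scalar_prod_def atLeast0LessThan mult.commute)
    ultimately show "lb dvd map_mat ktw bmat $$ (k, j) - (bmat * ?C) $$ (k, j)"
      using pair_crep[OF tb_torsion[OF kj(1)]] by simp
  qed (use bmat_carrier in auto)
  then show ?thesis unfolding ktw.hom_det det_mult[OF bmat_carrier C] D_def ek.hom_det .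
qed

lemma root_integral: "poly (es l) \<zeta> = 0 \<Longrightarrow> \<zeta> \<in> R"
proof -
  assume "poly (es l) \<zeta> = 0"
  moreover have "map_poly \<iota> (emb l) = es l" by (rule ek_emb)
  moreover have "lead_coeff (emb l) = [:lead_coeff l:]" by simp
  then have "lead_coeff (emb l) = 1" unfolding monic_primes_monic[OF l] const_hom.hom_one .
  ultimately show ?thesis unfolding integral_closure_A_def by (intro CollectI exI[of _ "emb l"]) simp
qed

lemma poly_integral: "p \<in> polyset R \<Longrightarrow> z \<in> R \<Longrightarrow> poly p z \<in> R"
  unfolding poly_altdef
  by (intro is_subring_sum[OF R_ring] integral_closure_A_mult integral_closure_A_power) (auto dest: polysetD)

lemma iota_not_P: "\<not> f dvd c \<Longrightarrow> \<iota> c \<notin> P"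
  by (rule prime_above_not_mem[OF P monic_primes_irreducible[OF f]])

lemma scal_not_P: "c \<noteq> 0 \<Longrightarrow> scal c \<notin> P"
proof (rule iota_not_P)
  assume "c \<noteq> 0"
  then show "\<not> f dvd [:c:]" using dvd_imp_degree_le[of f "[:c:]"] monic_primes_degree[OF f] by auto
qed

text \<open>Otherwise \<lambda>(\<theta>) would be congruent to \<lambda>(\<zeta>) = 0 modulo
  \<open>P\<close>, although \<open>f\<close> does not divide \<lambda>.\<close>

lemma root_not_theta:
  assumes "poly (es l) \<zeta> = 0"
  shows "\<zeta> - \<iota> [:0, 1:] \<notin> P"
proof
  let ?t = "\<iota> [:0, 1:] :: 'q kbar"
  assume *: "\<zeta> - ?t \<in> P"
  have pw: "\<zeta> ^ k - ?t ^ k \<in> P" for k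
    using ideal_cong_prod[OF R_ring P_ideal, of "{..<k}" "\<lambda>_. \<zeta>" "\<lambda>_. ?t"] root_integral[OF assms] * by simp
  have "poly (es l) \<zeta> - poly (es l) ?t = (\<Sum>k\<le>degree l. scal (coeff l k) * (\<zeta> ^ k - ?t ^ k))"
    by (simp add: poly_altdef degree_map_poly coeff_map_poly sum_subtractf right_diff_distrib)
  also have "\<dots> \<in> P" by (intro is_ideal_sum[OF P_ideal] is_idealD(4)[OF P_ideal] pw) simp
  finally have "- poly (es l) ?t \<in> P" using assms by simp
  then have "poly (es l) ?t \<in> P" using prime_above_uminus[OF P] by fastforce
  moreover have "poly (es l) ?t = \<iota> (poly (emb l) [:0, 1:])"
    unfolding ek_emb[symmetric] by (rule iota.poly_map_poly_hom)
  ultimately have "\<iota> l \<in> P" by (simp only: poly_emb_theta)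
  moreover have "\<not> f dvd l" using monic_primes_dvd_imp_eq[OF f l] fl by blast
  ultimately show False using iota_not_P by blast
qed

lemma P_mult_notin: "x \<in> R \<Longrightarrow> y \<in> R \<Longrightarrow> x \<notin> P \<Longrightarrow> y \<notin> P \<Longrightarrow> x * y \<notin> P"
  using prime_above_prime[OF P] by blast

lemma P_power_notin: "x \<in> R \<Longrightarrow> x \<notin> P \<Longrightarrow> x ^ k \<notin> P"
  by (induction k) (simp_all add: prime_above_1[OF P] P_mult_notin integral_closure_A_power)

text \<open>At the root \<zeta>^q, \<open>D_frobenius\<close> says that D(\<zeta>)^q equals
  \<epsilon> (\<zeta>^q - \<theta>) D(\<zeta>^q), where the factor is outside \<open>P\<close> by
  \<open>root_not_theta\<close>; iterate.\<close>

lemma D_root_frobenius: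
  assumes "poly (es l) \<zeta> = 0"
  shows "poly (es l) (\<zeta> ^ CARD('q) ^ i) = 0 \<and>
    (\<exists>u. u \<in> R \<and> u \<notin> P \<and> poly D \<zeta> ^ CARD('q) ^ i = u * poly D (\<zeta> ^ CARD('q) ^ i))"
proof (induction i)
  case 0
  then show ?case using assms by (auto intro!: exI[of _ 1] simp: prime_above_1[OF P])
next
  case (Suc i)
  let ?z = "\<zeta> ^ CARD('q) ^ i" and ?y = "\<zeta> ^ CARD('q) ^ Suc i"
  obtain u where u: "u \<in> R" "u \<notin> P" "poly D \<zeta> ^ CARD('q) ^ i = u * poly D ?z" using Suc by blast
  have y: "?y = ?z ^ CARD('q)" by (simp add: mult.commute flip: power_mult)
  have "poly (es l) ?y = poly (es l) ?z ^ CARD('q)"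
    unfolding y using kfrob.poly_map_poly_hom[of "es l" ?z] unfolding ktw_es .
  then have root: "poly (es l) ?y = 0" using Suc by (simp add: power_0_left)
  define w where "w = scal \<epsilon> * (?y - \<iota> [:0, 1:])"
  have w: "poly (ek (det (cmat (Suc 0)))) ?y = w"
    unfolding det_cmat_1 iota.map_poly_hom_smult ek_pCons poly_smult w_def iota.hom_uminus by simp
  have "poly D ?z ^ CARD('q) = poly (ktw D) ?y" unfolding y by (rule kfrob.poly_map_poly_hom[symmetric])
  also have "\<dots> = w * poly D ?y"
    using poly_eq_of_dvd[OF D_frobenius root] unfolding poly_mult w by (simp only: mult.commute)
  finally have "poly D \<zeta> ^ CARD('q) ^ Suc i = (u ^ CARD('q) * w) * poly D ?y"
    using u(3) by (simp add: power_mult mult.commute[of "CARD('q)"] power_mult_distrib)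
  moreover have w1: "w \<in> R" unfolding w_def
    by (rule integral_closure_A_mult[OF integral_closure_A_iota integral_closure_A_diff[OF root_integral[OF root] integral_closure_A_iota]])
  moreover have "w \<notin> P" unfolding w_def
    by (rule P_mult_notin[OF integral_closure_A_iota integral_closure_A_diff[OF root_integral[OF root] integral_closure_A_iota]
          scal_not_P root_not_theta[OF root]]) (use \<kappa>r in simp)
  then have "u ^ CARD('q) * w \<notin> P"
    by (rule P_mult_notin[OF integral_closure_A_power[OF u(1)] w1 P_power_notin[OF u(1,2)]])
  moreover have "u ^ CARD('q) * w \<in> R" by (rule integral_closure_A_mult[OF integral_closure_A_power[OF u(1)] w1])
  ultimately show ?case using root by blast
qed

text \<open>Since $\zeta^{q^n} = \zeta$, the relation above reads $D(\zeta)^{q^n} = u D(\zeta)$ with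
  \<open>u\<close> prime to \<open>P\<close>.\<close>
lemma D_root_not_P:
  assumes "poly (es l) \<zeta> = 0"
  shows "poly D \<zeta> \<notin> P" "poly D \<zeta> \<in> R"
proof -
  show R: "poly D \<zeta> \<in> R" by (rule poly_integral[OF D_integral root_integral[OF assms]])
  have "es l dvd es ([:0, 1:] ^ CARD('q) ^ n - [:0, 1:])"
    by (rule es.hom_dvd) (rule poly_little_fermat[OF monic_primes_irreducible[OF l]])
  then obtain w where w: "es ([:0, 1:] ^ CARD('q) ^ n - [:0, 1:]) = es l * w" by (elim dvdE)
  have "poly (es ([:0, 1:] ^ CARD('q) ^ n - [:0, 1:])) \<zeta> = \<zeta> ^ CARD('q) ^ n - \<zeta>"
    unfolding es.hom_minus es.hom_power by (simp add: es_pCons)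
  then have cyc: "\<zeta> ^ CARD('q) ^ n = \<zeta>" using assms unfolding w by simp
  obtain u where u: "u \<in> R" "u \<notin> P" "poly D \<zeta> ^ CARD('q) ^ n = u * poly D \<zeta>"
    using D_root_frobenius[OF assms, of n] unfolding cyc by blast
  obtain N where N: "CARD('q) ^ n = Suc N" using not0_implies_Suc[of "CARD('q) ^ n"] by auto
  \<comment> \<open>Cancelling the nonzero value D(\<zeta>) leaves a power of it that is outside
    \<open>P\<close>.\<close>
  have "poly D \<zeta> ^ N = u" using u(3) D_root_nonzero[OF assms] unfolding N by simp
  moreover have "N \<noteq> 0"
    using N one_less_power[OF card_field_gt_1[where 'q = 'q] n_pos] by auto
  ultimately show "poly D \<zeta> \<notin> P"
    using u R prime_above_mult[OF P integral_closure_A_power[of "poly D \<zeta>" "N - 1"], of "poly D \<zeta>"]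
    by (cases N) (auto simp: mult.commute)
qed

text \<open>For every root \<open>x\<close> of \<lambda> the difference D - D(x) is divisible by t -
  x. The product over all roots is divisible by \<lambda>(t) and has the form e + D G with
  \<open>e\<close> up to sign the product of the values, hence outside \<open>P\<close>. Raising it
  to the power q^m, which is at least the m-th, reaches \<lambda>(t)^m and keeps this form, as the
  q-power map is additive.\<close>

lemma D_inverse:
  obtains D' e where "D' \<in> polyset R" "e \<in> R" "e \<notin> P" "lb dvd D * D' - [:e:]"
proof -
  obtain A where A: "size A = degree (es l)" "es l = smult (lead_coeff (es l)) (\<Prod>x\<in>#A. [:- x, 1:])"
    using alg_closed_imp_factorization[of "es l"] by auto
  have lc: "lead_coeff (es l) = 1" using monic_primes_monic[OF l] by simp
  define p where "p = (\<Prod>x\<in>#A. D - [:poly D x:])"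
  have dvd: "es l dvd p"
  proof -
    have "(\<Prod>x\<in>#A. [:- x, 1:]) dvd (\<Prod>x\<in>#A. D - [:poly D x:])" for A
    proof (induction A)
      case (add x A)
      then show ?case unfolding image_mset_add_mset prod_mset.add_mset by (rule mult_dvd_mono[OF linear_dvd_minus_value])
    qed simp
    then show ?thesis using A(2) unfolding lc p_def by simp
  qed
  have root: "poly (es l) x = 0" if "x \<in># A" for x
  proof -
    have "[:- x, 1:] dvd (\<Prod>x\<in>#A. [:- x, 1:])" using that by (intro dvd_prod_mset) auto
    then show ?thesis using A(2) unfolding lc poly_eq_0_iff_dvd by simp
  qed
  have "\<exists>e G. e \<in> R \<and> e \<notin> P \<and> G \<in> polyset R \<and> (\<Prod>x\<in>#B. D - [:poly D x:]) = [:e:] + D * G"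
    if "\<And>x. x \<in># B \<Longrightarrow> poly (es l) x = 0" for B
    using that
  proof (induction B)
    case empty
    have "(1 :: 'q kbar poly) = [:1:] + D * 0" by simp
    then show ?case using prime_above_1[OF P] is_subringD(2)[OF R_poly]
      by (intro exI[of _ 1] exI[of _ 0]) auto
  next
    case (add x B)
    then obtain e G where IH: "e \<in> R" "e \<notin> P" "G \<in> polyset R" "(\<Prod>x\<in>#B. D - [:poly D x:]) = [:e:] + D * G"
      by auto
    let ?d = "poly D x"
    have d: "?d \<in> R" "?d \<notin> P" using D_root_not_P[of x] add.prems by auto
    have "(\<Prod>x\<in>#add_mset x B. D - [:poly D x:]) = [:- (?d * e):] + D * ([:e:] + (D - [:?d:]) * G)"
      using IH(4) by (simp add: algebra_simps)
    moreover have "- (?d * e) \<in> R" "- (?d * e) \<notin> P"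
      using d IH prime_above_uminus[OF P, of "- (?d * e)"] P_mult_notin[of ?d e]
      by (auto intro: integral_closure_A_uminus integral_closure_A_mult)
    moreover have "[:e:] + (D - [:?d:]) * G \<in> polyset R"
      using d IH by (intro is_subringD[OF R_poly] polyset_const[OF R_ring] D_integral)
    ultimately show ?case by blast
  qed
  from this[of A] root obtain e G where eG: "e \<in> R" "e \<notin> P" "G \<in> polyset R" "p = [:e:] + D * G"
    unfolding p_def by blast
  let ?Q = "CARD('q) ^ m"
  obtain N where N: "?Q = Suc N" using not0_implies_Suc[of ?Q] by auto
  then have DQ: "D ^ ?Q = D * D ^ N" by simp
  have "m \<le> ?Q" using power_gt_expt[of "CARD('q)" m] card_field_gt_1[where 'q = 'q] by simp
  then have "lb dvd es l ^ ?Q" unfolding es.hom_power by (rule le_imp_power_dvd)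
  also have "es l ^ ?Q dvd p ^ ?Q" by (rule dvd_power_same[OF dvd])
  also have "p ^ ?Q = [:e ^ ?Q:] + D * (D ^ N * G ^ ?Q)"
    unfolding eG(4) kpoly_frobenius_add power_mult_distrib poly_const_pow DQ mult.assoc ..
  finally have "lb dvd - (D * (- (D ^ N * G ^ ?Q)) - [:e ^ ?Q:])" by (simp add: algebra_simps)
  then have "lb dvd D * (- (D ^ N * G ^ ?Q)) - [:e ^ ?Q:]" by (simp only: dvd_minus_iff)
  moreover have pow: "z ^ k \<in> polyset R" if "z \<in> polyset R" for z k
    using is_subring_prod[OF R_poly, of "{..<k}" "\<lambda>_. z"] that by simp
  have "- (D ^ N * G ^ ?Q) \<in> polyset R"
    by (intro is_subringD[OF R_poly] pow D_integral eG)
  ultimately show ?thesis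
    using that eG P_power_notin integral_closure_A_power by blast
qed

text \<open>The ideal of $R[t]$ generated by \<open>P\<close> and $\lambda(t)^m$.\<close>
definition J :: "'q kbar poly set"
  where "J = {p \<in> polyset R. \<exists>v\<in>polyset R. p - lb * v \<in> polyset P}"

lemma lb_integral: "lb \<in> polyset R" by (rule es_integral)

lemma J_ideal: "is_ideal (polyset R) J"
  unfolding is_ideal_def
proof (intro conjI ballI)
  show "J \<subseteq> polyset R" by (auto simp: J_def)
  show "0 \<in> J" using is_subringD(2)[OF R_poly] is_idealD(1)[OF P_poly] by (auto simp: J_def intro!: bexI[of _ 0])
  fix x assume "x \<in> J"
  then obtain v where x: "x \<in> polyset R" "v \<in> polyset R" "x - lb * v \<in> polyset P" by (auto simp: J_def)
  show "x + y \<in> J" if yJ: "y \<in> J" for y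
  proof -
    obtain w where y: "y \<in> polyset R" "w \<in> polyset R" "y - lb * w \<in> polyset P" using yJ by (auto simp: J_def)
    have "x + y - lb * (v + w) \<in> polyset P" using is_idealD(3)[OF P_poly x(3) y(3)] by (simp add: algebra_simps)
    then show ?thesis unfolding J_def using x y is_subringD(4)[OF R_poly] by blast
  qed
  show "s * x \<in> J" if "s \<in> polyset R" for s
  proof -
    have "s * x - lb * (s * v) \<in> polyset P" using is_idealD(4)[OF P_poly that x(3)] by (simp add: algebra_simps)
    then show ?thesis unfolding J_def using x that is_subringD(6)[OF R_poly] by blast
  qed
qed

lemma lb_monic: "degree lb = m * n" "coeff lb (m * n) = 1"
proof -
  show "degree lb = m * n" by (simp add: degree_map_poly deg_l_power)
  have "lead_coeff la = 1" using monic_primes_monic[OF l] by (simp add: lead_coeff_power)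
  then show "coeff lb (m * n) = 1" by (simp add: deg_l_power)
qed

lemma J_dvd: "p \<in> polyset R \<Longrightarrow> lb dvd p \<Longrightarrow> p \<in> J"
proof -
  assume p: "p \<in> polyset R" "lb dvd p"
  then obtain v where v: "p = lb * v" by (elim dvdE)
  have "v \<in> polyset R"
  proof (rule monic_mult_polyset[OF lb_monic])
    show "coeff (lb * v) j \<in> R" for j using p v by (auto dest: polysetD)
  qed (auto intro: integral_closure_A_diff integral_closure_A_mult)
  then show "p \<in> J" unfolding J_def using p v is_idealD(1)[OF P_poly] by (auto intro!: bexI[of _ v])
qed

lemma J_P: "p \<in> polyset P \<Longrightarrow> p \<in> J"
  unfolding J_def using is_idealD(2)[OF P_poly] is_subringD(2)[OF R_poly] by (auto intro!: bexI[of _ 0])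

lemma J_diff: "x \<in> J \<Longrightarrow> y \<in> J \<Longrightarrow> x - y \<in> J"
  by (rule is_ideal_diff[OF R_poly J_ideal])

end

lemma mat_mult_entry:
  assumes "A \<in> carrier_mat r n" "B \<in> carrier_mat n k" "i < r" "j < k"
  shows "(A * B) $$ (i, j) = (\<Sum>p<n. A $$ (i, p) * B $$ (p, j))"
  using assms by (simp add: scalar_prod_def atLeast0LessThan)

section \<open>Frobenius and the matrix of \<tau>^d\<close>

context drinfeld_frobenius
begin

abbreviation "d \<equiv> degree f"
abbreviation "zb k \<equiv> inv_into UNIV \<sigma> (tb k)"
abbreviation "Mm \<equiv> map_mat es (gM \<sigma> m)"
abbreviation "Cm \<equiv> map_mat ek (cmat d)"

lemma zb_torsion: "k < r \<Longrightarrow> zb k \<in> torsion la"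
  using tate_torsion[OF galois_tate[OF galois_inv[OF \<sigma>] tbase(1)], of k m] by simp

lemma zb_expand: "k < r \<Longrightarrow> zb k = (\<Sum>i<r. act (gmat \<sigma> k i m) (tb i))"
  using coord_sum[OF galois_tate[OF galois_inv[OF \<sigma>] tbase(1)], of k m] by (simp add: gmat_def)

lemma P_power: "x \<in> P \<Longrightarrow> 0 < N \<Longrightarrow> x ^ N \<in> P"
  using prime_above_mult[OF P integral_closure_A_power[OF prime_above_integral[OF P]], of x x "N - 1"]
  by (cases N) (simp_all add: mult.commute)

text \<open>\<open>tb k\<close> is the image of \<open>zb k\<close> under \<open>\<sigma>\<close>,
  hence congruent to its power with exponent q^d modulo \<open>P\<close>; in the pairing this power
  amounts to \<open>d\<close> further factors \<tau>.\<close>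

lemma pair_galois:
  assumes k: "k < r"
  shows "pair la j (tb k) - pair la (d + j) (zb k) \<in> polyset P"
proof -
  define u v where "u i = act ([:0, 1:] ^ i) (tb k)" and "v i = act ([:0, 1:] ^ i) (zb k)" for i
  have "\<sigma> (zb k) = tb k"
    using \<sigma> by (simp add: galois_K_def bij_is_surj surj_f_inv_f)
  then have uv: "u i = \<sigma> (v i)" for i unfolding u_def v_def galois_act[OF \<sigma>] by simp
  have vR: "v i \<in> R" for i unfolding v_def by (rule torsion_integral[OF la0 torsion_act'[OF zb_torsion[OF k]]])
  have P': "u i ^ CARD('q) ^ j - v i ^ CARD('q) ^ (d + j) \<in> P" for i
  proof -
    have "u i - v i ^ CARD('q) ^ d \<in> P" unfolding uv by (rule frob[OF vR])
    then have "(u i - v i ^ CARD('q) ^ d) ^ CARD('q) ^ j \<in> P" by (rule P_power) simp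
    then show ?thesis unfolding kbar_frobenius_diff by (simp add: power_add flip: power_mult)
  qed
  have "pair la j (tb k) - pair la (d + j) (zb k) =
    (\<Sum>i<degree la. smult (u i ^ CARD('q) ^ j - v i ^ CARD('q) ^ (d + j)) (es (poly_shift (Suc i) la)))"
    unfolding pair_def u_def v_def by (simp only: sum_subtractf smult_diff_left)
  also have "\<dots> \<in> polyset P"
    by (intro is_ideal_sum[OF P_poly] polysetI)
       (auto simp: coeff_map_poly mult.commute intro!: prime_above_mult[OF P integral_closure_A_iota] P')
  finally show ?thesis .
qed

lemma pair_zb:
  assumes k: "k < r"
  shows "pair la j (zb k) - (\<Sum>i<r. es (gmat \<sigma> k i m) * pair la j (tb i)) \<in> J"
proof (rule J_dvd)
  have "lb dvd (\<Sum>i<r. pair la j (act (gmat \<sigma> k i m) (tb i)) - es (gmat \<sigma> k i m) * pair la j (tb i))"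
    by (intro dvd_sum pair_act tb_torsion) simp
  then show "lb dvd pair la j (zb k) - (\<Sum>i<r. es (gmat \<sigma> k i m) * pair la j (tb i))"
    unfolding zb_expand[OF k] pair_sum sum_subtractf .
  show "pair la j (zb k) - (\<Sum>i<r. es (gmat \<sigma> k i m) * pair la j (tb i)) \<in> polyset R"
    by (intro is_subringD[OF R_poly] is_subring_sum[OF R_poly] pair_integral zb_torsion tb_torsion la0 es_integral k) simp
qed

lemma Mm_carrier: "Mm \<in> carrier_mat r r" and Cm_carrier: "Cm \<in> carrier_mat r r"
  by simp_all

lemma MB_entry: "k < r \<Longrightarrow> j < r \<Longrightarrow> (Mm * bmat) $$ (k, j) = (\<Sum>i<r. es (gmat \<sigma> k i m) * pair la j (tb i))"
  by (simp add: bmat_def scalar_prod_def atLeast0LessThan)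

lemma MBC_entry: "k < r \<Longrightarrow> j < r \<Longrightarrow> (Mm * bmat * Cm) $$ (k, j) = (\<Sum>i<r. (Mm * bmat) $$ (k, i) * ek (crep (d + j) i))"
  using bmat_carrier by (subst index_mult_mat) (auto simp: scalar_prod_def atLeast0LessThan cmat_def intro!: sum.cong)

lemma MB_integral: "k < r \<Longrightarrow> j < r \<Longrightarrow> (Mm * bmat) $$ (k, j) \<in> polyset R"
  unfolding MB_entry
  by (intro is_subring_sum[OF R_poly] is_subringD[OF R_poly] es_integral pair_integral tb_torsion la0) simp

text \<open>Three replacements: the Frobenius congruence trades \<open>tb k\<close> for
  \<open>zb k\<close> and \<tau>^j for \<tau>^(d + j); the matrix of \<tau>^d returns to the basis;
  the Galois matrix expands \<open>zb k\<close>.\<close>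

lemma bmat_cong:
  assumes k: "k < r" and j: "j < r"
  shows "bmat $$ (k, j) - (Mm * bmat * Cm) $$ (k, j) \<in> J"
proof -
  have "pair la (d + j) (zb k) - (\<Sum>i<r. ek (crep (d + j) i) * pair la i (zb k)) \<in> J"
    by (intro J_dvd pair_crep zb_torsion k is_subringD[OF R_poly] is_subring_sum[OF R_poly] pair_integral la0 ek_integral)
  moreover have "(\<Sum>i<r. ek (crep (d + j) i) * (pair la i (zb k) - (Mm * bmat) $$ (k, i))) \<in> J"
    by (intro is_ideal_sum[OF J_ideal] is_idealD(4)[OF J_ideal] ek_integral) (simp add: MB_entry[OF k] pair_zb[OF k])
  moreover have "pair la j (tb k) - pair la (d + j) (zb k) \<in> J" by (rule J_P[OF pair_galois[OF k]])
  ultimately have "(pair la j (tb k) - pair la (d + j) (zb k)) +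
     (pair la (d + j) (zb k) - (\<Sum>i<r. ek (crep (d + j) i) * pair la i (zb k))) +
     (\<Sum>i<r. ek (crep (d + j) i) * (pair la i (zb k) - (Mm * bmat) $$ (k, i))) \<in> J"
    by (intro is_idealD(3)[OF J_ideal])
  moreover have "bmat $$ (k, j) = pair la j (tb k)" using k j by (simp add: bmat_def)
  ultimately show ?thesis
    unfolding MBC_entry[OF k j] right_diff_distrib sum_subtractf by (simp add: mult.commute)
qed

lemma MBC_integral: "k < r \<Longrightarrow> j < r \<Longrightarrow> (Mm * bmat * Cm) $$ (k, j) \<in> polyset R"
  unfolding MBC_entry
  by (intro is_subring_sum[OF R_poly] is_subringD[OF R_poly] ek_integral MB_integral) simp_all

lemma D_cong: "D - det Mm * D * ek (det (cmat d)) \<in> J"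
proof -
  have c: "Mm * bmat \<in> carrier_mat r r" by (rule mult_carrier_mat[OF Mm_carrier bmat_carrier])
  have "det bmat - det (Mm * bmat * Cm) \<in> J"
    by (rule ideal_cong_det[OF R_poly J_ideal bmat_carrier bmat_integral _ MBC_integral bmat_cong])
       (use c in auto)
  then show ?thesis
    unfolding det_mult[OF c Cm_carrier] det_mult[OF Mm_carrier bmat_carrier] ek.hom_det D_def .
qed

lemmas R_poly2 = is_subring_polyset[OF R_poly]
lemmas J_poly = is_ideal_polyset[OF R_poly J_ideal]

text \<open>From $B \equiv M B C$ one gets $M B (X C - 1) \equiv (X - M) B$; now take determinants.\<close>
lemma char_poly_cong1:
  "det Mm * D * ek (coeff (wpoly d) k) - coeff (char_poly Mm) k * D \<in> J"
proof -
  let ?c = "map_mat (\<lambda>c. [:c:]) :: 'q kbar poly mat \<Rightarrow> _"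
  interpret pek: map_poly_comm_ring_hom ek ..
  let ?E = "map_mat (map_poly ek) (wmat d)"
  let ?F = "char_poly_matrix Mm"
  have cE: "?E \<in> carrier_mat r r" by (simp add: wmat_def)
  have cM: "?c Mm \<in> carrier_mat r r" and cB: "?c bmat \<in> carrier_mat r r" using bmat_carrier by simp_all
  have cMB: "?c Mm * ?c bmat \<in> carrier_mat r r" by (rule mult_carrier_mat[OF cM cB])
  have cF: "?F \<in> carrier_mat r r" by (rule char_poly_matrix_closed[OF Mm_carrier])
  have cMBE: "?c Mm * ?c bmat * ?E \<in> carrier_mat r r" by (rule mult_carrier_mat[OF cMB cE])
  have cFB: "?F * ?c bmat \<in> carrier_mat r r" by (rule mult_carrier_mat[OF cF cB])
  have E: "?E $$ (i, j) = [:- (if i = j then 1 else 0), ek (crep (d + j) i):]" if "i < r" "j < r" for i j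
    using that by (simp add: wmat_def cmat_def ek.map_poly_pCons_hom ek.hom_uminus ek.hom_one)
  have F: "?F $$ (i, j) = [:- es (gmat \<sigma> i j m), if i = j then 1 else 0:]" if "i < r" "j < r" for i j
    using that by (simp add: char_poly_matrix_def)
  have MB: "(?c Mm * ?c bmat) $$ (i, j) = [:(Mm * bmat) $$ (i, j):]" if "i < r" "j < r" for i j
    using that bmat_carrier by (simp add: scalar_prod_def const_hom.hom_sum mult.commute)
  have csum: "(\<Sum>i<r. [:a i, b i:]) = [:\<Sum>i<r. a i, \<Sum>i<r. b i:]" for a b :: "nat \<Rightarrow> 'q kbar poly" and r
    by (induction r) simp_all
  have A: "(?c Mm * ?c bmat * ?E) $$ (k, j) = [:- (Mm * bmat) $$ (k, j), (Mm * bmat * Cm) $$ (k, j):]" (is "?L = ?R")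
    if kj: "k < r" "j < r" for k j
  proof -
    have "?L = (\<Sum>i<r. [:(Mm * bmat) $$ (k, i):] * [:- (if i = j then 1 else 0), ek (crep (d + j) i):])"
      unfolding mat_mult_entry[OF cMB cE kj] by (rule sum.cong) (simp_all only: MB E kj lessThan_iff)
    also have "\<dots> = (\<Sum>i<r. [:if i = j then - (Mm * bmat) $$ (k, j) else 0, (Mm * bmat) $$ (k, i) * ek (crep (d + j) i):])"
      by (rule sum.cong) auto
    also have "\<dots> = ?R" unfolding csum MBC_entry[OF kj] using kj by simp
    finally show ?thesis .
  qed
  have B: "(?F * ?c bmat) $$ (k, j) = [:- (Mm * bmat) $$ (k, j), bmat $$ (k, j):]" (is "?L = ?R")
    if kj: "k < r" "j < r" for k j
  proof -
    have "?L = (\<Sum>i<r. [:- es (gmat \<sigma> k i m), if k = i then 1 else 0:] * [:bmat $$ (i, j):])"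
      unfolding mat_mult_entry[OF cF cB kj]
      by (rule sum.cong) (use kj bmat_carrier in \<open>simp_all add: F del: mult_pCons_left mult_pCons_right\<close>)
    also have "\<dots> = (\<Sum>i<r. [:- (es (gmat \<sigma> k i m) * bmat $$ (i, j)), if k = i then bmat $$ (k, j) else 0:])"
      by (rule sum.cong) auto
    also have "\<dots> = ?R" unfolding csum MB_entry[OF kj] sum_negf using kj by (simp add: bmat_def)
    finally show ?thesis .
  qed
  have two: "[:x, y:] \<in> polyset S" if "x \<in> S" "y \<in> S" "0 \<in> S" for x y :: "'q kbar poly" and S
    using that by (intro polysetI) (auto simp: coeff_pCons split: nat.splits)
  have "det (?c Mm * ?c bmat * ?E) - det (?F * ?c bmat) \<in> polyset J"
  proof (rule ideal_cong_det[OF R_poly2 J_poly cMBE _ cFB])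
    fix i j assume ij: "i < r" "j < r"
    show "(?c Mm * ?c bmat * ?E) $$ (i, j) \<in> polyset (polyset R)"
      unfolding A[OF ij] by (intro two is_subringD[OF R_poly] MB_integral MBC_integral ij)
    show "(?F * ?c bmat) $$ (i, j) \<in> polyset (polyset R)"
      unfolding B[OF ij] by (intro two is_subringD[OF R_poly] MB_integral bmat_integral ij)
    have "- (bmat $$ (i, j) - (Mm * bmat * Cm) $$ (i, j)) \<in> J"
      by (rule is_ideal_uminus[OF R_poly J_ideal bmat_cong[OF ij]])
    then have "[:0, (Mm * bmat * Cm) $$ (i, j) - bmat $$ (i, j):] \<in> polyset J"
      by (intro two is_idealD(1)[OF J_ideal]) simp
    then show "(?c Mm * ?c bmat * ?E) $$ (i, j) - (?F * ?c bmat) $$ (i, j) \<in> polyset J"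
      unfolding A[OF ij] B[OF ij] by simp
  qed
  moreover have "det (?c Mm * ?c bmat * ?E) = [:det Mm * D:] * map_poly ek (wpoly d)"
    unfolding det_mult[OF cMB cE] det_mult[OF cM cB] const_hom.hom_det pek.hom_det wpoly_def D_def by (simp add: mult.commute)
  moreover have "det (?F * ?c bmat) = [:D:] * char_poly Mm"
    unfolding det_mult[OF cF cB] const_hom.hom_det char_poly_def D_def by (rule mult.commute)
  ultimately have "[:det Mm * D:] * map_poly ek (wpoly d) - [:D:] * char_poly Mm \<in> polyset J" by simp
  from polysetD[OF this, of k] show ?thesis by (simp add: coeff_map_poly mult_ac)
qed

lemma char_poly_Mm: "coeff (char_poly Mm) k = es (coeff (char_poly (gM \<sigma> m)) k)"
  by (subst es.char_poly_hom) (auto simp: coeff_map_poly)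

text \<open>Multiplying \<open>char_poly_cong1\<close> by the determinant of C and inserting
  \<open>D_cong\<close> makes the unknown determinant of M disappear.\<close>

lemma char_poly_cong2:
  "D * ek (det (cmat d) * emb (coeff (char_poly (gM \<sigma> m)) k) - coeff (wpoly d) k) \<in> J"
proof -
  define W c x where "W = ek (coeff (wpoly d) k)" and "c = ek (det (cmat d))" and "x = coeff (char_poly Mm) k"
  have "c * (det Mm * D * W - x * D) \<in> J"
    unfolding W_def c_def x_def by (rule is_idealD(4)[OF J_ideal ek_integral char_poly_cong1])
  moreover have "W * (D - det Mm * D * c) \<in> J"
    unfolding W_def c_def by (rule is_idealD(4)[OF J_ideal ek_integral D_cong])
  ultimately have "- (c * (det Mm * D * W - x * D) + W * (D - det Mm * D * c)) \<in> J"
    by (intro is_ideal_uminus[OF R_poly J_ideal] is_idealD(3)[OF J_ideal])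
  then have "D * (c * x - W) \<in> J" by (simp add: algebra_simps)
  then show ?thesis
    by (simp add: W_def c_def x_def char_poly_Mm ek.hom_minus ek.hom_mult ek_emb)
qed

text \<open>By \<open>D_inverse\<close>, \<open>D\<close> is invertible modulo \<open>J\<close> up
  to a factor outside \<open>P\<close>; primality of \<open>P\<close> removes this factor in
  \<open>smult_P\<close>.\<close>

lemma J_cancel_D:
  assumes "D * y \<in> J" "y \<in> polyset R"
  obtains e where "e \<in> R" "e \<notin> P" "smult e y \<in> J"
proof -
  obtain D' e where D': "D' \<in> polyset R" "e \<in> R" "e \<notin> P" "lb dvd D * D' - [:e:]" by (rule D_inverse)
  have "D * D' - [:e:] \<in> J"
    by (intro J_dvd D' is_subringD[OF R_poly] D_integral polyset_const[OF R_ring])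
  then have "D' * (D * y) - y * (D * D' - [:e:]) \<in> J"
    by (rule J_diff[OF is_idealD(4)[OF J_ideal D'(1) assms(1)] is_idealD(4)[OF J_ideal assms(2)]])
  then have "smult e y \<in> J" by (simp add: algebra_simps)
  then show ?thesis using that D' by blast
qed

lemma smult_P:
  assumes e: "e \<in> R" "e \<notin> P" and "smult e (ek y) \<in> polyset P"
  shows "[:f:] dvd y"
proof -
  have "f dvd coeff y i" for i
  proof -
    have "e * \<iota> (coeff y i) \<in> P" using polysetD[OF assms(3), of i] by simp
    then have "\<iota> (coeff y i) \<in> P" using prime_above_prime[OF P e(1) integral_closure_A_iota] e(2) by blast
    then show ?thesis using iota_not_P by blast
  qed
  then show ?thesis by (simp add: const_poly_dvd_iff)
qed

abbreviation "c\<^sub>f \<equiv> \<epsilon> ^ d"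

lemma det_cmat_mod: "[:f:] dvd det (cmat d) - emb (smult c\<^sub>f f)"
proof -
  have "[:f:] dvd [:[:c\<^sub>f:]:] * (emb f - (\<Prod>i<d. [:- ([:0, 1:] ^ CARD('q) ^ i), 1:]))"
    by (rule dvd_mult[OF emb_irreducible_cong[OF f]])
  moreover have "emb (smult c\<^sub>f f) = [:[:c\<^sub>f:]:] * emb f"
    by (simp add: const_hom.map_poly_hom_smult)
  ultimately have "[:f:] dvd - (det (cmat d) - emb (smult c\<^sub>f f))"
    unfolding det_cmat by (simp add: algebra_simps)
  then show ?thesis by (simp only: dvd_minus_iff)
qed

text \<open>Modulo \<open>P\<close> and \<lambda>(t)^m the two sides agree up to a factor outside
  \<open>P\<close>. Both the remainder modulo \<lambda>^m and, by hypothesis, the coefficient of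
  \<open>wpoly\<close> have degree below that of \<lambda>(t)^m in t, which leaves no room for a
  multiple of this monic polynomial: they agree modulo \<open>P\<close>, hence modulo
  \<open>f\<close>.\<close>

lemma char_coeff_mod:
  assumes W: "coeff (wpoly d) k \<in> lowdeg (m * n)"
  shows "[:f:] dvd emb (smult c\<^sub>f f * coeff (char_poly (gM \<sigma> m)) k mod la) - coeff (wpoly d) k"
proof -
  define ch where "ch = coeff (char_poly (gM \<sigma> m)) k"
  define g h where "g = smult c\<^sub>f f * ch mod la" and "h = smult c\<^sub>f f * ch div la"
  have gh: "smult c\<^sub>f f * ch = la * h + g" unfolding g_def h_def by simp
  let ?W = "coeff (wpoly d) k"
  obtain e where e: "e \<in> R" "e \<notin> P" "smult e (ek (det (cmat d) * emb ch - ?W)) \<in> J"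
    using J_cancel_D[OF char_poly_cong2[of k] ek_integral] unfolding ch_def by blast
  obtain z where z: "det (cmat d) - emb (smult c\<^sub>f f) = [:f:] * z" using det_cmat_mod by (elim dvdE)
  have "det (cmat d) * emb ch - ?W = [:f:] * (z * emb ch) + emb la * emb h + (emb g - ?W)"
  proof -
    have "det (cmat d) * emb ch = ([:f:] * z + emb (smult c\<^sub>f f)) * emb ch" by (simp only: z[symmetric] diff_add_cancel)
    also have "\<dots> = [:f:] * (z * emb ch) + emb (smult c\<^sub>f f * ch)"
      unfolding distrib_right emb.hom_mult mult.assoc ..
    finally show ?thesis unfolding gh emb.hom_add emb.hom_mult by simp
  qed
  then have split: "smult e (ek (det (cmat d) * emb ch - ?W)) =
     smult e (ek ([:f:] * (z * emb ch))) + lb * smult e (es h) + smult e (ek (emb g - ?W))"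
    by (simp only: ek.hom_add ek.hom_mult ek_emb smult_add_right mult_smult_right)
  have fP: "smult e (ek ([:f:] * y)) \<in> polyset P" for y
  proof (rule polysetI)
    fix i
    have "coeff (smult e (ek ([:f:] * y))) i = (e * \<iota> (coeff y i)) * \<iota> f"
      by (simp add: coeff_map_poly iota.hom_mult)
    also have "\<dots> \<in> P"
      by (rule prime_above_mult[OF P integral_closure_A_mult[OF e(1) integral_closure_A_iota] prime_above_dvd[OF P dvd_refl]])
    finally show "coeff (smult e (ek ([:f:] * y))) i \<in> P" .
  qed
  obtain v where v: "v \<in> polyset R" "smult e (ek (det (cmat d) * emb ch - ?W)) - lb * v \<in> polyset P"
    using e(3) by (auto simp: J_def)
  define v' where "v' = v - smult e (es h)"
  have 1: "smult e (ek (emb g - ?W)) - lb * v' \<in> polyset P"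
    using is_ideal_diff[OF R_poly P_poly v(2) fP[of "z * emb ch"]] unfolding split v'_def by (simp add: algebra_simps)
  have low: "coeff (emb g - ?W) i = 0" if "i \<ge> m * n" for i
  proof -
    have "coeff g i = 0" using mod_in_lowdeg[of "smult c\<^sub>f f * ch" m] that unfolding g_def lowdeg_def by blast
    moreover have "coeff ?W i = 0" using W that unfolding lowdeg_def by blast
    ultimately show ?thesis by (simp add: coeff_map_poly)
  qed
  \<comment> \<open>In degrees \<open>m * n\<close> and above only the multiple of \<open>lb\<close>
    contributes, and \<open>lb\<close> is monic.\<close>
  have "v' \<in> polyset P"
  proof (rule monic_mult_polyset[OF lb_monic])
    fix j assume "j \<ge> m * n"
    then have "coeff (smult e (ek (emb g - ?W))) j = 0"
      using low[of j] by (simp add: coeff_map_poly del: coeff_diff)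
    then have "- coeff (lb * v') j \<in> P" using polysetD[OF 1, of j] by (simp only: coeff_diff diff_0)
    from prime_above_uminus[OF P this] show "coeff (lb * v') j \<in> P" by (simp only: minus_minus)
  qed (auto simp: prime_above_0[OF P] coeff_map_poly intro: prime_above_diff[OF P] prime_above_mult[OF P])
  from is_idealD(3)[OF P_poly 1 is_idealD(4)[OF P_poly lb_integral this]]
  have "smult e (ek (emb g - ?W)) \<in> polyset P" by simp
  from smult_P[OF e(1,2) this] show ?thesis unfolding g_def ch_def .
qed

end

section \<open>The characteristic polynomial over K\<close>

text \<open>Euclid's argument: f^2 + 1 is prime to \<open>f\<close>.\<close>

lemma exists_other_monic_prime:
  assumes "f \<in> (monic_primes :: 'q::field poly set)"
  obtains l where "l \<in> monic_primes - {f}"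
proof -
  have f: "degree f > 0" "\<not> is_unit f"
    using monic_primes_degree[OF assms] monic_primes_irreducible[OF assms] irreducible_not_unit by blast+
  then have "degree (f * f + 1) > 0" by (cases "f = 0") (auto simp: degree_add_eq_left degree_mult_eq)
  then obtain l where l: "irreducible l" "l dvd f * f + 1" "lead_coeff l = 1" by (rule irreducible_factor_exists)
  have "l \<noteq> f"
  proof
    assume "l = f"
    then have "f dvd (f * f + 1) - f * f" using l by (intro dvd_diff) auto
    then show False using f by simp
  qed
  then show ?thesis using that[of l] l by (simp add: monic_primes_def monics_def)
qed

lemma adic_mod_le: "a \<in> adic l \<Longrightarrow> a (m + k) mod l ^ m = a m"
proof (induction k)
  case (Suc k)
  have "a (m + Suc k) mod l ^ m = a (Suc (m + k)) mod l ^ (m + k) mod l ^ m"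
    by (simp add: mod_mod_cancel le_imp_power_dvd)
  then show ?case using Suc by (simp flip: adicD)
qed (simp add: adic_mod)

lemma char_poly_cong_dvd:
  fixes A B :: "'a::comm_ring_1 mat"
  assumes "A \<in> carrier_mat n n" "B \<in> carrier_mat n n"
    and "\<And>i j. i < n \<Longrightarrow> j < n \<Longrightarrow> z dvd A $$ (i, j) - B $$ (i, j)"
  shows "z dvd coeff (char_poly A) k - coeff (char_poly B) k"
proof -
  have "[:z:] dvd det (char_poly_matrix A) - det (char_poly_matrix B)"
  proof (rule det_cong_dvd[OF char_poly_matrix_closed[OF assms(1)] char_poly_matrix_closed[OF assms(2)]])
    fix i j assume ij: "i < n" "j < n"
    obtain w where "A $$ (i, j) - B $$ (i, j) = z * w" using assms(3)[OF ij] by (elim dvdE)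
    then have "char_poly_matrix A $$ (i, j) - char_poly_matrix B $$ (i, j) = [:z:] * [:- w:]"
      using ij assms by (simp add: char_poly_matrix_def algebra_simps)
    then show "[:z:] dvd char_poly_matrix A $$ (i, j) - char_poly_matrix B $$ (i, j)" by (rule dvdI)
  qed
  then have "z dvd coeff (det (char_poly_matrix A) - det (char_poly_matrix B)) k"
    by (elim dvdE) (simp only: coeff_pCons_0 mult_pCons_left mult_zero_left pCons_0_0 add_0_right coeff_smult dvd_triv_left)
  then show ?thesis by (simp add: char_poly_def)
qed

text \<open>Distinct constants are incongruent modulo \<open>f\<close>, so a polynomial in t over
  F_q is determined by its class.\<close>

lemma emb_unique_mod:
  fixes f :: "'a::field poly"
  assumes f: "degree f > 0" and "[:f:] dvd emb u - W" "[:f:] dvd emb v - W"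
  shows "u = v"
proof (rule poly_eqI)
  fix i
  have "[:f:] dvd (emb u - W) - (emb v - W)" using assms by (rule_tac dvd_diff)
  then have "f dvd coeff ((emb u - W) - (emb v - W)) i" unfolding const_poly_dvd_iff by blast
  then have "f dvd [:coeff u i - coeff v i:]" by (simp add: coeff_map_poly)
  then show "coeff u i = coeff v i"
    using dvd_imp_degree_le[of f "[:coeff u i - coeff v i:]"] f by fastforce
qed

context drinfeld
begin

lemma frobenius_trace_bound:
  assumes "[:f:] dvd emb u - coeff (wpoly (degree f)) k" and f: "degree f > 0" and "coeff u j \<noteq> 0"
  shows "r * j \<le> k * degree f"
proof (rule ccontr)
  assume "\<not> ?thesis"
  then have "coeff (coeff (wpoly (degree f)) k) j = 0" using wpoly_bound by blast
  moreover have "f dvd coeff (emb u - coeff (wpoly (degree f)) k) j" using assms(1) unfolding const_poly_dvd_iff by blast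
  ultimately have "f dvd [:coeff u j:]" by (simp add: coeff_map_poly)
  then show False using dvd_imp_degree_le[of f "[:coeff u j:]"] f assms(3) by fastforce
qed

text \<open>By \<open>char_coeff_mod\<close> the coefficients multiplied by \<open>v\<close> and
  reduced modulo \<lambda>^m lift those of \<open>wpoly\<close>, in which neither \<lambda> nor
  \<open>\<sigma>\<close> occurs. Since such a lift is unique, one polynomial \<open>u k\<close>
  serves for all \<lambda>, all Frobenius elements and all large \<open>m\<close>, so u k / v is the
  coefficient.\<close>

theorem frob_dual_poly_coeffs:
  assumes f: "f \<in> monic_primes"
  obtains u where "\<And>k. coeff (frob_dual_poly \<phi> f) k = Fract (u k) (smult (\<epsilon> ^ degree f) f)"
    "u r = smult (\<epsilon> ^ degree f) f" "\<And>k. k > r \<Longrightarrow> u k = 0" "u 0 = [:(- 1) ^ r:]"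
    "\<And>k j. coeff (u k) j \<noteq> 0 \<Longrightarrow> r * j \<le> k * degree f"
proof -
  define d where "d = degree f"
  define v where "v = smult (\<epsilon> ^ d) f"
  have d: "d > 0" unfolding d_def by (rule monic_primes_degree[OF f])
  have v0: "v \<noteq> 0" using \<kappa>r monic_primes_nonzero[OF f] by (simp add: v_def)
  have key: "[:f:] dvd emb (v * coeff (char_poly (drinfeld_tate.gM \<phi> r l \<sigma> m)) k mod l ^ m) - coeff (wpoly d) k"
    if l: "l \<in> monic_primes - {f}" and \<sigma>: "\<sigma> \<in> frobenius_at f" and k: "k \<le> r" and m: "m > d" for l \<sigma> k m
  proof -
    obtain P where P: "\<sigma> \<in> galois_K" "prime_above f P"
      "\<And>x. x \<in> integral_closure_A \<Longrightarrow> \<sigma> x - x ^ (CARD('q) ^ degree f) \<in> P"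
      using \<sigma> unfolding frobenius_at_def by blast
    interpret drinfeld_frobenius \<phi> \<kappa> \<kappa>\<^sub>r r l f \<sigma> P m
      by unfold_locales (use l f P m in auto)
    \<comment> \<open>For \<open>k\<close> at most \<open>r\<close> the weight bound gives degree at
      most \<open>d\<close> in t, which is less than \<open>m\<close>.\<close>
    have "coeff (wpoly d) k \<in> lowdeg (m * degree l)"
      unfolding lowdeg_def
    proof (intro CollectI allI impI)
      fix j assume j: "m * degree l \<le> j"
      have "m * 1 \<le> m * degree l" using n_pos by (intro mult_le_mono) auto
      then have "d < j" using j m by linarith
      then have "r * d < r * j" using r_ge by simp
      moreover have "k * d \<le> r * d" using k by simp
      ultimately show "coeff (coeff (wpoly d) k) j = 0" using wpoly_bound[of d k j] by linarith
    qed
    from char_coeff_mod[OF this[unfolded d_def]] show ?thesis unfolding v_def d_def .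
  qed
  define u where "u k = (if k \<le> r then (THE u. [:f:] dvd emb u - coeff (wpoly d) k) else 0)" for k
  obtain lz :: "'q poly" where lz: "lz \<in> monic_primes - {f}" by (rule exists_other_monic_prime[OF f])
  obtain \<sigma>0 where \<sigma>0: "\<sigma>0 \<in> frobenius_at f" using frobenius_exists[OF monic_primes_irreducible[OF f]] by blast
  have u: "[:f:] dvd emb (u k) - coeff (wpoly d) k" if "k \<le> r" for k
  proof -
    note K = key[OF lz \<sigma>0 that lessI]
    have uniq: "w = w'" if "[:f:] dvd emb w - coeff (wpoly d) k" "[:f:] dvd emb w' - coeff (wpoly d) k" for w w'
      by (rule emb_unique_mod[OF d[unfolded d_def] that])
    show ?thesis
      using theI[of "\<lambda>u. [:f:] dvd emb u - coeff (wpoly d) k", OF K uniq[OF _ K]] that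
      unfolding u_def by (simp only: if_True)
  qed
  have rep: "l ^ m dvd v * coeff (char_poly (drinfeld_tate.gM \<phi> r l \<sigma> m)) k - u k"
    if L: "l \<in> monic_primes - {f}" and S: "\<sigma> \<in> frobenius_at f" for l \<sigma> k m
  proof -
    interpret drinfeld_tate \<phi> \<kappa> \<kappa>\<^sub>r r l by unfold_locales (use L in auto)
    have \<sigma>K: "\<sigma> \<in> galois_K" using S by (simp add: frobenius_at_def)
    show ?thesis
    proof (cases "k \<le> r")
      case False
      have "degree (char_poly (gM \<sigma> m)) = r" using degree_monic_char_poly[of "gM \<sigma> m" r] by simp
      then show ?thesis using False by (simp add: u_def coeff_eq_0)
    next
      case True
      \<comment> \<open>The congruence is known only beyond level \<open>d\<close>, so it is taken
        at a higher level and reduced.\<close>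
      define M where "M = Suc (m + d)"
      define x y where "x = coeff (char_poly (gM \<sigma> M)) k" and "y = coeff (char_poly (gM \<sigma> m)) k"
      have "v * x mod l ^ M = u k"
        unfolding x_def by (rule emb_unique_mod[OF d[unfolded d_def] key[OF L S True] u[OF True]]) (simp add: M_def)
      then have "l ^ M dvd v * x - u k" by (metis dvd_minus_mod)
      moreover have "l ^ m dvd l ^ M" unfolding M_def by (rule le_imp_power_dvd) simp
      ultimately have 1: "l ^ m dvd v * x - u k" using dvd_trans by blast
      have "l ^ m dvd x - y"
        unfolding x_def y_def
      proof (rule char_poly_cong_dvd)
        fix i j assume ij: "i < r" "j < r"
        have "gmat \<sigma> i j m = gmat \<sigma> i j M mod l ^ m"
          using adic_mod_le[OF gmat_adic[OF \<sigma>K ij], of m "Suc d"] by (simp add: M_def)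
        then have "l ^ m dvd gmat \<sigma> i j M - gmat \<sigma> i j m" by (metis dvd_minus_mod)
        then show "l ^ m dvd gM \<sigma> M $$ (i, j) - gM \<sigma> m $$ (i, j)" using ij by simp
      qed auto
      then have "l ^ m dvd (v * x - u k) - v * (x - y)" by (intro dvd_diff[OF 1] dvd_mult)
      then show ?thesis unfolding y_def by (simp add: algebra_simps)
    qed
  qed
  define Q where "Q = (\<Sum>k\<le>r. monom (Fract (u k) v) k)"
  have Q: "coeff Q k = Fract (u k) v" for k
  proof (cases "k \<le> r")
    case True
    then show ?thesis by (simp add: Q_def coeff_sum)
  next
    case False
    then show ?thesis using v0 by (simp add: Q_def coeff_sum u_def fract_collapse)
  qed
  have isd: "is_dual_char_poly \<phi> l \<sigma> Q" if L: "l \<in> monic_primes - {f}" and S: "\<sigma> \<in> frobenius_at f" for l \<sigma>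
  proof -
    interpret drinfeld_tate \<phi> \<kappa> \<kappa>\<^sub>r r l by unfold_locales (use L in auto)
    have \<sigma>K: "\<sigma> \<in> galois_K" using S by (simp add: frobenius_at_def)
    have "\<not> l dvd v"
    proof
      assume "l dvd v"
      then have "l dvd f" using \<kappa>r by (simp add: v_def dvd_smult_iff)
      then show False using monic_primes_dvd_imp_eq[of l f] L f by blast
    qed
    then show ?thesis
      by (intro is_dual_char_polyI[OF \<sigma>K]) (use rep[OF L S] in \<open>auto simp: adic_represents_def Q\<close>)
  qed
  have "frob_dual_poly \<phi> f = Q"
    unfolding frob_dual_poly_def
  proof (rule the_equality)
    show "\<forall>l\<in>monic_primes - {f}. \<forall>\<sigma>\<in>frobenius_at f. is_dual_char_poly \<phi> l \<sigma> Q" using isd by blast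
    \<comment> \<open>Uniqueness rests on an actual prime \<open>lz\<close> and an actual Frobenius
      element \<open>\<sigma>0\<close>.\<close>
    fix Q' assume Q': "\<forall>l\<in>monic_primes - {f}. \<forall>\<sigma>\<in>frobenius_at f. is_dual_char_poly \<phi> l \<sigma> Q'"
    interpret drinfeld_tate \<phi> \<kappa> \<kappa>\<^sub>r r lz by unfold_locales (use lz in auto)
    have "\<sigma>0 \<in> galois_K" using \<sigma>0 by (simp add: frobenius_at_def)
    from dual_char_poly_unique[OF this _ isd[OF lz \<sigma>0]] show "Q' = Q" using Q' lz \<sigma>0 by blast
  qed
  \<comment> \<open>The characteristic polynomial is monic, so powers of \<open>lz\<close> beyond
    the degree of v - u r divide this difference.\<close>
  moreover have "u r = v"
  proof (rule ccontr)
    assume ne: "u r \<noteq> v"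
    interpret drinfeld_tate \<phi> \<kappa> \<kappa>\<^sub>r r lz by unfold_locales (use lz in auto)
    define m where "m = Suc (degree (v - u r))"
    have "lead_coeff (char_poly (gM \<sigma>0 m)) = 1" "degree (char_poly (gM \<sigma>0 m)) = r"
      using degree_monic_char_poly[of "gM \<sigma>0 m" r] by auto
    then have "lz ^ m dvd v - u r" using rep[OF lz \<sigma>0, of m r] by simp
    then have "m * degree lz \<le> degree (v - u r)" using ne dvd_imp_degree_le[of "lz ^ m" "v - u r"] by (simp only: deg_l_power right_minus_eq) simp
    moreover have "m * 1 \<le> m * degree lz" using n_pos by (intro mult_le_mono) auto
    ultimately show False by (simp add: m_def)
  qed
  moreover have "u 0 = [:(- 1) ^ r:]"
  proof (rule emb_unique_mod[OF d[unfolded d_def] u[of 0]])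
    have "emb [:(- 1) ^ r :: 'q:] = [:[:(- 1) ^ r:]:]" by simp
    also have "\<dots> = (- 1) ^ r" by (simp only: const_hom.hom_power const_hom.hom_uminus const_hom.hom_one)
    finally show "[:f:] dvd emb [:(- 1) ^ r:] - coeff (wpoly d) 0" by (simp only: wpoly_0 diff_self dvd_0_right)
  qed simp
  moreover have "r * j \<le> k * degree f" if "coeff (u k) j \<noteq> 0" for k j
  proof (cases "k \<le> r")
    case True
    show ?thesis by (rule frobenius_trace_bound[OF u[OF True, unfolded d_def] d[unfolded d_def] that])
  qed (use that in \<open>simp add: u_def\<close>)
  ultimately show ?thesis using that[of u] Q by (simp add: v_def d_def u_def)
qed

end

section \<open>Schur polynomials\<close>

text \<open>With values in any ring, so that it can be taken at the roots as well as at the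
  variables \<open>mvar\<close>.\<close>

definition alt :: "nat \<Rightarrow> (nat \<Rightarrow> 'a::comm_ring_1) \<Rightarrow> (nat \<Rightarrow> nat) \<Rightarrow> 'a"
  where "alt r x e = det (mat r r (\<lambda>(i, j). x j ^ e i))"

definition root_poly :: "nat \<Rightarrow> (nat \<Rightarrow> 'a::comm_ring_1) \<Rightarrow> 'a poly"
  where "root_poly r x = (\<Prod>j<r. [:- x j, 1:])"

lemma poly_root_poly: "poly (root_poly r x) z = (\<Prod>j<r. z - x j)"
  by (simp add: root_poly_def poly_prod)

lemma root_poly_monic: "coeff (root_poly r x) r = 1 \<and> degree (root_poly r x) \<le> r"
proof (induction r)
  case (Suc r)
  have *: "root_poly (Suc r) x = pCons 0 (root_poly r x) - smult (x r) (root_poly r x)"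
    by (simp add: root_poly_def)
  have "degree (pCons 0 (root_poly r x)) \<le> Suc r" using Suc by (simp add: degree_pCons_le le_trans)
  moreover have "degree (smult (x r) (root_poly r x)) \<le> Suc r"
    using Suc degree_smult_le[of "x r" "root_poly r x"] by linarith
  ultimately have "degree (root_poly (Suc r) x) \<le> Suc r" unfolding * by (rule degree_diff_le)
  moreover have "coeff (root_poly r x) (Suc r) = 0" using Suc by (intro coeff_eq_0) simp
  ultimately show ?case using Suc unfolding * by simp
qed (simp add: root_poly_def)

text \<open>The coordinates of $z^l$ modulo a monic polynomial \<open>P\<close> of degree \<open>r\<close>.\<close>
primrec pow_red :: "'a::comm_ring_1 poly \<Rightarrow> nat \<Rightarrow> nat \<Rightarrow> nat \<Rightarrow> 'a" where
  "pow_red P r 0 = (\<lambda>k. if k = 0 then 1 else 0)"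
| "pow_red P r (Suc l) = (\<lambda>k. (if k = 0 then 0 else pow_red P r l (k - 1)) - pow_red P r l (r - 1) * coeff P k)"

lemma pow_red_root:
  assumes r: "r > 0" and P: "coeff P r = 1" "degree P \<le> r" and z: "poly P z = 0"
  shows "z ^ l = (\<Sum>k<r. pow_red P r l k * z ^ k)"
proof (induction l)
  case 0
  have "(\<Sum>k<r. pow_red P r 0 k * z ^ k) = (\<Sum>k<r. if k = 0 then 1 else 0)"
    by (rule sum.cong) auto
  then show ?case using r by simp
next
  case (Suc l)
  define c where "c = pow_red P r l"
  obtain r' where r': "r = Suc r'" using r by (cases r) auto
  have "0 = (\<Sum>k\<le>r. coeff P k * z ^ k)"
    unfolding z[symmetric] poly_altdef
    by (rule sum.mono_neutral_left) (use P in \<open>auto simp: coeff_eq_0\<close>)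
  then have zr: "z ^ r = - (\<Sum>k<r. coeff P k * z ^ k)"
    using P(1) by (simp add: lessThan_Suc_atMost[symmetric] eq_neg_iff_add_eq_0 add.commute)
  have "z ^ Suc l = (\<Sum>k<r. c k * z ^ Suc k)"
    unfolding power_Suc Suc c_def by (simp add: sum_distrib_left mult_ac)
  also have "\<dots> = (\<Sum>k<r'. c k * z ^ Suc k) + c (r - 1) * z ^ r" unfolding r' by simp
  also have "(\<Sum>k<r'. c k * z ^ Suc k) = (\<Sum>k<r. (if k = 0 then 0 else c (k - 1)) * z ^ k)"
    unfolding r' sum.lessThan_Suc_shift by simp
  also have "\<dots> + c (r - 1) * z ^ r = (\<Sum>k<r. pow_red P r (Suc l) k * z ^ k)"
    unfolding zr pow_red.simps c_def by (simp add: left_diff_distrib sum_subtractf sum_distrib_left mult.assoc)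
  finally show ?case .
qed

text \<open>The Schur value in terms of the coefficients of \<open>P\<close>: reducing the powers
  z^(p_i + r - 1 - i) modulo \<open>P\<close> gives the matrix that takes the Vandermonde matrix to
  the alternant matrix. For \<open>P\<close> over K the value is visibly in K, and its order at
  infinity can be estimated.\<close>

definition schur_val :: "'a::comm_ring_1 poly \<Rightarrow> nat \<Rightarrow> (nat \<Rightarrow> nat) \<Rightarrow> 'a"
  where "schur_val P r p = det (mat r r (\<lambda>(i, k). pow_red P r (p i + (r - 1 - i)) (r - 1 - k)))"

lemma schur_val_alt:
  fixes x :: "nat \<Rightarrow> 'a::comm_ring_1"
  assumes r: "r > 0"
  shows "schur_val (root_poly r x) r p * alt r x (\<lambda>i. r - 1 - i) = alt r x (\<lambda>i. p i + (r - 1 - i))"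
proof -
  let ?P = "root_poly r x"
  define C where "C = mat r r (\<lambda>(i, k). pow_red ?P r (p i + (r - 1 - i)) (r - 1 - k))"
  define V where "V = mat r r (\<lambda>(i, j). x j ^ (r - 1 - i))"
  have cC: "C \<in> carrier_mat r r" and cV: "V \<in> carrier_mat r r" by (simp_all add: C_def V_def)
  have "mat r r (\<lambda>(i, j). x j ^ (p i + (r - 1 - i))) = C * V"
  proof (rule eq_matI)
    fix i j assume "i < dim_row (C * V)" "j < dim_col (C * V)"
    then have ij: "i < r" "j < r" using cC cV by auto
    have "poly ?P (x j) = 0" unfolding poly_root_poly by (rule prod_zero) (use ij in auto)
    then have "x j ^ (p i + (r - 1 - i)) = (\<Sum>k<r. pow_red ?P r (p i + (r - 1 - i)) k * x j ^ k)"
      using pow_red_root[OF r] root_poly_monic[of r x] by blast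
    also have "\<dots> = (\<Sum>k<r. pow_red ?P r (p i + (r - 1 - i)) (r - 1 - k) * x j ^ (r - 1 - k))"
      by (rule sum.reindex_bij_witness[of _ "\<lambda>k. r - 1 - k" "\<lambda>k. r - 1 - k"]) auto
    also have "\<dots> = (C * V) $$ (i, j)"
      unfolding mat_mult_entry[OF cC cV ij] by (rule sum.cong) (use ij in \<open>auto simp: C_def V_def\<close>)
    finally show "mat r r (\<lambda>(i, j). x j ^ (p i + (r - 1 - i))) $$ (i, j) = (C * V) $$ (i, j)" using ij by simp
  qed (use cC cV in auto)
  then show ?thesis unfolding schur_val_def alt_def C_def[symmetric] V_def[symmetric]
    using det_mult[OF cC cV] by simp
qed

lemma pow_red_hom: "comm_ring_hom h \<Longrightarrow> h (pow_red P r l k) = pow_red (map_poly h P) r l k"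
proof (induction l arbitrary: k)
  case 0
  interpret comm_ring_hom h by fact
  show ?case by simp
next
  case (Suc l)
  interpret comm_ring_hom h by fact
  show ?case using Suc by (simp add: hom_minus hom_mult)
qed

lemma schur_val_hom:
  assumes "comm_ring_hom h"
  shows "h (schur_val P r p) = schur_val (map_poly h P) r p"
proof -
  interpret comm_ring_hom h by fact
  have "map_mat h (mat r r (\<lambda>(i, k). pow_red P r (p i + (r - 1 - i)) (r - 1 - k))) =
      mat r r (\<lambda>(i, k). pow_red (map_poly h P) r (p i + (r - 1 - i)) (r - 1 - k))"
    by (rule eq_matI) (auto simp: pow_red_hom[OF assms])
  then show ?thesis unfolding schur_val_def hom_det[symmetric] by simp
qed

lemma root_poly_hom:
  assumes "comm_ring_hom h"
  shows "map_poly h (root_poly r x) = root_poly r (\<lambda>j. h (x j))"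
proof -
  interpret comm_ring_hom h by fact
  interpret m: map_poly_comm_ring_hom h ..
  show ?thesis by (simp add: root_poly_def m.hom_prod map_poly_pCons_hom hom_uminus)
qed

lemma alt_hom:
  assumes "comm_ring_hom h"
  shows "h (alt r x e) = alt r (\<lambda>j. h (x j)) e"
proof -
  interpret comm_ring_hom h by fact
  have "map_mat h (mat r r (\<lambda>(i, j). x j ^ e i)) = mat r r (\<lambda>(i, j). h (x j) ^ e i)"
    by (rule eq_matI) (auto simp: hom_power)
  then show ?thesis unfolding alt_def hom_det[symmetric] by simp
qed

lemma poly_low_degree: "degree p < r \<Longrightarrow> poly p (z :: 'a::comm_ring_1) = (\<Sum>k<r. coeff p (r - 1 - k) * z ^ (r - 1 - k))"
proof -
  assume "degree p < r"
  then have "poly p z = (\<Sum>k<r. coeff p k * z ^ k)"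
    unfolding poly_altdef by (intro sum.mono_neutral_left) (auto simp: coeff_eq_0)
  also have "\<dots> = (\<Sum>k<r. coeff p (r - 1 - k) * z ^ (r - 1 - k))"
    by (rule sum.reindex_bij_witness[of _ "\<lambda>k. r - 1 - k" "\<lambda>k. r - 1 - k"]) auto
  finally show ?thesis .
qed

text \<open>Lagrange interpolation: the coefficients of the products of X - x_l over l \<noteq> i
  form a matrix that makes the Vandermonde matrix diagonal with nonzero entries.\<close>

lemma vandermonde_nonzero:
  fixes x :: "nat \<Rightarrow> 'a::idom"
  assumes "\<And>i j. i < r \<Longrightarrow> j < r \<Longrightarrow> i \<noteq> j \<Longrightarrow> x i \<noteq> x j"
  shows "alt r x (\<lambda>i. r - 1 - i) \<noteq> 0"
proof -
  define p where "p i = (\<Prod>l\<in>{..<r} - {i}. [:- x l, 1:])" for i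
  define V where "V = mat r r (\<lambda>(i, j). x j ^ (r - 1 - i))"
  define E where "E = mat r r (\<lambda>(i, k). coeff (p i) (r - 1 - k))"
  have cE: "E \<in> carrier_mat r r" and cV: "V \<in> carrier_mat r r" by (simp_all add: E_def V_def)
  have EV: "(E * V) $$ (i, j) = (if i = j then poly (p i) (x i) else 0)" if ij: "i < r" "j < r" for i j
  proof -
    have deg: "degree (p i) < r" using ij unfolding p_def degree_prod_linear by simp
    have "(E * V) $$ (i, j) = poly (p i) (x j)"
      unfolding mat_mult_entry[OF cE cV ij] poly_low_degree[OF deg]
      by (intro sum.cong) (use ij in \<open>auto simp: E_def V_def\<close>)
    moreover have "poly (p i) (x j) = 0" if "i \<noteq> j"
      unfolding p_def poly_prod by (rule prod_zero) (use that ij in auto)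
    ultimately show ?thesis by auto
  qed
  have cEV: "E * V \<in> carrier_mat r r" using cE cV by simp
  have "det (E * V) = prod_list (diag_mat (E * V))"
    by (rule det_upper_triangular[OF _ cEV]) (use EV cE cV in auto)
  also have "\<dots> \<noteq> 0"
    unfolding prod_list_zero_iff
  proof
    assume "0 \<in> set (diag_mat (E * V))"
    then obtain i where i: "i < r" "(E * V) $$ (i, i) = 0" using cEV by (auto simp: diag_mat_def)
    then have "poly (p i) (x i) = 0" using EV by simp
    then show False using assms i by (auto simp: p_def poly_prod)
  qed
  finally show ?thesis unfolding det_mult[OF cE cV] by (auto simp: alt_def V_def)
qed

section \<open>Evaluation of the formal Schur polynomials\<close>

definition mpol_mono :: "(nat \<Rightarrow> 'a::comm_ring_1) \<Rightarrow> (nat \<Rightarrow>\<^sub>0 nat) \<Rightarrow> 'a"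
  where "mpol_mono x m = (\<Prod>i\<in>Poly_Mapping.keys m. x i ^ Poly_Mapping.lookup m i)"

lemma mpol_mono_superset:
  "finite A \<Longrightarrow> Poly_Mapping.keys m \<subseteq> A \<Longrightarrow> mpol_mono x m = (\<Prod>i\<in>A. x i ^ Poly_Mapping.lookup m i)"
  unfolding mpol_mono_def by (rule prod.mono_neutral_left) (auto simp: in_keys_iff)

lemma mpol_mono_add: "mpol_mono x (m + n) = mpol_mono x m * mpol_mono x n"
proof -
  let ?A = "Poly_Mapping.keys m \<union> Poly_Mapping.keys n"
  have "mpol_mono x (m + n) = (\<Prod>i\<in>?A. x i ^ Poly_Mapping.lookup (m + n) i)"
    by (rule mpol_mono_superset) (use Poly_Mapping.keys_add[of m n] in auto)
  then show ?thesis
    by (simp add: mpol_mono_superset[of ?A m] mpol_mono_superset[of ?A n] lookup_add power_add prod.distrib)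
qed

lemma mpol_eval_pm_extend: "mpol_eval S x = pm_extend (\<lambda>m c. of_int c * mpol_mono x m) S"
  by (simp add: mpol_eval_def pm_extend_def mpol_mono_def)

lemma mpol_eval_hom: "comm_ring_hom (\<lambda>S. mpol_eval S x)"
proof -
  let ?g = "\<lambda>m c. of_int c * mpol_mono x m"
  interpret pm_additive ?g by standard (simp add: algebra_simps)
  have "pm_extend ?g (Poly_Mapping.single 0 1) = 1" unfolding extend_single by (simp add: mpol_mono_def)
  then have 1: "mpol_eval 1 x = 1" unfolding mpol_eval_pm_extend single_one .
  have 0: "mpol_eval 0 x = 0" unfolding mpol_eval_pm_extend by (rule extend_zero)
  have add: "mpol_eval (v + w) x = mpol_eval v x + mpol_eval w x" for v w
    unfolding mpol_eval_pm_extend by (rule extend_add)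
  have mult: "mpol_eval (v * w) x = mpol_eval v x * mpol_eval w x" for v w
    unfolding mpol_eval_pm_extend by (rule pm_extend_mult) (simp_all add: algebra_simps mpol_mono_add)
  show ?thesis by standard (rule 0 add 1 mult)+
qed

lemma mpol_eval_mvar: "mpol_eval (mvar j) x = x j"
  by (simp add: mpol_eval_def mvar_def)

text \<open>Evaluate at the distinct integers 0, ..., r - 1.\<close>

lemma alternant_nonzero: "alternant r (\<lambda>i. r - 1 - i) \<noteq> 0"
proof
  interpret comm_ring_hom "\<lambda>S. mpol_eval S int" by (rule mpol_eval_hom)
  assume "alternant r (\<lambda>i. r - 1 - i) = 0"
  then have "mpol_eval (alt r mvar (\<lambda>i. r - 1 - i)) int = 0"
    unfolding alternant_def alt_def by (simp only: hom_zero)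
  then have "alt r int (\<lambda>i. r - 1 - i) = 0"
    unfolding alt_hom[OF mpol_eval_hom] mpol_eval_mvar .
  moreover have "alt r int (\<lambda>i. r - 1 - i) \<noteq> 0" by (rule vandermonde_nonzero) simp
  ultimately show False by contradiction
qed

text \<open>The generic roots \<open>mvar\<close> solve the defining equation, and the nonzero
  alternant can be cancelled.\<close>

lemma schur_eq:
  assumes "r > 0"
  shows "schur r p = schur_val (root_poly r mvar) r p"
  unfolding schur_def
proof (rule the_equality)
  show *: "schur_val (root_poly r mvar) r p * alternant r (\<lambda>i. r - 1 - i) = alternant r (\<lambda>i. p i + (r - 1 - i))"
    using schur_val_alt[OF assms, of mvar p] by (simp add: alternant_def alt_def)
  fix S assume "S * alternant r (\<lambda>i. r - 1 - i) = alternant r (\<lambda>i. p i + (r - 1 - i))"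
  then show "S = schur_val (root_poly r mvar) r p"
    unfolding *[symmetric] by (rule iffD1[OF mult_right_cancel[OF alternant_nonzero]])
qed

lemma mpol_eval_schur: "r > 0 \<Longrightarrow> mpol_eval (schur r p) x = schur_val (root_poly r x) r p"
  by (simp add: schur_eq schur_val_hom[OF mpol_eval_hom] root_poly_hom[OF mpol_eval_hom] mpol_eval_mvar)

section \<open>The Cauchy identity\<close>

definition compositions :: "nat \<Rightarrow> nat \<Rightarrow> (nat \<Rightarrow> nat) set"
  where "compositions r N = {g \<in> {..<r} \<rightarrow>\<^sub>E UNIV. (\<Sum>i<r. g i) = N}"

text \<open>Strictly decreasing vectors are the sums of a partition and the staircase r - 1, ..., 1,
  0.\<close>

definition decreasing_compositions :: "nat \<Rightarrow> nat \<Rightarrow> (nat \<Rightarrow> nat) set"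
  where "decreasing_compositions r N = {g \<in> compositions r N. \<forall>i j. i < j \<longrightarrow> j < r \<longrightarrow> g j < g i}"

lemma finite_compositions [simp]: "finite (compositions r N)"
proof (rule finite_subset)
  show "compositions r N \<subseteq> {..<r} \<rightarrow>\<^sub>E {..N}"
  proof
    fix g assume g: "g \<in> compositions r N"
    then have "g i \<le> N" if "i < r" for i
      using member_le_sum[of i "{..<r}" g] that by (auto simp: compositions_def)
    then show "g \<in> {..<r} \<rightarrow>\<^sub>E {..N}" using g by (auto simp: compositions_def PiE_iff)
  qed
qed (simp add: finite_PiE)

lemma finite_decreasing_compositions [simp]: "finite (decreasing_compositions r N)"
  by (rule finite_subset[OF _ finite_compositions[of r N]]) (auto simp: decreasing_compositions_def)

lemma alt_cong:
  assumes "\<And>i. i < r \<Longrightarrow> e i = e' i" "\<And>i. i < r \<Longrightarrow> x i = x' i"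
  shows "alt r x e = alt r x' e'"
  unfolding alt_def by (rule arg_cong[where f = det], rule eq_matI) (use assms in auto)

lemma det_mat_leibniz:
  "det (mat r r (\<lambda>(i, j). f i j)) = (\<Sum>p | p permutes {0..<r}. signof p * (\<Prod>i<r. f i (p i)))"
proof -
  let ?A = "mat r r (\<lambda>(i, j). f i j)"
  have "det ?A = (\<Sum>p | p permutes {0..<r}. signof p * (\<Prod>i = 0..<r. ?A $$ (i, p i)))"
    by (rule det_def') simp
  also have "\<dots> = (\<Sum>p | p permutes {0..<r}. signof p * (\<Prod>i<r. f i (p i)))"
  proof (rule sum.cong[OF refl])
    fix p assume "p \<in> {p. p permutes {0..<r}}"
    then have "p i < r" if "i < r" for i using permutes_in_image[of p "{0..<r}" i] that by simp
    then show "signof p * (\<Prod>i = 0..<r. ?A $$ (i, p i)) = signof p * (\<Prod>i<r. f i (p i))"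
      by (intro arg_cong2[where f = "(*)"] prod.cong) auto
  qed
  finally show ?thesis .
qed

lemma alt_rows: "alt r x e = (\<Sum>p | p permutes {0..<r}. signof p * (\<Prod>i<r. x (p i) ^ e i))"
  unfolding alt_def by (rule det_mat_leibniz)

lemma alt_transpose: "alt r x e = det (mat r r (\<lambda>(i, j). x i ^ e j))"
proof -
  let ?A = "mat r r (\<lambda>(i, j). x j ^ e i)"
  have "det ?A = det (transpose_mat ?A)" by (rule det_transpose[of ?A r, OF mat_carrier, symmetric])
  also have "transpose_mat ?A = mat r r (\<lambda>(i, j). x i ^ e j)" by (rule eq_matI) auto
  finally show ?thesis by (simp only: alt_def)
qed

lemma alt_cols: "alt r x e = (\<Sum>p | p permutes {0..<r}. signof p * (\<Prod>i<r. x i ^ e (p i)))"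
  unfolding alt_transpose by (rule det_mat_leibniz)

lemma alt_permute:
  assumes "p permutes {0..<r}"
  shows "signof p * alt r x e = alt r x (e \<circ> p)"
proof -
  have "alt r x (e \<circ> p) = det (mat r r (\<lambda>(i, j). mat r r (\<lambda>(i, j). x j ^ e i) $$ (p i, j)))"
    unfolding alt_def
    by (rule arg_cong[where f = det], rule eq_matI) (use assms permutes_in_image[OF assms] in auto)
  also have "\<dots> = signof p * alt r x e"
    unfolding alt_def by (rule det_permute_rows[of "mat r r (\<lambda>(i, j). x j ^ e i)" r p, OF mat_carrier assms])
  finally show ?thesis ..
qed

lemma alt_not_inj:
  assumes "\<not> inj_on e {..<r}"
  shows "alt r x e = 0"
proof -
  obtain i j where "i < r" "j < r" "i \<noteq> j" "e i = e j" using assms by (auto simp: inj_on_def)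
  then show ?thesis unfolding alt_def
    by (intro det_identical_rows[of _ r i j]) (auto intro!: eq_vecI)
qed

text \<open>Counting larger values gives the permutation that sorts an injective \<open>g\<close>
  into decreasing order; it is the identity outside the range, as \<open>permutes\<close>
  demands.\<close>

definition rank_perm :: "nat \<Rightarrow> (nat \<Rightarrow> nat) \<Rightarrow> nat \<Rightarrow> nat"
  where "rank_perm r g i = (if i < r then card {j. j < r \<and> g i < g j} else i)"

lemma rank_perm_less: "i < r \<Longrightarrow> j < r \<Longrightarrow> g i < g j \<Longrightarrow> rank_perm r g j < rank_perm r g i"
  unfolding rank_perm_def by (auto intro!: psubset_card_mono)

lemma rank_perm_permutes:
  assumes "inj_on g {..<r}"
  shows "rank_perm r g permutes {0..<r}"
proof (rule bij_imp_permutes)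
  have inj: "inj_on (rank_perm r g) {0..<r}"
  proof (rule inj_onI)
    fix i j assume ij: "i \<in> {0..<r}" "j \<in> {0..<r}" "rank_perm r g i = rank_perm r g j"
    then have "\<not> g i < g j" "\<not> g j < g i" using rank_perm_less[of i r j g] rank_perm_less[of j r i g] by auto
    then show "i = j" using assms ij by (auto simp: inj_on_def)
  qed
  have "rank_perm r g i < r" if "i < r" for i
  proof -
    have "card {j. j < r \<and> g i < g j} < card {..<r}" using that by (intro psubset_card_mono) auto
    then show ?thesis using that by (simp add: rank_perm_def)
  qed
  then have "rank_perm r g ` {0..<r} \<subseteq> {0..<r}" by auto
  with inj show "bij_betw (rank_perm r g) {0..<r} {0..<r}"
    by (simp add: bij_betw_def endo_inj_surj)
qed (simp add: rank_perm_def)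

lemma rank_perm_decreasing:
  assumes p: "p permutes {0..<r}" and l: "\<And>i j. i < j \<Longrightarrow> j < r \<Longrightarrow> l j < (l i :: nat)"
  shows "rank_perm r (\<lambda>i\<in>{..<r}. l (p i)) = p"
proof
  fix i
  have less: "l j < l i \<longleftrightarrow> i < j" if "i < r" "j < r" for i j
    using l[of i j] l[of j i] that by (cases i j rule: linorder_cases) auto
  have pr: "p j < r \<longleftrightarrow> j < r" for j using permutes_in_image[OF p, of j] by simp
  show "rank_perm r (\<lambda>i\<in>{..<r}. l (p i)) i = p i"
  proof (cases "i < r")
    case True
    then have S: "{j. j < r \<and> l (p i) < l (p j)} = {j. j < r \<and> p j < p i}" using less pr by auto
    have "p ` {j. j < r \<and> p j < p i} = {..<p i}"
    proof
      show "{..<p i} \<subseteq> p ` {j. j < r \<and> p j < p i}"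
      proof
        fix k assume k: "k \<in> {..<p i}"
        obtain j where j: "k = p j" using permutes_surj[OF p] by blast
        have "p i < r" using pr True by simp
        then have "p j < r" using k j by simp
        then show "k \<in> p ` {j. j < r \<and> p j < p i}" using k j pr by auto
      qed
    qed auto
    moreover have "card (p ` {j. j < r \<and> p j < p i}) = card {j. j < r \<and> p j < p i}"
      by (rule card_image) (rule inj_on_subset[OF permutes_inj[OF p]], simp)
    ultimately have "card {j. j < r \<and> l (p i) < l (p j)} = p i" unfolding S by simp
    moreover have "{j. j < r \<and> (\<lambda>i\<in>{..<r}. l (p i)) i < (\<lambda>i\<in>{..<r}. l (p i)) j} = {j. j < r \<and> l (p i) < l (p j)}"
      using True by auto
    ultimately show ?thesis using True unfolding rank_perm_def by simp
  next
    case False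
    then show ?thesis using p by (simp add: rank_perm_def permutes_def)
  qed
qed

text \<open>The Cauchy-Binet formula in degree \<open>N\<close> for the infinite matrices of powers
  of \<open>x\<close> and of \<open>y\<close>. Vectors with repeated entries contribute 0; each
  other one is a decreasing vector composed with a unique permutation, and the signs assemble the
  alternant in \<open>x\<close>.\<close>

lemma cauchy_binet_alt:
  fixes x y :: "nat \<Rightarrow> 'a::comm_ring_1"
  shows "(\<Sum>g\<in>compositions r N. (\<Prod>i<r. x i ^ g i) * alt r y g) =
    (\<Sum>l\<in>decreasing_compositions r N. alt r x l * alt r y l)"
proof -
  let ?F = "\<lambda>g. (\<Prod>i<r. x i ^ g i) * alt r y g"
  let ?Dec = "decreasing_compositions r N" and ?Per = "{p. p permutes {0..<r}}"
  have Fc: "?F g = ?F h" if "\<And>i. i < r \<Longrightarrow> g i = h i" for g h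
    using that by (intro arg_cong2[where f = "(*)"] prod.cong alt_cong) auto
  have sum_perm: "(\<Sum>i<r. g (p i)) = (\<Sum>i<r. g i)" if "p permutes {0..<r}" for p and g :: "nat \<Rightarrow> nat"
    using sum.permute[OF that, of g] by (simp add: atLeast0LessThan)
  have "(\<Sum>l\<in>?Dec. alt r x l * alt r y l) = (\<Sum>l\<in>?Dec. \<Sum>p\<in>?Per. ?F (l \<circ> p))"
  proof (rule sum.cong[OF refl])
    fix l
    show "alt r x l * alt r y l = (\<Sum>p\<in>?Per. ?F (l \<circ> p))"
      unfolding alt_cols[of r x l] sum_distrib_right
      by (rule sum.cong) (simp_all add: alt_permute[symmetric] mult_ac)
  qed
  also have "\<dots> = (\<Sum>(l, p)\<in>?Dec \<times> ?Per. ?F (l \<circ> p))"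
    by (simp add: sum.cartesian_product)
  also have "\<dots> = (\<Sum>g\<in>{g \<in> compositions r N. inj_on g {..<r}}. ?F g)"
  proof -
    define fwd :: "(nat \<Rightarrow> nat) \<times> (nat \<Rightarrow> nat) \<Rightarrow> nat \<Rightarrow> nat" where "fwd a = (\<lambda>i\<in>{..<r}. fst a (snd a i))" for a
    define bwd where "bwd g = (\<lambda>i\<in>{..<r}. g (inv_into UNIV (rank_perm r g) i), rank_perm r g)" for g
    have 1: "bwd (fwd a) = a" and 2: "fwd a \<in> compositions r N \<and> inj_on (fwd a) {..<r}" if aS: "a \<in> ?Dec \<times> ?Per" for a
    proof -
      obtain l p where a: "a = (l, p)" and l: "l \<in> compositions r N" and p: "p permutes {0..<r}"
        and dec: "\<And>i j. i < j \<Longrightarrow> j < r \<Longrightarrow> l j < l i"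
        using aS by (auto simp: decreasing_compositions_def)
      let ?g = "\<lambda>i\<in>{..<r}. l (p i)"
      have rk: "rank_perm r ?g = p" by (rule rank_perm_decreasing[OF p dec])
      have pr: "p j < r \<longleftrightarrow> j < r" for j using permutes_in_image[OF p, of j] by simp
      have ip: "inv_into UNIV p permutes {0..<r}" by (rule permutes_inv[OF p])
      have "(\<lambda>i\<in>{..<r}. ?g (inv_into UNIV p i)) = l"
      proof
        fix i
        have "inv_into UNIV p i < r \<longleftrightarrow> i < r" using permutes_in_image[OF ip, of i] by simp
        then show "(\<lambda>i\<in>{..<r}. ?g (inv_into UNIV p i)) i = l i"
          using l permutes_inverses[OF p] by (auto simp: compositions_def PiE_iff extensional_def)
      qed
      then show "bwd (fwd a) = a" unfolding a fwd_def bwd_def fst_conv snd_conv rk by simp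
      have li: "i = j" if "i < r" "j < r" "l i = l j" for i j
        using dec[of i j] dec[of j i] that by (cases i j rule: linorder_cases) auto
      have "inj_on ?g {..<r}"
      proof (rule inj_onI)
        fix i j assume ij: "i \<in> {..<r}" "j \<in> {..<r}" "?g i = ?g j"
        then have *: "p i < r" "p j < r" "l (p i) = l (p j)" unfolding pr by simp_all
        have "p i = p j" by (rule li[OF *])
        then show "i = j" using permutes_inj[OF p] by (simp add: inj_eq)
      qed
      moreover have "?g \<in> compositions r N"
        using l sum_perm[OF p, of l] by (simp add: compositions_def)
      ultimately show "fwd a \<in> compositions r N \<and> inj_on (fwd a) {..<r}" by (simp add: a fwd_def)
    qed
    have 3: "fwd (bwd g) = g" and 4: "bwd g \<in> ?Dec \<times> ?Per" if gS: "g \<in> compositions r N" "inj_on g {..<r}" for g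
    proof -
      let ?p = "rank_perm r g"
      let ?q = "inv_into UNIV ?p"
      have p: "?p permutes {0..<r}" by (rule rank_perm_permutes[OF gS(2)])
      have ip: "?q permutes {0..<r}" by (rule permutes_inv[OF p])
      have pr: "?p j < r \<longleftrightarrow> j < r" for j using permutes_in_image[OF p, of j] by simp
      have ipr: "?q j < r \<longleftrightarrow> j < r" for j using permutes_in_image[OF ip, of j] by simp
      have pq: "?p (?q j) = j" "?q (?p j) = j" for j by (rule permutes_inverses[OF p])+
      show "fwd (bwd g) = g"
      proof
        fix i show "fwd (bwd g) i = g i"
          using gS(1) by (cases "i < r") (simp_all add: fwd_def bwd_def pq pr compositions_def PiE_iff extensional_def)
      qed
      let ?l = "\<lambda>i\<in>{..<r}. g (?q i)"
      have "?l j < ?l i" if ij: "i < j" "j < r" for i j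
      proof -
        have ir: "?q i < r" "?q j < r" using ipr ij by auto
        have "\<not> g (?q i) < g (?q j)"
        proof
          assume "g (?q i) < g (?q j)"
          from rank_perm_less[OF ir this] show False using ij by (simp add: pq)
        qed
        moreover have "g (?q i) \<noteq> g (?q j)"
        proof
          assume "g (?q i) = g (?q j)"
          then have "?q i = ?q j" using gS(2) ir by (simp add: inj_on_def)
          then have "?p (?q i) = ?p (?q j)" by simp
          then show False using ij by (simp add: pq)
        qed
        ultimately show ?thesis using ij by simp
      qed
      moreover have "?l \<in> compositions r N" using gS(1) sum_perm[OF ip, of g] by (simp add: compositions_def)
      ultimately show "bwd g \<in> ?Dec \<times> ?Per" using p by (simp add: bwd_def decreasing_compositions_def)
    qed
    show ?thesis
    proof (rule sum.reindex_bij_witness[of _ bwd fwd])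
      fix a assume "a \<in> ?Dec \<times> ?Per"
      show "?F (fwd a) = (case a of (l, p) \<Rightarrow> ?F (l \<circ> p))"
        unfolding case_prod_beta by (rule Fc) (simp add: fwd_def)
    qed (use 1 2 3 4 in blast)+
  qed
  also have "\<dots> = (\<Sum>g\<in>compositions r N. ?F g)"
    by (rule sum.mono_neutral_left) (auto simp: alt_not_inj)
  finally show ?thesis ..
qed

lemma sum_compositions_Suc:
  fixes h :: "(nat \<Rightarrow> nat) \<Rightarrow> 'a::comm_monoid_add"
  shows "(\<Sum>g\<in>compositions (Suc r) N. h g) = (\<Sum>m\<le>N. \<Sum>g\<in>compositions r (N - m). h (g(r := m)))"
proof -
  have "(\<Sum>m\<le>N. \<Sum>g\<in>compositions r (N - m). h (g(r := m))) =
      (\<Sum>(m, g)\<in>(SIGMA m:{..N}. compositions r (N - m)). h (g(r := m)))"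
    by (rule sum.Sigma) auto
  also have "\<dots> = (\<Sum>g\<in>compositions (Suc r) N. h g)"
  proof (rule sum.reindex_bij_witness[of _ "\<lambda>g. (g r, restrict g {..<r})" "\<lambda>(m, g). g(r := m)"])
    fix g assume g: "g \<in> compositions (Suc r) N"
    then have N: "(\<Sum>i<r. g i) + g r = N" by (simp add: compositions_def)
    show "(case (g r, restrict g {..<r}) of (m, g) \<Rightarrow> g(r := m)) = g"
      using g by (auto simp: compositions_def PiE_iff extensional_def fun_eq_iff)
    show "(g r, restrict g {..<r}) \<in> (SIGMA m:{..N}. compositions r (N - m))"
      using N by (auto simp: compositions_def)
  next
    fix a assume "a \<in> (SIGMA m:{..N}. compositions r (N - m))"
    then obtain m g where a: "a = (m, g)" "m \<le> N" "g \<in> compositions r (N - m)" by auto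
    have "restrict (g(r := m)) {..<r} = g"
      using a(3) by (auto simp: compositions_def PiE_iff extensional_def fun_eq_iff)
    then show "((case a of (m, g) \<Rightarrow> g(r := m)) r, restrict (case a of (m, g) \<Rightarrow> g(r := m)) {..<r}) = a"
      by (simp add: a)
    have "(\<Sum>i<r. (g(r := m)) i) = N - m" using a(3) by (simp add: compositions_def)
    then show "(case a of (m, g) \<Rightarrow> g(r := m)) \<in> compositions (Suc r) N"
      using a by (auto simp: compositions_def PiE_iff extensional_def)
    show "h (case a of (m, g) \<Rightarrow> g(r := m)) = (case a of (m, g) \<Rightarrow> h (g(r := m)))" by (simp add: a)
  qed
  finally show ?thesis ..
qed

lemma fps_prod_nth_compositions:
  fixes f :: "nat \<Rightarrow> 'a::comm_ring_1 fps"
  shows "fps_nth (\<Prod>j<r. f j) N = (\<Sum>g\<in>compositions r N. \<Prod>j<r. fps_nth (f j) (g j))"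
proof (induction r arbitrary: N)
  case 0
  have "compositions 0 N = (if N = 0 then {\<lambda>x. undefined} else {})" by (auto simp: compositions_def)
  then show ?case by simp
next
  case (Suc r)
  have "fps_nth (\<Prod>j<Suc r. f j) N = (\<Sum>m\<le>N. fps_nth (f r) m * fps_nth (\<Prod>j<r. f j) (N - m))"
    by (simp add: mult.commute[of _ "f r"] fps_mult_nth atLeast0AtMost)
  also have "\<dots> = (\<Sum>m\<le>N. \<Sum>g\<in>compositions r (N - m). \<Prod>j<Suc r. fps_nth (f j) ((g(r := m)) j))"
    unfolding Suc sum_distrib_left by (intro sum.cong refl) (simp add: mult.commute)
  finally show ?case unfolding sum_compositions_Suc .
qed

section \<open>Cauchy's determinant\<close>

definition geo :: "'a::comm_ring_1 \<Rightarrow> 'a fps"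
  where "geo a = Abs_fps (\<lambda>n. a ^ n)"

lemma geo_inverse: "(1 - fps_const a * fps_X) * geo a = 1"
proof (rule fps_ext)
  fix n show "fps_nth ((1 - fps_const a * fps_X) * geo a) n = fps_nth 1 n"
    by (cases n) (simp_all add: geo_def left_diff_distrib mult.assoc)
qed

definition cauchy_Q :: "nat \<Rightarrow> (nat \<Rightarrow> 'a::comm_ring_1) \<Rightarrow> (nat \<Rightarrow> 'a) \<Rightarrow> 'a fps"
  where "cauchy_Q r x y = (\<Prod>i<r. \<Prod>j<r. 1 - fps_const (x i * y j) * fps_X)"

text \<open>By Cauchy-Binet this is the determinant with entries 1/(1 - x_i y_j X).\<close>

definition cauchy_E :: "nat \<Rightarrow> (nat \<Rightarrow> 'a::comm_ring_1) \<Rightarrow> (nat \<Rightarrow> 'a) \<Rightarrow> 'a fps"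
  where "cauchy_E r x y = Abs_fps (\<lambda>N. \<Sum>l\<in>decreasing_compositions r N. alt r x l * alt r y l)"

lemma cauchy_E_geo:
  "cauchy_E r x y = (\<Sum>p | p permutes {0..<r}. signof p * (\<Prod>i<r. geo (x i * y (p i))))"
proof (rule fps_ext)
  fix N
  have sg: "fps_nth (signof p * F) N = signof p * fps_nth F N" for p :: "nat \<Rightarrow> nat" and F :: "'a fps"
    by (simp add: sign_def)
  have "fps_nth (\<Sum>p | p permutes {0..<r}. signof p * (\<Prod>i<r. geo (x i * y (p i)))) N =
     (\<Sum>p | p permutes {0..<r}. signof p * (\<Sum>g\<in>compositions r N. \<Prod>i<r. (x i * y (p i)) ^ g i))"
    unfolding fps_sum_nth sg fps_prod_nth_compositions geo_def fps_nth_Abs_fps ..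
  also have "\<dots> = (\<Sum>g\<in>compositions r N. (\<Prod>i<r. x i ^ g i) * alt r y g)"
    unfolding alt_rows sum_distrib_left power_mult_distrib prod.distrib
    by (subst sum.swap) (simp add: mult_ac)
  also have "\<dots> = fps_nth (cauchy_E r x y) N"
    unfolding cauchy_binet_alt cauchy_E_def by simp
  finally show "fps_nth (cauchy_E r x y) N = fps_nth (\<Sum>p | p permutes {0..<r}. signof p * (\<Prod>i<r. geo (x i * y (p i)))) N" ..
qed

text \<open>Row \<open>i\<close> of Cauchy's determinant is multiplied by the product over
  \<open>j\<close> of the factors 1 - x_i y_j X.\<close>

lemma cauchy_QE_det:
  "cauchy_Q r x y * cauchy_E r x y = det (mat r r (\<lambda>(i, j). \<Prod>l\<in>{..<r} - {j}. 1 - fps_const (x i * y l) * fps_X))"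
proof -
  have "cauchy_Q r x y * (\<Prod>i<r. geo (x i * y (p i))) = (\<Prod>i<r. \<Prod>l\<in>{..<r} - {p i}. 1 - fps_const (x i * y l) * fps_X)"
    if p: "p permutes {0..<r}" for p
    unfolding cauchy_Q_def prod.distrib[symmetric]
  proof (rule prod.cong[OF refl])
    fix i assume "i \<in> {..<r}"
    then have pi: "p i \<in> {..<r}" using permutes_in_image[OF p, of i] by simp
    have "(\<Prod>j<r. 1 - fps_const (x i * y j) * fps_X) =
        (1 - fps_const (x i * y (p i)) * fps_X) * (\<Prod>l\<in>{..<r} - {p i}. 1 - fps_const (x i * y l) * fps_X)"
      by (rule prod.remove[OF _ pi]) simp
    then have "(\<Prod>j<r. 1 - fps_const (x i * y j) * fps_X) * geo (x i * y (p i)) =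
        ((1 - fps_const (x i * y (p i)) * fps_X) * geo (x i * y (p i))) * (\<Prod>l\<in>{..<r} - {p i}. 1 - fps_const (x i * y l) * fps_X)"
      by (simp only: mult_ac)
    then show "(\<Prod>j<r. 1 - fps_const (x i * y j) * fps_X) * geo (x i * y (p i)) =
        (\<Prod>l\<in>{..<r} - {p i}. 1 - fps_const (x i * y l) * fps_X)"
      unfolding geo_inverse mult_1 .
  qed
  then show ?thesis
    unfolding cauchy_E_geo det_mat_leibniz sum_distrib_left
    by (intro sum.cong refl) (simp add: mult.left_commute)
qed

text \<open>The entries are polynomials of degree below \<open>r\<close> in x_i X whose coefficients
  depend only on the column; so the determinant is that of the powers of x_i X, homogeneous in X,
  times a constant.\<close>

lemma cauchy_QE_shape: "\<exists>c. cauchy_Q r x y * cauchy_E r x y = fps_const c * fps_X ^ (\<Sum>j<r. j)"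
proof -
  interpret fc: comm_ring_hom "fps_const :: 'a \<Rightarrow> 'a fps"
    by unfold_locales simp_all
  define p where "p j = (\<Prod>l\<in>{..<r} - {j}. [:1, - y l:])" for j
  define A where "A = mat r r (\<lambda>(i, k). fps_const (x i ^ k) * fps_X ^ k)"
  define B where "B = map_mat fps_const (mat r r (\<lambda>(k, j). coeff (p j) k))"
  have cA: "A \<in> carrier_mat r r" and cB: "B \<in> carrier_mat r r" by (simp_all add: A_def B_def)
  have deg: "degree (p j) < r" if "j < r" for j
  proof -
    have "degree (p j) \<le> sum (degree \<circ> (\<lambda>l. [:1, - y l:])) ({..<r} - {j})"
      unfolding p_def by (rule degree_prod_sum_le) simp
    also have "\<dots> \<le> (\<Sum>l\<in>{..<r} - {j}. 1)" by (intro sum_mono) auto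
    finally show ?thesis using that by simp
  qed
  have M: "mat r r (\<lambda>(i, j). \<Prod>l\<in>{..<r} - {j}. 1 - fps_const (x i * y l) * fps_X) = A * B"
  proof (rule eq_matI)
    fix i j assume "i < dim_row (A * B)" "j < dim_col (A * B)"
    then have ij: "i < r" "j < r" using cA cB by auto
    interpret m: map_poly_comm_ring_hom "fps_const :: 'a \<Rightarrow> 'a fps" ..
    let ?z = "fps_const (x i) * fps_X"
    have "(\<Prod>l\<in>{..<r} - {j}. 1 - fps_const (x i * y l) * fps_X) = poly (map_poly fps_const (p j)) ?z"
      unfolding p_def m.hom_prod poly_prod
      by (rule prod.cong) (auto simp: fc.map_poly_pCons_hom mult_ac simp flip: fps_const_mult fps_const_neg)
    also have "\<dots> = (\<Sum>k<r. coeff (map_poly fps_const (p j)) k * ?z ^ k)"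
      unfolding poly_altdef
    proof (rule sum.mono_neutral_left)
      show "{..degree (map_poly fps_const (p j))} \<subseteq> {..<r}"
        using deg[OF ij(2)] degree_map_poly_le[of fps_const "p j"] by auto
      show "\<forall>k\<in>{..<r} - {..degree (map_poly fps_const (p j))}. coeff (map_poly fps_const (p j)) k * ?z ^ k = 0"
        using coeff_eq_0[of "map_poly fps_const (p j)"] by (metis DiffD2 atMost_iff mult_zero_left not_le)
    qed simp
    also have "\<dots> = (\<Sum>k<r. fps_const (coeff (p j) k) * ?z ^ k)" by (simp add: coeff_map_poly)
    also have "\<dots> = (A * B) $$ (i, j)"
      unfolding mat_mult_entry[OF cA cB ij]
      by (rule sum.cong) (use ij in \<open>auto simp: A_def B_def power_mult_distrib mult_ac fps_const_power\<close>)
    finally show "mat r r (\<lambda>(i, j). \<Prod>l\<in>{..<r} - {j}. 1 - fps_const (x i * y l) * fps_X) $$ (i, j) = (A * B) $$ (i, j)"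
      using ij by simp
  qed (use cA cB in auto)
  have dA: "det A = fps_const (alt r x (\<lambda>k. k)) * fps_X ^ (\<Sum>j<r. j)"
  proof -
    have "det A = (\<Sum>p | p permutes {0..<r}. signof p * (\<Prod>i<r. fps_const (x i ^ p i) * fps_X ^ p i))"
      unfolding A_def by (rule det_mat_leibniz)
    also have "\<dots> = (\<Sum>p | p permutes {0..<r}. fps_const (signof p * (\<Prod>i<r. x i ^ p i)) * fps_X ^ (\<Sum>j<r. j))"
    proof (rule sum.cong[OF refl])
      fix p assume "p \<in> {p. p permutes {0..<r}}"
      then have "(\<Sum>i<r. p i) = (\<Sum>j<r. j)" using sum.permute[of p "{0..<r}" "\<lambda>j. j"] by (simp add: atLeast0LessThan comp_def)
      then show "signof p * (\<Prod>i<r. fps_const (x i ^ p i) * fps_X ^ p i) =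
          fps_const (signof p * (\<Prod>i<r. x i ^ p i)) * fps_X ^ (\<Sum>j<r. j)"
        by (simp add: prod.distrib power_sum[symmetric] fc.hom_mult fc.hom_prod sign_def mult.assoc fc.hom_uminus flip: fps_const_neg)
    qed
    finally show ?thesis unfolding alt_cols sum_distrib_right[symmetric] fc.hom_sum[symmetric] .
  qed
  have dB: "det B = fps_const (det (mat r r (\<lambda>(k, j). coeff (p j) k)))"
    unfolding B_def by (rule fc.hom_det)
  have "cauchy_Q r x y * cauchy_E r x y = det A * det B"
    unfolding cauchy_QE_det M by (rule det_mult[OF cA cB])
  also have "\<dots> = fps_const (alt r x (\<lambda>k. k) * det (mat r r (\<lambda>(k, j). coeff (p j) k))) * fps_X ^ (\<Sum>j<r. j)"
    unfolding dA dB fc.hom_mult by (simp only: mult_ac)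
  finally show ?thesis by blast
qed

lemma decreasing_bound:
  assumes "\<And>i j. i < j \<Longrightarrow> j < r \<Longrightarrow> l j < (l i :: nat)" and "i < r"
  shows "l i \<ge> l (r - 1) + (r - 1 - i)"
proof -
  have "l (r - 1 - k) \<ge> l (r - 1) + k" if "k < r" for k
    using that
  proof (induction k)
    case (Suc k)
    have "l (r - 1 - k) < l (r - 1 - Suc k)" by (rule assms) (use Suc.prems in auto)
    then show ?case using Suc by simp
  qed simp
  from this[of "r - 1 - i"] show ?thesis using assms(2) by simp
qed

definition delta :: "nat \<Rightarrow> nat \<Rightarrow> nat" where "delta r i = r - 1 - i"

lemma sum_rev_index: "(\<Sum>i<r. delta r i) = (\<Sum>j<r. j)"
  unfolding delta_def by (rule sum.reindex_bij_witness[of _ "\<lambda>k. r - 1 - k" "\<lambda>k. r - 1 - k"]) auto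

text \<open>The staircase is entry by entry the smallest strictly decreasing vector.\<close>

lemma decreasing_compositions_small:
  assumes "N \<le> (\<Sum>j<r. j)"
  shows "decreasing_compositions r N = (if N = (\<Sum>j<r. j) then {\<lambda>i\<in>{..<r}. delta r i} else {})"
proof -
  have ge: "l i \<ge> delta r i" if "l \<in> decreasing_compositions r N" "i < r" for l i
    using decreasing_bound[of r l i] that by (auto simp: decreasing_compositions_def delta_def)
  have eq: "l = (\<lambda>i\<in>{..<r}. delta r i) \<and> N = (\<Sum>j<r. j)" if l: "l \<in> decreasing_compositions r N" for l
  proof -
    have s: "(\<Sum>i<r. l i) = N" and ext: "l \<in> extensional {..<r}" using l by (auto simp: decreasing_compositions_def compositions_def PiE_def)
    have "(\<Sum>i<r. delta r i) \<le> (\<Sum>i<r. l i)" by (intro sum_mono ge l) simp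
    then have N: "N = (\<Sum>j<r. j)" using assms s by (simp add: sum_rev_index)
    have "l i = delta r i" if "i < r" for i
    proof (rule ccontr)
      assume "l i \<noteq> delta r i"
      then have "(\<Sum>i<r. delta r i) < (\<Sum>i<r. l i)"
        using ge[OF l] that by (intro sum_strict_mono_ex1) (auto intro!: bexI[of _ i] simp: le_neq_implies_less)
      then show False using N s by (simp add: sum_rev_index)
    qed
    then show ?thesis using ext N by (auto simp: extensional_def)
  qed
  moreover have "(\<lambda>i\<in>{..<r}. delta r i) \<in> decreasing_compositions r N" if "N = (\<Sum>j<r. j)"
    using that sum_rev_index[of r] by (auto simp: decreasing_compositions_def compositions_def delta_def)
  ultimately show ?thesis by auto
qed

text \<open>The unknown constant is read off in the lowest degree, to which only the staircase
  contributes.\<close>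

lemma cauchy_QE:
  "cauchy_Q r x y * cauchy_E r x y = fps_const (alt r x (delta r) * alt r y (delta r)) * fps_X ^ (\<Sum>j<r. j)"
proof -
  let ?T = "\<Sum>j<r. j"
  obtain c where c: "cauchy_Q r x y * cauchy_E r x y = fps_const c * fps_X ^ ?T" using cauchy_QE_shape by blast
  interpret n0: comm_ring_hom "\<lambda>F :: 'a fps. fps_nth F 0" by unfold_locales simp_all
  have "fps_nth (cauchy_Q r x y) 0 = 1"
    by (simp add: cauchy_Q_def n0.hom_prod)
  have E: "fps_nth (cauchy_E r x y) n = (if n = ?T then alt r x (delta r) * alt r y (delta r) else 0)" if "n \<le> ?T" for n
  proof -
    have "alt r z (\<lambda>i\<in>{..<r}. delta r i) = alt r z (delta r)" for z :: "nat \<Rightarrow> 'a" by (rule alt_cong) auto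
    then show ?thesis using that by (simp add: cauchy_E_def decreasing_compositions_small)
  qed
  have "fps_nth (cauchy_Q r x y * cauchy_E r x y) ?T =
      (\<Sum>i\<le>?T. fps_nth (cauchy_Q r x y) i * fps_nth (cauchy_E r x y) (?T - i))"
    by (simp add: fps_mult_nth atLeast0AtMost)
  also have "\<dots> = (\<Sum>i\<le>?T. if i = 0 then alt r x (delta r) * alt r y (delta r) else 0)"
    by (rule sum.cong) (auto simp: E \<open>fps_nth (cauchy_Q r x y) 0 = 1\<close>)
  finally have "fps_nth (cauchy_Q r x y * cauchy_E r x y) ?T = alt r x (delta r) * alt r y (delta r)" by simp
  then have "c = alt r x (delta r) * alt r y (delta r)" unfolding c by simp
  then show ?thesis using c by simp
qed

section \<open>Partitions with at most r - 1 parts\<close>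

text \<open>\<open>k j\<close> counts the columns of length \<open>j\<close> in a Young diagram, so
  these tuples are the partitions of \<open>N\<close> with at most \<open>r - 1\<close>
  parts.\<close>

definition weighted_tuples :: "nat \<Rightarrow> nat \<Rightarrow> (nat \<Rightarrow> nat) set"
  where "weighted_tuples r N = {k \<in> {1..<r} \<rightarrow>\<^sub>E UNIV. (\<Sum>j\<in>{1..<r}. j * k j) = N}"

lemma sum_partition_of: "(\<Sum>i<r. partition_of r k i) = (\<Sum>j\<in>{1..<r}. j * k j)"
proof -
  have "(\<Sum>i<r. partition_of r k i) = (\<Sum>i<r. \<Sum>j<r. if i < j then k j else 0)"
    unfolding partition_of_def
    by (rule sum.cong[OF refl], rule sum.mono_neutral_cong_left) auto
  also have "\<dots> = (\<Sum>j<r. \<Sum>i<r. if i < j then k j else 0)" by (rule sum.swap)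
  also have "\<dots> = (\<Sum>j<r. j * k j)"
  proof (rule sum.cong[OF refl])
    fix j assume "j \<in> {..<r}"
    then have "{i \<in> {..<r}. i < j} = {..<j}" by auto
    then show "(\<Sum>i<r. if i < j then k j else 0) = j * k j" by (simp add: sum.inter_filter[symmetric])
  qed
  also have "\<dots> = (\<Sum>j\<in>{1..<r}. j * k j)"
    by (rule sum.mono_neutral_right) (auto simp: not_le)
  finally show ?thesis .
qed

lemma partition_of_last [simp]: "partition_of r k (r - Suc 0) = 0"
  by (auto simp: partition_of_def intro!: sum.neutral)

lemma partition_of_step: "Suc i < r \<Longrightarrow> partition_of r k i = k (Suc i) + partition_of r k (Suc i)"
proof -
  assume "Suc i < r"
  then have "{i<..<r} = insert (Suc i) {Suc i<..<r}" by auto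
  then show ?thesis by (simp add: partition_of_def)
qed

lemma partition_of_cong: "(\<And>j. j \<in> {1..<r} \<Longrightarrow> k j = k' j) \<Longrightarrow> partition_of r k i = partition_of r k' i"
  unfolding partition_of_def by (rule sum.cong) auto

lemma delta_step: "Suc i < r \<Longrightarrow> delta r i = Suc (delta r (Suc i))"
  by (simp add: delta_def)

text \<open>Removing the staircase from a vector that ends in 0 leaves a partition with last part 0;
  \<open>k\<close> records its successive differences.\<close>

lemma decreasing_last_zero:
  fixes x y :: "nat \<Rightarrow> 'a::comm_ring_1"
  assumes r: "r > 0"
  shows "(\<Sum>l\<in>{l \<in> decreasing_compositions r (N + (\<Sum>j<r. j)). l (r - 1) = 0}. alt r x l * alt r y l) =
    (\<Sum>k\<in>weighted_tuples r N. alt r x (\<lambda>i. partition_of r k i + delta r i) * alt r y (\<lambda>i. partition_of r k i + delta r i))"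
    (is "sum _ ?D = _")
proof -
  define fwd where "fwd k = (\<lambda>i\<in>{..<r}. partition_of r k i + delta r i)" for k
  define bwd where "bwd l = (\<lambda>j\<in>{1..<r}. l (j - 1) - l j - 1)" for l :: "nat \<Rightarrow> nat"
  have step: "fwd k i = fwd k (Suc i) + k (Suc i) + 1" if "Suc i < r" for k i
    using that by (simp add: fwd_def partition_of_step delta_step)
  have fwd: "fwd k \<in> ?D" "bwd (fwd k) = k" if k: "k \<in> weighted_tuples r N" for k
  proof -
    have "fwd k j < fwd k i" if "i < j" "j < r" for i j
      using that
    proof (induction j)
      case (Suc j)
      then show ?case using step[of j k] by (cases "i = j") auto
    qed simp
    moreover have "(\<Sum>i<r. fwd k i) = N + (\<Sum>j<r. j)"
      using k by (simp add: fwd_def sum.distrib sum_partition_of sum_rev_index weighted_tuples_def)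
    ultimately show "fwd k \<in> ?D"
      using r by (simp add: decreasing_compositions_def compositions_def) (simp add: fwd_def delta_def)
    have "bwd (fwd k) j = k j" for j
    proof (cases "j \<in> {1..<r}")
      case True
      then show ?thesis using step[of "j - 1" k] by (simp add: bwd_def)
    next
      case False
      then show ?thesis using k by (auto simp: bwd_def weighted_tuples_def PiE_iff extensional_def)
    qed
    then show "bwd (fwd k) = k" by blast
  qed
  have bwd: "fwd (bwd l) = l" if l: "l \<in> ?D" for l
  proof
    have dec: "l j < l i" if "i < j" "j < r" for i j using l that by (simp add: decreasing_compositions_def)
    have "fwd (bwd l) (r - 1 - i) = l (r - 1 - i)" if "i < r" for i
      using that
    proof (induction i)
      case 0
      then show ?case using l r by (simp add: fwd_def delta_def)
    next
      case (Suc i)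
      let ?i = "r - 1 - Suc i"
      have i: "Suc ?i = r - 1 - i" "Suc ?i < r" using Suc.prems by auto
      have "l (Suc ?i) < l ?i" by (rule dec) (use i in auto)
      moreover have "bwd l (Suc ?i) = l ?i - l (Suc ?i) - 1" using i(2) by (simp add: bwd_def)
      moreover have "fwd (bwd l) (Suc ?i) = l (Suc ?i)" unfolding i(1) using Suc by simp
      ultimately show ?case using step[OF i(2), of "bwd l"] by linarith
    qed
    note rev = this
    have eq: "fwd (bwd l) i = l i" if "i < r" for i
    proof -
      have "r - 1 - (r - 1 - i) = i" "r - 1 - i < r" using that by auto
      then show ?thesis using rev[of "r - 1 - i"] by simp
    qed
    show "fwd (bwd l) i = l i" for i
      using l eq[of i] by (cases "i < r") (auto simp: fwd_def decreasing_compositions_def compositions_def PiE_iff extensional_def)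
  qed
  have bwdT: "bwd l \<in> weighted_tuples r N" if l: "l \<in> ?D" for l
  proof -
    have "(\<Sum>i<r. fwd (bwd l) i) = N + (\<Sum>j<r. j)"
      unfolding bwd[OF l] using l by (simp add: decreasing_compositions_def compositions_def)
    then have "(\<Sum>j\<in>{1..<r}. j * bwd l j) = N" by (simp add: fwd_def sum.distrib sum_partition_of sum_rev_index)
    then show ?thesis by (simp add: weighted_tuples_def bwd_def)
  qed
  show ?thesis
  proof (rule sum.reindex_bij_witness[of _ fwd bwd])
    fix l assume l: "l \<in> ?D"
    have "alt r z (\<lambda>i. partition_of r (bwd l) i + delta r i) = alt r z l" for z :: "nat \<Rightarrow> 'a"
    proof (rule alt_cong)
      fix i assume "i < r"
      then show "partition_of r (bwd l) i + delta r i = l i" using fun_cong[OF bwd[OF l], of i] by (simp add: fwd_def)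
    qed simp
    then show "alt r x (\<lambda>i. partition_of r (bwd l) i + delta r i) * alt r y (\<lambda>i. partition_of r (bwd l) i + delta r i)
        = alt r x l * alt r y l" by simp
  qed (use fwd bwd bwdT in blast)+
qed

lemma alt_shift: "alt r x (\<lambda>i. l i + 1) = (\<Prod>i<r. x i) * alt r x l"
proof -
  have "(\<Prod>i<r. x (p i) ^ (l i + 1)) = (\<Prod>i<r. x i) * (\<Prod>i<r. x (p i) ^ l i)" if "p permutes {0..<r}" for p
  proof -
    have "(\<Prod>i<r. x (p i)) = (\<Prod>i<r. x i)"
      using prod.permute[OF that, of x] by (simp add: atLeast0LessThan comp_def)
    then show ?thesis by (simp add: prod.distrib)
  qed
  then show ?thesis unfolding alt_rows sum_distrib_left
    by (intro sum.cong refl) (simp only: mem_Collect_eq mult.left_commute)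
qed

text \<open>A decreasing vector with positive last entry is positive throughout; lowering all
  entries by 1 takes the product of the variables out of each alternant and lowers the degree by
  \<open>r\<close>.\<close>

lemma decreasing_last_nonzero:
  fixes x y :: "nat \<Rightarrow> 'a::comm_ring_1"
  assumes r: "r > 0"
  shows "(\<Sum>l\<in>{l \<in> decreasing_compositions r N. l (r - 1) \<noteq> 0}. alt r x l * alt r y l) =
    (if N < r then 0 else (\<Prod>i<r. x i) * (\<Prod>i<r. y i) *
      (\<Sum>l\<in>decreasing_compositions r (N - r). alt r x l * alt r y l))"
proof -
  let ?D = "{l \<in> decreasing_compositions r N. l (r - 1) \<noteq> 0}"
  have pos: "l i \<ge> 1" if "l \<in> ?D" "i < r" for l i
    using decreasing_bound[of r l i] that by (auto simp: decreasing_compositions_def)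
  show ?thesis
  proof (cases "N < r")
    case True
    have "?D = {}"
    proof (rule ccontr)
      assume "?D \<noteq> {}"
      then obtain l where l: "l \<in> ?D" by blast
      have "(\<Sum>i<r. 1) \<le> (\<Sum>i<r. l i)" by (intro sum_mono pos[OF l]) simp
      then show False using l True by (simp add: decreasing_compositions_def compositions_def)
    qed
    then show ?thesis using True by (simp only: if_True sum.empty)
  next
    case False
    have "(\<Sum>l\<in>?D. alt r x l * alt r y l) =
      (\<Sum>l\<in>decreasing_compositions r (N - r). (\<Prod>i<r. x i) * alt r x l * ((\<Prod>i<r. y i) * alt r y l))"
    proof (rule sum.reindex_bij_witness[of _ "\<lambda>l. \<lambda>i\<in>{..<r}. l i + 1" "\<lambda>l. \<lambda>i\<in>{..<r}. l i - 1"])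
      fix l assume l: "l \<in> ?D"
      have li: "(\<lambda>i\<in>{..<r}. (\<lambda>i\<in>{..<r}. l i - 1) i + 1) i = l i" for i
        using pos[OF l, of i] l by (auto simp: decreasing_compositions_def compositions_def PiE_iff extensional_def)
      then show "(\<lambda>i\<in>{..<r}. (\<lambda>i\<in>{..<r}. l i - 1) i + 1) = l" by blast
      have l1: "(l i - 1) + 1 = l i" if "i < r" for i using pos[OF l that] by simp
      then have "(\<Sum>i<r. l i) = (\<Sum>i<r. (l i - 1) + 1)" by (intro sum.cong) auto
      then have "(\<Sum>i<r. l i) = (\<Sum>i<r. l i - 1) + r" by (simp only: sum.distrib) simp
      moreover have "(\<Sum>i<r. l i) = N" using l by (simp add: decreasing_compositions_def compositions_def)
      ultimately have "(\<Sum>i<r. l i - 1) = N - r" by simp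
      moreover have "l j - 1 < l i - 1" if "i < j" "j < r" for i j
        using pos[OF l, of j] l that by (auto simp: decreasing_compositions_def intro!: diff_less_mono)
      ultimately show "(\<lambda>i\<in>{..<r}. l i - 1) \<in> decreasing_compositions r (N - r)"
        by (simp add: decreasing_compositions_def compositions_def)
      have "alt r z l = (\<Prod>i<r. z i) * alt r z (\<lambda>i\<in>{..<r}. l i - 1)" for z :: "nat \<Rightarrow> 'a"
        unfolding alt_shift[symmetric] by (rule alt_cong) (use l1 in simp_all)
      then show "(\<Prod>i<r. x i) * alt r x (\<lambda>i\<in>{..<r}. l i - 1) * ((\<Prod>i<r. y i) * alt r y (\<lambda>i\<in>{..<r}. l i - 1))
          = alt r x l * alt r y l" by simp
    next
      fix l assume l: "l \<in> decreasing_compositions r (N - r)"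
      then show "(\<lambda>i\<in>{..<r}. (\<lambda>i\<in>{..<r}. l i + 1) i - 1) = l"
        by (auto simp: decreasing_compositions_def compositions_def PiE_iff extensional_def fun_eq_iff)
      have "(\<Sum>i<r. l i + 1) = N"
        using l False by (simp only: sum.distrib) (simp add: decreasing_compositions_def compositions_def)
      then show "(\<lambda>i\<in>{..<r}. l i + 1) \<in> ?D" using l r by (simp add: decreasing_compositions_def compositions_def)
    qed
    then show ?thesis using False by (simp add: sum_distrib_left mult_ac)
  qed
qed

definition schur_series :: "nat \<Rightarrow> (nat \<Rightarrow> 'a::comm_ring_1) \<Rightarrow> (nat \<Rightarrow> 'a) \<Rightarrow> 'a fps"
  where "schur_series r x y = Abs_fps (\<lambda>N. \<Sum>k\<in>weighted_tuples r N.
    schur_val (root_poly r x) r (partition_of r k) * schur_val (root_poly r y) r (partition_of r k))"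

lemma schur_val_delta:
  "r > 0 \<Longrightarrow> schur_val (root_poly r x) r p * alt r x (delta r) = alt r x (\<lambda>i. p i + delta r i)"
  using schur_val_alt[of r x p] unfolding delta_def[abs_def] .

text \<open>The factor on the left removes exactly the vectors with positive last entry; the
  remaining alternants are Schur values times Vandermonde determinants.\<close>

lemma cauchy_E_series:
  assumes r: "r > 0"
  shows "(1 - fps_const ((\<Prod>i<r. x i) * (\<Prod>i<r. y i)) * fps_X ^ r) * cauchy_E r x y =
    fps_const (alt r x (delta r) * alt r y (delta r)) * fps_X ^ (\<Sum>j<r. j) * schur_series r x y"
proof (rule fps_ext)
  fix N
  let ?T = "\<Sum>j<r. j" and ?e = "(\<Prod>i<r. x i) * (\<Prod>i<r. y i)"
  let ?a = "\<lambda>l. alt r x l * alt r y l"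
  have "fps_nth ((1 - fps_const ?e * fps_X ^ r) * cauchy_E r x y) N =
     fps_nth (cauchy_E r x y) N - (if N < r then 0 else ?e * fps_nth (cauchy_E r x y) (N - r))"
    by (simp add: left_diff_distrib mult.assoc fps_X_power_mult_nth)
  also have "\<dots> = (\<Sum>l\<in>decreasing_compositions r N. ?a l) - (\<Sum>l\<in>{l \<in> decreasing_compositions r N. l (r - 1) \<noteq> 0}. ?a l)"
    unfolding decreasing_last_nonzero[OF r] cauchy_E_def by simp
  also have "\<dots> = (\<Sum>l\<in>{l \<in> decreasing_compositions r N. l (r - 1) = 0}. ?a l)"
    by (subst sum_diff[symmetric]) (auto intro!: sum.cong)
  also have "\<dots> = fps_nth (fps_const (alt r x (delta r) * alt r y (delta r)) * fps_X ^ ?T * schur_series r x y) N"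
  proof (cases "N < ?T")
    case True
    then show ?thesis by (simp add: decreasing_compositions_small mult.assoc fps_X_power_mult_nth)
  next
    case False
    then have N: "N = (N - ?T) + ?T" by simp
    have "(\<Sum>l\<in>{l \<in> decreasing_compositions r N. l (r - 1) = 0}. ?a l) =
      (\<Sum>k\<in>weighted_tuples r (N - ?T). ?a (\<lambda>i. partition_of r k i + delta r i))"
      by (subst N) (rule decreasing_last_zero[OF r])
    also have "\<dots> = alt r x (delta r) * alt r y (delta r) * fps_nth (schur_series r x y) (N - ?T)"
      unfolding schur_val_delta[OF r, symmetric] schur_series_def fps_nth_Abs_fps sum_distrib_left
      by (simp only: mult_ac)
    finally show ?thesis using False by (simp add: mult.assoc fps_X_power_mult_nth)
  qed
  finally show "fps_nth ((1 - fps_const ?e * fps_X ^ r) * cauchy_E r x y) N =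
    fps_nth (fps_const (alt r x (delta r) * alt r y (delta r)) * fps_X ^ ?T * schur_series r x y) N" .
qed

text \<open>\<open>cauchy_QE\<close> and \<open>cauchy_E_series\<close> give the identity multiplied
  by both Vandermonde determinants, which are nonzero for distinct variables.\<close>

lemma cauchy_distinct:
  fixes x y :: "nat \<Rightarrow> 'a::idom"
  assumes r: "r > 0"
    and x: "\<And>i j. i < r \<Longrightarrow> j < r \<Longrightarrow> i \<noteq> j \<Longrightarrow> x i \<noteq> x j"
    and y: "\<And>i j. i < r \<Longrightarrow> j < r \<Longrightarrow> i \<noteq> j \<Longrightarrow> y i \<noteq> y j"
  shows "cauchy_Q r x y * schur_series r x y = 1 - fps_const ((\<Prod>i<r. x i) * (\<Prod>i<r. y i)) * fps_X ^ r"
proof -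
  define c where "c = fps_const (alt r x (delta r) * alt r y (delta r)) * fps_X ^ (\<Sum>j<r. j)"
  let ?g = "1 - fps_const ((\<Prod>i<r. x i) * (\<Prod>i<r. y i)) * fps_X ^ r"
  have "c * (cauchy_Q r x y * schur_series r x y) = cauchy_Q r x y * (?g * cauchy_E r x y)"
    unfolding cauchy_E_series[OF r] c_def by (simp only: mult_ac)
  also have "\<dots> = ?g * (cauchy_Q r x y * cauchy_E r x y)" by (simp only: mult_ac)
  also have "\<dots> = c * ?g" unfolding cauchy_QE c_def by (rule mult.commute)
  finally have "c * (cauchy_Q r x y * schur_series r x y) = c * ?g" .
  moreover have "alt r x (delta r) \<noteq> 0" "alt r y (delta r) \<noteq> 0"
    using vandermonde_nonzero[of r x] vandermonde_nonzero[of r y] x y unfolding delta_def[abs_def] by blast+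
  then have "c \<noteq> 0" by (simp add: c_def)
  ultimately show ?thesis by simp
qed

text \<open>The roots are made distinct by the perturbation $x_i + \varepsilon^{i+1}$, and then
  $\varepsilon$ is set to $0$.\<close>
theorem cauchy_identity:
  fixes x y :: "nat \<Rightarrow> 'a::idom"
  assumes r: "r > 0"
  shows "cauchy_Q r x y * schur_series r x y = 1 - fps_const ((\<Prod>i<r. x i) * (\<Prod>i<r. y i)) * fps_X ^ r"
proof -
  let ?h = "\<lambda>p :: 'a poly. poly p 0"
  define m where "m F = Abs_fps (\<lambda>n. ?h (fps_nth F n))" for F
  interpret m: comm_ring_hom m
    by unfold_locales (auto simp: m_def fps_eq_iff fps_mult_nth poly_hom.hom_sum)
  have mc: "m (fps_const c) = fps_const (?h c)" for c by (simp add: m_def fps_eq_iff)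
  have mX: "m fps_X = fps_X" by (simp add: m_def fps_eq_iff)
  define z where "z x i = [:x i:] + monom 1 (Suc i)" for x :: "nat \<Rightarrow> 'a" and i
  have z0: "?h (z x i) = x i" for x i by (simp add: z_def poly_monom)
  have inj: "z x i \<noteq> z x j" if "i \<noteq> j" for x i j
  proof
    assume "z x i = z x j"
    then have "coeff (z x i) (Suc i) = coeff (z x j) (Suc i)" by simp
    then show False using that by (simp add: z_def)
  qed
  have "m (cauchy_Q r (z x) (z y) * schur_series r (z x) (z y)) =
     m (1 - fps_const ((\<Prod>i<r. z x i) * (\<Prod>i<r. z y i)) * fps_X ^ r)"
    by (subst cauchy_distinct[OF r]) (auto simp: inj)
  moreover have "m (cauchy_Q r (z x) (z y)) = cauchy_Q r x y"
    unfolding cauchy_Q_def by (simp only: m.hom_prod m.hom_minus m.hom_one m.hom_mult mc mX poly_hom.hom_mult z0)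
  moreover have "m (schur_series r (z x) (z y)) = schur_series r x y"
    unfolding m_def schur_series_def fps_nth_Abs_fps
    by (simp only: poly_hom.hom_sum poly_hom.hom_mult schur_val_hom[OF poly_hom.comm_ring_hom_axioms] root_poly_hom[OF poly_hom.comm_ring_hom_axioms] z0)
  moreover have "m (1 - fps_const ((\<Prod>i<r. z x i) * (\<Prod>i<r. z y i)) * fps_X ^ r)
      = 1 - fps_const ((\<Prod>i<r. x i) * (\<Prod>i<r. y i)) * fps_X ^ r"
    by (simp only: m.hom_minus m.hom_one m.hom_mult m.hom_power mc mX poly_hom.hom_mult poly_hom.hom_prod z0)
  ultimately show ?thesis by (simp only: m.hom_mult)
qed

section \<open>Convergence in $K_\infty$\<close>

declare One_nat_def [simp del]

text \<open>The factor \<open>r\<close> avoids fractions: the Frobenius roots at \<open>f\<close> have valuation at least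
  $\deg f / r$ at infinity.\<close>
definition ord_ge :: "nat \<Rightarrow> int \<Rightarrow> 'a::field fls \<Rightarrow> bool"
  where "ord_ge r N x \<longleftrightarrow> x = 0 \<or> N \<le> int r * fls_subdegree x"

lemma ord_ge_0 [simp]: "ord_ge r N 0"
  by (simp add: ord_ge_def)

lemma ord_ge_1 [simp]: "ord_ge r 0 1"
  by (simp add: ord_ge_def)

lemma ord_ge_mono: "ord_ge r N x \<Longrightarrow> M \<le> N \<Longrightarrow> ord_ge r M x"
  by (auto simp: ord_ge_def)

lemma ord_ge_add:
  assumes "ord_ge r N x" "ord_ge r N y" shows "ord_ge r N (x + y)"
proof (cases "x = 0 \<or> y = 0 \<or> x + y = 0")
  case False
  then have xy: "N \<le> int r * fls_subdegree x" "N \<le> int r * fls_subdegree y"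
    using assms by (auto simp: ord_ge_def)
  have "min (fls_subdegree x) (fls_subdegree y) \<le> fls_subdegree (x + y)"
    using False by (intro fls_plus_subdegree) simp
  then have "int r * min (fls_subdegree x) (fls_subdegree y) \<le> int r * fls_subdegree (x + y)"
    by (rule mult_left_mono) simp
  moreover have "N \<le> int r * min (fls_subdegree x) (fls_subdegree y)" using xy by (simp add: min_def)
  ultimately show ?thesis by (simp add: ord_ge_def)
qed (use assms in auto)

lemma ord_ge_uminus: "ord_ge r N (- x) \<longleftrightarrow> ord_ge r N x"
  by (simp add: ord_ge_def)

lemma ord_ge_diff: "ord_ge r N x \<Longrightarrow> ord_ge r N y \<Longrightarrow> ord_ge r N (x - y)"
  using ord_ge_add[of r N x "- y"] by (simp add: ord_ge_uminus)

lemma ord_ge_sum: "(\<And>i. i \<in> I \<Longrightarrow> ord_ge r N (g i)) \<Longrightarrow> ord_ge r N (sum g I)"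
  by (induction I rule: infinite_finite_induct) (simp_all add: ord_ge_add)

lemma ord_ge_mult: "ord_ge r N x \<Longrightarrow> ord_ge r M y \<Longrightarrow> ord_ge r (N + M) (x * y)"
  by (cases "x = 0 \<or> y = 0") (auto simp: ord_ge_def distrib_left)

lemma ord_ge_prod: "(\<And>i. i \<in> I \<Longrightarrow> ord_ge r (N i) (g i)) \<Longrightarrow> finite I \<Longrightarrow> ord_ge r (sum N I) (prod g I)"
  by (induction I rule: infinite_finite_induct) (simp_all add: ord_ge_mult)

lemma ord_ge_power: "ord_ge r N x \<Longrightarrow> ord_ge r (int n * N) (x ^ n)"
  using ord_ge_prod[of "{..<n}" r "\<lambda>_. N" "\<lambda>_. x"] by simp

lemma ord_ge_scale: "ord_ge 1 N x \<longleftrightarrow> ord_ge r (int r * N) x" if "r > 0"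
  using that by (simp add: ord_ge_def)

lemma ord_ge_nth: "ord_ge 1 N x \<longleftrightarrow> (\<forall>i<N. fls_nth x i = 0)"
  unfolding ord_ge_def using fls_subdegree_geI[of x N] by (auto intro: fls_eq0_below_subdegree)

lemma ord_ge_all_imp_0: "(\<And>N. ord_ge 1 N x) \<Longrightarrow> x = 0"
proof (rule fls_eqI)
  fix n assume "\<And>N. ord_ge 1 N x"
  from this[of "n + 1"] show "fls_nth x n = fls_nth 0 n" unfolding ord_ge_nth by simp
qed

lemma fls_tendstoI:
  fixes L :: "'a::field fls"
  assumes "\<And>N. \<forall>\<^sub>F i in F. ord_ge 1 N (g i - L)"
  shows "(g \<longlongrightarrow> L) F"
proof (rule tendstoI)
  fix e :: real assume "e > 0"
  then obtain n where n: "inverse (2 ^ n) < e"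
    using real_arch_pow_inv[of e "1/2"] by (auto simp: power_one_over inverse_eq_divide)
  have d: "dist x L < e" if "ord_ge 1 (int n) (x - L)" for x
  proof (cases "x = L")
    case False
    then have s: "int n \<le> fls_subdegree (x - L)" using that by (simp add: ord_ge_def)
    then have "dist x L = inverse (2 ^ nat (fls_subdegree (x - L)))" using False by (simp add: dist_fls_def)
    also have "\<dots> \<le> inverse (2 ^ n)" using s by (intro le_imp_inverse_le power_increasing) auto
    finally show ?thesis using n by simp
  qed (use \<open>e > 0\<close> in simp)
  show "\<forall>\<^sub>F i in F. dist (g i) L < e"
    by (rule eventually_mono[OF assms[of "int n"] d])
qed

lemma fls_tendstoD:
  fixes L :: "'a::field fls"
  assumes "(g \<longlongrightarrow> L) F"
  shows "\<forall>\<^sub>F i in F. ord_ge 1 N (g i - L)"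
proof -
  have "ord_ge 1 N (x - L)" if "dist x L < inverse (2 ^ nat N)" for x
  proof (cases "x = L")
    case False
    have "N \<le> fls_subdegree (x - L)"
    proof (rule ccontr)
      assume n: "\<not> ?thesis"
      show False
      proof (cases "fls_subdegree (x - L) \<ge> 0")
        case True
        then have "inverse (2 ^ nat N) \<le> (inverse (2 ^ nat (fls_subdegree (x - L))) :: real)"
          using n by (intro le_imp_inverse_le power_increasing) auto
        moreover have "dist x L = inverse (2 ^ nat (fls_subdegree (x - L)))"
          using True False by (simp add: dist_fls_def)
        ultimately show False using that by linarith
      next
        case neg: False
        have "inverse (2 ^ nat N) \<le> (1 :: real)" by (simp add: inverse_le_1_iff)
        also have "1 \<le> (2 ^ nat (- fls_subdegree (x - L)) :: real)" by simp
        finally show False using that neg False by (simp add: dist_fls_def)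
      qed
    qed
    then show ?thesis by (simp add: ord_ge_def)
  qed simp
  then show ?thesis using tendstoD[OF assms, of "inverse (2 ^ nat N)"] by (auto elim: eventually_mono)
qed

section \<open>Null families\<close>

text \<open>The terms that are not small; a family is null when this set is finite for every
  \<open>N\<close>.\<close>

definition null_bad :: "('i \<Rightarrow> 'a::field fls) \<Rightarrow> 'i set \<Rightarrow> int \<Rightarrow> 'i set"
  where "null_bad t A N = {i \<in> A. \<not> ord_ge 1 N (t i)}"

lemma null_bad_mono: "M \<le> N \<Longrightarrow> null_bad t A M \<subseteq> null_bad t A N"
  by (auto simp: null_bad_def intro: ord_ge_mono)

text \<open>In a complete nonarchimedean field null families are summable. The second conclusion
  keeps the error explicit: any finite set that contains the large terms already gives the sum up to
  order \<open>N\<close>.\<close>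

lemma null_family_limit:
  fixes t :: "'i \<Rightarrow> 'a::field fls"
  assumes fin: "\<And>N. finite (null_bad t A N)"
  obtains L where "(t has_sum L) A"
    "\<And>N C. finite C \<Longrightarrow> null_bad t A N \<subseteq> C \<Longrightarrow> C \<subseteq> A \<Longrightarrow> ord_ge 1 N (sum t C - L)"
proof -
  \<comment> \<open>Terms of order at least n + 1 do not contribute to the coefficient of index
    \<open>n\<close>.\<close>
  define co where "co n = (\<Sum>i\<in>null_bad t A (n + 1). fls_nth (t i) n)" for n
  define m where "m = Min (insert 0 (fls_subdegree ` t ` null_bad t A 0))"
  have m: "m \<le> 0" "\<And>i. i \<in> null_bad t A 0 \<Longrightarrow> m \<le> fls_subdegree (t i)"
    unfolding m_def using fin by (auto intro!: Min_le)
  have low: "co n = 0" if "n < m" for n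
    unfolding co_def
  proof (rule sum.neutral, rule ballI)
    fix i assume "i \<in> null_bad t A (n + 1)"
    then have "i \<in> null_bad t A 0" using null_bad_mono[of "n + 1" 0 t A] that m(1) by auto
    then show "fls_nth (t i) n = 0" using m(2) that by (intro fls_eq0_below_subdegree) force
  qed
  define L where "L = Abs_fls co"
  have L: "fls_nth L n = co n" for n
    unfolding L_def by (rule nth_Abs_fls_lower_bound[of m]) (use low in auto)
  have close: "ord_ge 1 N (sum t C - L)" if C: "finite C" "null_bad t A N \<subseteq> C" "C \<subseteq> A" for N C
    unfolding ord_ge_nth
  proof (intro allI impI)
    fix n assume n: "n < N"
    have "null_bad t A (n + 1) \<subseteq> C" using null_bad_mono[of "n + 1" N t A] n C by auto
    then have "(\<Sum>i\<in>C. fls_nth (t i) n) = co n"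
      unfolding co_def
    proof (intro sum.mono_neutral_right ballI C(1))
      fix i assume "i \<in> C - null_bad t A (n + 1)"
      then have "ord_ge 1 (n + 1) (t i)" using C by (auto simp: null_bad_def)
      then show "fls_nth (t i) n = 0" unfolding ord_ge_nth by simp
    qed
    then show "fls_nth (sum t C - L) n = 0" by (simp add: fls_nth_sum L)
  qed
  have "(t has_sum L) A"
    unfolding has_sum_def
  proof (rule fls_tendstoI)
    fix N
    show "\<forall>\<^sub>F C in finite_subsets_at_top A. ord_ge 1 N (sum t C - L)"
      unfolding eventually_finite_subsets_at_top
      by (rule exI[of _ "null_bad t A N"]) (use fin close in \<open>auto simp: null_bad_def\<close>)
  qed
  then show ?thesis using that close by blast
qed

section \<open>The embedding of K into K_infinity\<close>

interpretation flsc: inj_comm_ring_hom "fls_const :: 'a::field \<Rightarrow> 'a fls"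
  by unfold_locales (simp_all flip: fls_const_mult_const fls_plus_const add: fls_const_nonzero)

interpretation akinf: comm_ring_hom "A_to_Kinf :: 'q::field poly \<Rightarrow> 'q fls"
proof -
  interpret m: map_poly_comm_ring_hom "fls_const :: 'q \<Rightarrow> 'q fls" ..
  show "comm_ring_hom (A_to_Kinf :: 'q poly \<Rightarrow> 'q fls)"
    by unfold_locales (simp_all add: A_to_Kinf_def m.hom_add m.hom_mult)
qed

lemma A_to_Kinf_nth: "fls_nth (A_to_Kinf a) n = (if n \<le> 0 then coeff a (nat (- n)) else 0)"
proof -
  have "A_to_Kinf a = (\<Sum>i\<le>degree a. fls_const (coeff a i) * fls_X_inv ^ i)"
    unfolding A_to_Kinf_def poly_altdef by (simp add: degree_map_poly coeff_map_poly)
  then have "fls_nth (A_to_Kinf a) n = (\<Sum>i\<le>degree a. coeff a i * (if n = - int i then 1 else 0))"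
    by (simp add: fls_nth_sum)
  also have "\<dots> = (\<Sum>i\<le>degree a. if i = nat (- n) then (if n \<le> 0 then coeff a i else 0) else 0)"
    by (rule sum.cong) auto
  also have "\<dots> = (if n \<le> 0 then coeff a (nat (- n)) else 0)"
    by (simp add: coeff_eq_0)
  finally show ?thesis .
qed

lemma A_to_Kinf_eq_0_iff [simp]: "A_to_Kinf a = 0 \<longleftrightarrow> a = 0"
proof
  assume *: "A_to_Kinf a = 0"
  show "a = 0"
  proof (rule poly_eqI)
    fix i show "coeff a i = coeff 0 i" using A_to_Kinf_nth[of a "- int i"] unfolding * by simp
  qed
qed simp

lemma A_to_Kinf_subdegree: "a \<noteq> 0 \<Longrightarrow> fls_subdegree (A_to_Kinf a) = - int (degree a)"
  by (rule fls_subdegree_eqI) (auto simp: A_to_Kinf_nth coeff_eq_0)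

lemma K_to_Kinf_Fract: "v \<noteq> 0 \<Longrightarrow> K_to_Kinf (Fract u v) = A_to_Kinf u / A_to_Kinf v"
  unfolding K_to_Kinf_def
proof (rule the_equality)
  assume v: "v \<noteq> 0"
  show "\<forall>u' v'. v' \<noteq> 0 \<and> Fract u v = Fract u' v' \<longrightarrow> A_to_Kinf u / A_to_Kinf v = A_to_Kinf u' / A_to_Kinf v'"
  proof (intro allI impI)
    fix u' v' assume *: "v' \<noteq> 0 \<and> Fract u v = Fract u' v'"
    then have "v' \<noteq> 0" "Fract u v = Fract u' v'" by auto
    then have "u * v' = u' * v" using v by (simp add: eq_fract)
    then have "A_to_Kinf (u * v') = A_to_Kinf (u' * v)" by simp
    then show "A_to_Kinf u / A_to_Kinf v = A_to_Kinf u' / A_to_Kinf v'"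
      using v * by (simp add: akinf.hom_mult divide_simps)
  qed
qed blast

interpretation kinf: field_hom "K_to_Kinf :: 'q::field poly fract \<Rightarrow> 'q fls"
proof
  show "K_to_Kinf 0 = (0 :: 'q fls)" using K_to_Kinf_Fract[of 1 0] by (simp add: fract_collapse)
  show "K_to_Kinf 1 = (1 :: 'q fls)" using K_to_Kinf_Fract[of 1 1] by (simp add: fract_collapse)
  fix x y :: "'q poly fract"
  obtain a b c d where xy: "x = Fract a b" "b \<noteq> 0" "y = Fract c d" "d \<noteq> 0" by (metis Fract_cases)
  show "K_to_Kinf (x + y) = K_to_Kinf x + K_to_Kinf y"
    using xy by (simp add: K_to_Kinf_Fract akinf.hom_add akinf.hom_mult divide_simps)
  show "K_to_Kinf (x * y) = K_to_Kinf x * K_to_Kinf y"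
    using xy by (simp add: K_to_Kinf_Fract akinf.hom_mult)
qed

lemma K_to_Kinf_to_fract: "K_to_Kinf (to_fract a) = A_to_Kinf a"
  by (simp add: to_fract_def K_to_Kinf_Fract)

section \<open>Euler products\<close>

abbreviation fexp :: "'a::field poly \<Rightarrow> 'a poly \<Rightarrow> nat" where "fexp f a \<equiv> Max {n. f ^ n dvd a}"

lemma prime_power_dvd_iff:
  fixes f c :: "'a::idom"
  assumes f: "prime_elem f" and c: "\<not> f dvd c"
  shows "f ^ n dvd f ^ k * c \<longleftrightarrow> n \<le> (k :: nat)"
proof
  assume *: "f ^ n dvd f ^ k * c"
  show "n \<le> k"
  proof (rule ccontr)
    assume "\<not> n \<le> k"
    then have "f ^ k * f dvd f ^ n" by (metis le_imp_power_dvd not_less_eq_eq power_Suc2)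
    then have "f ^ k * f dvd f ^ k * c" using * dvd_trans by blast
    moreover have "f \<noteq> 0" using f by (simp add: prime_elem_def)
    then have "f ^ k \<noteq> 0" by simp
    ultimately show False using c dvd_mult_cancel_left[of "f ^ k" f c] by blast
  qed
qed (simp add: le_imp_power_dvd dvd_mult2)

lemma prod_monic_primes_not_dvd:
  assumes "F \<subseteq> monic_primes" "finite F" "f \<in> monic_primes" "f \<notin> F"
  shows "\<not> f dvd (\<Prod>g\<in>F. g ^ (e g :: nat))"
proof
  have p: "prime_elem f" by (rule monic_primes_prime[OF assms(3)])
  assume "f dvd (\<Prod>g\<in>F. g ^ e g)"
  then obtain g where g: "g \<in> F" "f dvd g ^ e g" using prime_elem_dvd_prodD[OF p assms(2)] by blast
  then have "f dvd g" using prime_elem_dvd_power[OF p] by blast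
  then have "f = g" using monic_primes_dvd_imp_eq[of f g] assms g by blast
  then show False using g assms by blast
qed

lemma fexp_prod:
  assumes F: "F \<subseteq> monic_primes" "finite F" and f: "f \<in> F"
  shows "fexp f (\<Prod>g\<in>F. g ^ e g) = e f"
proof -
  have "(\<Prod>g\<in>F. g ^ e g) = f ^ e f * (\<Prod>g\<in>F - {f}. g ^ e g)" by (rule prod.remove[OF F(2) f])
  moreover have nd: "\<not> f dvd (\<Prod>g\<in>F - {f}. g ^ e g)"
    by (rule prod_monic_primes_not_dvd) (use F f in auto)
  have "prime_elem f" using monic_primes_prime F f by blast
  ultimately have "{n. f ^ n dvd (\<Prod>g\<in>F. g ^ e g)} = {..e f}"
    using prime_power_dvd_iff[OF _ nd] by (simp only: atMost_def)
  moreover have "Max {..e f} = e f" by (rule Max_eqI) auto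
  ultimately show ?thesis by simp
qed

lemma prod_powers_monic: "F \<subseteq> monic_primes \<Longrightarrow> (\<Prod>g\<in>F. g ^ e g) \<in> monics"
  by (induction F rule: infinite_finite_induct)
     (auto simp: monics_def lead_coeff_mult lead_coeff_power monic_primes_def)

lemma monic_factorization:
  assumes "a \<in> monics" "finite F" "{f \<in> monic_primes. f dvd a} \<subseteq> F" "F \<subseteq> monic_primes"
  shows "\<exists>e. a = (\<Prod>f\<in>F. f ^ e f)"
  using assms(1,3)
proof (induction "degree a" arbitrary: a rule: less_induct)
  case less
  have a0: "a \<noteq> 0" using less.prems by (auto simp: monics_def)
  show ?case
  proof (cases "degree a = 0")
    case True
    then have "a = 1" using less.prems(1) by (auto simp: monics_def elim!: degree_eq_zeroE simp flip: one_pCons)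
    then show ?thesis by (intro exI[of _ "\<lambda>_. 0"]) simp
  next
    case False
    then obtain f where f: "irreducible f" "f dvd a" "lead_coeff f = 1"
      using irreducible_factor_exists[of a] by blast
    then have fp: "f \<in> monic_primes" by (simp add: monic_primes_def monics_def)
    then have fF: "f \<in> F" using less.prems f by blast
    obtain b where b: "a = f * b" using f(2) by (elim dvdE)
    have b0: "b \<noteq> 0" using a0 b by auto
    have "degree b < degree a" using a0 b monic_primes_degree[OF fp] by (simp add: degree_mult_eq)
    moreover have "b \<in> monics" using less.prems(1) f(3) by (simp add: monics_def b lead_coeff_mult)
    moreover have "{f \<in> monic_primes. f dvd b} \<subseteq> F" using less.prems(2) b by auto
    ultimately obtain e where "b = (\<Prod>g\<in>F. g ^ e g)" using less.hyps[of b] by blast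
    then have "a = f * (f ^ e f * (\<Prod>g\<in>F - {f}. g ^ e g))"
      unfolding b by (simp add: prod.remove[OF assms(2) fF])
    also have "\<dots> = f ^ (e(f := Suc (e f))) f * (\<Prod>g\<in>F - {f}. g ^ (e(f := Suc (e f))) g)"
      by (simp add: mult.assoc)
    also have "\<dots> = (\<Prod>g\<in>F. g ^ (e(f := Suc (e f))) g)" by (rule prod.remove[OF assms(2) fF, symmetric])
    finally show ?thesis by blast
  qed
qed

lemma monic_eq_prod_fexp:
  assumes "a \<in> monics" "finite F" "{f \<in> monic_primes. f dvd a} \<subseteq> F" "F \<subseteq> monic_primes"
  shows "a = (\<Prod>f\<in>F. f ^ fexp f a)"
proof -
  obtain e where e: "a = (\<Prod>f\<in>F. f ^ e f)" using monic_factorization[OF assms] by blast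
  have "fexp f a = e f" if "f \<in> F" for f unfolding e by (rule fexp_prod[OF assms(4,2) that])
  then show ?thesis by (subst e) (intro prod.cong, auto)
qed

lemma monic_nonzero: "a \<in> monics \<Longrightarrow> a \<noteq> 0"
  by (auto simp: monics_def)

lemma lowdeg_Suc_iff: "p \<in> lowdeg (Suc n) \<longleftrightarrow> degree p \<le> n"
  by (auto simp: lowdeg_iff)

lemma finite_monic_prime_divisors:
  assumes "a \<noteq> 0" shows "finite {f \<in> monic_primes. f dvd (a :: 'q::{field,finite} poly)}"
proof (rule finite_subset)
  show "{f \<in> monic_primes. f dvd a} \<subseteq> lowdeg (Suc (degree a))"
    using dvd_imp_degree_le[OF _ assms] by (auto simp: lowdeg_Suc_iff)
qed simp

text \<open>Approximation becomes congruence modulo an ideal, so that \<open>ideal_cong_prod\<close>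
  compares finite products.\<close>

lemma ord_ge_ideal:
  assumes "N \<ge> 0"
  shows "is_subring {x :: 'a::field fls. ord_ge 1 0 x}" "is_ideal {x :: 'a fls. ord_ge 1 0 x} {x. ord_ge 1 N x}"
proof -
  show "is_subring {x :: 'a::field fls. ord_ge 1 0 x}"
    using ord_ge_mult[of 1 0 _ 0] by (auto simp: is_subring_def ord_ge_add ord_ge_uminus ord_ge_diff simp del: One_nat_def)
  show "is_ideal {x :: 'a fls. ord_ge 1 0 x} {x. ord_ge 1 N x}"
    using ord_ge_mult[of 1 0 _ N] assms by (auto simp: is_ideal_def ord_ge_add ord_ge_diff intro: ord_ge_mono simp del: One_nat_def)
qed

section \<open>Euler products of multiplicative families\<close>

text \<open>Common to both series on the right-hand side: \<open>J\<close> indexes the variables,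
  and \<open>tf f k\<close> is the contribution of the prime \<open>f\<close> with exponents
  \<open>k\<close>. The bound grows with the degrees, which makes all families involved
  null.\<close>

locale euler =
  fixes J :: "nat set" and r :: nat and tf :: "'q::{field,finite} poly \<Rightarrow> (nat \<Rightarrow> nat) \<Rightarrow> 'q fls"
  assumes J: "finite J" and r: "r > 0"
    and tf_cong: "\<And>f k k'. (\<And>j. j \<in> J \<Longrightarrow> k j = k' j) \<Longrightarrow> tf f k = tf f k'"
    and tf_0: "\<And>f. f \<in> monic_primes \<Longrightarrow> tf f (\<lambda>_. 0) = 1"
    and tf_bound: "\<And>f k. f \<in> monic_primes \<Longrightarrow> ord_ge r (int (degree f * (\<Sum>j\<in>J. k j))) (tf f k)"
begin

definition term_of :: "(nat \<Rightarrow> 'q poly) \<Rightarrow> 'q fls"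
  where "term_of a = (\<Prod>f\<in>{f \<in> monic_primes. f dvd (\<Prod>j\<in>J. a j)}. tf f (\<lambda>j. fexp f (a j)))"

lemma term_of_superset:
  assumes a: "\<And>j. j \<in> J \<Longrightarrow> a j \<in> monics" and F: "finite F" "F \<subseteq> monic_primes"
    and sub: "{f \<in> monic_primes. f dvd (\<Prod>j\<in>J. a j)} \<subseteq> F"
  shows "term_of a = (\<Prod>f\<in>F. tf f (\<lambda>j. fexp f (a j)))"
  unfolding term_of_def
proof (rule prod.mono_neutral_left[OF F(1) sub], rule ballI)
  fix f assume f: "f \<in> F - {f \<in> monic_primes. f dvd (\<Prod>j\<in>J. a j)}"
  have "fexp f (a j) = 0" if j: "j \<in> J" for j
  proof -
    have "\<not> f dvd a j" using f F dvd_trans[OF _ dvd_prodI[OF J j, of a]] by auto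
    then have "n = 0" if "f ^ n dvd a j" for n using that by (cases n) (auto dest: dvd_mult_left)
    then have "{n. f ^ n dvd a j} = {0}" by auto
    then show ?thesis by simp
  qed
  then have "tf f (\<lambda>j. fexp f (a j)) = tf f (\<lambda>_. 0)" by (rule tf_cong)
  then show "tf f (\<lambda>j. fexp f (a j)) = 1" using f F tf_0 by auto
qed

lemma divisor_of_factor:
  assumes "j \<in> J" shows "{f \<in> monic_primes. f dvd a j} \<subseteq> {f \<in> monic_primes. f dvd (\<Prod>j\<in>J. a j)}"
  using dvd_prodI[OF J assms, of a] dvd_trans by blast

lemma term_of_bound:
  assumes a: "\<And>j. j \<in> J \<Longrightarrow> a j \<in> monics"
  shows "ord_ge r (int (\<Sum>j\<in>J. degree (a j))) (term_of a)"
proof -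
  define F where "F = {f \<in> monic_primes. f dvd (\<Prod>j\<in>J. a j)}"
  have F: "finite F" "F \<subseteq> monic_primes"
    using finite_monic_prime_divisors[of "\<Prod>j\<in>J. a j"] a J monic_nonzero by (auto simp: F_def)
  have "degree (a j) = (\<Sum>f\<in>F. degree f * fexp f (a j))" if j: "j \<in> J" for j
  proof -
    have "{f \<in> monic_primes. f dvd a j} \<subseteq> F" unfolding F_def by (rule divisor_of_factor[OF j])
    from arg_cong[OF monic_eq_prod_fexp[OF a[OF j] F(1) this F(2)], of degree]
    have "degree (a j) = degree (\<Prod>f\<in>F. f ^ fexp f (a j))" .
    also have "\<dots> = (\<Sum>f\<in>F. degree (f ^ fexp f (a j)))"
      by (rule degree_prod_eq_sum_degree) (use F monic_primes_nonzero in auto)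
    also have "\<dots> = (\<Sum>f\<in>F. degree f * fexp f (a j))"
    proof (rule sum.cong[OF refl])
      fix f assume "f \<in> F"
      then have "f \<noteq> 0" using F monic_primes_nonzero by blast
      then show "degree (f ^ fexp f (a j)) = degree f * fexp f (a j)" by (rule degree_power_eq)
    qed
    finally show ?thesis .
  qed
  then have "(\<Sum>j\<in>J. degree (a j)) = (\<Sum>f\<in>F. degree f * (\<Sum>j\<in>J. fexp f (a j)))"
    unfolding sum_distrib_left by (subst sum.swap) simp
  then show ?thesis
    unfolding term_of_def F_def[symmetric] using F
    by (simp only: of_nat_sum) (intro ord_ge_prod tf_bound, auto)
qed

text \<open>A term that is not small has entries of bounded degree by \<open>term_of_bound\<close>,
  and over a finite field there are finitely many such tuples.\<close>

lemma null_terms: "finite (null_bad term_of (J \<rightarrow>\<^sub>E monics) N)"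
  and null_terms_degree: "a \<in> null_bad term_of (J \<rightarrow>\<^sub>E monics) N \<Longrightarrow> j \<in> J \<Longrightarrow> degree (a j) \<le> nat (int r * N)"
proof -
  have deg: "degree (a j) \<le> nat (int r * N)" if a: "a \<in> null_bad term_of (J \<rightarrow>\<^sub>E monics) N" and j: "j \<in> J" for a j
  proof -
    have "ord_ge r (int (\<Sum>j\<in>J. degree (a j))) (term_of a)"
      by (rule term_of_bound) (use a in \<open>auto simp: null_bad_def\<close>)
    moreover have "\<not> ord_ge r (int r * N) (term_of a)" using a ord_ge_scale[OF r] by (auto simp: null_bad_def)
    ultimately have "int (\<Sum>j\<in>J. degree (a j)) < int r * N" using ord_ge_mono not_le by blast
    moreover have "degree (a j) \<le> (\<Sum>j\<in>J. degree (a j))" by (rule member_le_sum[OF j _ J]) simp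
    ultimately show ?thesis by linarith
  qed
  then show "a \<in> null_bad term_of (J \<rightarrow>\<^sub>E monics) N \<Longrightarrow> j \<in> J \<Longrightarrow> degree (a j) \<le> nat (int r * N)" .
  show "finite (null_bad term_of (J \<rightarrow>\<^sub>E monics) N)"
  proof (rule finite_subset)
    show "null_bad term_of (J \<rightarrow>\<^sub>E monics) N \<subseteq> J \<rightarrow>\<^sub>E lowdeg (Suc (nat (int r * N)))"
    proof
      fix a assume a: "a \<in> null_bad term_of (J \<rightarrow>\<^sub>E monics) N"
      then show "a \<in> J \<rightarrow>\<^sub>E lowdeg (Suc (nat (int r * N)))"
        using deg[OF a] unfolding null_bad_def PiE_def Pi_def lowdeg_Suc_iff by blast
    qed
  qed (simp add: finite_PiE J)
qed

lemma null_local_exponent: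
  assumes f: "f \<in> monic_primes" and k: "k \<in> null_bad (tf f) (J \<rightarrow>\<^sub>E UNIV) N" and j: "j \<in> J"
  shows "k j \<le> nat (int r * N)"
proof -
  have "\<not> ord_ge r (int r * N) (tf f k)" using k ord_ge_scale[OF r] by (auto simp: null_bad_def)
  then have "int (degree f * (\<Sum>j\<in>J. k j)) < int r * N" using tf_bound[OF f, of k] ord_ge_mono not_le by blast
  moreover have "1 * k j \<le> degree f * (\<Sum>j\<in>J. k j)"
    by (intro mult_le_mono member_le_sum[OF j _ J]) (use monic_primes_degree[OF f] in auto)
  ultimately show ?thesis by linarith
qed

lemma null_local:
  assumes f: "f \<in> monic_primes" shows "finite (null_bad (tf f) (J \<rightarrow>\<^sub>E UNIV) N)"
proof (rule finite_subset)
  show "null_bad (tf f) (J \<rightarrow>\<^sub>E UNIV) N \<subseteq> J \<rightarrow>\<^sub>E {..nat (int r * N)}"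
  proof
    fix k assume k: "k \<in> null_bad (tf f) (J \<rightarrow>\<^sub>E UNIV) N"
    then show "k \<in> J \<rightarrow>\<^sub>E {..nat (int r * N)}"
      using null_local_exponent[OF f k] unfolding null_bad_def PiE_def Pi_def atMost_iff by blast
  qed
qed (simp add: finite_PiE J)

text \<open>Product and series are compared with one finite sum, over the tuples composed of primes
  in \<open>F\<close> with exponents at most \<open>D\<close>. The product of the truncated local
  sums expands into it exactly, and by unique factorization it contains all terms of the series that
  are not small.\<close>

theorem euler_product:
  assumes H: "\<And>f. f \<in> monic_primes \<Longrightarrow> (tf f has_sum H f) (J \<rightarrow>\<^sub>E UNIV)"
  obtains L where "(term_of has_sum L) (J \<rightarrow>\<^sub>E monics)"
    "((\<lambda>F. \<Prod>f\<in>F. H f) \<longlongrightarrow> L) (finite_subsets_at_top monic_primes)"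
proof -
  let ?A = "J \<rightarrow>\<^sub>E (monics :: 'q poly set)"
  obtain L where L: "(term_of has_sum L) ?A"
    "\<And>N C. finite C \<Longrightarrow> null_bad term_of ?A N \<subseteq> C \<Longrightarrow> C \<subseteq> ?A \<Longrightarrow> ord_ge 1 N (sum term_of C - L)"
    using null_family_limit[of term_of ?A, OF null_terms] by blast
  have Hc: "ord_ge 1 N (sum (tf f) C - H f)"
    if f: "f \<in> monic_primes" and C: "finite C" "null_bad (tf f) (J \<rightarrow>\<^sub>E UNIV) N \<subseteq> C" "C \<subseteq> J \<rightarrow>\<^sub>E UNIV" for f N C
  proof -
    obtain H' where H': "(tf f has_sum H') (J \<rightarrow>\<^sub>E UNIV)"
      "\<And>N C. finite C \<Longrightarrow> null_bad (tf f) (J \<rightarrow>\<^sub>E UNIV) N \<subseteq> C \<Longrightarrow> C \<subseteq> J \<rightarrow>\<^sub>E UNIV \<Longrightarrow> ord_ge 1 N (sum (tf f) C - H')"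
      using null_family_limit[of "tf f" "J \<rightarrow>\<^sub>E UNIV", OF null_local[OF f]] by blast
    have "H' = H f" using infsumI[OF H'(1)] infsumI[OF H[OF f]] by simp
    then show ?thesis using H'(2)[OF C] by simp
  qed
  have tf0: "ord_ge 1 0 (tf f k)" if "f \<in> monic_primes" for f k
  proof -
    have "ord_ge r (int r * 0) (tf f k)"
      unfolding mult_zero_right by (rule ord_ge_mono[OF tf_bound[OF that, of k] of_nat_0_le_iff])
    then show ?thesis unfolding ord_ge_scale[OF r] .
  qed
  have H0: "ord_ge 1 0 (H f)" if f: "f \<in> monic_primes" for f
  proof -
    have "null_bad (tf f) (J \<rightarrow>\<^sub>E UNIV) 0 \<subseteq> {}" using tf0[OF f] by (auto simp: null_bad_def)
    from Hc[OF f _ this] show ?thesis by (simp add: ord_ge_uminus)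
  qed
  have "((\<lambda>F. \<Prod>f\<in>F. H f) \<longlongrightarrow> L) (finite_subsets_at_top monic_primes)"
  proof (rule fls_tendstoI)
    fix N0 :: int
    \<comment> \<open>\<open>ord_ge_ideal\<close> requires a nonnegative bound.\<close>
    define N where "N = max 0 N0"
    define D where "D = nat (int r * N)"
    \<comment> \<open>A tuple whose term is not small has entries of degree at most
      \<open>D\<close>, so all its primes are among these.\<close>
    define F0 where "F0 = {f \<in> (monic_primes :: 'q poly set). degree f \<le> D}"
    have F0: "finite F0" by (rule finite_subset[of _ "lowdeg (Suc D)"]) (auto simp: F0_def lowdeg_Suc_iff)
    have close: "ord_ge 1 N ((\<Prod>f\<in>F. H f) - L)" if F: "finite F" "F0 \<subseteq> F" "F \<subseteq> monic_primes" for F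
    proof -
      define B where "B = J \<rightarrow>\<^sub>E {..D}"
      have B: "finite B" by (simp add: B_def finite_PiE J)
      define mk where "mk K = (\<lambda>j\<in>J. \<Prod>f\<in>F. f ^ K f j)" for K
      define h where "h f = (\<Sum>k\<in>B. tf f k)" for f
      \<comment> \<open>Truncating the exponents at \<open>D\<close> discards only small local
        terms.\<close>
      have hH: "ord_ge 1 N (H f - h f)" if f: "f \<in> F" for f
      proof -
        have fp: "f \<in> monic_primes" using f F by blast
        have "ord_ge 1 N (h f - H f)"
          unfolding h_def
        proof (rule Hc[OF fp B])
          show "null_bad (tf f) (J \<rightarrow>\<^sub>E UNIV) N \<subseteq> B"
          proof
            fix k assume k: "k \<in> null_bad (tf f) (J \<rightarrow>\<^sub>E UNIV) N"
            then show "k \<in> B"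
              using null_local_exponent[OF fp k] unfolding B_def D_def null_bad_def PiE_def Pi_def atMost_iff by blast
          qed
        qed (auto simp: B_def)
        then show ?thesis using ord_ge_uminus[of 1 N "h f - H f"] by simp
      qed
      have "(\<Prod>f\<in>F. H f) - (\<Prod>f\<in>F. h f) \<in> {x. ord_ge 1 N x}"
        by (rule ideal_cong_prod[OF ord_ge_ideal]) (use F hH H0 tf0 in \<open>auto simp: N_def h_def intro!: ord_ge_sum\<close>)
      moreover have "(\<Prod>f\<in>F. h f) = sum term_of (mk ` (F \<rightarrow>\<^sub>E B))"
      proof -
        have ex: "fexp f (mk K j) = K f j" if "f \<in> F" "j \<in> J" for f K j
          using fexp_prod[OF F(3,1) that(1), of "\<lambda>f. K f j"] that(2) by (simp add: mk_def)
        have mon: "mk K j \<in> monics" if "j \<in> J" for K j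
          using prod_powers_monic[OF F(3), of "\<lambda>f. K f j"] that by (simp add: mk_def)
        have "inj_on mk (F \<rightarrow>\<^sub>E B)"
        proof (rule inj_onI)
          fix K K' assume K: "K \<in> F \<rightarrow>\<^sub>E B" "K' \<in> F \<rightarrow>\<^sub>E B" "mk K = mk K'"
          show "K = K'"
          proof (rule PiE_ext[OF K(1,2)])
            fix f assume f: "f \<in> F"
            show "K f = K' f"
            proof (rule PiE_ext)
              show "K f \<in> J \<rightarrow>\<^sub>E {..D}" "K' f \<in> J \<rightarrow>\<^sub>E {..D}" using K f by (auto simp: B_def)
              fix j assume j: "j \<in> J"
              show "K f j = K' f j" using ex[OF f j, of K] ex[OF f j, of K'] K(3) by simp
            qed
          qed
        qed
        moreover have "term_of (mk K) = (\<Prod>f\<in>F. tf f (K f))" for K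
        proof -
          have "{f \<in> monic_primes. f dvd (\<Prod>j\<in>J. mk K j)} \<subseteq> F"
          proof
            fix f assume f: "f \<in> {f \<in> monic_primes. f dvd (\<Prod>j\<in>J. mk K j)}"
            then obtain j where j: "j \<in> J" "f dvd mk K j"
              using prime_elem_dvd_prodD[OF monic_primes_prime J, of f] by blast
            then show "f \<in> F" using prod_monic_primes_not_dvd[OF F(3,1), of f "\<lambda>f. K f j"] f by (auto simp: mk_def)
          qed
          from term_of_superset[OF mon F(1,3) this]
          have "term_of (mk K) = (\<Prod>f\<in>F. tf f (\<lambda>j. fexp f (mk K j)))" by simp
          also have "\<dots> = (\<Prod>f\<in>F. tf f (K f))"
          proof (rule prod.cong[OF refl])
            fix f assume f: "f \<in> F"
            show "tf f (\<lambda>j. fexp f (mk K j)) = tf f (K f)" by (rule tf_cong) (rule ex[OF f])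
          qed
          finally show ?thesis .
        qed
        ultimately show ?thesis
          unfolding h_def prod_sum_PiE[OF F(1) B] by (simp add: sum.reindex)
      qed
      moreover have "ord_ge 1 N (sum term_of (mk ` (F \<rightarrow>\<^sub>E B)) - L)"
      proof (rule L(2))
        show "finite (mk ` (F \<rightarrow>\<^sub>E B))" by (simp add: finite_PiE F B)
        show "mk ` (F \<rightarrow>\<^sub>E B) \<subseteq> ?A"
          using prod_powers_monic[OF F(3)] by (auto simp: mk_def)
        \<comment> \<open>The exponents in such a tuple are bounded by the degrees of its entries,
          hence by \<open>D\<close>.\<close>
        show "null_bad term_of ?A N \<subseteq> mk ` (F \<rightarrow>\<^sub>E B)"
        proof
          fix a assume a: "a \<in> null_bad term_of ?A N"
          then have aA: "a \<in> ?A" by (simp add: null_bad_def)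
          have deg: "degree (a j) \<le> D" if "j \<in> J" for j
            using null_terms_degree[OF a that] by (simp add: D_def)
          define K where "K = (\<lambda>f\<in>F. \<lambda>j\<in>J. fexp f (a j))"
          have fac: "a j = (\<Prod>f\<in>F. f ^ fexp f (a j))" if j: "j \<in> J" for j
          proof (rule monic_eq_prod_fexp[OF _ F(1) _ F(3)])
            show m: "a j \<in> monics" using aA j by auto
            show "{f \<in> monic_primes. f dvd a j} \<subseteq> F"
              using dvd_imp_degree_le[OF _ monic_nonzero[OF m]] deg[OF j] F(2) by (force simp: F0_def)
          qed
          have "fexp f (a j) \<le> D" if f: "f \<in> F" and j: "j \<in> J" for f j
          proof -
            have fp: "f \<in> monic_primes" using f F by blast
            have "f ^ fexp f (a j) dvd (\<Prod>f\<in>F. f ^ fexp f (a j))" by (rule dvd_prodI[OF F(1) f])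
            then have "f ^ fexp f (a j) dvd a j" using fac[OF j] by simp
            moreover have "a j \<noteq> 0" using aA j monic_nonzero by auto
            ultimately have "degree (f ^ fexp f (a j)) \<le> degree (a j)" by (rule dvd_imp_degree_le)
            then have "fexp f (a j) * degree f \<le> D"
              using deg[OF j] unfolding degree_power_eq[OF monic_primes_nonzero[OF fp]] mult.commute[of "degree f"] by linarith
            moreover have "fexp f (a j) * 1 \<le> fexp f (a j) * degree f"
              using monic_primes_degree[OF fp] by (intro mult_le_mono) auto
            ultimately show ?thesis by linarith
          qed
          then have "K \<in> F \<rightarrow>\<^sub>E B" by (auto simp: K_def B_def)
          moreover have "a = mk K"
          proof (rule PiE_ext[OF aA])
            show "mk K \<in> ?A" using prod_powers_monic[OF F(3)] by (auto simp: mk_def)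
            fix j assume j: "j \<in> J"
            have "mk K j = (\<Prod>f\<in>F. f ^ fexp f (a j))" using j by (simp add: mk_def K_def)
            then show "a j = mk K j" using fac[OF j] by simp
          qed
          ultimately show "a \<in> mk ` (F \<rightarrow>\<^sub>E B)" by blast
        qed
      qed
      ultimately have "ord_ge 1 N (((\<Prod>f\<in>F. H f) - (\<Prod>f\<in>F. h f)) + ((\<Prod>f\<in>F. h f) - L))"
        by (intro ord_ge_add) auto
      then show ?thesis by simp
    qed
    have "ord_ge 1 N0 ((\<Prod>f\<in>F. H f) - L)" if F: "finite F" "F0 \<subseteq> F" "F \<subseteq> monic_primes" for F
      by (rule ord_ge_mono[OF close[OF F]]) (simp add: N_def)
    moreover have "F0 \<subseteq> monic_primes" by (auto simp: F0_def)
    ultimately show "\<forall>\<^sub>F F in finite_subsets_at_top monic_primes. ord_ge 1 N0 ((\<Prod>f\<in>F. H f) - L)"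
      unfolding eventually_finite_subsets_at_top using F0 by blast
  qed
  then show ?thesis by (rule that[OF L(1)])
qed

end

section \<open>Local factors\<close>

lemma pow_red_small: "l < r \<Longrightarrow> k < r \<Longrightarrow> pow_red P r l k = (if k = l then 1 else 0)"
proof (induction l arbitrary: k)
  case (Suc l)
  then show ?case by (cases k) auto
qed simp

lemma schur_val_0: "schur_val P r (\<lambda>_. 0) = 1"
proof -
  have "mat r r (\<lambda>(i, k). pow_red P r (0 + (r - 1 - i)) (r - 1 - k)) = 1\<^sub>m r"
    by (rule eq_matI) (auto simp: pow_red_small)
  then show ?thesis by (simp add: schur_val_def)
qed

lemma schur_val_cong: "(\<And>i. i < r \<Longrightarrow> p i = p' i) \<Longrightarrow> schur_val P r p = schur_val P r p'"
  unfolding schur_val_def by (rule arg_cong[where f = det], rule eq_matI) auto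

lemma partition_of_0 [simp]: "partition_of r (\<lambda>_. 0) = (\<lambda>_. 0)"
  by (simp add: partition_of_def fun_eq_iff)

text \<open>The hypothesis is what holds for coefficients homogeneous of degree r - k in roots of
  order at least d/r. The recursion is homogeneous: \<open>pow_red P r l k\<close> has degree l -
  k.\<close>

lemma pow_red_ord:
  assumes r: "r > 0" and P: "\<And>k. k < r \<Longrightarrow> ord_ge r (int d * (int r - int k)) (coeff P k)" and k: "k < r"
  shows "ord_ge r (int d * (int l - int k)) (pow_red P r l k)"
  using k
proof (induction l arbitrary: k)
  case 0
  then show ?case by auto
next
  case (Suc l)
  have "ord_ge r (int d * (int l - int (r - 1)) + int d * (int r - int k)) (pow_red P r l (r - 1) * coeff P k)"
    by (intro ord_ge_mult Suc.IH P Suc.prems) (use r in simp)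
  then have "ord_ge r (int d * (int (Suc l) - int k)) (pow_red P r l (r - 1) * coeff P k)"
    using r by (simp add: algebra_simps of_nat_diff One_nat_def)
  moreover have "ord_ge r (int d * (int (Suc l) - int k)) (if k = 0 then 0 else pow_red P r l (k - 1))"
  proof (cases "k = 0")
    case False
    then have e: "int d * (int l - int (k - 1)) = int d * (int (Suc l) - int k)" by (simp add: of_nat_diff One_nat_def)
    have "ord_ge r (int d * (int l - int (k - 1))) (pow_red P r l (k - 1))"
      by (rule Suc.IH) (use Suc.prems in simp)
    then show ?thesis using False unfolding e by (simp only: if_False)
  qed simp
  ultimately show ?case unfolding pow_red.simps by (rule ord_ge_diff[rotated])
qed

text \<open>In every term of the determinant the column shifts cancel the row shifts, and only the
  size of \<open>p\<close> remains.\<close>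

lemma schur_val_ord:
  assumes r: "r > 0" and P: "\<And>k. k < r \<Longrightarrow> ord_ge r (int d * (int r - int k)) (coeff P k)"
  shows "ord_ge r (int (d * (\<Sum>i<r. p i))) (schur_val P r p)"
  unfolding schur_val_def det_mat_leibniz
proof (rule ord_ge_sum)
  fix q assume "q \<in> {q. q permutes {0..<r}}"
  then have q: "q permutes {0..<r}" by simp
  have "ord_ge r (\<Sum>i<r. int d * (int (p i + (r - 1 - i)) - int (r - 1 - q i)))
      (\<Prod>i<r. pow_red P r (p i + (r - 1 - i)) (r - 1 - q i))"
    by (intro ord_ge_prod pow_red_ord[OF r P]) (use r in auto)
  moreover have "(\<Sum>i<r. int (r - 1 - q i)) = (\<Sum>i<r. int (r - 1 - i))"
    using sum.permute[OF q, of "\<lambda>i. int (r - 1 - i)"] by (simp add: atLeast0LessThan comp_def)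
  then have "(\<Sum>i<r. int d * (int (p i + (r - 1 - i)) - int (r - 1 - q i))) = int (d * (\<Sum>i<r. p i))"
    unfolding sum_distrib_left[symmetric] by (simp add: sum_subtractf sum.distrib)
  moreover have "ord_ge r 0 (of_int (sign q))" by (simp add: sign_def ord_ge_uminus)
  ultimately show "ord_ge r (int (d * (\<Sum>i<r. p i))) (of_int (sign q) * (\<Prod>i<r. pow_red P r (p i + (r - 1 - i)) (r - 1 - q i)))"
    using ord_ge_mult[of r 0 "of_int (sign q)"] by fastforce
qed

lemma monic_splits:
  fixes P :: "'a::alg_closed_field poly"
  assumes "coeff P r = 1" "degree P = r"
  shows "\<exists>\<alpha>. P = (\<Prod>i<r. [:- \<alpha> i, 1:])"
proof -
  have "P \<noteq> 0" using assms by auto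
  then obtain A where A: "size A = degree P" "P = smult (lead_coeff P) (\<Prod>x\<in>#A. [:- x, 1:])"
    using alg_closed_imp_factorization by blast
  obtain xs where xs: "mset xs = A" using ex_mset by blast
  have "P = (\<Prod>x\<leftarrow>xs. [:- x, 1:])"
    using A(2) assms unfolding xs[symmetric] by (simp flip: prod_mset_prod_list)
  also have "\<dots> = (\<Prod>i<r. [:- (xs ! i), 1:])"
    using A(1) assms xs[symmetric] by (simp add: prod.list_conv_set_nth atLeast0LessThan)
  finally show ?thesis by blast
qed

context drinfeld
begin

abbreviation "fP f \<equiv> frob_dual_poly \<phi> f"
abbreviation "fr f \<equiv> frob_dual_roots \<phi> f"

text \<open>The orders follow from the denominator, a constant multiple of \<open>f\<close>, and the
  degree bound on the numerators. The product of the roots comes from the constant coefficient,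
  where the two signs (-1)^r cancel.\<close>

lemma
  assumes f: "f \<in> monic_primes"
  shows frob_dual_roots: "map_poly to_ac (fP f) = root_poly r (fr f)"
    and frob_dual_poly_ord: "ord_ge r (int (degree f) * (int r - int k)) (K_to_Kinf (coeff (fP f) k))"
    and prod_frob_dual_roots: "(\<Prod>i<r. fr f i) = to_ac (Fract 1 (smult (\<epsilon> ^ degree f) f))"
proof -
  obtain u where u: "\<And>k. coeff (fP f) k = Fract (u k) (smult (\<epsilon> ^ degree f) f)"
    "u r = smult (\<epsilon> ^ degree f) f" "\<And>k. k > r \<Longrightarrow> u k = 0" "u 0 = [:(- 1) ^ r:]"
    "\<And>k j. coeff (u k) j \<noteq> 0 \<Longrightarrow> r * j \<le> k * degree f"
    using frob_dual_poly_coeffs[OF f] by blast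
  let ?v = "smult (\<epsilon> ^ degree f) f"
  have v0: "?v \<noteq> 0" using \<kappa>r monic_primes_nonzero[OF f] by simp
  have dv: "degree ?v = degree f" using \<kappa>r by simp
  have "Fract v v = 1" if "v \<noteq> 0" for v :: "'q poly" using that by (simp add: One_fract_def eq_fract)
  then have lead: "coeff (fP f) r = 1" unfolding u(1,2) using v0 by blast
  have "degree (fP f) \<le> r" by (rule degree_le) (use u(1,3) v0 in \<open>simp add: fract_collapse\<close>)
  then have deg: "degree (fP f) = r" using lead le_degree[of "fP f" r] by simp
  have "\<exists>\<alpha>. map_poly to_ac (fP f) = (\<Prod>i<r. [:- \<alpha> i, 1:])"
    by (rule monic_splits) (use lead deg in \<open>simp_all add: coeff_map_poly\<close>)
  then show *: "map_poly to_ac (fP f) = root_poly r (fr f)"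
    unfolding frob_dual_roots_def rank root_poly_def by (rule someI_ex)
  show "ord_ge r (int (degree f) * (int r - int k)) (K_to_Kinf (coeff (fP f) k))"
  proof (cases "u k = 0")
    case True
    then show ?thesis unfolding u(1) using v0 by (simp add: K_to_Kinf_Fract)
  next
    case False
    have "K_to_Kinf (coeff (fP f) k) = A_to_Kinf (u k) / A_to_Kinf ?v" unfolding u(1) by (rule K_to_Kinf_Fract[OF v0])
    moreover have "fls_subdegree (A_to_Kinf (u k) / A_to_Kinf ?v) = int (degree f) - int (degree (u k))"
      using False v0 dv by (subst fls_divide_subdegree) (simp_all add: A_to_Kinf_subdegree)
    moreover have "r * degree (u k) \<le> k * degree f" using u(5)[of k "degree (u k)"] False by simp
    then have "int r * int (degree (u k)) \<le> int k * int (degree f)" by (simp flip: of_nat_mult)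
    then have "int (degree f) * (int r - int k) \<le> int r * (int (degree f) - int (degree (u k)))"
      by (simp add: algebra_simps)
    ultimately show ?thesis unfolding ord_ge_def by metis
  qed
  have "to_ac (coeff (fP f) 0) = coeff (root_poly r (fr f)) 0"
    unfolding *[symmetric] by (simp add: coeff_map_poly)
  also have "\<dots> = (- 1) ^ r * (\<Prod>i<r. fr f i)"
    unfolding poly_0_coeff_0[symmetric] poly_root_poly by (simp add: prod_uminus)
  finally have "(\<Prod>i<r. fr f i) = (- 1) ^ r * to_ac (coeff (fP f) 0)" by (simp add: power_mult_distrib[symmetric] mult.assoc[symmetric])
  also have "\<dots> = to_ac ((- 1) ^ r * coeff (fP f) 0)" by (simp add: to_ac.hom_mult to_ac.hom_power to_ac.hom_uminus)
  also have "(- 1) ^ r * coeff (fP f) 0 = Fract 1 ?v"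
  proof -
    have "(- 1) ^ r = (Fract ((- 1) ^ r) 1 :: 'q poly fract)"
      by (simp add: to_fract.hom_power to_fract.hom_uminus flip: to_fract_def)
    moreover have "(- 1) ^ r * u 0 = 1" unfolding u(4) by (cases "even r") (simp_all flip: one_pCons)
    ultimately show ?thesis unfolding u(1) by simp
  qed
  finally show "(\<Prod>i<r. fr f i) = to_ac (Fract 1 ?v)" .
qed

text \<open>The value of \<mu> at prime powers without its power of \<open>f\<close>, computed in K
  from the coefficients of the Frobenius polynomial.\<close>

definition sv :: "'q poly \<Rightarrow> (nat \<Rightarrow> nat) \<Rightarrow> 'q poly fract"
  where "sv f k = schur_val (fP f) r (partition_of r k)"

lemma r_pos: "r > 0" using r_ge by simp

lemma sv_roots: "f \<in> monic_primes \<Longrightarrow> to_ac (sv f k) = schur_val (root_poly r (fr f)) r (partition_of r k)"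
  unfolding sv_def schur_val_hom[OF to_ac.comm_ring_hom_axioms] frob_dual_roots ..

lemma mu_prime_power_eq:
  "f \<in> monic_primes \<Longrightarrow> mu_prime_power \<phi> f k = to_ac (sv f k * to_fract f ^ (\<Sum>j\<in>{1..<r}. k j))"
  unfolding mu_prime_power_def rank
  by (simp add: mpol_eval_schur[OF r_pos] sv_roots to_ac.hom_mult to_ac.hom_power \<iota>_def)

lemma sv_ord: "f \<in> monic_primes \<Longrightarrow> ord_ge r (int (degree f * (\<Sum>j\<in>{1..<r}. j * k j))) (K_to_Kinf (sv f k))"
  unfolding sv_def schur_val_hom[OF kinf.comm_ring_hom_axioms] sum_partition_of[symmetric]
  by (rule schur_val_ord[OF r_pos]) (simp add: coeff_map_poly frob_dual_poly_ord)

lemma sv_cong: "(\<And>j. j \<in> {1..<r} \<Longrightarrow> k j = k' j) \<Longrightarrow> sv f k = sv f k'"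
  unfolding sv_def using partition_of_cong[of r k k'] by (intro schur_val_cong) blast

lemma sv_0: "sv f (\<lambda>_. 0) = 1"
  by (simp add: sv_def schur_val_0)

lemma mu_eq:
  "mu \<phi> a = (\<Prod>f\<in>{f \<in> monic_primes. f dvd (\<Prod>j\<in>{1..<r}. a j)}.
    sv f (\<lambda>j. fexp f (a j)) * to_fract f ^ (\<Sum>j\<in>{1..<r}. fexp f (a j)))"
proof -
  have "mu \<phi> a = of_ac (to_ac (\<Prod>f\<in>{f \<in> monic_primes. f dvd (\<Prod>j\<in>{1..<r}. a j)}.
    sv f (\<lambda>j. fexp f (a j)) * to_fract f ^ (\<Sum>j\<in>{1..<r}. fexp f (a j))))"
    unfolding mu_def rank to_ac.hom_prod by (intro arg_cong[where f = of_ac] prod.cong refl) (simp add: mu_prime_power_eq)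
  then show ?thesis by (simp only: of_ac_to_ac)
qed

end

section \<open>Evaluation of power series identities\<close>

text \<open>The product of partial sums exceeds the partial sum of the convolution by the pairs with
  i + n > M; as \<open>a\<close> has finite support, only large \<open>n\<close> occur among
  them.\<close>

lemma tail_double_sum:
  fixes a b :: "nat \<Rightarrow> 'a::comm_ring"
  assumes a: "\<And>i. i > G \<Longrightarrow> a i = 0" and M: "M \<ge> G"
  shows "(\<Sum>i\<le>G. a i) * (\<Sum>n\<le>M. b n) - (\<Sum>m\<le>M. \<Sum>i\<le>m. a i * b (m - i)) =
    (\<Sum>i\<le>G. \<Sum>n\<in>{M - i<..M}. a i * b n)"
proof -
  have "(\<Sum>m\<le>M. \<Sum>i\<le>m. a i * b (m - i)) = (\<Sum>(i, n)\<in>{(i, n). i + n \<le> M}. a i * b n)"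
    by (rule sum.triangle_reindex_eq[symmetric])
  also have "{(i, n). i + n \<le> M} = (SIGMA i:{..M}. {..M - i})" by auto
  also have "(\<Sum>(i, n)\<in>(SIGMA i:{..M}. {..M - i}). a i * b n) = (\<Sum>i\<le>M. \<Sum>n\<le>M - i. a i * b n)"
    by (rule sum.Sigma[symmetric]) auto
  also have "\<dots> = (\<Sum>i\<le>G. \<Sum>n\<le>M - i. a i * b n)"
    by (rule sum.mono_neutral_right) (use a M in auto)
  finally have 1: "(\<Sum>m\<le>M. \<Sum>i\<le>m. a i * b (m - i)) = (\<Sum>i\<le>G. \<Sum>n\<le>M - i. a i * b n)" .
  have "(\<Sum>i\<le>G. a i) * (\<Sum>n\<le>M. b n) = (\<Sum>i\<le>G. \<Sum>n\<le>M. a i * b n)" by (rule sum_product)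
  also have "\<dots> = (\<Sum>i\<le>G. (\<Sum>n\<le>M - i. a i * b n) + (\<Sum>n\<in>{M - i<..M}. a i * b n))"
  proof (rule sum.cong[OF refl])
    fix i
    have "{..M} = {..M - i} \<union> {M - i<..M}" by auto
    moreover have "(\<Sum>n\<in>{..M - i} \<union> {M - i<..M}. a i * b n) = (\<Sum>n\<le>M - i. a i * b n) + (\<Sum>n\<in>{M - i<..M}. a i * b n)"
      by (rule sum.union_disjoint) auto
    ultimately show "(\<Sum>n\<le>M. a i * b n) = (\<Sum>n\<le>M - i. a i * b n) + (\<Sum>n\<in>{M - i<..M}. a i * b n)" by simp
  qed
  finally show ?thesis unfolding 1 by (simp add: sum.distrib)
qed

lemma ord_ge_exists: "\<exists>C\<ge>0. \<forall>i\<in>I. ord_ge 1 (- C) (x i)" if "finite I" for x :: "'i \<Rightarrow> 'a::field fls"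
  using that
proof (induction I rule: finite_induct)
  case (insert j I)
  then obtain C where C: "C \<ge> 0" "\<forall>i\<in>I. ord_ge 1 (- C) (x i)" by blast
  let ?C = "max C (- fls_subdegree (x j))"
  have "ord_ge 1 (- ?C) (x j)" by (auto simp: ord_ge_def max_def)
  moreover have "\<forall>i\<in>I. ord_ge 1 (- ?C) (x i)" using C(2) by (auto intro: ord_ge_mono)
  ultimately show ?case using C(1) by (intro exI[of _ ?C]) auto
qed (auto intro: exI[of _ 0])

text \<open>Evaluation of an identity of formal power series at a point where the series converges.\<close>
lemma evaluate_convolution:
  fixes a b c :: "nat \<Rightarrow> 'a::field fls"
  assumes r: "r > 0" and a: "\<And>i. i > G \<Longrightarrow> a i = 0" and b: "\<And>n. ord_ge r (int n) (b n)"
    and ab: "\<And>m. (\<Sum>i\<le>m. a i * b (m - i)) = c m" and c: "\<And>m. m > r \<Longrightarrow> c m = 0"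
    and H: "\<And>N. \<exists>M0. \<forall>M\<ge>M0. ord_ge 1 N ((\<Sum>n\<le>M. b n) - H)"
  shows "(\<Sum>i\<le>G. a i) * H = (\<Sum>m\<le>r. c m)"
proof -
  obtain C where C: "C \<ge> 0" "\<forall>i\<in>{..G}. ord_ge 1 (- C) (a i)" using ord_ge_exists[of "{..G}" a] by auto
  have "ord_ge 1 N ((\<Sum>i\<le>G. a i) * H - (\<Sum>m\<le>r. c m))" for N
  proof -
    obtain M0 where M0: "\<And>M. M \<ge> M0 \<Longrightarrow> ord_ge 1 (N + C) ((\<Sum>n\<le>M. b n) - H)" using H[of "N + C"] by blast
    \<comment> \<open>Large enough that every \<open>b n\<close> in the tail has order at least N +
      C, where \<open>C\<close> bounds the poles of the \<open>a i\<close>.\<close>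
    define M where "M = M0 + G + r + nat (int r * (N + C))"
    have M: "M \<ge> M0" "M \<ge> G" "M \<ge> r" by (simp_all add: M_def)
    let ?S = "\<Sum>n\<le>M. b n" and ?A = "\<Sum>i\<le>G. a i"
    have "ord_ge 1 (- C + (N + C)) (?A * (?S - H))"
      by (intro ord_ge_mult ord_ge_sum M0 M) (use C(2) in auto)
    then have 1: "ord_ge 1 N (?A * (?S - H))" by simp
    have "(\<Sum>m\<le>r. c m) = (\<Sum>m\<le>M. c m)"
      by (rule sum.mono_neutral_left) (use M c in auto)
    then have "?A * ?S - (\<Sum>m\<le>r. c m) = (\<Sum>i\<le>G. \<Sum>n\<in>{M - i<..M}. a i * b n)"
      using tail_double_sum[of G a M b] a M unfolding ab by simp
    also have "ord_ge 1 N \<dots>"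
    proof (intro ord_ge_sum)
      fix i n assume i: "i \<in> {..G}" and n: "n \<in> {M - i<..M}"
      then have "int n \<ge> int r * (N + C)" by (auto simp: M_def)
      then have "ord_ge r (int r * (N + C)) (b n)" by (rule ord_ge_mono[OF b])
      then have "ord_ge 1 (N + C) (b n)" unfolding ord_ge_scale[OF r] .
      then have "ord_ge 1 (- C + (N + C)) (a i * b n)" using C(2) i by (intro ord_ge_mult) auto
      then show "ord_ge 1 N (a i * b n)" by simp
    qed
    finally have 2: "ord_ge 1 N (?A * ?S - (\<Sum>m\<le>r. c m))" .
    have eq: "?A * H - (\<Sum>m\<le>r. c m) = (?A * ?S - (\<Sum>m\<le>r. c m)) - ?A * (?S - H)" by (simp add: algebra_simps)
    show ?thesis unfolding eq by (rule ord_ge_diff[OF 2 1])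
  qed
  then have "(\<Sum>i\<le>G. a i) * H - (\<Sum>m\<le>r. c m) = 0" by (rule ord_ge_all_imp_0)
  then show ?thesis by simp
qed

lemma tendsto_mult_fls:
  fixes g h :: "'i \<Rightarrow> 'a::field fls"
  assumes "(g \<longlongrightarrow> L) F" "(h \<longlongrightarrow> M) F"
  shows "((\<lambda>i. g i * h i) \<longlongrightarrow> L * M) F"
proof (rule fls_tendstoI)
  fix N
  obtain C where C: "C \<ge> 0" "ord_ge 1 (- C) L" "ord_ge 1 (- C) M"
    using ord_ge_exists[of "{True, False}" "\<lambda>b. if b then L else M"] by auto
  let ?K = "max N 0 + C"
  have "ord_ge 1 N (g i * h i - L * M)" if i: "ord_ge 1 ?K (g i - L)" "ord_ge 1 ?K (h i - M)" for i
  proof -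
    have "ord_ge 1 (?K + ?K) ((g i - L) * (h i - M))" by (intro ord_ge_mult i)
    then have 1: "ord_ge 1 N ((g i - L) * (h i - M))" by (rule ord_ge_mono) (use C in auto)
    have "ord_ge 1 (?K + - C) ((g i - L) * M)" "ord_ge 1 (- C + ?K) (L * (h i - M))"
      by (intro ord_ge_mult i C)+
    then have 2: "ord_ge 1 N ((g i - L) * M)" "ord_ge 1 N (L * (h i - M))" by (auto elim: ord_ge_mono)
    have "g i * h i - L * M = (g i - L) * (h i - M) + (g i - L) * M + L * (h i - M)" by (simp add: algebra_simps)
    then show ?thesis using ord_ge_add[OF ord_ge_add[OF 1 2(1)] 2(2)] by simp
  qed
  then show "\<forall>\<^sub>F i in F. ord_ge 1 N (g i * h i - L * M)"
    using eventually_conj[OF fls_tendstoD[OF assms(1), of ?K] fls_tendstoD[OF assms(2), of ?K]]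
    by (auto elim: eventually_mono)
qed

text \<open>A growing exhaustion by finite sets eventually contains all terms that are not small.
  This permits summing the local terms by weight.\<close>

lemma null_family_partial_sums:
  fixes t :: "'i \<Rightarrow> 'a::field fls" and B :: "nat \<Rightarrow> 'i set"
  assumes "(t has_sum H) A" and fin: "\<And>N. finite (null_bad t A N)"
    and B: "\<And>M. finite (B M)" "\<And>M. B M \<subseteq> A" "\<And>M M'. M \<le> M' \<Longrightarrow> B M \<subseteq> B M'" "\<And>i. i \<in> A \<Longrightarrow> \<exists>M. i \<in> B M"
  shows "\<exists>M0. \<forall>M\<ge>M0. ord_ge 1 N (sum t (B M) - H)"
proof -
  obtain H' where H': "(t has_sum H') A"
    "\<And>N C. finite C \<Longrightarrow> null_bad t A N \<subseteq> C \<Longrightarrow> C \<subseteq> A \<Longrightarrow> ord_ge 1 N (sum t C - H')"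
    using null_family_limit[of t A, OF fin] by blast
  have "H' = H" using infsumI[OF H'(1)] infsumI[OF assms(1)] by simp
  have "\<forall>i\<in>null_bad t A N. \<exists>M. i \<in> B M" using B(4) by (auto simp: null_bad_def)
  from bchoice[OF this] obtain g where g: "\<forall>i\<in>null_bad t A N. i \<in> B (g i)" by blast
  let ?M0 = "Max (insert (0::nat) (g ` null_bad t A N))"
  have "null_bad t A N \<subseteq> B M" if "M \<ge> ?M0" for M
  proof
    fix i assume i: "i \<in> null_bad t A N"
    then have "g i \<le> ?M0" using fin by (intro Max_ge) auto
    then show "i \<in> B M" using g i B(3)[of "g i" M] that by auto
  qed
  then have "\<forall>M\<ge>?M0. ord_ge 1 N (sum t (B M) - H)" using H'(2)[OF B(1) _ B(2)] \<open>H' = H\<close> by blast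
  then show ?thesis by blast
qed

section \<open>The local factors of the convolution series\<close>

locale drinfeld_pair = A: drinfeld \<phi> \<kappa> \<kappa>\<^sub>r r + B: drinfeld \<psi> \<eta> \<eta>\<^sub>r r
  for \<phi> \<psi> :: "'q::{field,finite} poly \<Rightarrow> 'q poly poly" and \<kappa> \<eta> \<kappa>\<^sub>r \<eta>\<^sub>r r +
  fixes s :: nat
begin

abbreviation "J \<equiv> {1..<r}"
abbreviation "w f \<equiv> inverse (to_fract f ^ s) :: 'q poly fract"

text \<open>The powers of \<open>f\<close> in the two values of \<mu> cancel against the square in
  the denominator of the series; only Schur values and powers of f^(-s) remain.\<close>

definition tf :: "'q poly \<Rightarrow> (nat \<Rightarrow> nat) \<Rightarrow> 'q fls"
  where "tf f k = K_to_Kinf (A.sv f k * B.sv f k * w f ^ (\<Sum>j\<in>J. j * k j))"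

lemma sum_le_weighted: "(\<Sum>j\<in>J. k j) \<le> (\<Sum>j\<in>J. j * k j)"
  by (rule sum_mono) auto

lemma w_ord:
  assumes f: "f \<in> monic_primes" shows "ord_ge r 0 (K_to_Kinf (w f ^ m))"
proof -
  have "f \<noteq> 0" by (rule monic_primes_nonzero[OF f])
  then have "ord_ge r 0 (inverse (A_to_Kinf f))" by (simp add: ord_ge_def A_to_Kinf_subdegree)
  moreover have "K_to_Kinf (w f ^ m) = inverse (A_to_Kinf f) ^ (s * m)"
    by (simp add: kinf.hom_power kinf.hom_inverse K_to_Kinf_to_fract power_mult power_inverse)
  ultimately show ?thesis using ord_ge_power[of r 0 _ "s * m"] by simp
qed

lemma tf_ord:
  assumes f: "f \<in> monic_primes"
  shows "ord_ge r (int (degree f * (\<Sum>j\<in>J. j * k j))) (tf f k)"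
proof -
  let ?n = "int (degree f * (\<Sum>j\<in>J. j * k j))"
  have "ord_ge r (?n + ?n + 0) (tf f k)"
    unfolding tf_def kinf.hom_mult by (intro ord_ge_mult A.sv_ord B.sv_ord w_ord f)
  moreover have "0 \<le> ?n" by (rule of_nat_0_le_iff)
  ultimately show ?thesis by (elim ord_ge_mono) linarith
qed

sublocale L: euler J r tf
proof
  show "r > 0" by (rule A.r_pos)
  show "tf f k = tf f k'" if eq: "\<And>j. j \<in> J \<Longrightarrow> k j = k' j" for f k k'
  proof -
    have "A.sv f k = A.sv f k'" by (rule A.sv_cong) (rule eq)
    moreover have "B.sv f k = B.sv f k'" by (rule B.sv_cong) (rule eq)
    moreover have "(\<Sum>j\<in>J. j * k j) = (\<Sum>j\<in>J. j * k' j)" by (rule sum.cong) (simp_all add: eq)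
    ultimately show ?thesis by (simp add: tf_def)
  qed
  show "tf f (\<lambda>_. 0) = 1" for f by (simp add: tf_def A.sv_0 B.sv_0)
  show "ord_ge r (int (degree f * (\<Sum>j\<in>J. k j))) (tf f k)" if "f \<in> monic_primes" for f k
    by (rule ord_ge_mono[OF tf_ord[OF that]]) (use sum_le_weighted in \<open>simp only: of_nat_le_iff mult_le_mono2\<close>)
qed simp

lemma conv_term_eq:
  assumes a: "a \<in> monic_tuples r"
  shows "conv_term \<phi> \<psi> s a = L.term_of a"
proof -
  define F where "F = {f \<in> monic_primes. f dvd (\<Prod>j\<in>J. a j)}"
  have mon: "a j \<in> monics" if "j \<in> J" for j using a that by (auto simp: monic_tuples_def)
  then have "(\<Prod>j\<in>J. a j) \<noteq> 0" unfolding prod_zero_iff[OF finite_atLeastLessThan] using monic_nonzero by blast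
  then have F: "finite F" "F \<subseteq> monic_primes"
    unfolding F_def using finite_monic_prime_divisors by blast+
  have fac: "a j = (\<Prod>f\<in>F. f ^ fexp f (a j))" if j: "j \<in> J" for j
    by (rule monic_eq_prod_fexp[OF mon[OF j] F(1) _ F(2)]) (unfold F_def, rule L.divisor_of_factor[OF j])
  have power_sum_prod: "(\<Prod>j\<in>J. a j ^ m j) = (\<Prod>f\<in>F. f ^ (\<Sum>j\<in>J. m j * fexp f (a j)))" for m
  proof -
    have "(\<Prod>j\<in>J. a j ^ m j) = (\<Prod>j\<in>J. \<Prod>f\<in>F. f ^ (m j * fexp f (a j)))"
    proof (rule prod.cong[OF refl])
      fix j assume "j \<in> J"
      from arg_cong[OF fac[OF this], of "\<lambda>x. x ^ m j"]
      have "a j ^ m j = (\<Prod>f\<in>F. f ^ fexp f (a j)) ^ m j" .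
      also have "\<dots> = (\<Prod>f\<in>F. f ^ (m j * fexp f (a j)))"
        unfolding prod_power_distrib power_mult[symmetric] mult.commute[of "m j"] ..
      finally show "a j ^ m j = (\<Prod>f\<in>F. f ^ (m j * fexp f (a j)))" .
    qed
    also have "\<dots> = (\<Prod>f\<in>F. f ^ (\<Sum>j\<in>J. m j * fexp f (a j)))"
      unfolding power_sum by (rule prod.swap)
    finally show ?thesis .
  qed
  have p1: "(\<Prod>j\<in>J. a j) = (\<Prod>f\<in>F. f ^ (\<Sum>j\<in>J. fexp f (a j)))"
    using power_sum_prod[of "\<lambda>_. 1"] by (simp only: power_one_right mult_1)
  have nz: "to_fract f \<noteq> 0" if "f \<in> F" for f using that F monic_primes_nonzero by auto
  have muA: "mu \<phi> a = (\<Prod>f\<in>F. A.sv f (\<lambda>j. fexp f (a j)) * to_fract f ^ (\<Sum>j\<in>J. fexp f (a j)))"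
    and muB: "mu \<psi> a = (\<Prod>f\<in>F. B.sv f (\<lambda>j. fexp f (a j)) * to_fract f ^ (\<Sum>j\<in>J. fexp f (a j)))"
    unfolding F_def by (rule A.mu_eq, rule B.mu_eq)
  have "mu \<phi> a * mu \<psi> a / to_fract ((\<Prod>j\<in>J. a j) ^ 2 * (\<Prod>j\<in>J. a j ^ j) ^ s) =
    (\<Prod>f\<in>F. A.sv f (\<lambda>j. fexp f (a j)) * B.sv f (\<lambda>j. fexp f (a j)) * w f ^ (\<Sum>j\<in>J. j * fexp f (a j)))"
    unfolding muA muB p1 power_sum_prod to_fract.hom_mult to_fract.hom_power to_fract.hom_prod
      prod_power_distrib prod.distrib[symmetric] prod_dividef[symmetric]
  proof (rule prod.cong[OF refl])
    fix f assume "f \<in> F"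
    then have nz: "to_fract f \<noteq> 0" by (rule nz)
    define x y z n e where "x = to_fract f" and "y = A.sv f (\<lambda>j. fexp f (a j))" and "z = B.sv f (\<lambda>j. fexp f (a j))"
      and "n = (\<Sum>j\<in>J. fexp f (a j))" and "e = (\<Sum>j\<in>J. j * fexp f (a j))"
    have x: "x \<noteq> 0" using nz by (simp add: x_def)
    have "y * x ^ n * (z * x ^ n) / ((x ^ n) ^ 2 * (x ^ e) ^ s) = y * z * inverse (x ^ s) ^ e"
      using x by (simp add: field_simps power2_eq_square flip: power_mult)
    then show "A.sv f (\<lambda>j. fexp f (a j)) * to_fract f ^ (\<Sum>j\<in>J. fexp f (a j)) *
        (B.sv f (\<lambda>j. fexp f (a j)) * to_fract f ^ (\<Sum>j\<in>J. fexp f (a j))) /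
        ((to_fract f ^ (\<Sum>j\<in>J. fexp f (a j)))\<^sup>2 * (to_fract f ^ (\<Sum>j\<in>J. j * fexp f (a j))) ^ s) =
        A.sv f (\<lambda>j. fexp f (a j)) * B.sv f (\<lambda>j. fexp f (a j)) * w f ^ (\<Sum>j\<in>J. j * fexp f (a j))"
      unfolding x_def y_def z_def n_def e_def .
  qed
  then show ?thesis
    unfolding conv_term_def A.rank L.term_of_def tf_def F_def[symmetric] by (simp only: kinf.hom_prod)
qed

text \<open>The product of all Frobenius roots of both modules at \<open>f\<close>.\<close>

definition e0 :: "'q poly \<Rightarrow> 'q poly fract"
  where "e0 f = Fract 1 (smult (A.\<epsilon> ^ degree f) f) * Fract 1 (smult (B.\<epsilon> ^ degree f) f)"

definition hser :: "'q poly \<Rightarrow> 'q poly fract fps"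
  where "hser f = Abs_fps (\<lambda>N. \<Sum>k\<in>weighted_tuples r N. A.sv f k * B.sv f k)"

definition gser :: "'q poly \<Rightarrow> 'q poly fract fps" where "gser f = 1 - fps_const (e0 f) * fps_X ^ r"

text \<open>Cauchy's identity solved for the tensor polynomial by power series over K; this is how
  its coefficients are seen to lie in K.\<close>

definition Qser :: "'q poly \<Rightarrow> 'q poly fract fps" where "Qser f = gser f * inverse (hser f)"

lemma weighted_tuples_bound: "k \<in> weighted_tuples r N \<Longrightarrow> j \<in> J \<Longrightarrow> k j \<le> N"
proof -
  assume k: "k \<in> weighted_tuples r N" and j: "j \<in> J"
  have "k j \<le> (\<Sum>j\<in>J. k j)" by (rule member_le_sum[OF j]) auto
  also have "\<dots> \<le> N" using sum_le_weighted[of k] k by (simp add: weighted_tuples_def)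
  finally show ?thesis .
qed

lemma finite_weighted_tuples: "finite (weighted_tuples r N)"
proof (rule finite_subset)
  show "weighted_tuples r N \<subseteq> J \<rightarrow>\<^sub>E {..N}"
    using weighted_tuples_bound[of _ N] by (force simp: weighted_tuples_def PiE_def)
qed (simp add: finite_PiE)

lemma weighted_tuples_0: "weighted_tuples r 0 = {\<lambda>j\<in>J. 0}"
  using weighted_tuples_bound[of _ 0] by (fastforce simp: weighted_tuples_def PiE_def extensional_def fun_eq_iff)

lemma hser_0: "fps_nth (hser f) 0 = 1"
proof -
  have "A.sv f (\<lambda>j\<in>J. 0) = A.sv f (\<lambda>_. 0)" by (rule A.sv_cong) simp
  moreover have "B.sv f (\<lambda>j\<in>J. 0) = B.sv f (\<lambda>_. 0)" by (rule B.sv_cong) simp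
  ultimately show ?thesis by (simp add: hser_def weighted_tuples_0 A.sv_0 B.sv_0)
qed

lemma Qser_hser: "Qser f * hser f = gser f"
  unfolding Qser_def mult.assoc using inverse_mult_eq_1[of "hser f"] hser_0[of f] by simp

text \<open>Over the algebraic closure, \<open>Qser\<close> and \<open>cauchy_Q\<close> have the
  same product with the Schur series, which is nonzero as its constant coefficient is 1.\<close>

lemma map_Qser:
  assumes f: "f \<in> monic_primes"
  shows "to_ac (fps_nth (Qser f) i) = coeff (tensor_dual_Q \<phi> \<psi> f) i"
proof -
  define m where "m F = Abs_fps (\<lambda>n. to_ac (fps_nth F n))" for F :: "'q poly fract fps"
  interpret m: comm_ring_hom m
    by unfold_locales (auto simp: m_def fps_eq_iff fps_mult_nth to_ac.hom_sum to_ac.hom_add to_ac.hom_mult)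
  have mh: "m (hser f) = schur_series r (A.fr f) (B.fr f)"
    unfolding m_def hser_def schur_series_def fps_nth_Abs_fps
    by (simp only: to_ac.hom_sum to_ac.hom_mult A.sv_roots[OF f] B.sv_roots[OF f])
  have mg: "m (gser f) = 1 - fps_const ((\<Prod>i<r. A.fr f i) * (\<Prod>i<r. B.fr f i)) * fps_X ^ r"
  proof -
    have "m (fps_const c) = fps_const (to_ac c)" for c by (simp add: m_def fps_eq_iff)
    moreover have "m fps_X = fps_X" by (simp add: m_def fps_eq_iff)
    ultimately show ?thesis
      unfolding gser_def e0_def A.prod_frob_dual_roots[OF f] B.prod_frob_dual_roots[OF f]
      by (simp only: m.hom_minus m.hom_one m.hom_mult m.hom_power to_ac.hom_mult)
  qed
  have "m (Qser f) * schur_series r (A.fr f) (B.fr f) =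
      cauchy_Q r (A.fr f) (B.fr f) * schur_series r (A.fr f) (B.fr f)"
    unfolding cauchy_identity[OF A.r_pos] using arg_cong[OF Qser_hser[of f], of m] unfolding m.hom_mult mh mg .
  moreover have "schur_series r (A.fr f) (B.fr f) \<noteq> 0"
  proof
    assume "schur_series r (A.fr f) (B.fr f) = 0"
    then have "fps_nth (m (hser f)) 0 = 0" using mh by simp
    then show False by (simp add: m_def hser_0)
  qed
  ultimately have 1: "m (Qser f) = cauchy_Q r (A.fr f) (B.fr f)" by simp
  have refl1: "reflect_poly [:- c, 1:] = [:1, - c:]" for c :: "'q kbar"
  proof (cases "c = 0")
    case True
    then show ?thesis by (simp add: reflect_poly_pCons')
  qed (simp add: reflect_poly_pCons)
  have "tensor_dual_Q \<phi> \<psi> f = (\<Prod>i<r. \<Prod>j<r. [:1, - (A.fr f i * B.fr f j):])"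
    unfolding tensor_dual_Q_def A.rank B.rank reflect_poly_prod refl1 ..
  then have "fps_of_poly (tensor_dual_Q \<phi> \<psi> f) = cauchy_Q r (A.fr f) (B.fr f)"
    by (simp add: cauchy_Q_def fps_of_poly_prod fps_of_poly_pCons fps_of_poly_const flip: fps_const_neg)
  then have "fps_nth (m (Qser f)) i = coeff (tensor_dual_Q \<phi> \<psi> f) i" unfolding 1 by (metis fps_of_poly_nth)
  then show ?thesis by (simp add: m_def)
qed

abbreviation "G f \<equiv> degree (tensor_dual_Q \<phi> \<psi> f)"

lemma tensor_factor_eq:
  assumes f: "f \<in> monic_primes"
  shows "tensor_factor \<phi> \<psi> s f = inverse (\<Sum>i\<le>G f. K_to_Kinf (fps_nth (Qser f) i * w f ^ i))"
proof -
  have "inverse (\<iota> f ^ s) = to_ac (w f)" by (simp add: \<iota>_def to_ac.hom_inverse to_ac.hom_power)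
  then have "poly (tensor_dual_Q \<phi> \<psi> f) (inverse (\<iota> f ^ s)) = to_ac (\<Sum>i\<le>G f. fps_nth (Qser f) i * w f ^ i)"
    unfolding poly_altdef map_Qser[OF f, symmetric] by (simp add: to_ac.hom_sum to_ac.hom_mult to_ac.hom_power)
  then show ?thesis unfolding tensor_factor_def by (simp only: of_ac_to_ac kinf.hom_sum)
qed

text \<open>The identity \<open>Qser_hser\<close> at X = f^(-s), where the local sum over all tuples
  is first arranged by weight.\<close>

lemma local_identity:
  assumes f: "f \<in> monic_primes" and H: "(tf f has_sum H) (J \<rightarrow>\<^sub>E UNIV)"
  shows "(\<Sum>i\<le>G f. K_to_Kinf (fps_nth (Qser f) i * w f ^ i)) * H = 1 - K_to_Kinf (e0 f * w f ^ r)"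
proof -
  let ?b = "\<lambda>n. \<Sum>k\<in>weighted_tuples r n. tf f k"
  have b: "?b n = K_to_Kinf (fps_nth (hser f) n * w f ^ n)" for n
    unfolding hser_def fps_nth_Abs_fps sum_distrib_right kinf.hom_sum
    by (rule sum.cong) (simp_all add: tf_def weighted_tuples_def)
  have g: "fps_nth (gser f) m = (if m = 0 then 1 else 0) - (if m = r then e0 f else 0)" for m
    using A.r_pos by (simp add: gser_def)
  have "(\<Sum>i\<le>G f. K_to_Kinf (fps_nth (Qser f) i * w f ^ i)) * H = (\<Sum>m\<le>r. K_to_Kinf (fps_nth (gser f) m * w f ^ m))"
  proof (rule evaluate_convolution[where b = ?b, OF A.r_pos])
    show "K_to_Kinf (fps_nth (Qser f) i * w f ^ i) = 0" if "i > G f" for i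
    proof -
      have "to_ac (fps_nth (Qser f) i) = 0" unfolding map_Qser[OF f] by (rule coeff_eq_0[OF that])
      then show ?thesis by simp
    qed
    show "ord_ge r (int n) (?b n)" for n
    proof (rule ord_ge_sum)
      fix k assume k: "k \<in> weighted_tuples r n"
      have "1 * n \<le> degree f * n" using monic_primes_degree[OF f] by (intro mult_le_mono) auto
      moreover have "(\<Sum>j\<in>J. j * k j) = n" using k by (simp add: weighted_tuples_def)
      ultimately have "int n \<le> int (degree f * (\<Sum>j\<in>J. j * k j))" by (simp only: of_nat_le_iff mult_1)
      then show "ord_ge r (int n) (tf f k)" by (rule ord_ge_mono[OF tf_ord[OF f]])
    qed
    show "(\<Sum>i\<le>m. K_to_Kinf (fps_nth (Qser f) i * w f ^ i) * ?b (m - i)) = K_to_Kinf (fps_nth (gser f) m * w f ^ m)" for m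
    proof -
      have "fps_nth (gser f) m = (\<Sum>i\<le>m. fps_nth (Qser f) i * fps_nth (hser f) (m - i))"
        unfolding Qser_hser[symmetric] by (simp add: fps_mult_nth atLeast0AtMost)
      then have "K_to_Kinf (fps_nth (gser f) m * w f ^ m) =
        (\<Sum>i\<le>m. K_to_Kinf (fps_nth (Qser f) i * fps_nth (hser f) (m - i) * w f ^ m))"
        by (simp only: sum_distrib_right kinf.hom_sum)
      also have "\<dots> = (\<Sum>i\<le>m. K_to_Kinf (fps_nth (Qser f) i * w f ^ i) * ?b (m - i))"
      proof (rule sum.cong[OF refl])
        fix i assume "i \<in> {..m}"
        then have "w f ^ m = w f ^ i * w f ^ (m - i)" by (simp flip: power_add)
        then show "K_to_Kinf (fps_nth (Qser f) i * fps_nth (hser f) (m - i) * w f ^ m) =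
            K_to_Kinf (fps_nth (Qser f) i * w f ^ i) * ?b (m - i)"
          unfolding b by (simp only: kinf.hom_mult[symmetric] mult_ac)
      qed
      finally show ?thesis ..
    qed
    show "K_to_Kinf (fps_nth (gser f) m * w f ^ m) = 0" if "m > r" for m
      using that by (simp add: g)
    fix N
    let ?B = "\<lambda>M. \<Union>n\<le>M. weighted_tuples r n"
    have "\<exists>M0. \<forall>M\<ge>M0. ord_ge 1 N (sum (tf f) (?B M) - H)"
    proof (rule null_family_partial_sums[OF H L.null_local[OF f]])
      show "finite (?B M)" for M by (simp add: finite_weighted_tuples)
      show "?B M \<subseteq> J \<rightarrow>\<^sub>E UNIV" for M by (auto simp: weighted_tuples_def)
      show "?B M \<subseteq> ?B M'" if "M \<le> M'" for M M' using that by fastforce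
      show "\<exists>M. i \<in> ?B M" if "i \<in> J \<rightarrow>\<^sub>E UNIV" for i
        using that by (intro exI[of _ "\<Sum>j\<in>J. j * i j"]) (auto simp: weighted_tuples_def)
    qed
    moreover have "sum (tf f) (?B M) = (\<Sum>n\<le>M. ?b n)" for M
    proof (rule sum.UNION_disjoint)
      show "\<forall>i\<in>{..M}. \<forall>j\<in>{..M}. i \<noteq> j \<longrightarrow> weighted_tuples r i \<inter> weighted_tuples r j = {}"
        by (auto simp: weighted_tuples_def)
    qed (simp_all add: finite_weighted_tuples)
    ultimately show "\<exists>M0. \<forall>M\<ge>M0. ord_ge 1 N ((\<Sum>n\<le>M. ?b n) - H)" by simp
  qed
  also have "\<dots> = (\<Sum>m\<le>r. (if m = 0 then 1 else 0) - (if m = r then K_to_Kinf (e0 f * w f ^ r) else 0))"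
    by (rule sum.cong[OF refl]) (use A.r_pos in \<open>auto simp: g kinf.hom_uminus\<close>)
  also have "\<dots> = 1 - K_to_Kinf (e0 f * w f ^ r)"
    unfolding sum_subtractf by simp
  finally show ?thesis .
qed

end

section \<open>The series of the characters and the conclusion\<close>

context drinfeld_pair
begin

abbreviation "\<chi> a \<equiv> chi r \<kappa>\<^sub>r a * chi r \<eta>\<^sub>r a"
definition la where "la = LA_term \<chi> (r * s + 2)"

lemma la_mult: "a \<noteq> 0 \<Longrightarrow> b \<noteq> 0 \<Longrightarrow> la (a * b) = la a * la b"
  by (simp add: la_def LA_term_def chi_def degree_mult_eq power_add akinf.hom_mult power_mult_distrib flip: fls_const_mult_const)

lemma la_1: "la 1 = 1"
  by (simp add: la_def LA_term_def chi_def)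

lemma la_power: "a \<noteq> 0 \<Longrightarrow> la (a ^ n) = la a ^ n"
  by (induction n) (simp_all add: la_1 la_mult)

lemma la_prod: "(\<And>i. i \<in> I \<Longrightarrow> g i \<noteq> 0) \<Longrightarrow> la (prod g I) = (\<Prod>i\<in>I. la (g i))"
  by (induction I rule: infinite_finite_induct) (simp_all add: la_1 la_mult)

lemma la_ord: "a \<noteq> 0 \<Longrightarrow> ord_ge r (int (degree a)) (la a)"
proof -
  assume a: "a \<noteq> 0"
  have "ord_ge r 0 (fls_const (\<chi> a))" by (simp add: ord_ge_def)
  moreover have "ord_ge r (int (degree a)) (inverse (A_to_Kinf a ^ (r * s + 2)))"
  proof -
    have "fls_subdegree (inverse (A_to_Kinf a ^ (r * s + 2))) = int ((r * s + 2) * degree a)"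
      using a by (simp add: fls_subdegree_pow A_to_Kinf_subdegree)
    moreover have "1 * degree a \<le> r * ((r * s + 2) * degree a)"
      unfolding mult.assoc[symmetric] using A.r_pos by (intro mult_le_mono) auto
    then have "int (degree a) \<le> int r * int ((r * s + 2) * degree a)" unfolding of_nat_mult[symmetric] of_nat_le_iff by simp
    ultimately show ?thesis unfolding ord_ge_def by simp
  qed
  ultimately show ?thesis unfolding la_def LA_term_def using ord_ge_mult[of r 0] by fastforce
qed

text \<open>The product of the roots of each module contributes a factor 1/f and, as the inverse of
  a power of \<epsilon>, a value of its character; together with f^(-r s) this accounts for the
  argument \<open>r * s + 2\<close>.\<close>

lemma la_e0:
  assumes f: "f \<in> monic_primes"
  shows "K_to_Kinf (e0 f * w f ^ r) = la f"
proof -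
  have f0: "f \<noteq> 0" by (rule monic_primes_nonzero[OF f])
  have K: "K_to_Kinf (Fract 1 (smult c f)) = fls_const (inverse c) * inverse (A_to_Kinf f)" if "c \<noteq> 0" for c
  proof -
    have "A_to_Kinf (smult c f) = A_to_Kinf ([:c:] * f)" by simp
    also have "\<dots> = fls_const c * A_to_Kinf f" unfolding akinf.hom_mult by (simp add: A_to_Kinf_def flsc.map_poly_pCons_hom)
    finally have "A_to_Kinf (smult c f) = fls_const c * A_to_Kinf f" .
    then show ?thesis using that f0 by (simp add: K_to_Kinf_Fract fls_inverse_const divide_inverse)
  qed
  have c: "inverse (((- 1) ^ (r + 1) * inverse x) ^ degree f) = chi r x f" if "x \<noteq> 0" for x :: 'q
    using that by (cases "even r") (simp_all add: chi_def flip: power_inverse)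
  have KA: "K_to_Kinf (Fract 1 (smult (((- 1) ^ (r + 1) * inverse x) ^ degree f) f)) =
      fls_const (chi r x f) * inverse (A_to_Kinf f)" if "x \<noteq> 0" for x
    unfolding c[OF that, symmetric] by (rule K) (use that in simp)
  have W: "K_to_Kinf (w f ^ r) = inverse (A_to_Kinf f ^ (r * s))"
    by (simp add: kinf.hom_power kinf.hom_inverse K_to_Kinf_to_fract power_inverse mult.commute flip: power_mult)
  have "K_to_Kinf (e0 f * w f ^ r) = (fls_const (chi r \<kappa>\<^sub>r f) * inverse (A_to_Kinf f)) *
      (fls_const (chi r \<eta>\<^sub>r f) * inverse (A_to_Kinf f)) * inverse (A_to_Kinf f ^ (r * s))"
    unfolding e0_def kinf.hom_mult W KA[OF A.\<kappa>r] KA[OF B.\<kappa>r] ..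
  also have "\<dots> = la f"
    by (simp add: la_def LA_term_def power_add power2_eq_square mult_ac flip: fls_const_mult_const)
  finally show ?thesis .
qed

text \<open>Casts a completely multiplicative series in one variable, of index 0, into the form
  required by \<open>euler\<close>.\<close>

definition la_term :: "'q poly \<Rightarrow> (nat \<Rightarrow> nat) \<Rightarrow> 'q fls" where "la_term f k = la f ^ k 0"

sublocale M: euler "{0}" r la_term
proof
  show "r > 0" by (rule A.r_pos)
  show "ord_ge r (int (degree f * (\<Sum>j\<in>{0}. k j))) (la_term f k)" if "f \<in> monic_primes" for f k
    using ord_ge_power[OF la_ord[OF monic_primes_nonzero[OF that]], of "k 0"] by (simp add: la_term_def mult.commute)
qed (simp_all add: la_term_def)

lemma M_term:
  assumes a: "a \<in> {0} \<rightarrow>\<^sub>E monics"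
  shows "M.term_of a = la (a 0)"
proof -
  define F where "F = {f \<in> monic_primes. f dvd a 0}"
  have m: "a 0 \<in> monics" using a by auto
  have F: "finite F" "F \<subseteq> monic_primes"
    unfolding F_def using finite_monic_prime_divisors[OF monic_nonzero[OF m]] by auto
  have fac: "a 0 = (\<Prod>f\<in>F. f ^ fexp f (a 0))"
    by (rule monic_eq_prod_fexp[OF m F(1) _ F(2)]) (simp add: F_def)
  have nz: "f \<noteq> 0" if "f \<in> F" for f using that F monic_primes_nonzero by blast
  have "la (a 0) = la (\<Prod>f\<in>F. f ^ fexp f (a 0))" by (rule arg_cong[OF fac])
  also have "\<dots> = (\<Prod>f\<in>F. la (f ^ fexp f (a 0)))" by (rule la_prod) (simp add: nz)
  also have "\<dots> = (\<Prod>f\<in>F. la f ^ fexp f (a 0))" by (rule prod.cong[OF refl]) (simp add: la_power nz)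
  finally show ?thesis by (simp add: M.term_of_def la_term_def F_def)
qed

text \<open>The geometric series, treated as a convolution with the coefficients of 1 - x X.\<close>

lemma geometric_local:
  assumes f: "f \<in> monic_primes" and H: "(la_term f has_sum H) ({0} \<rightarrow>\<^sub>E UNIV)"
  shows "(1 - la f) * H = 1"
proof -
  define x where "x = la f"
  let ?a = "\<lambda>i :: nat. if i = 0 then 1 else if i = 1 then - x else 0"
  have x: "ord_ge r 1 x"
    unfolding x_def using monic_primes_degree[OF f] by (intro ord_ge_mono[OF la_ord[OF monic_primes_nonzero[OF f]]]) simp
  have "(\<Sum>i\<le>1. ?a i) * H = (\<Sum>m\<le>r. if m = 0 then 1 else 0)"
  proof (rule evaluate_convolution[where a = ?a and b = "\<lambda>n. x ^ n" and c = "\<lambda>m. if m = 0 then 1 else 0", OF A.r_pos])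
    show "ord_ge r (int n) (x ^ n)" for n using ord_ge_power[OF x, of n] by simp
    show "(\<Sum>i\<le>m. ?a i * x ^ (m - i)) = (if m = 0 then 1 else 0)" for m
    proof (cases m)
      case 0
      then show ?thesis by simp
    next
      case (Suc m')
      have "(\<Sum>i\<le>m. ?a i * x ^ (m - i)) = (\<Sum>i\<in>{0, 1}. ?a i * x ^ (m - i))"
        by (rule sum.mono_neutral_right) (use Suc in auto)
      then show ?thesis using Suc by (simp add: One_nat_def)
    qed
    show "?a i = 0" if "i > 1" for i using that by simp
    show "(if m = 0 then 1 else 0) = (0 :: 'q fls)" if "m > r" for m using that by simp
    fix N
    define b :: "nat \<Rightarrow> nat \<Rightarrow> nat" where "b n = (\<lambda>j\<in>{0}. n)" for n
    have b: "b n 0 = n" "b n \<in> {0} \<rightarrow>\<^sub>E UNIV" for n by (simp_all add: b_def)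
    have inj: "inj_on b A" for A by (rule inj_on_inverseI[of _ "\<lambda>k. k 0"]) (rule b(1))
    have "\<exists>M0. \<forall>M\<ge>M0. ord_ge 1 N (sum (la_term f) (b ` {..M}) - H)"
    proof (rule null_family_partial_sums[OF H M.null_local[OF f]])
      show "finite (b ` {..M})" for M by simp
      show "b ` {..M} \<subseteq> {0} \<rightarrow>\<^sub>E UNIV" for M using b(2) by blast
      show "b ` {..M} \<subseteq> b ` {..M'}" if "M \<le> M'" for M M' using that by (intro image_mono) simp
      show "\<exists>M. k \<in> b ` {..M}" if k: "k \<in> {0} \<rightarrow>\<^sub>E UNIV" for k
      proof -
        have "k = b (k 0)" by (rule PiE_ext[OF k b(2)]) (simp add: b_def)
        then show ?thesis by blast
      qed
    qed
    moreover have "sum (la_term f) (b ` {..M}) = (\<Sum>n\<le>M. x ^ n)" for M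
      by (simp add: sum.reindex[OF inj] la_term_def b(1) x_def)
    ultimately show "\<exists>M0. \<forall>M\<ge>M0. ord_ge 1 N ((\<Sum>n\<le>M. x ^ n) - H)" by simp
  qed
  then show ?thesis by (simp add: x_def One_nat_def)
qed

theorem L_tensor_product:
  "(\<exists>L. ((\<lambda>F. \<Prod>f\<in>F. tensor_factor \<phi> \<psi> s f) \<longlongrightarrow> L) (finite_subsets_at_top monic_primes)) \<and>
    LA_term \<chi> (r * s + 2) summable_on monics \<and> conv_term \<phi> \<psi> s summable_on monic_tuples r \<and>
    L_tensor_dual \<phi> \<psi> s = L_A \<chi> (r * s + 2) * L_conv \<phi> \<psi> s"
proof -
  have "\<forall>f\<in>monic_primes. \<exists>H. (tf f has_sum H) (J \<rightarrow>\<^sub>E UNIV)"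
    using null_family_limit[OF L.null_local] by blast
  from bchoice[OF this] obtain H where H: "\<And>f. f \<in> monic_primes \<Longrightarrow> (tf f has_sum H f) (J \<rightarrow>\<^sub>E UNIV)" by blast
  have "\<forall>f\<in>monic_primes. \<exists>H. (la_term f has_sum H) ({0} \<rightarrow>\<^sub>E UNIV)"
    using null_family_limit[OF M.null_local] by blast
  from bchoice[OF this] obtain H' where H': "\<And>f. f \<in> monic_primes \<Longrightarrow> (la_term f has_sum H' f) ({0} \<rightarrow>\<^sub>E UNIV)" by blast
  obtain L where L: "(L.term_of has_sum L) (J \<rightarrow>\<^sub>E monics)"
    "((\<lambda>F. \<Prod>f\<in>F. H f) \<longlongrightarrow> L) (finite_subsets_at_top monic_primes)"
    using L.euler_product[OF H] by blast
  obtain L' where L': "(M.term_of has_sum L') ({0} \<rightarrow>\<^sub>E monics)"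
    "((\<lambda>F. \<Prod>f\<in>F. H' f) \<longlongrightarrow> L') (finite_subsets_at_top monic_primes)"
    using M.euler_product[OF H'] by blast
  \<comment> \<open>The two local identities show that the tensor polynomial at f^(-s) times
    \<open>H' f * H f\<close> is 1; in particular it is nonzero, so taking its inverse is
    meaningful.\<close>
  have factor: "tensor_factor \<phi> \<psi> s f = H' f * H f" if f: "f \<in> monic_primes" for f
  proof -
    let ?Q = "\<Sum>i\<le>G f. K_to_Kinf (fps_nth (Qser f) i * w f ^ i)"
    have "?Q * H f = 1 - la f" using local_identity[OF f H[OF f]] unfolding la_e0[OF f] .
    then have "?Q * (H' f * H f) = (1 - la f) * H' f" by (simp add: mult_ac)
    also have "\<dots> = 1" by (rule geometric_local[OF f H'[OF f]])
    finally show ?thesis unfolding tensor_factor_eq[OF f] by (rule inverse_unique)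
  qed
  have "((\<lambda>F. (\<Prod>f\<in>F. H' f) * (\<Prod>f\<in>F. H f)) \<longlongrightarrow> L' * L) (finite_subsets_at_top monic_primes)"
    by (rule tendsto_mult_fls[OF L'(2) L(2)])
  moreover have "\<forall>\<^sub>F F in finite_subsets_at_top monic_primes.
      (\<Prod>f\<in>F. H' f) * (\<Prod>f\<in>F. H f) = (\<Prod>f\<in>F. tensor_factor \<phi> \<psi> s f)"
  proof (rule eventually_finite_subsets_at_top_weakI)
    fix F :: "'q poly set" assume "F \<subseteq> monic_primes"
    then show "(\<Prod>f\<in>F. H' f) * (\<Prod>f\<in>F. H f) = (\<Prod>f\<in>F. tensor_factor \<phi> \<psi> s f)"
      unfolding prod.distrib[symmetric] by (intro prod.cong refl) (auto simp: factor)
  qed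
  ultimately have lim: "((\<lambda>F. \<Prod>f\<in>F. tensor_factor \<phi> \<psi> s f) \<longlongrightarrow> L' * L) (finite_subsets_at_top monic_primes)"
    by (rule Lim_transform_eventually)
  have conv: "(conv_term \<phi> \<psi> s has_sum L) (monic_tuples r)"
    using L(1) has_sum_cong[of "monic_tuples r" "conv_term \<phi> \<psi> s" L.term_of] conv_term_eq
    by (simp add: monic_tuples_def)
  have la: "(la has_sum L') monics"
  proof -
    have "bij_betw (\<lambda>a. a 0) ({0} \<rightarrow>\<^sub>E monics) (monics :: 'q poly set)"
      by (rule bij_betw_byWitness[of _ "\<lambda>x. \<lambda>j\<in>{0}. x"]) (auto simp: PiE_def extensional_def fun_eq_iff)
    from has_sum_reindex_bij_betw[OF this, of la L'] show ?thesis
      using L'(1) has_sum_cong[of "{0} \<rightarrow>\<^sub>E monics" M.term_of "\<lambda>a. la (a 0)"] M_term by blast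
  qed
  have "L_tensor_dual \<phi> \<psi> s = L' * L"
    unfolding L_tensor_dual_def by (rule tendsto_Lim[OF finite_subsets_at_top_neq_bot lim])
  moreover have "L_A \<chi> (r * s + 2) = L'" unfolding L_A_def la_def[symmetric] by (rule infsumI[OF la])
  moreover have "L_conv \<phi> \<psi> s = L" unfolding L_conv_def A.rank by (rule infsumI[OF conv])
  ultimately show ?thesis using lim has_sum_imp_summable[OF la] has_sum_imp_summable[OF conv] unfolding la_def by blast
qed

end

theorem theorem4p3p13:
  fixes \<phi> \<psi> :: "'q::{field,finite} poly \<Rightarrow> 'q poly poly"
    and \<kappa> \<eta> :: "nat \<Rightarrow> 'q poly" and \<kappa>\<^sub>r \<eta>\<^sub>r :: 'q and r s :: nat
  assumes "r \<ge> 2"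
    and "drinfeld_module \<phi>" and "drinfeld_module \<psi>"
    and "\<phi> [:0, 1:] = [:\<theta>:] + (\<Sum>i=1..<r. monom (\<kappa> i) i) + monom [:\<kappa>\<^sub>r:] r"
    and "\<psi> [:0, 1:] = [:\<theta>:] + (\<Sum>i=1..<r. monom (\<eta> i) i) + monom [:\<eta>\<^sub>r:] r"
    and "\<kappa>\<^sub>r \<noteq> 0" and "\<eta>\<^sub>r \<noteq> 0"
  shows "(\<exists>L. ((\<lambda>F. \<Prod>f\<in>F. tensor_factor \<phi> \<psi> s f) \<longlongrightarrow> L)
            (finite_subsets_at_top monic_primes)) \<and>
         LA_term (\<lambda>a. chi r \<kappa>\<^sub>r a * chi r \<eta>\<^sub>r a) (r * s + 2) summable_on monics \<and>
         conv_term \<phi> \<psi> s summable_on monic_tuples r \<and>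
         L_tensor_dual \<phi> \<psi> s =
           L_A (\<lambda>a. chi r \<kappa>\<^sub>r a * chi r \<eta>\<^sub>r a) (r * s + 2) * L_conv \<phi> \<psi> s"
proof -
  interpret drinfeld_pair \<phi> \<psi> \<kappa> \<eta> \<kappa>\<^sub>r \<eta>\<^sub>r r s
    by unfold_locales (use assms in auto)
  show ?thesis by (rule L_tensor_product)
qed

end
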